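(* Let $f\in M_p$, $1<p<\infty$, $\beta_1,\beta_2,r_1,r_2>0$, and $\delta_1,\delta_2\in(0,\frac12)$. Then $$\omega_{\beta_1,\beta_2}(f^{(r_1,r_2)},\delta_1,\delta_2)_{L_p(\mathbb{T}^2)}\asymp\left\{\int_0^{\delta_1}\int_0^{\delta_2}t_1^{-r_1p-1}t_2^{-r_2p-1}\,\omega^p_{r_1+\beta_1,r_2+\beta_2}(f,t_1,t_2)_{L_p(\mathbb{T}^2)}\,dt_1\,dt_2\right\}^{1/p}$$ (with $t_i\in(0,\delta_i)$, $i=1,2$).
   Context: $L_p(\mathbb{T}^2)$, $1<p<\infty$, is the space of measurable functions $f(x,y)$ that are $2\pi$-periodic in each variable with $\|f\|_{L_p(\mathbb{T}^2)}=\big(\int_0^{2\pi}\int_0^{2\pi}|f(x,y)|^p\,dx\,dy\big)^{1/p}<\infty$; $L_p^0(\mathbb{T}^2)$ is the set of $f\in L_p(\mathbb{T}^2)$ with $\int_0^{2\pi}f(x,y)\,dy=0$ for a.e. $x$ and $\int_0^{2\pi}f(x,y)\,dx=0$ for a.e. $y$. The class $M_p$, $1<p<\infty$, is the set of $f\in L_p^0(\mathbb{T}^2)$ whose Fourier series is $\sum_{\nu_1=1}^\infty\sum_{\nu_2=1}^\infty a_{\nu_1,\nu_2}\cos\nu_1x\cos\nu_2y$ with $a_{\nu_1,\nu_2}-a_{\nu_1+1,\nu_2}-a_{\nu_1,\nu_2+1}+a_{\nu_1+1,\nu_2+1}\ge0$ for all integers $\nu_1,\nu_2\ge1$. For $\alpha_1,\alpha_2>0$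 the (fractional) differences are $\Delta_{h_1}^{\alpha_1}(f)=\sum_{\nu=0}^\infty(-1)^\nu\binom{\alpha_1}{\nu}f(x+(\alpha_1-\nu)h_1,y)$ and $\Delta_{h_2}^{\alpha_2}(f)=\sum_{\nu=0}^\infty(-1)^\nu\binom{\alpha_2}{\nu}f(x,y+(\alpha_2-\nu)h_2)$, where $\binom{\alpha}{0}=1$ and $\binom{\alpha}{\nu}=\frac{\alpha(\alpha-1)\cdots(\alpha-\nu+1)}{\nu!}$ for $\nu\ge1$. The mixed modulus of smoothness is $\omega_{\alpha_1,\alpha_2}(f,\delta_1,\delta_2)_{L_p(\mathbb{T}^2)}=\sup_{|h_i|\le\delta_i,\,i=1,2}\|\Delta_{h_1}^{\alpha_1}(\Delta_{h_2}^{\alpha_2}(f))\|_{L_p(\mathbb{T}^2)}$, and $\omega^p$ denotes its $p$-th power. $f^{(\rho_1,\rho_2)}$, $\rho_1,\rho_2\ge0$, denotes the Weyl derivative of $f$ of order $\rho_1$ with respect to $x$ and of order $\rho_2$ with respect to $y$. In one variable, for a $2\pi$-periodic integrable function with Fourier series $\sum_n c_ne^{inx}$, $c_0=0$, the Weyl derivative of order $\rho$ is $\frac{d^n}{dx^n}I^{n-\rho}f$ with $n=\lfloor\rho\rfloor+1$, where $I^{\alpha}f$ is the convolution $\frac1{2\pi}\int_0^{2\pi}f(t)\psi_\alpha(x-t)\,dt$ with $\psi_\alpha(x)=\sum_{n\ne0}e^{inx}/(in)^\alpha$; thus its Fourier series is $\sum_{n\ne0}(in)^\rho c_ne^{inx}$,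 where $(in)^\rho=|n|^\rho e^{i\pi\rho\,\mathrm{sign}(n)/2}$. $A\asymp B$ means $C^{-1}B\le A\le CB$ with a constant $C>0$ independent of $f,\delta_1,\delta_2$ ($C$ may depend on $p,\beta_i,r_i$). *)

theory Defs
  imports "HOL-Analysis.Analysis"
begin

definition torus :: "(real \<times> real) set" where
  "torus = {0..2 * pi} \<times> {0..2 * pi}"

(* Real powers on [0, \<infinity>]; only exponents a > 0 are used. *)
definition enn_powr :: "ennreal \<Rightarrow> real \<Rightarrow> ennreal" where
  "enn_powr u a = (if u = \<infinity> then \<infinity> else ennreal (enn2real u powr a))"

definition Lp_norm :: "real \<Rightarrow> (real \<times> real \<Rightarrow> complex) \<Rightarrow> ennreal" where
  "Lp_norm p f = enn_powr (\<integral>\<^sup>+z\<in>torus. ennreal (norm (f z) powr p) \<partial>lebesgue) (1 / p)"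

(* Functions, not classes modulo null sets: every notion below is insensitive to changing a
   periodic function on a null set. *)
definition Lp_space :: "real \<Rightarrow> (real \<times> real \<Rightarrow> complex) set" where
  "Lp_space p = {f. f \<in> borel_measurable lebesgue \<and>
     (\<forall>x y. f (x + 2 * pi, y) = f (x, y) \<and> f (x, y + 2 * pi) = f (x, y)) \<and>
     Lp_norm p f < \<infinity>}"

definition Lp0_space :: "real \<Rightarrow> (real \<times> real \<Rightarrow> complex) set" where
  "Lp0_space p = {f \<in> Lp_space p.
     (AE x in lebesgue. (LINT y:{0..2 * pi}|lebesgue. f (x, y)) = 0) \<and>
     (AE y in lebesgue. (LINT x:{0..2 * pi}|lebesgue. f (x, y)) = 0)}"

(* The double trigonometric Fourier series of f is the sum over m, n \<ge> 1 of
   a m n cos(m x) cos(n y): the Fourier coefficients with respect to the remaining products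
   of sines and cosines (frequency 0 included) vanish, and
   a m n = (1 / pi^2) * (integral of f(x,y) cos(m x) cos(n y) over the torus). *)
definition has_cosine_series :: "(real \<times> real \<Rightarrow> complex) \<Rightarrow> (nat \<Rightarrow> nat \<Rightarrow> real) \<Rightarrow> bool" where
  "has_cosine_series f a \<longleftrightarrow> (\<forall>m n.
     (LINT z:torus|lebesgue. f z * of_real (cos (m * fst z) * cos (n * snd z)))
       = (if m \<ge> 1 \<and> n \<ge> 1 then of_real (pi\<^sup>2 * a m n) else 0) \<and>
     (LINT z:torus|lebesgue. f z * of_real (cos (m * fst z) * sin (n * snd z))) = 0 \<and>
     (LINT z:torus|lebesgue. f z * of_real (sin (m * fst z) * cos (n * snd z))) = 0 \<and>
     (LINT z:torus|lebesgue. f z * of_real (sin (m * fst z) * sin (n * snd z))) = 0)"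

definition M_class :: "real \<Rightarrow> (real \<times> real \<Rightarrow> complex) set" where
  "M_class p = {f \<in> Lp0_space p. \<exists>a :: nat \<Rightarrow> nat \<Rightarrow> real. has_cosine_series f a \<and>
     (\<forall>m\<ge>1. \<forall>n\<ge>1. a m n - a (m + 1) n - a m (n + 1) + a (m + 1) (n + 1) \<ge> 0)}"

(* For f in L_p the series converge absolutely almost everywhere, because the binomial
   coefficients are absolutely summable for \<alpha> > 0. *)
definition frac_diff_x :: "real \<Rightarrow> real \<Rightarrow> (real \<times> real \<Rightarrow> complex) \<Rightarrow> real \<times> real \<Rightarrow> complex" where
  "frac_diff_x \<alpha> h f = (\<lambda>(x, y). \<Sum>k. ((-1) ^ k * (\<alpha> gchoose k)) *\<^sub>R f (x + (\<alpha> - real k) * h, y))"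

definition frac_diff_y :: "real \<Rightarrow> real \<Rightarrow> (real \<times> real \<Rightarrow> complex) \<Rightarrow> real \<times> real \<Rightarrow> complex" where
  "frac_diff_y \<alpha> h f = (\<lambda>(x, y). \<Sum>k. ((-1) ^ k * (\<alpha> gchoose k)) *\<^sub>R f (x, y + (\<alpha> - real k) * h))"

definition mixed_modulus ::
    "real \<Rightarrow> real \<Rightarrow> real \<Rightarrow> (real \<times> real \<Rightarrow> complex) \<Rightarrow> real \<Rightarrow> real \<Rightarrow> ennreal" where
  "mixed_modulus p \<alpha>1 \<alpha>2 f \<delta>1 \<delta>2 =
     (SUP h1\<in>{h. \<bar>h\<bar> \<le> \<delta>1}. SUP h2\<in>{h. \<bar>h\<bar> \<le> \<delta>2}.
        Lp_norm p (frac_diff_x \<alpha>1 h1 (frac_diff_y \<alpha>2 h2 f)))"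

(* The complex powr is the principal power, so
   (i n)^\<alpha> = |n|^\<alpha> exp(i pi \<alpha> sgn(n) / 2) for n \<noteq> 0.  The limit exists for \<alpha> > 0 and x not in 2 pi Z. *)
definition weyl_kernel :: "real \<Rightarrow> real \<Rightarrow> complex" where
  "weyl_kernel \<alpha> x =
     lim (\<lambda>N::nat. \<Sum>n\<in>{- int N..int N} - {0}. cis (of_int n * x) / (\<i> * of_int n) powr of_real \<alpha>)"

definition weyl_integral :: "real \<Rightarrow> (real \<Rightarrow> complex) \<Rightarrow> real \<Rightarrow> complex" where
  "weyl_integral \<alpha> u x =
     (LINT t:{0..2 * pi}|lebesgue. u t * weyl_kernel \<alpha> (x - t)) / (2 * pi)"

(* v is the n-th derivative of F: up to a null set F has an absolutely continuous derivative
   of order n - 1, the derivative of which is v almost everywhere.  Absolute continuity is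
   expressed as being an indefinite Lebesgue integral.  (Almost everywhere derivatives of
   functions that are not absolutely continuous do not have the expected Fourier series.) *)
primrec has_nth_derivative :: "nat \<Rightarrow> (real \<Rightarrow> complex) \<Rightarrow> (real \<Rightarrow> complex) \<Rightarrow> bool" where
  "has_nth_derivative 0 F v \<longleftrightarrow> (AE x in lebesgue. F x = v x)"
| "has_nth_derivative (Suc n) F v \<longleftrightarrow>
     (\<exists>G F'. (AE x in lebesgue. F x = G x) \<and>
        (\<forall>a b. a \<le> b \<longrightarrow> set_integrable lebesgue {a..b} F' \<and>
           G b - G a = (LINT t:{a..b}|lebesgue. F' t)) \<and>
        has_nth_derivative n F' v)"

definition has_weyl_derivative :: "real \<Rightarrow> (real \<Rightarrow> complex) \<Rightarrow> (real \<Rightarrow> complex) \<Rightarrow> bool" where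
  "has_weyl_derivative \<rho> u v \<longleftrightarrow> set_integrable lebesgue {0..2 * pi} u \<and>
     (let n = nat \<lfloor>\<rho>\<rfloor> + 1 in has_nth_derivative n (weyl_integral (real n - \<rho>) u) v)"

(* g = f^{(\<rho>1,\<rho>2)}; h is the derivative of f of order \<rho>1 with respect to x. *)
definition has_mixed_weyl_derivative ::
    "real \<Rightarrow> real \<Rightarrow> (real \<times> real \<Rightarrow> complex) \<Rightarrow> (real \<times> real \<Rightarrow> complex) \<Rightarrow> bool" where
  "has_mixed_weyl_derivative \<rho>1 \<rho>2 f g \<longleftrightarrow> (\<exists>h\<in>Lp_space 1.
     (AE y in lebesgue. has_weyl_derivative \<rho>1 (\<lambda>x. f (x, y)) (\<lambda>x. h (x, y))) \<and>
     (AE x in lebesgue. has_weyl_derivative \<rho>2 (\<lambda>y. h (x, y)) (\<lambda>y. g (x, y))))"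

definition smoothness_integral ::
    "real \<Rightarrow> real \<Rightarrow> real \<Rightarrow> real \<Rightarrow> real \<Rightarrow> (real \<times> real \<Rightarrow> complex) \<Rightarrow> real \<Rightarrow> real \<Rightarrow> ennreal" where
  "smoothness_integral p r1 r2 \<beta>1 \<beta>2 f \<delta>1 \<delta>2 =
     enn_powr
       (\<integral>\<^sup>+t1\<in>{0<..<\<delta>1}. (\<integral>\<^sup>+t2\<in>{0<..<\<delta>2}.
          ennreal (t1 powr (- r1 * p - 1) * t2 powr (- r2 * p - 1)) *
            enn_powr (mixed_modulus p (r1 + \<beta>1) (r2 + \<beta>2) f t1 t2) p
        \<partial>lborel) \<partial>lborel) (1 / p)"

end

theory Submission
  imports Defs
begin

text \<open>Nonnegative mixed differences make the coefficients \<open>a k l\<close> doubly monotone. For such coefficients both sides,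
  raised to the power \<open>p\<close>, are comparable with the Hardy--Littlewood type sum of
  \<open>(a k l * V1 k * V2 l) powr p * (k l) powr (p - 2)\<close>, where \<open>V k = k powr r * min 1 (k \<delta>) powr \<beta>\<close>.
  For the upper bound, double Abel summation against the differences of \<open>a\<close> bounds a function by a sum of
  products of the kernels \<open>1 / (1 + k \<bar>sin (x / 2)\<bar>)\<close> and of their translates, which satisfy a Hardy inequality.
  For the lower bound, the difference is averaged over its step, which keeps its multiplier away from zero on dyadic
  blocks; duality with the same Hardy inequality recovers the coefficients from the blocks. The integral over the
  steps is computed termwise: over \<open>0 < t < \<delta>\<close>, the integral of \<open>t powr (- r p - 1) * min 1 (k t) powr ((r + \<beta>) p)\<close>
  is of the order of \<open>V k powr p\<close>.
  Weyl derivatives are identified with Fourier multipliers in each variable separately.\<close>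

subsection \<open>Powers and Jensen's inequality on the extended half-line\<close>

text \<open>Two obstacles shape the argument. The multiplier \<open>mu \<beta> (k * h)\<close> of a
  fractional difference vanishes whenever \<open>k * h\<close> is a multiple of
  \<open>2 * pi\<close>, so no single step \<open>h\<close> gives a lower bound; the modulus, a
  supremum over all steps, dominates an average over them. The double series of \<open>f\<close>
  itself need not converge absolutely; the nonnegative mixed differences are what makes the
  Abel-summed series absolutely convergent almost everywhere once the coefficient sum is finite.
  Positivity allows every interchange by Tonelli and treats the two variables independently. Hence
  weights, kernels and norms live in \<open>ennreal\<close>: the integral of the moduli is
  comparable with the coefficient sum even when both are infinite, and when they are finite the
  derivative is synthesised from its coefficients. The kernel
  \<open>1 / (1 + k \<bar>sin (x / 2)\<bar>)\<close> majorises normalised exponential sums. It is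
  positive and depends on the product of \<open>k\<close> and \<open>\<bar>sin (x / 2)\<bar>\<close>
  alone, so one Schur test, with power weights in either variable, serves all \<open>p > 1\<close>
  and replaces multiplier theorems.\<close>

lemma enn_powr_ennreal [simp]: "0 \<le> x \<Longrightarrow> enn_powr (ennreal x) a = ennreal (x powr a)"
  by (simp add: enn_powr_def)

lemma enn_powr_top [simp]: "enn_powr top a = top"
  by (simp add: enn_powr_def)

lemma enn_powr_0 [simp]: "enn_powr 0 a = 0"
  by (simp add: enn_powr_def)

lemma enn_powr_mono: "u \<le> v \<Longrightarrow> 0 \<le> a \<Longrightarrow> enn_powr u a \<le> enn_powr v a"
  by (cases u; cases v) (auto intro!: ennreal_leI powr_mono2 simp: top_unique)

lemma enn_powr_mult: "0 < a \<Longrightarrow> enn_powr (u * v) a = enn_powr u a * enn_powr v a"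
proof (cases u; cases v)
  fix r s :: real assume "0 \<le> r" "u = ennreal r" "0 \<le> s" "v = ennreal s" "0 < a"
  then show ?thesis by (simp add: powr_mult flip: ennreal_mult)
next
  fix r :: real assume "0 < a" "0 \<le> r" "u = ennreal r" "v = top"
  then show ?thesis by (cases "r = 0") (auto simp: ennreal_mult_top)
next
  fix r :: real assume "0 < a" "0 \<le> r" "v = ennreal r" "u = top"
  then show ?thesis by (cases "r = 0") (auto simp: ennreal_top_mult)
qed auto

lemma enn_powr_powr: "enn_powr (enn_powr u a) b = enn_powr u (a * b)"
  by (cases u) (auto simp: powr_powr)

lemma enn_powr_one [simp]: "enn_powr u 1 = u"
  by (cases u) auto

lemma enn_powr_inverse: "0 < p \<Longrightarrow> enn_powr (enn_powr u (1 / p)) p = u"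
  by (simp add: enn_powr_powr)

lemma enn_powr_inverse': "0 < p \<Longrightarrow> enn_powr (enn_powr u p) (1 / p) = u"
  by (simp add: enn_powr_powr)

lemma enn_powr_eq_0_iff: "enn_powr u a = 0 \<longleftrightarrow> u = 0"
  by (cases u) auto

lemma enn_powr_eq_top_iff [simp]: "enn_powr u a = top \<longleftrightarrow> u = top"
  by (cases u) auto

lemma measurable_enn_powr [measurable]: "(\<lambda>u. enn_powr u a) \<in> borel_measurable borel"
  unfolding enn_powr_def by measurable

text \<open>The tangent-line form of convexity: equality holds at \<open>z = s\<close>. The free
  parameter \<open>s\<close> is fixed only after integration.\<close>

lemma enn_young:
  fixes z :: ennreal and p s :: real
  assumes "1 < p" "0 < s"
  shows "z \<le> enn_powr z p * ennreal (s powr (1 - p) / p) + ennreal (s * (1 - 1 / p))"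
proof (cases z)
  case (real r)
  have "r = (r * s powr (1 / p - 1)) * s powr (1 - 1 / p)"
    using assms by (simp add: powr_add[symmetric])
  also have "\<dots> \<le> (r * s powr (1 / p - 1)) powr p / p + (s powr (1 - 1 / p)) powr (1 / (1 - 1 / p)) / (1 / (1 - 1 / p))"
    using assms real by (intro Youngs_inequality) (auto simp: field_simps)
  also have "\<dots> = r powr p * (s powr (1 - p) / p) + s * (1 - 1 / p)"
  proof -
    have "(1 / p - 1) * p = 1 - p" "(1 - 1 / p) * (1 / (1 - 1 / p)) = 1"
      using assms by (auto simp: field_simps)
    then show ?thesis using assms real by (simp add: powr_mult powr_powr del: powr_eq_one_iff)
  qed
  finally show ?thesis
    using real assms by (simp flip: ennreal_mult ennreal_plus)
next
  case top
  then show ?thesis using assms by (simp add: ennreal_top_mult)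
qed

text \<open>Hoelder's inequality for the measure with density \<open>q\<close>, free of
  integrability hypotheses. Integrating \<open>enn_young\<close> against \<open>q\<close> leaves one
  scalar \<open>s\<close> to optimise; the cases where a factor on the right is \<open>0\<close> or
  infinite are separated first.\<close>

lemma enn_jensen:
  fixes q z :: "'a \<Rightarrow> ennreal"
  assumes [measurable]: "q \<in> borel_measurable M" "z \<in> borel_measurable M" and p: "1 < p"
  shows "enn_powr (\<integral>\<^sup>+x. q x * z x \<partial>M) p
    \<le> enn_powr (\<integral>\<^sup>+x. q x \<partial>M) (p - 1) * (\<integral>\<^sup>+x. q x * enn_powr (z x) p \<partial>M)"
proof -
  let ?Q = "\<integral>\<^sup>+x. q x \<partial>M" and ?R = "\<integral>\<^sup>+x. q x * enn_powr (z x) p \<partial>M"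
  have zero: "(\<integral>\<^sup>+x. q x * z x \<partial>M) = 0" if "?Q = 0 \<or> ?R = 0"
    using that
  proof
    assume "?Q = 0"
    then have "AE x in M. q x = 0" by (simp add: nn_integral_0_iff_AE)
    then show ?thesis by (auto simp: nn_integral_0_iff_AE)
  next
    assume "?R = 0"
    then have "AE x in M. q x * enn_powr (z x) p = 0" by (simp add: nn_integral_0_iff_AE)
    then show ?thesis by (auto simp: nn_integral_0_iff_AE enn_powr_eq_0_iff)
  qed
  show ?thesis
  proof (cases "?Q = 0 \<or> ?R = 0")
    case True
    then show ?thesis using zero by simp
  next
    case False
    show ?thesis
    proof (cases "?Q = top \<or> ?R = top")
      case True
      then show ?thesis using False
        by (auto simp: ennreal_top_mult ennreal_mult_top enn_powr_eq_0_iff)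
    next
      case F2: False
      obtain Q where Q: "?Q = ennreal Q" "0 < Q"
        using False F2 by (cases ?Q) (auto simp: less_le)
      obtain R where R: "?R = ennreal R" "0 < R"
        using False F2 by (cases ?R) (auto simp: less_le)
      \<comment> \<open>The optimal parameter: the two terms of Young's inequality become
        \<open>s * Q / p\<close> and \<open>s * Q * (1 - 1 / p)\<close>, with sum
        \<open>s * Q\<close>.\<close>
      define s where "s = (R / Q) powr (1 / p)"
      have s: "0 < s" "s powr p = R / Q" using Q R p by (auto simp: s_def powr_powr)
      have "(\<integral>\<^sup>+x. q x * z x \<partial>M)
         \<le> (\<integral>\<^sup>+x. q x * (enn_powr (z x) p * ennreal (s powr (1 - p) / p) + ennreal (s * (1 - 1 / p))) \<partial>M)"
        by (intro nn_integral_mono mult_left_mono enn_young p s) auto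
      also have "\<dots> = ?R * ennreal (s powr (1 - p) / p) + ?Q * ennreal (s * (1 - 1 / p))"
        by (simp add: distrib_left nn_integral_add nn_integral_multc mult.assoc[symmetric])
      also have "\<dots> = ennreal (R * (s powr (1 - p) / p) + Q * (s * (1 - 1 / p)))"
        using Q R s p by (simp flip: ennreal_mult)
      also have "R * (s powr (1 - p) / p) + Q * (s * (1 - 1 / p)) = s * Q"
        using Q R s p by (simp add: powr_diff field_simps)
      finally have "(\<integral>\<^sup>+x. q x * z x \<partial>M) \<le> ennreal (s * Q)" .
      then have "enn_powr (\<integral>\<^sup>+x. q x * z x \<partial>M) p \<le> enn_powr (ennreal (s * Q)) p"
        using p by (intro enn_powr_mono) auto
      also have "\<dots> = ennreal (Q powr (p - 1) * R)"
        using Q R s p by (simp add: powr_mult powr_diff field_simps)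
      finally show ?thesis using Q R by (simp add: ennreal_mult)
    qed
  qed
qed

lemma enn_jensen_suminf:
  fixes q z :: "nat \<Rightarrow> ennreal"
  assumes p: "1 < p"
  shows "enn_powr (\<Sum>k. q k * z k) p \<le> enn_powr (\<Sum>k. q k) (p - 1) * (\<Sum>k. q k * enn_powr (z k) p)"
  using enn_jensen[of q "count_space UNIV" z p] p by (simp add: nn_integral_count_space_nat)

lemma ennreal_suminf_commute:
  fixes f :: "nat \<Rightarrow> nat \<Rightarrow> ennreal"
  shows "(\<Sum>i. \<Sum>j. f i j) = (\<Sum>j. \<Sum>i. f i j)"
  using nn_integral_suminf[of "\<lambda>i j. f i j" "count_space UNIV"]
  by (simp add: nn_integral_count_space_nat)

lemma ennreal_suminf_le: "(\<And>n. f n \<le> g n) \<Longrightarrow> (\<Sum>n. f n) \<le> (\<Sum>n. g n)" for f g :: "nat \<Rightarrow> ennreal"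
  by (intro suminf_le) auto

text \<open>A concave function lies above its chord, here the one joining the values
  \<open>0\<close> at \<open>0\<close> and \<open>1\<close> at \<open>pi\<close>.\<close>

lemma jordan_sin:
  fixes x :: real assumes "0 \<le> x" "x \<le> pi"
  shows "x / pi \<le> sin (x / 2)"
proof -
  have "concave_on {0..pi} (\<lambda>x. sin (x / 2))"
    by (rule f''_le0_imp_concave[where f' = "\<lambda>x. cos (x / 2) / 2" and f'' = "\<lambda>x. - sin (x / 2) / 4"])
      (auto intro!: derivative_eq_intros sin_ge_zero)
  from concave_onD[OF this, of "x / pi" 0 pi] assms show ?thesis by (simp add: field_simps)
qed

subsection \<open>The kernel \<open>1 / (1 + k \<bar>sin (x / 2)\<bar>)\<close>\<close>

text \<open>The circle as Lebesgue measure of total mass \<open>2 * pi\<close> carried by one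
  period, on the Borel sets of the whole line. Products of it then have the Borel sets of the plane,
  and periodic functions stay functions on the line.\<close>

definition circ :: "real measure" where
  "circ = density lborel (indicator {0..2 * pi})"

lemma sets_circ [measurable_cong, simp]: "sets circ = sets borel"
  and space_circ [simp]: "space circ = UNIV"
  by (auto simp: circ_def)

lemma nn_integral_circ:
  "f \<in> borel_measurable borel \<Longrightarrow> (\<integral>\<^sup>+x. f x \<partial>circ) = (\<integral>\<^sup>+x\<in>{0..2 * pi}. f x \<partial>lborel)"
  unfolding circ_def by (subst nn_integral_density) (auto simp: mult.commute)

lemma emeasure_circ: "emeasure circ UNIV = ennreal (2 * pi)"
  by (simp add: circ_def emeasure_density)

interpretation circ: finite_measure circ
  by standard (simp add: emeasure_circ)

interpretation circ2: pair_sigma_finite circ circ ..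

definition sig :: "real \<Rightarrow> real" where "sig x = \<bar>sin (x / 2)\<bar>"

text \<open>The product \<open>real k * wker k x\<close> is comparable with the minimum of
  \<open>k\<close> and \<open>1 / sig x\<close>, the usual bound for an exponential sum of length
  \<open>k\<close>; a single fraction avoids case distinctions later.\<close>

definition wker :: "nat \<Rightarrow> real \<Rightarrow> real" where "wker k x = 1 / (1 + real k * sig x)"

lemma sig_nonneg [simp]: "0 \<le> sig x" by (simp add: sig_def)

lemma wker_pos: "0 < wker k x"
  by (simp add: wker_def add_pos_nonneg)

lemma wker_le_1: "wker k x \<le> 1"
  by (simp add: wker_def divide_le_eq add_pos_nonneg)

lemma wker_antimono: "i \<le> k \<Longrightarrow> wker k x \<le> wker i x"
  by (auto simp: wker_def intro!: divide_left_mono mult_right_mono add_pos_nonneg mult_pos_pos)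

lemma sig_measurable [measurable]: "sig \<in> borel_measurable borel"
  unfolding sig_def by measurable

lemma wker_measurable [measurable]: "wker k \<in> borel_measurable borel"
  unfolding wker_def by measurable

lemma sig_periodic: "sig (x + 2 * pi) = sig x"
  by (simp add: sig_def add_divide_distrib)

lemma wker_periodic: "wker k (x + 2 * pi) = wker k x"
  by (simp add: wker_def sig_periodic)

lemma sig_pos_AE: "AE x in lborel. 0 < sig x"
proof -
  have "{x. sig x = 0} = range (\<lambda>n::int. 2 * pi * real_of_int n)"
    by (auto simp: sig_def sin_zero_iff_int2 image_def field_simps)
  then have "countable {x. sig x = 0}" by auto
  then have "AE x in lborel. x \<notin> {x. sig x = 0}"
    by (intro AE_not_in countable_imp_null_set_lborel) auto
  then show ?thesis by eventually_elim (auto simp: less_le)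
qed

lemma AE_circ: "(AE x in lborel. P x) \<Longrightarrow> AE x in circ. P x"
  unfolding circ_def by (subst AE_density) auto

lemma nn_integral_powr_from_0:
  assumes "a > (-1::real)" "c \<ge> 0"
  shows "(\<integral>\<^sup>+x\<in>{0..c}. ennreal (x powr a) \<partial>lborel) = ennreal (c powr (a + 1) / (a + 1))"
proof -
  have "((\<lambda>x. if x \<in> {0..c} then x powr a else 0) has_integral (c powr (a + 1) / (a + 1))) UNIV"
    using has_integral_powr_from_0[OF assms] by (subst has_integral_restrict_UNIV)
  from nn_integral_has_integral_lborel[OF _ _ this]
  have "integral\<^sup>N lborel (\<lambda>x. ennreal (if x \<in> {0..c} then x powr a else 0)) = ennreal (c powr (a + 1) / (a + 1))"
    by auto
  also have "(\<lambda>x. ennreal (if x \<in> {0..c} then x powr a else 0)) = (\<lambda>x. ennreal (x powr a) * indicator {0..c} x)"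
    by (auto simp: indicator_def)
  finally show ?thesis .
qed

lemma nn_integral_powr_to_inf:
  assumes "a < (-1::real)" "c > 0"
  shows "(\<integral>\<^sup>+x\<in>{c..}. ennreal (x powr a) \<partial>lborel) = ennreal (- (c powr (a + 1)) / (a + 1))"
proof -
  have "((\<lambda>x. if x \<in> {c..} then x powr a else 0) has_integral (- (c powr (a + 1)) / (a + 1))) UNIV"
    using has_integral_powr_to_inf[OF assms] by (subst has_integral_restrict_UNIV)
  from nn_integral_has_integral_lborel[OF _ _ this]
  have "integral\<^sup>N lborel (\<lambda>x. ennreal (if x \<in> {c..} then x powr a else 0)) = ennreal (- (c powr (a + 1)) / (a + 1))"
    by auto
  also have "(\<lambda>x. ennreal (if x \<in> {c..} then x powr a else 0)) = (\<lambda>x. ennreal (x powr a) * indicator {c..} x)"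
    by (auto simp: indicator_def)
  finally show ?thesis .
qed

text \<open>The integral is cut at \<open>u = 1 / k\<close>, where the denominator changes from size
  \<open>1\<close> to size \<open>k * u\<close>; the two halves give \<open>1 / (1 - s)\<close> and
  \<open>1 / s\<close>. By homogeneity the power of \<open>k\<close> is forced.\<close>

lemma nn_integral_kernel:
  fixes k s :: real
  assumes k: "0 < k" and s: "0 < s" "s < 1"
  shows "(\<integral>\<^sup>+u\<in>{0..}. ennreal (u powr (- s) / (1 + k * u)) \<partial>lborel)
    \<le> ennreal ((1 / (1 - s) + 1 / s) * k powr (s - 1))"
proof -
  have "(\<integral>\<^sup>+u\<in>{0..}. ennreal (u powr (- s) / (1 + k * u)) \<partial>lborel)
    \<le> (\<integral>\<^sup>+u. ennreal (u powr (- s)) * indicator {0..1 / k} u + ennreal (1 / k) * (ennreal (u powr (- s - 1)) * indicator {1 / k..} u) \<partial>lborel)"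
  proof (intro nn_integral_mono)
    fix u :: real
    show "ennreal (u powr (- s) / (1 + k * u)) * indicator {0..} u
      \<le> ennreal (u powr (- s)) * indicator {0..1 / k} u + ennreal (1 / k) * (ennreal (u powr (- s - 1)) * indicator {1 / k..} u)"
    proof (cases "0 \<le> u")
      case True
      show ?thesis
      proof (cases "u \<le> 1 / k")
        case T: True
        have "ennreal (u powr (- s) / (1 + k * u)) \<le> ennreal (u powr (- s))"
          using True k by (intro ennreal_leI) (simp add: divide_le_eq mult_right_le_one_le add_pos_nonneg mult_le_cancel_left1)
        then show ?thesis using True T by (simp add: add_increasing2)
      next
        case F: False
        then have u: "0 < u" using k by (smt (verit) divide_pos_pos)
        have "u powr (- s) / (1 + k * u) \<le> u powr (- s) / (k * u)"
          using u k by (intro divide_left_mono) (auto intro!: mult_pos_pos add_pos_pos)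
        also have "\<dots> = 1 / k * u powr (- s - 1)"
          using u k by (simp add: powr_diff field_simps)
        finally have "ennreal (u powr (- s) / (1 + k * u)) \<le> ennreal (1 / k) * ennreal (u powr (- s - 1))"
          using k by (simp flip: ennreal_mult)
        then show ?thesis using u F by auto
      qed
    qed auto
  qed
  also have "\<dots> = (\<integral>\<^sup>+u\<in>{0..1 / k}. ennreal (u powr (- s)) \<partial>lborel) + ennreal (1 / k) * (\<integral>\<^sup>+u\<in>{1 / k..}. ennreal (u powr (- s - 1)) \<partial>lborel)"
    by (subst nn_integral_add) (auto simp: nn_integral_cmult)
  also have "\<dots> = ennreal ((1 / k) powr (1 - s) / (1 - s) + 1 / k * ((1 / k) powr (- s) / s))"
  proof -
    have "(\<integral>\<^sup>+u\<in>{0..1 / k}. ennreal (u powr (- s)) \<partial>lborel) = ennreal ((1 / k) powr (1 - s) / (1 - s))"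
      using nn_integral_powr_from_0[of "- s" "1 / k"] s k by (simp add: add.commute)
    moreover have "(\<integral>\<^sup>+u\<in>{1 / k..}. ennreal (u powr (- s - 1)) \<partial>lborel) = ennreal ((1 / k) powr (- s) / s)"
      using nn_integral_powr_to_inf[of "- s - 1" "1 / k"] s k by simp
    ultimately show ?thesis using s k by (simp flip: ennreal_mult ennreal_plus)
  qed
  also have "(1 / k) powr (1 - s) / (1 - s) + 1 / k * ((1 / k) powr (- s) / s) = (1 / (1 - s) + 1 / s) * k powr (s - 1)"
    using k s by (simp add: powr_divide powr_diff powr_minus field_simps)
  finally show ?thesis .
qed

text \<open>On each half of the period \<open>sig\<close> is at least the distance to the nearer
  endpoint divided by \<open>pi\<close>, and the integrand decreases in \<open>sig\<close>. This
  reduces to \<open>nn_integral_kernel\<close>; the two halves, each with Jacobian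
  \<open>pi\<close>, give the factor \<open>2 * pi\<close>.\<close>

lemma nn_integral_sig_wker:
  assumes s: "0 < s" "s < 1" and k: "0 < k"
  shows "(\<integral>\<^sup>+x. ennreal (sig x powr (- s) * wker k x) \<partial>circ)
    \<le> ennreal (2 * pi * (1 / (1 - s) + 1 / s) * real k powr (s - 1))"
proof -
  define F where "F u = ennreal (u powr (- s) / (1 + k * u)) * indicator {0..} u" for u :: real
  have [measurable]: "F \<in> borel_measurable borel" unfolding F_def by measurable
  have bnd: "ennreal (sig x powr (- s) * wker k x) \<le> F (u / pi)" if "0 < u" "u / pi \<le> sig x" for x u
  proof -
    have up: "0 < u / pi" using that by simp
    have "sig x powr (- s) * wker k x \<le> (u / pi) powr (- s) * (1 / (1 + k * (u / pi)))"
      using that up s unfolding wker_def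
      by (intro mult_mono powr_mono2' divide_left_mono add_left_mono mult_left_mono)
        (auto intro!: mult_pos_pos add_pos_nonneg)
    then show ?thesis using up unfolding F_def by (auto intro!: ennreal_leI)
  qed
  have "(\<integral>\<^sup>+x. ennreal (sig x powr (- s) * wker k x) \<partial>circ)
    = (\<integral>\<^sup>+x\<in>{0..2 * pi}. ennreal (sig x powr (- s) * wker k x) \<partial>lborel)"
    by (subst nn_integral_circ) auto
  also have "\<dots> \<le> (\<integral>\<^sup>+x. F (0 + 1 / pi * x) + F (2 + (- 1 / pi) * x) \<partial>lborel)"
  proof (intro nn_integral_mono_AE)
    have "AE x in lborel. x \<noteq> (0::real)" "AE x in lborel. x \<noteq> 2 * pi" by (rule AE_lborel_singleton)+
    then show "AE x in lborel. ennreal (sig x powr (- s) * wker k x) * indicator {0..2 * pi} x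
      \<le> F (0 + 1 / pi * x) + F (2 + (- 1 / pi) * x)"
    proof eventually_elim
      case (elim x)
      consider "x < 0 \<or> x > 2 * pi" | "0 < x" "x \<le> pi" | "pi \<le> x" "x < 2 * pi" using elim by fastforce
      then show ?case
      proof cases
        case 2
        have "x / pi \<le> sig x" using jordan_sin[of x] 2 unfolding sig_def by simp
        from bnd[OF _ this] 2 show ?thesis by (simp add: add_increasing2)
      next
        case 3
        have "sin ((2 * pi - x) / 2) = sin (x / 2)" by (simp add: diff_divide_distrib sin_diff)
        then have "(2 * pi - x) / pi \<le> sig x" using jordan_sin[of "2 * pi - x"] 3 unfolding sig_def by simp
        from bnd[OF _ this] 3 have "ennreal (sig x powr (- s) * wker k x) \<le> F ((2 * pi - x) / pi)" by auto
        also have "(2 * pi - x) / pi = 2 + (- 1 / pi) * x" by (simp add: field_simps)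
        finally show ?thesis using 3 by (simp add: add_increasing)
      qed auto
    qed
  qed
  also have "\<dots> = ennreal (2 * pi) * (\<integral>\<^sup>+u. F u \<partial>lborel)"
  proof -
    have A: "(\<integral>\<^sup>+x. F (t + c * x) \<partial>lborel) = ennreal pi * (\<integral>\<^sup>+u. F u \<partial>lborel)" if "\<bar>c\<bar> = 1 / pi" for c t :: real
    proof -
      have "(\<integral>\<^sup>+u. F u \<partial>lborel) = ennreal \<bar>c\<bar> * (\<integral>\<^sup>+x. F (t + c * x) \<partial>lborel)"
        using that by (intro nn_integral_real_affine) auto
      then have "ennreal pi * (\<integral>\<^sup>+u. F u \<partial>lborel) = (ennreal pi * ennreal \<bar>c\<bar>) * (\<integral>\<^sup>+x. F (t + c * x) \<partial>lborel)"
        by (simp add: mult.assoc)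
      also have "ennreal pi * ennreal \<bar>c\<bar> = 1" by (simp add: that flip: ennreal_mult)
      finally show ?thesis by simp
    qed
    have "(\<integral>\<^sup>+x. F (0 + 1 / pi * x) + F (2 + (- 1 / pi) * x) \<partial>lborel)
      = (\<integral>\<^sup>+x. F (0 + 1 / pi * x) \<partial>lborel) + (\<integral>\<^sup>+x. F (2 + (- 1 / pi) * x) \<partial>lborel)"
      by (rule nn_integral_add) measurable
    also have "\<dots> = ennreal pi * (\<integral>\<^sup>+u. F u \<partial>lborel) + ennreal pi * (\<integral>\<^sup>+u. F u \<partial>lborel)"
      by (subst (1 2) A) auto
    also have "\<dots> = ennreal (pi + pi) * (\<integral>\<^sup>+u. F u \<partial>lborel)"
      by (subst ennreal_plus) (auto simp: distrib_right)
    finally show ?thesis by simp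
  qed
  also have "\<dots> \<le> ennreal (2 * pi) * ennreal ((1 / (1 - s) + 1 / s) * real k powr (s - 1))"
    using nn_integral_kernel[of k s] s k unfolding F_def by (intro mult_left_mono) auto
  also have "\<dots> = ennreal (2 * pi * (1 / (1 - s) + 1 / s) * real k powr (s - 1))"
    using s by (simp add: mult.assoc flip: ennreal_mult)
  finally show ?thesis .
qed

text \<open>The kernel is symmetric in \<open>k\<close> and \<open>sig x\<close>, so this is the
  half-line integral of \<open>nn_integral_kernel\<close> with the roles exchanged, after comparing
  the sum of a decreasing function with its integral. The term \<open>k = 0\<close> is zero because
  \<open>0 powr (- s) = 0\<close>.\<close>

lemma suminf_wker:
  assumes s: "0 < s" "s < 1" and x: "0 < sig x"
  shows "(\<Sum>k. ennreal (real k powr (- s) * wker k x))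
    \<le> ennreal ((1 / (1 - s) + 1 / s) * sig x powr (s - 1))"
proof -
  define F where "F u = u powr (- s) / (1 + sig x * u)" for u :: real
  have [measurable]: "F \<in> borel_measurable borel" unfolding F_def by measurable
  have "(\<Sum>k. ennreal (real k powr (- s) * wker k x)) = (\<Sum>k. ennreal (F (real (Suc k))))"
    by (subst suminf_offset[of _ 1]) (auto simp: F_def wker_def mult.commute)
  also have "\<dots> \<le> (\<Sum>k. (\<integral>\<^sup>+u. ennreal (F u) * indicator {real k<..real (Suc k)} u \<partial>lborel))"
  proof (rule ennreal_suminf_le)
    fix k
    have "ennreal (F (real (Suc k))) = (\<integral>\<^sup>+u. ennreal (F (real (Suc k))) * indicator {real k<..real (Suc k)} u \<partial>lborel)"
      by (simp add: nn_integral_cmult)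
    also have "\<dots> \<le> (\<integral>\<^sup>+u. ennreal (F u) * indicator {real k<..real (Suc k)} u \<partial>lborel)"
    proof (intro nn_integral_mono)
      fix u
      have "F (real (Suc k)) \<le> F u" if "real k < u" "u \<le> real (Suc k)"
        using that s unfolding F_def
        by (intro frac_le powr_mono2' add_left_mono mult_left_mono) (auto intro!: add_pos_nonneg)
      then show "ennreal (F (real (Suc k))) * indicator {real k<..real (Suc k)} u
          \<le> ennreal (F u) * indicator {real k<..real (Suc k)} u"
        by (auto simp: indicator_def intro!: ennreal_leI)
    qed
    finally show "ennreal (F (real (Suc k))) \<le> (\<integral>\<^sup>+u. ennreal (F u) * indicator {real k<..real (Suc k)} u \<partial>lborel)" .
  qed
  also have "\<dots> = (\<integral>\<^sup>+u. (\<Sum>k. ennreal (F u) * indicator {real k<..real (Suc k)} u) \<partial>lborel)"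
    by (intro nn_integral_suminf[symmetric]) measurable
  also have "\<dots> \<le> (\<integral>\<^sup>+u\<in>{0..}. ennreal (F u) \<partial>lborel)"
  proof (intro nn_integral_mono)
    fix u :: real
    have "disjoint_family (\<lambda>k. {real k<..real (Suc k)})"
      unfolding disjoint_family_on_def
    proof (intro ballI impI)
      fix i j :: nat assume "i \<noteq> j"
      then have "real i + 1 \<le> real j \<or> real j + 1 \<le> real i" by linarith
      then show "{real i<..real (Suc i)} \<inter> {real j<..real (Suc j)} = {}" by fastforce
    qed
    then have "(\<Sum>k. indicator {real k<..real (Suc k)} u :: ennreal) = indicator (\<Union>k. {real k<..real (Suc k)}) u"
      by (rule suminf_indicator)
    also have "\<dots> \<le> indicator {0..} u" by (auto simp: indicator_def)
    finally show "(\<Sum>k. ennreal (F u) * indicator {real k<..real (Suc k)} u) \<le> ennreal (F u) * indicator {0..} u"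
      by (simp add: mult_left_mono)
  qed
  also have "\<dots> \<le> ennreal ((1 / (1 - s) + 1 / s) * sig x powr (s - 1))"
    unfolding F_def using nn_integral_kernel[OF x s] by simp
  finally show ?thesis .
qed

subsection \<open>Hardy-type inequalities\<close>

text \<open>The pointwise half of a Schur test: Jensen with the weights
  \<open>real k powr (- s) * wker k x\<close>. The choice \<open>s = 1 - 1 / p\<close> gives
  \<open>(s - 1) * (p - 1) = - s\<close>, so the sum of the weights contributes
  \<open>sig x powr (- s)\<close>, which \<open>nn_integral_sig_wker\<close> can integrate against
  the kernel.\<close>

lemma enn_powr_suminf_wker:
  assumes p: "1 < p" and s_def: "s = 1 - 1 / p" and c0: "c 0 = 0" and x: "0 < sig x"
  shows "enn_powr (\<Sum>k. c k * ennreal (wker k x)) p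
    \<le> ennreal ((p + p / (p - 1)) powr (p - 1)) *
        (\<Sum>k. enn_powr (c k) p * ennreal (real k powr (s * (p - 1))) * ennreal (sig x powr (- s) * wker k x))"
proof -
  have s: "0 < s" "s < 1" "1 - s = 1 / p" "1 / s = p / (p - 1)" using p by (auto simp: s_def field_simps)
  let ?K = "p + p / (p - 1)"
  have K: "1 / (1 - s) + 1 / s = ?K" using s p by simp
  have K0: "0 < ?K" using p by (simp add: add_pos_pos)
  let ?q = "\<lambda>k. ennreal (real k powr (- s) * wker k x)"
  let ?z = "\<lambda>k. c k * ennreal (real k powr s)"
  have w0: "0 \<le> wker k x" for k using wker_pos[of k x] by simp
  have "(\<Sum>k. c k * ennreal (wker k x)) = (\<Sum>k. ?q k * ?z k)"
  proof (rule suminf_cong)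
    fix k show "c k * ennreal (wker k x) = ?q k * ?z k"
    proof (cases "k = 0")
      case False
      then have "ennreal (wker k x) = ?q k * ennreal (real k powr s)"
        using w0 by (simp add: powr_minus flip: ennreal_mult)
      then show ?thesis by (simp add: mult_ac)
    qed (simp add: c0)
  qed
  then have "enn_powr (\<Sum>k. c k * ennreal (wker k x)) p
      \<le> enn_powr (\<Sum>k. ?q k) (p - 1) * (\<Sum>k. ?q k * enn_powr (?z k) p)"
    using enn_jensen_suminf[OF p, of ?q ?z] by simp
  also have "enn_powr (\<Sum>k. ?q k) (p - 1) \<le> enn_powr (ennreal (?K * sig x powr (s - 1))) (p - 1)"
    using suminf_wker[OF s(1,2) x] p unfolding K by (intro enn_powr_mono) auto
  also have "\<dots> = ennreal (?K powr (p - 1) * sig x powr (- s))"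
  proof -
    have "(s - 1) * (p - 1) = - s" using p by (simp add: s_def field_simps)
    then show ?thesis using K0 by (simp add: powr_mult powr_powr)
  qed
  also have "(\<Sum>k. ?q k * enn_powr (?z k) p)
    = (\<Sum>k. enn_powr (c k) p * ennreal (real k powr (s * (p - 1))) * ennreal (wker k x))"
  proof (rule suminf_cong)
    fix k
    have "?q k * ennreal (real k powr (s * p)) = ennreal (real k powr (s * (p - 1))) * ennreal (wker k x)"
      using w0 by (cases "k = 0") (auto simp: powr_add[symmetric] algebra_simps simp flip: ennreal_mult)
    then show "?q k * enn_powr (?z k) p = enn_powr (c k) p * ennreal (real k powr (s * (p - 1))) * ennreal (wker k x)"
      using p by (simp add: enn_powr_mult powr_powr mult_ac)
  qed
  also have "ennreal (?K powr (p - 1) * sig x powr (- s)) * (\<Sum>k. enn_powr (c k) p * ennreal (real k powr (s * (p - 1))) * ennreal (wker k x))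
    = ennreal (?K powr (p - 1)) * (\<Sum>k. enn_powr (c k) p * ennreal (real k powr (s * (p - 1))) * ennreal (sig x powr (- s) * wker k x))"
    using w0 by (simp add: ennreal_mult mult_ac flip: ennreal_suminf_cmult)
  finally show ?thesis by (simp add: mult_right_mono)
qed

text \<open>A family of nonnegative functions on the circle admits \<^emph>\<open>Hardy sums\<close> if it behaves in
  \<open>L\<^sub>p\<close> like the family of the functions \<open>1 / (1 + k \<bar>x\<bar>)\<close>.\<close>

definition hardy_family :: "real \<Rightarrow> real \<Rightarrow> (nat \<Rightarrow> real \<Rightarrow> ennreal) \<Rightarrow> bool" where
  "hardy_family p C H \<longleftrightarrow> (\<forall>k. H k \<in> borel_measurable borel) \<and>
     (\<forall>c. c 0 = 0 \<longrightarrow> (\<integral>\<^sup>+x. enn_powr (\<Sum>k. c k * H k x) p \<partial>circ)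
        \<le> ennreal C * (\<Sum>k. enn_powr (c k) p * ennreal (real k powr (p - 2))))"

text \<open>With \<open>s = 1 - 1 / p\<close> one has
  \<open>1 / (1 - s) + 1 / s = p + p / (p - 1)\<close>. This number enters to the power
  \<open>p - 1\<close> from the summation over \<open>k\<close>, and once more, with
  \<open>2 * pi\<close>, from the integration over \<open>x\<close>.\<close>

definition hardy_const :: "real \<Rightarrow> real" where
  "hardy_const p = (p + p / (p - 1)) powr (p - 1) * (2 * pi * (p + p / (p - 1)))"

lemma hardy_const_pos: "1 < p \<Longrightarrow> 0 < hardy_const p"
  unfolding hardy_const_def by (smt (verit) divide_pos_pos mult_pos_pos pi_gt_zero powr_gt_zero)

text \<open>The second half of the Schur test integrates the pointwise bound in \<open>x\<close>.
  The powers of \<open>k\<close> combine to \<open>s * (p - 1) + (s - 1) = p - 2\<close>, the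
  Hardy-Littlewood exponent.\<close>

lemma hardy_family_wker:
  assumes p: "1 < p"
  shows "hardy_family p (hardy_const p) (\<lambda>k x. ennreal (wker k x))"
  unfolding hardy_family_def
proof (intro conjI allI impI)
  fix c :: "nat \<Rightarrow> ennreal" assume c0: "c 0 = 0"
  define s where "s = 1 - 1 / p"
  have s: "0 < s" "s < 1" "1 - s = 1 / p" "1 / s = p / (p - 1)" using p by (auto simp: s_def field_simps)
  define K where "K = p + p / (p - 1)"
  have K0: "0 < K" using p by (simp add: K_def add_pos_pos)
  have "(\<integral>\<^sup>+x. enn_powr (\<Sum>k. c k * ennreal (wker k x)) p \<partial>circ)
    \<le> (\<integral>\<^sup>+x. ennreal (K powr (p - 1)) *
        (\<Sum>k. enn_powr (c k) p * ennreal (real k powr (s * (p - 1))) * ennreal (sig x powr (- s) * wker k x)) \<partial>circ)"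
    by (rule nn_integral_mono_AE, rule eventually_mono[OF AE_circ[OF sig_pos_AE]])
      (rule enn_powr_suminf_wker[where c = c, OF p s_def c0, folded K_def])
  also have "\<dots> = ennreal (K powr (p - 1)) *
        (\<Sum>k. enn_powr (c k) p * ennreal (real k powr (s * (p - 1))) * (\<integral>\<^sup>+x. ennreal (sig x powr (- s) * wker k x) \<partial>circ))"
    by (simp add: nn_integral_cmult nn_integral_suminf)
  also have "\<dots> \<le> ennreal (K powr (p - 1)) *
        (\<Sum>k. enn_powr (c k) p * (ennreal (2 * pi * K) * ennreal (real k powr (p - 2))))"
  proof (intro mult_left_mono ennreal_suminf_le)
    fix k
    show "enn_powr (c k) p * ennreal (real k powr (s * (p - 1))) * (\<integral>\<^sup>+x. ennreal (sig x powr (- s) * wker k x) \<partial>circ)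
       \<le> enn_powr (c k) p * (ennreal (2 * pi * K) * ennreal (real k powr (p - 2)))"
    proof (cases "k = 0")
      case False
      have "ennreal (real k powr (s * (p - 1))) * (\<integral>\<^sup>+x. ennreal (sig x powr (- s) * wker k x) \<partial>circ)
        \<le> ennreal (real k powr (s * (p - 1))) * ennreal (2 * pi * K * real k powr (s - 1))"
        using nn_integral_sig_wker[OF s(1,2), of k] False s(3,4) unfolding K_def by (intro mult_left_mono) auto
      also have "\<dots> = ennreal (2 * pi * K) * ennreal (real k powr (s * (p - 1)) * real k powr (s - 1))"
        using K0 by (simp add: ennreal_mult mult_ac)
      also have "real k powr (s * (p - 1)) * real k powr (s - 1) = real k powr (p - 2)"
      proof -
        have "s * (p - 1) + (s - 1) = p - 2" using p by (simp add: s_def field_simps)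
        then show ?thesis by (simp only: powr_add[symmetric])
      qed
      finally show ?thesis by (simp add: mult.assoc mult_left_mono)
    qed simp
  qed auto
  also have "\<dots> = ennreal (hardy_const p) * (\<Sum>k. enn_powr (c k) p * ennreal (real k powr (p - 2)))"
    using K0 by (simp add: hardy_const_def K_def[symmetric] ennreal_mult mult_ac flip: ennreal_suminf_cmult)
  finally show "(\<integral>\<^sup>+x. enn_powr (\<Sum>k. c k * ennreal (wker k x)) p \<partial>circ)
    \<le> ennreal (hardy_const p) * (\<Sum>k. enn_powr (c k) p * ennreal (real k powr (p - 2)))" .
qed auto

text \<open>The adjoint of \<open>hardy_family_wker\<close> for the conjugate exponent. It is proved
  directly by the Schur test with the roles of \<open>k\<close> and \<open>x\<close> interchanged
  and the weight \<open>sig x powr (- t)\<close>, \<open>t = 1 / p\<close>; the powers of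
  \<open>k\<close> now combine to \<open>p - 2 + (t - 1) * (p - 1) = - t\<close>.\<close>

lemma hardy_family_dual:
  assumes p: "1 < p" and [measurable]: "g \<in> borel_measurable borel"
  shows "(\<Sum>k. ennreal (real k powr (p - 2)) * enn_powr (\<integral>\<^sup>+x. g x * ennreal (wker k x) \<partial>circ) p)
    \<le> ennreal ((2 * pi * (p + p / (p - 1))) powr (p - 1) * (p + p / (p - 1))) * (\<integral>\<^sup>+x. enn_powr (g x) p \<partial>circ)"
proof -
  define t where "t = 1 / p"
  have t: "0 < t" "t < 1" "1 / (1 - t) + 1 / t = p + p / (p - 1)" "t * (p - 1) = 1 - t" using p by (auto simp: t_def field_simps)
  define K where "K = p + p / (p - 1)"
  have K0: "0 < K" using p by (simp add: K_def add_pos_pos)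
  have w0: "0 \<le> wker k x" for k x using wker_pos[of k x] by simp
  have step: "ennreal (real k powr (p - 2)) * enn_powr (\<integral>\<^sup>+x. g x * ennreal (wker k x) \<partial>circ) p
    \<le> ennreal ((2 * pi * K) powr (p - 1)) * (\<integral>\<^sup>+x. enn_powr (g x) p * ennreal (sig x powr (t * (p - 1))) * ennreal (real k powr (- t) * wker k x) \<partial>circ)" for k
  proof (cases "k = 0")
    case False
    let ?q = "\<lambda>x. ennreal (sig x powr (- t) * wker k x)"
    let ?z = "\<lambda>x. g x * ennreal (sig x powr t)"
    have "(\<integral>\<^sup>+x. g x * ennreal (wker k x) \<partial>circ) = (\<integral>\<^sup>+x. ?q x * ?z x \<partial>circ)"
    proof (rule nn_integral_cong_AE, use AE_circ[OF sig_pos_AE] in eventually_elim)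
      case (elim x)
      then have "ennreal (wker k x) = ?q x * ennreal (sig x powr t)"
        using w0 by (simp add: powr_minus flip: ennreal_mult)
      then show ?case by (simp add: mult_ac)
    qed
    then have "enn_powr (\<integral>\<^sup>+x. g x * ennreal (wker k x) \<partial>circ) p
      \<le> enn_powr (\<integral>\<^sup>+x. ?q x \<partial>circ) (p - 1) * (\<integral>\<^sup>+x. ?q x * enn_powr (?z x) p \<partial>circ)"
      using enn_jensen[of ?q circ ?z p] p by simp
    also have "enn_powr (\<integral>\<^sup>+x. ?q x \<partial>circ) (p - 1) \<le> enn_powr (ennreal (2 * pi * K * real k powr (t - 1))) (p - 1)"
      using nn_integral_sig_wker[OF t(1,2), of k] False p unfolding t(3) K_def[symmetric] by (intro enn_powr_mono) auto
    also have "\<dots> = ennreal ((2 * pi * K) powr (p - 1) * real k powr ((t - 1) * (p - 1)))"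
      using K0 by (simp add: powr_mult powr_powr)
    also have "(\<integral>\<^sup>+x. ?q x * enn_powr (?z x) p \<partial>circ)
      = (\<integral>\<^sup>+x. enn_powr (g x) p * ennreal (sig x powr (t * (p - 1))) * ennreal (wker k x) \<partial>circ)"
    proof (rule nn_integral_cong_AE, use AE_circ[OF sig_pos_AE] in eventually_elim)
      case (elim x)
      have "?q x * ennreal (sig x powr (t * p)) = ennreal (sig x powr (t * (p - 1))) * ennreal (wker k x)"
        using w0 elim by (simp add: powr_add[symmetric] algebra_simps flip: ennreal_mult)
      then show ?case using p by (simp add: enn_powr_mult powr_powr mult_ac)
    qed
    finally have "ennreal (real k powr (p - 2)) * enn_powr (\<integral>\<^sup>+x. g x * ennreal (wker k x) \<partial>circ) p
      \<le> ennreal (real k powr (p - 2)) * (ennreal ((2 * pi * K) powr (p - 1) * real k powr ((t - 1) * (p - 1))) * 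
        (\<integral>\<^sup>+x. enn_powr (g x) p * ennreal (sig x powr (t * (p - 1))) * ennreal (wker k x) \<partial>circ))"
      by (simp add: mult_left_mono mult_right_mono)
    also have "\<dots> = ennreal ((2 * pi * K) powr (p - 1)) * (ennreal (real k powr (p - 2) * real k powr ((t - 1) * (p - 1))) *
        (\<integral>\<^sup>+x. enn_powr (g x) p * ennreal (sig x powr (t * (p - 1))) * ennreal (wker k x) \<partial>circ))"
      by (simp add: ennreal_mult mult_ac)
    also have "real k powr (p - 2) * real k powr ((t - 1) * (p - 1)) = real k powr (- t)"
    proof -
      have "p - 2 + (t - 1) * (p - 1) = - t" using p by (simp add: t_def field_simps)
      then show ?thesis by (simp add: powr_add[symmetric])
    qed
    finally show ?thesis using w0 by (simp add: ennreal_mult mult_ac flip: nn_integral_cmult)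
  qed simp
  have "(\<Sum>k. ennreal (real k powr (p - 2)) * enn_powr (\<integral>\<^sup>+x. g x * ennreal (wker k x) \<partial>circ) p)
    \<le> (\<Sum>k. ennreal ((2 * pi * K) powr (p - 1)) * (\<integral>\<^sup>+x. enn_powr (g x) p * ennreal (sig x powr (t * (p - 1))) * ennreal (real k powr (- t) * wker k x) \<partial>circ))"
    by (intro ennreal_suminf_le step)
  also have "\<dots> = ennreal ((2 * pi * K) powr (p - 1)) * (\<integral>\<^sup>+x. enn_powr (g x) p * ennreal (sig x powr (t * (p - 1))) * (\<Sum>k. ennreal (real k powr (- t) * wker k x)) \<partial>circ)"
    by (simp add: nn_integral_suminf[symmetric])
  also have "\<dots> \<le> ennreal ((2 * pi * K) powr (p - 1)) * (\<integral>\<^sup>+x. ennreal K * enn_powr (g x) p \<partial>circ)"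
  proof (intro mult_left_mono nn_integral_mono_AE, use AE_circ[OF sig_pos_AE] in eventually_elim)
    case (elim x)
    have "sig x powr (1 - t) * sig x powr (t - 1) = 1"
      using elim by (simp add: powr_add[symmetric])
    then have eq: "ennreal (sig x powr (t * (p - 1))) * ennreal (K * sig x powr (t - 1)) = ennreal K"
      using elim K0 by (simp add: t(4) mult.left_commute[of _ K] flip: ennreal_mult)
    have "enn_powr (g x) p * ennreal (sig x powr (t * (p - 1))) * (\<Sum>k. ennreal (real k powr (- t) * wker k x))
      \<le> enn_powr (g x) p * ennreal (sig x powr (t * (p - 1))) * ennreal (K * sig x powr (t - 1))"
      using suminf_wker[OF t(1,2) elim] unfolding t(3) K_def[symmetric] by (intro mult_left_mono) auto
    also have "\<dots> = ennreal K * enn_powr (g x) p" by (simp only: mult.assoc eq) (simp add: mult.commute)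
    finally show ?case .
  qed auto
  also have "\<dots> = ennreal ((2 * pi * K) powr (p - 1) * K) * (\<integral>\<^sup>+x. enn_powr (g x) p \<partial>circ)"
    using K0 by (simp add: nn_integral_cmult ennreal_mult mult.assoc)
  finally show ?thesis unfolding K_def .
qed

text \<open>One variable at a time: for fixed \<open>y\<close> the inner sums over \<open>l\<close>
  are nonnegative coefficients of the family in \<open>x\<close>, and each of them is then treated
  by the family in \<open>y\<close>. Arbitrary coefficients in \<open>ennreal\<close> are allowed in
  \<open>hardy_family\<close> for this purpose.\<close>

lemma hardy_family_2d:
  assumes p: "1 < p" and H: "hardy_family p C H" "hardy_family p C' H'"
    and c0: "\<And>l. c 0 l = 0" "\<And>k. c k 0 = 0"
  shows "(\<integral>\<^sup>+y. \<integral>\<^sup>+x. enn_powr (\<Sum>k. \<Sum>l. c k l * H k x * H' l y) p \<partial>circ \<partial>circ)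
    \<le> ennreal C * ennreal C' * (\<Sum>k. \<Sum>l. enn_powr (c k l) p * ennreal (real k powr (p - 2) * real l powr (p - 2)))"
proof -
  have [measurable]: "H k \<in> borel_measurable borel" "H' k \<in> borel_measurable borel" for k
    using H by (auto simp: hardy_family_def)
  have "(\<integral>\<^sup>+y. \<integral>\<^sup>+x. enn_powr (\<Sum>k. \<Sum>l. c k l * H k x * H' l y) p \<partial>circ \<partial>circ)
    = (\<integral>\<^sup>+y. \<integral>\<^sup>+x. enn_powr (\<Sum>k. (\<Sum>l. c k l * H' l y) * H k x) p \<partial>circ \<partial>circ)"
    by (simp add: mult_ac flip: ennreal_suminf_cmult)
  also have "\<dots> \<le> (\<integral>\<^sup>+y. ennreal C * (\<Sum>k. enn_powr (\<Sum>l. c k l * H' l y) p * ennreal (real k powr (p - 2))) \<partial>circ)"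
    using H(1) c0 unfolding hardy_family_def by (intro nn_integral_mono) auto
  also have "\<dots> = ennreal C * (\<Sum>k. (\<integral>\<^sup>+y. enn_powr (\<Sum>l. c k l * H' l y) p \<partial>circ) * ennreal (real k powr (p - 2)))"
    by (simp add: nn_integral_cmult nn_integral_suminf nn_integral_multc)
  also have "\<dots> \<le> ennreal C * (\<Sum>k. (ennreal C' * (\<Sum>l. enn_powr (c k l) p * ennreal (real l powr (p - 2)))) * ennreal (real k powr (p - 2)))"
    using H(2) c0 unfolding hardy_family_def
    by (intro mult_left_mono ennreal_suminf_le mult_right_mono) auto
  also have "\<dots> = ennreal C * ennreal C' * (\<Sum>k. \<Sum>l. enn_powr (c k l) p * ennreal (real k powr (p - 2) * real l powr (p - 2)))"
    by (simp add: ennreal_mult mult_ac flip: ennreal_suminf_cmult)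
  finally show ?thesis .
qed

lemma hardy_dual_2d:
  fixes g :: "real \<Rightarrow> real \<Rightarrow> ennreal"
  assumes p: "1 < p" and g[measurable]: "case_prod g \<in> borel_measurable (borel \<Otimes>\<^sub>M borel)"
  defines "K \<equiv> (2 * pi * (p + p / (p - 1))) powr (p - 1) * (p + p / (p - 1))"
  shows "(\<Sum>k. \<Sum>l. ennreal (real k powr (p - 2) * real l powr (p - 2)) *
      enn_powr (\<integral>\<^sup>+x. \<integral>\<^sup>+y. g x y * ennreal (wker k x * wker l y) \<partial>circ \<partial>circ) p)
    \<le> ennreal K * ennreal K * (\<integral>\<^sup>+x. \<integral>\<^sup>+y. enn_powr (g x y) p \<partial>circ \<partial>circ)"
proof -
  have w0: "0 \<le> wker k x" for k x using wker_pos[of k x] by simp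
  have [measurable]: "g x \<in> borel_measurable borel" for x
    using measurable_compose[OF measurable_Pair1' g, of x] by simp
  define I where "I l x = (\<integral>\<^sup>+y. g x y * ennreal (wker l y) \<partial>circ)" for l x
  have [measurable]: "I l \<in> borel_measurable borel" for l unfolding I_def by measurable
  have "(\<integral>\<^sup>+x. \<integral>\<^sup>+y. g x y * ennreal (wker k x * wker l y) \<partial>circ \<partial>circ) = (\<integral>\<^sup>+x. I l x * ennreal (wker k x) \<partial>circ)" for k l
    unfolding I_def using w0
    by (simp add: ennreal_mult mult.left_commute[of "g _ _"] nn_integral_cmult mult.commute[of _ "ennreal (wker k _)"])
  then have "(\<Sum>k. \<Sum>l. ennreal (real k powr (p - 2) * real l powr (p - 2)) *
      enn_powr (\<integral>\<^sup>+x. \<integral>\<^sup>+y. g x y * ennreal (wker k x * wker l y) \<partial>circ \<partial>circ) p)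
    = (\<Sum>l. \<Sum>k. ennreal (real k powr (p - 2) * real l powr (p - 2)) * enn_powr (\<integral>\<^sup>+x. I l x * ennreal (wker k x) \<partial>circ) p)"
    by (subst ennreal_suminf_commute) simp
  also have "\<dots> = (\<Sum>l. ennreal (real l powr (p - 2)) * (\<Sum>k. ennreal (real k powr (p - 2)) * enn_powr (\<integral>\<^sup>+x. I l x * ennreal (wker k x) \<partial>circ) p))"
    by (simp add: ennreal_mult mult_ac flip: ennreal_suminf_cmult)
  also have "\<dots> \<le> (\<Sum>l. ennreal (real l powr (p - 2)) * (ennreal K * (\<integral>\<^sup>+x. enn_powr (I l x) p \<partial>circ)))"
    unfolding K_def by (intro ennreal_suminf_le mult_left_mono hardy_family_dual p) auto
  also have "\<dots> = ennreal K * (\<integral>\<^sup>+x. (\<Sum>l. ennreal (real l powr (p - 2)) * enn_powr (I l x) p) \<partial>circ)"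
    by (simp add: nn_integral_suminf nn_integral_cmult mult.left_commute)
  also have "\<dots> \<le> ennreal K * (\<integral>\<^sup>+x. ennreal K * (\<integral>\<^sup>+y. enn_powr (g x y) p \<partial>circ) \<partial>circ)"
    unfolding K_def I_def by (intro mult_left_mono nn_integral_mono hardy_family_dual p) measurable
  also have "\<dots> = ennreal K * ennreal K * (\<integral>\<^sup>+x. \<integral>\<^sup>+y. enn_powr (g x y) p \<partial>circ \<partial>circ)"
    by (subst nn_integral_cmult) (auto simp: mult.assoc)
  finally show ?thesis .
qed

lemma nn_integral_circ_shift:
  fixes f :: "real \<Rightarrow> ennreal"
  assumes [measurable]: "f \<in> borel_measurable borel" and per: "\<And>x. f (x + 2 * pi) = f x"
  shows "(\<integral>\<^sup>+x. f (x + a) \<partial>circ) = (\<integral>\<^sup>+x. f x \<partial>circ)"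
proof -
  define T where "T = 2 * pi"
  have T: "0 < T" and perT: "f (x + T) = f x" for x using per by (auto simp: T_def)
  define J where "J a = (\<integral>\<^sup>+x\<in>{a..<a + T}. f x \<partial>lborel)" for a
  have perT': "f (x + of_int n * T) = f x" for x n
  proof (induction n rule: int_induct[where k = 0])
    case (step1 i) then show ?case using perT[of "x + of_int i * T"] by (simp add: algebra_simps)
  next
    case (step2 i) then show ?case using perT[of "x + of_int i * T - T"] by (simp add: algebra_simps)
  qed simp
  have sh: "(\<integral>\<^sup>+x. h (x + b) \<partial>lborel) = (\<integral>\<^sup>+x. h x \<partial>lborel)" if "h \<in> borel_measurable borel" for h :: "real \<Rightarrow> ennreal" and b
    using nn_integral_real_affine[OF that, of 1 b] by (simp add: add.commute)
  have J1: "J (a + of_int n * T) = J a" for a n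
  proof -
    have "J (a + of_int n * T) = (\<integral>\<^sup>+x. f (x + of_int n * T) * indicator {a + of_int n * T..<a + of_int n * T + T} (x + of_int n * T) \<partial>lborel)"
      unfolding J_def by (rule sh[symmetric]) measurable
    also have "\<dots> = J a" unfolding J_def by (intro nn_integral_cong) (auto simp: perT' indicator_def)
    finally show ?thesis .
  qed
  have J2: "J a = J 0" if "0 \<le> a" "a < T" for a
  proof -
    have "J a = (\<integral>\<^sup>+x. f x * indicator {a..<T} x + f x * indicator {T..<a + T} x \<partial>lborel)"
      unfolding J_def using that by (intro nn_integral_cong) (auto simp: indicator_def)
    also have "\<dots> = (\<integral>\<^sup>+x. f x * indicator {a..<T} x \<partial>lborel) + (\<integral>\<^sup>+x. f x * indicator {T..<a + T} x \<partial>lborel)"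
      by (intro nn_integral_add) auto
    also have "(\<integral>\<^sup>+x. f x * indicator {T..<a + T} x \<partial>lborel) = (\<integral>\<^sup>+x. f (x + T) * indicator {T..<a + T} (x + T) \<partial>lborel)"
      by (rule sh[symmetric]) measurable
    also have "\<dots> = (\<integral>\<^sup>+x. f x * indicator {0..<a} x \<partial>lborel)"
      by (intro nn_integral_cong) (auto simp: perT indicator_def)
    also have "(\<integral>\<^sup>+x. f x * indicator {a..<T} x \<partial>lborel) + (\<integral>\<^sup>+x. f x * indicator {0..<a} x \<partial>lborel)
      = (\<integral>\<^sup>+x. f x * indicator {a..<T} x + f x * indicator {0..<a} x \<partial>lborel)"
      by (intro nn_integral_add[symmetric]) auto
    also have "\<dots> = J 0"
      unfolding J_def using that by (intro nn_integral_cong) (auto simp: indicator_def)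
    finally show ?thesis .
  qed
  have J3: "J a = J 0" for a
  proof -
    define n where "n = \<lfloor>a / T\<rfloor>"
    have "of_int n \<le> a / T" "a / T < of_int n + 1" unfolding n_def by linarith+
    then have "of_int n * T \<le> a" "a < of_int n * T + T" using T by (auto simp: field_simps)
    then have "J (a - of_int n * T) = J 0" by (intro J2) auto
    then show ?thesis using J1[of "a - of_int n * T" n] by simp
  qed
  have ae: "(\<integral>\<^sup>+x\<in>{0..2 * pi}. h x \<partial>lborel) = (\<integral>\<^sup>+x\<in>{0..<T}. h x \<partial>lborel)" for h
    using AE_lborel_singleton[of "2 * pi"]
    by (intro nn_integral_cong_AE) (auto simp: T_def indicator_def elim!: eventually_mono)
  have "(\<integral>\<^sup>+x. f (x + a) \<partial>circ) = (\<integral>\<^sup>+x. f (x + a) * indicator {0..<T} x \<partial>lborel)"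
    by (subst nn_integral_circ) (simp_all add: ae)
  also have "\<dots> = (\<integral>\<^sup>+x. f (x + a) * indicator {a..<a + T} (x + a) \<partial>lborel)"
    by (intro nn_integral_cong) (simp add: indicator_def)
  also have "\<dots> = J a" unfolding J_def by (rule sh) measurable
  also have "\<dots> = (\<integral>\<^sup>+x. f x \<partial>circ)"
    using J3[of a] by (subst nn_integral_circ) (simp_all add: ae J_def)
  finally show ?thesis .
qed

text \<open>The shifts \<open>a j\<close> do not depend on \<open>k\<close>, so the sum over
  \<open>j\<close> can be pulled out of the sum over \<open>k\<close>. Jensen over \<open>j\<close>
  and invariance under translation then give the factor \<open>D powr (p - 1) * D\<close>. The
  constant is independent of the shifts, hence later of the step of the difference.\<close>

lemma hardy_family_shifts:
  fixes d :: "nat \<Rightarrow> real" and a :: "nat \<Rightarrow> real"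
  assumes p: "1 < p" and d: "\<And>j. 0 \<le> d j" "d sums D"
  shows "hardy_family p (D powr p * hardy_const p) (\<lambda>k x. \<Sum>j. ennreal (d j) * ennreal (wker k (x + a j)))"
  unfolding hardy_family_def
proof (intro conjI allI impI)
  fix c :: "nat \<Rightarrow> ennreal" assume c0: "c 0 = 0"
  have sd: "summable d" "suminf d = D" using d(2) by (simp_all add: sums_iff)
  have D: "0 \<le> D" "(\<Sum>j. ennreal (d j)) = ennreal D"
    using suminf_nonneg[OF sd(1) d(1)] suminf_ennreal2[OF d(1) sd(1)] sd(2) by simp_all
  define S where "S x = (\<Sum>k. c k * ennreal (wker k x))" for x
  have [measurable]: "S \<in> borel_measurable borel" unfolding S_def by measurable
  have "(\<integral>\<^sup>+x. enn_powr (\<Sum>k. c k * (\<Sum>j. ennreal (d j) * ennreal (wker k (x + a j)))) p \<partial>circ)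
    = (\<integral>\<^sup>+x. enn_powr (\<Sum>k. \<Sum>j. c k * (ennreal (d j) * ennreal (wker k (x + a j)))) p \<partial>circ)"
    by (intro nn_integral_cong arg_cong2[where f = enn_powr] suminf_cong ennreal_suminf_cmult[symmetric] refl)
  also have "\<dots> = (\<integral>\<^sup>+x. enn_powr (\<Sum>j. \<Sum>k. c k * (ennreal (d j) * ennreal (wker k (x + a j)))) p \<partial>circ)"
    by (subst ennreal_suminf_commute) simp
  also have "\<dots> = (\<integral>\<^sup>+x. enn_powr (\<Sum>j. ennreal (d j) * S (x + a j)) p \<partial>circ)"
    unfolding S_def by (simp add: mult_ac flip: ennreal_suminf_cmult)
  also have "\<dots> \<le> (\<integral>\<^sup>+x. enn_powr (ennreal D) (p - 1) * (\<Sum>j. ennreal (d j) * enn_powr (S (x + a j)) p) \<partial>circ)"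
    by (intro nn_integral_mono order_trans[OF enn_jensen_suminf[OF p]]) (simp add: D)
  also have "\<dots> = enn_powr (ennreal D) (p - 1) * (\<Sum>j. ennreal (d j) * (\<integral>\<^sup>+x. enn_powr (S (x + a j)) p \<partial>circ))"
    by (simp add: nn_integral_cmult nn_integral_suminf)
  also have "\<dots> = enn_powr (ennreal D) (p - 1) * (ennreal D * (\<integral>\<^sup>+x. enn_powr (S x) p \<partial>circ))"
  proof -
    have "(\<integral>\<^sup>+x. enn_powr (S (x + a j)) p \<partial>circ) = (\<integral>\<^sup>+x. enn_powr (S x) p \<partial>circ)" for j
      by (rule nn_integral_circ_shift[where f = "\<lambda>x. enn_powr (S x) p"]) (auto simp: S_def wker_periodic)
    then show ?thesis by (simp add: D)
  qed
  also have "\<dots> = ennreal (D powr p) * (\<integral>\<^sup>+x. enn_powr (S x) p \<partial>circ)"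
    using D(1) p by (cases "D = 0") (auto simp: powr_diff mult.assoc[symmetric] simp flip: ennreal_mult)
  also have "\<dots> \<le> ennreal (D powr p) * (ennreal (hardy_const p) * (\<Sum>k. enn_powr (c k) p * ennreal (real k powr (p - 2))))"
    using hardy_family_wker[OF p] c0 unfolding hardy_family_def S_def by (intro mult_left_mono) auto
  also have "\<dots> = ennreal (D powr p * hardy_const p) * (\<Sum>k. enn_powr (c k) p * ennreal (real k powr (p - 2)))"
    using hardy_const_pos[OF p] by (simp add: ennreal_mult mult.assoc)
  finally show "(\<integral>\<^sup>+x. enn_powr (\<Sum>k. c k * (\<Sum>j. ennreal (d j) * ennreal (wker k (x + a j)))) p \<partial>circ)
    \<le> ennreal (D powr p * hardy_const p) * (\<Sum>k. enn_powr (c k) p * ennreal (real k powr (p - 2)))" .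
qed measurable

subsection \<open>Fourier coefficients determine an integrable function\<close>

lemma norm_one_minus_cis: "norm (1 - cis x) = 2 * sig x"
proof -
  have "1 - cis x = - (2 * \<i> * complex_of_real (sin (x / 2)) * cis (x / 2))"
  proof (rule complex_eqI)
    have "1 - cos x = 2 * sin (x / 2) * sin (x / 2)"
      using cos_double_sin[of "x / 2"] by (simp add: power2_eq_square)
    then show "Re (1 - cis x) = Re (- (2 * \<i> * complex_of_real (sin (x / 2)) * cis (x / 2)))" by simp
    have "sin x = 2 * sin (x / 2) * cos (x / 2)" using sin_double[of "x / 2"] by simp
    then show "Im (1 - cis x) = Im (- (2 * \<i> * complex_of_real (sin (x / 2)) * cis (x / 2)))" by simp
  qed
  then show ?thesis by (simp add: norm_mult sig_def)
qed

lemma norm_sum_cis_le: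
  assumes "0 < sig x"
  shows "norm (\<Sum>k=m..<n. cis (real k * x)) \<le> 1 / sig x"
proof (cases "m < n")
  case True
  have "(1 - cis x) * (\<Sum>k=m..<n. cis (real k * x)) = (\<Sum>k=m..<n. cis (real k * x) - cis (real (Suc k) * x))"
  proof -
    have "(1 - cis x) * cis (real k * x) = cis (real k * x) - cis (real (Suc k) * x)" for k
      by (simp add: left_diff_distrib cis_mult) (simp add: algebra_simps)
    then show ?thesis by (simp only: sum_distrib_left)
  qed
  also have "\<dots> = cis (real m * x) - cis (real n * x)"
    using sum_Suc_diff'[of m n "\<lambda>k. - cis (real k * x)"] True by simp
  finally have "2 * sig x * norm (\<Sum>k=m..<n. cis (real k * x)) = norm (cis (real m * x) - cis (real n * x))"
    by (metis norm_mult norm_one_minus_cis)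
  also have "\<dots> \<le> 2" by (rule order_trans[OF norm_triangle_ineq4]) simp
  finally show ?thesis using assms by (simp add: field_simps)
qed (use assms in auto)

text \<open>The trivial bound for \<open>n * sig x \<le> 1\<close> and the geometric sum otherwise,
  each within a factor \<open>2\<close> of the kernel. The bound involves the upper end alone, so
  that the same majorant serves partial sums from any starting index.\<close>

lemma norm_sum_cis_wker:
  "norm (\<Sum>k=m..<n. cis (real k * x)) \<le> 2 * real n * wker n x"
proof (cases "real n * sig x \<le> 1")
  case True
  have "norm (\<Sum>k=m..<n. cis (real k * x)) \<le> real (n - m)"
    by (rule order_trans[OF norm_sum]) simp
  also have "\<dots> \<le> real n" by simp
  also have "\<dots> \<le> 2 * real n * wker n x"
    using True mult_right_mono[of "1 + real n * sig x" 2 "real n"] by (simp add: wker_def field_simps add_pos_nonneg)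
  finally show ?thesis .
next
  case False
  then have "real n * sig x \<noteq> 0" by linarith
  then have "sig x \<noteq> 0" "n \<noteq> 0" by auto
  then have s: "0 < sig x" "0 < real n" using sig_nonneg[of x] by linarith+
  have "norm (\<Sum>k=m..<n. cis (real k * x)) \<le> 1 / sig x" by (rule norm_sum_cis_le[OF s(1)])
  also have "\<dots> \<le> 2 * real n * wker n x"
    using False s by (simp add: wker_def field_simps add_pos_nonneg)
  finally show ?thesis .
qed

text \<open>The coefficients carry no factor \<open>1 / (2 * pi)\<close>. The constants
  \<open>(2 * pi)\<^sup>2\<close>, \<open>pi\<^sup>2\<close> and their quotient \<open>1 / 4\<close>
  below all come from this normalisation.\<close>

definition fc1 :: "(real \<Rightarrow> complex) \<Rightarrow> int \<Rightarrow> complex" where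
  "fc1 u k = (LINT x|circ. u x * cis (- (of_int k * x)))"

lemma integrable_mult_cis:
  assumes "integrable circ u"
  shows "integrable circ (\<lambda>x. u x * cis (a * x))"
proof -
  have "u \<in> borel_measurable circ" using assms by simp
  then have [measurable]: "u \<in> borel_measurable borel" by simp
  have "integrable circ (\<lambda>x. cis (a * x) * u x)"
    by (rule Bochner_Integration.integrable_bound[OF assms]) (auto simp: norm_mult cis_conv_exp)
  then show ?thesis by (simp add: mult.commute)
qed

text \<open>A real-linear function of \<open>cis x\<close> is a combination of \<open>cis x\<close>
  and \<open>cis (- x)\<close>, so multiplication by it shifts the coefficients by one in either
  direction and keeps all of them zero. For products the induction hypothesis is applied to a new
  \<open>u\<close>, which is why \<open>u\<close> is arbitrary.\<close>

lemma fc1_polynomial: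
  fixes q :: "complex \<Rightarrow> real"
  assumes "real_polynomial_function q" "integrable circ u" "\<And>k. fc1 u k = 0"
  shows "integrable circ (\<lambda>x. u x * of_real (q (cis x))) \<and> (\<forall>k. fc1 (\<lambda>x. u x * of_real (q (cis x))) k = 0)"
  using assms
proof (induction q arbitrary: u rule: real_polynomial_function.induct)
  case (linear f)
  interpret bounded_linear f by fact
  define \<alpha> \<beta> where "\<alpha> = (of_real (f 1) - \<i> * of_real (f \<i>)) / 2" "\<beta> = (of_real (f 1) + \<i> * of_real (f \<i>)) / 2"
  have eq: "complex_of_real (f (cis x)) = \<alpha> * cis (1 * x) + \<beta> * cis ((-1) * x)" for x
  proof -
    have "cis x = cos x *\<^sub>R 1 + sin x *\<^sub>R \<i>" by (simp add: complex_eq_iff)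
    then have "f (cis x) = cos x * f 1 + sin x * f \<i>" by (metis add scaleR real_scaleR_def)
    then show ?thesis by (simp add: \<alpha>_\<beta>_def complex_eq_iff algebra_simps add_divide_distrib diff_divide_distrib)
  qed
  have int: "integrable circ (\<lambda>x. u x * cis (1 * x))" "integrable circ (\<lambda>x. u x * cis ((-1) * x))"
    by (rule integrable_mult_cis[OF linear.prems(1)])+
  have ueq: "u x * of_real (f (cis x)) = \<alpha> * (u x * cis (1 * x)) + \<beta> * (u x * cis ((-1) * x))" for x
    unfolding eq by (simp add: algebra_simps)
  show ?case
  proof (intro conjI allI)
    show "integrable circ (\<lambda>x. u x * of_real (f (cis x)))"
      unfolding ueq by (rule Bochner_Integration.integrable_add[OF integrable_mult_right[OF int(1)] integrable_mult_right[OF int(2)]])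
    fix k
    have sh: "cis (j * x) * cis (- (of_int k * x)) = cis (- ((of_int k - j) * x))" for x j :: real
      by (simp add: cis_mult algebra_simps)
    have i2: "integrable circ (\<lambda>x. u x * cis (- ((of_int k - j) * x)))" for j :: real
      using integrable_mult_cis[OF linear.prems(1), of "- (of_int k - j)"] by (simp only: mult_minus_left)
    have "fc1 (\<lambda>x. u x * of_real (f (cis x))) k
      = (LINT x|circ. \<alpha> * (u x * cis (- ((of_int k - 1) * x))) + \<beta> * (u x * cis (- ((of_int k - (-1)) * x))))"
      unfolding fc1_def ueq sh[symmetric] by (simp add: algebra_simps)
    also have "\<dots> = \<alpha> * fc1 u (k - 1) + \<beta> * fc1 u (k + 1)"
      using i2[of 1] i2[of "-1"] by (subst Bochner_Integration.integral_add) (auto simp: fc1_def)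
    finally show "fc1 (\<lambda>x. u x * of_real (f (cis x))) k = 0" using linear.prems by simp
  qed
next
  case (const c)
  then show ?case by (auto simp: fc1_def mult.commute[of _ "of_real c"] mult.assoc intro!: integrable_mult_right)
next
  case (add f g)
  then have F: "integrable circ (\<lambda>x. u x * of_real (f (cis x)))" "fc1 (\<lambda>x. u x * of_real (f (cis x))) k = 0"
    and G: "integrable circ (\<lambda>x. u x * of_real (g (cis x)))" "fc1 (\<lambda>x. u x * of_real (g (cis x))) k = 0" for k
    by blast+
  have "fc1 (\<lambda>x. u x * of_real (f (cis x) + g (cis x))) k
    = fc1 (\<lambda>x. u x * of_real (f (cis x))) k + fc1 (\<lambda>x. u x * of_real (g (cis x))) k" for k
    using integrable_mult_cis[OF F(1), of "- of_int k"] integrable_mult_cis[OF G(1), of "- of_int k"]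
    unfolding fc1_def by (simp add: algebra_simps flip: Bochner_Integration.integral_add)
  then show ?case using F G by (simp add: distrib_left)
next
  case (mult f g)
  have "integrable circ (\<lambda>x. u x * of_real (f (cis x)))" "fc1 (\<lambda>x. u x * of_real (f (cis x))) k = 0" for k
    using mult by blast+
  from mult.IH(2)[OF this] show ?case by (simp add: mult.assoc)
qed

text \<open>By Stone-Weierstrass \<open>\<phi>\<close> is uniformly close to a polynomial on the
  unit circle, and the integral against the polynomial is a zeroth Fourier coefficient that
  vanishes. The error is at most \<open>e\<close> times the integral of
  \<open>norm (u x)\<close>.\<close>

lemma fc1_zero_continuous:
  fixes \<phi> :: "complex \<Rightarrow> real"
  assumes u: "integrable circ u" "\<And>k. fc1 u k = 0" and \<phi>: "continuous_on UNIV \<phi>"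
  shows "integrable circ (\<lambda>x. u x * of_real (\<phi> (cis x)))" "(LINT x|circ. u x * of_real (\<phi> (cis x))) = 0"
proof -
  have "u \<in> borel_measurable circ" using u by simp
  then have [measurable]: "u \<in> borel_measurable borel" by simp
  have [measurable]: "\<phi> \<in> borel_measurable borel" using \<phi> by (rule borel_measurable_continuous_onI)
  have [measurable]: "cis \<in> borel_measurable borel" by (simp add: cis_conv_exp[abs_def])
  have "compact (\<phi> ` sphere 0 1)" using \<phi> by (intro compact_continuous_image) (auto intro: continuous_on_subset)
  then obtain B where B: "\<And>z. z \<in> sphere 0 1 \<Longrightarrow> norm (\<phi> z) \<le> B"
    by (metis compact_imp_bounded bounded_iff imageI)
  have "integrable circ (\<lambda>x. of_real (\<phi> (cis x)) * u x)"
    by (rule Bochner_Integration.integrable_bound[OF integrable_mult_right[OF u(1), of "of_real B"]])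
      (auto simp: norm_mult intro!: mult_right_mono order_trans[OF B[unfolded real_norm_def] abs_ge_self])
  then show int: "integrable circ (\<lambda>x. u x * of_real (\<phi> (cis x)))" by (simp add: mult.commute)
  have "norm (LINT x|circ. u x * of_real (\<phi> (cis x))) \<le> e * (LINT x|circ. norm (u x))" if e: "0 < e" for e
  proof -
    obtain q where q: "real_polynomial_function q" "\<And>z. z \<in> sphere 0 1 \<Longrightarrow> \<bar>\<phi> z - q z\<bar> < e"
      using Stone_Weierstrass_real_polynomial_function[of "sphere (0::complex) 1" \<phi> e] \<phi> e
      by (metis compact_sphere continuous_on_subset subset_UNIV)
    have Q: "integrable circ (\<lambda>x. u x * of_real (q (cis x)))" "fc1 (\<lambda>x. u x * of_real (q (cis x))) 0 = 0"
      using fc1_polynomial[OF q(1) u] by auto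
    have "(LINT x|circ. u x * of_real (\<phi> (cis x))) = (LINT x|circ. u x * of_real (\<phi> (cis x)) - u x * of_real (q (cis x)))"
      using int Q by (simp add: fc1_def)
    also have "norm \<dots> \<le> (LINT x|circ. e * norm (u x))"
    proof (intro Bochner_Integration.integral_norm_bound[THEN order_trans] integral_mono)
      show "integrable circ (\<lambda>x. norm (u x * of_real (\<phi> (cis x)) - u x * of_real (q (cis x))))"
        using int Q by auto
      fix x
      have "norm (u x * of_real (\<phi> (cis x)) - u x * of_real (q (cis x))) = norm (u x) * \<bar>\<phi> (cis x) - q (cis x)\<bar>"
        by (metis norm_mult norm_of_real of_real_diff right_diff_distrib)
      also have "\<dots> \<le> norm (u x) * e" using q(2)[of "cis x"] by (intro mult_left_mono) auto
      finally show "norm (u x * of_real (\<phi> (cis x)) - u x * of_real (q (cis x))) \<le> e * norm (u x)"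
        by (simp add: mult.commute)
    qed (use u in auto)
    finally show ?thesis by simp
  qed
  then have "norm (LINT x|circ. u x * of_real (\<phi> (cis x))) \<le> 0"
  proof -
    define I where "I = (LINT x|circ. norm (u x))"
    have I0: "0 \<le> I" unfolding I_def by (rule integral_nonneg_AE) simp
    assume *: "\<And>e. 0 < e \<Longrightarrow> norm (LINT x|circ. u x * of_real (\<phi> (cis x))) \<le> e * (LINT x|circ. norm (u x))"
    show ?thesis
    proof (rule field_le_epsilon)
      fix e :: real assume e: "0 < e"
      have "norm (LINT x|circ. u x * of_real (\<phi> (cis x))) \<le> e / (I + 1) * I"
        using *[of "e / (I + 1)"] e I0 by (simp add: I_def add_nonneg_pos)
      also have "\<dots> \<le> e" using e I0 by (simp add: divide_le_eq add_nonneg_pos mult_left_mono)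
      finally show "norm (LINT x|circ. u x * of_real (\<phi> (cis x))) \<le> 0 + e" by simp
    qed
  qed
  then show "(LINT x|circ. u x * of_real (\<phi> (cis x))) = 0" by simp
qed

text \<open>Open intervals are stable under intersection and generate the Borel sets, so the
  vanishing of the integral spreads to all Borel sets by Dynkin's argument; a function whose
  integrals over all measurable sets vanish is zero almost everywhere.\<close>

lemma AE_zero_if_interval_integrals_zero:
  fixes u :: "real \<Rightarrow> complex"
  assumes M: "sigma_finite_measure M" "sets M = sets borel" and u: "integrable M u"
    and I: "\<And>a b. a < b \<Longrightarrow> (LINT x:{a<..<b}|M. u x) = 0"
  shows "AE x in M. u x = 0"
proof -
  have [measurable_cong]: "sets M = sets borel" by fact
  have si: "set_integrable M A u" if "A \<in> sets borel" for A
    using that u M(2) unfolding set_integrable_def by (intro integrable_mult_indicator) auto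
  have lim: "(LINT x:(\<Union>i. A i)|M. u x) = 0" if "range A \<subseteq> sets borel" "disjoint_family A" "\<And>i. (LINT x:A i|M. u x) = 0" for A :: "nat \<Rightarrow> real set"
  proof -
    have "A i \<in> sets M" for i using that(1) M(2) by auto
    then have "(LINT x:(\<Union>i. A i)|M. u x) = (\<Sum>i. LINT x:A i|M. u x)"
      using that(2) si[of "\<Union>i. A i"] that(1) by (intro lebesgue_integral_countable_add) (auto simp: disjoint_family_on_def)
    then show ?thesis using that(3) by simp
  qed
  \<comment> \<open>The whole line is not one of the generating intervals, yet complements in the
    Dynkin argument need it; it is exhausted by the intervals
    \<open>{- real i - 1<..<real i + 1}\<close>.\<close>
  have univ: "(LINT x:UNIV|M. u x) = 0"
  proof -
    have inc: "(\<lambda>i. LINT x:{- real i - 1<..<real i + 1}|M. u x) \<longlonglongrightarrow> (LINT x:(\<Union>i. {- real i - 1<..<real i + 1})|M. u x)"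
      using si[of "\<Union>i::nat. {- real i - 1<..<real i + 1}"] M(2)
      by (intro set_integral_cont_up) (auto simp: incseq_def)
    have "(\<Union>i::nat. {- real i - 1<..<real i + 1}) = UNIV"
    proof -
      have "\<exists>i::nat. - real i - 1 < x \<and> x < real i + 1" for x :: real
      proof -
        obtain i :: nat where "\<bar>x\<bar> < real i" using reals_Archimedean2 by blast
        then show ?thesis by (intro exI[of _ i]) linarith
      qed
      then show ?thesis by auto
    qed
    then show ?thesis using inc I by (simp add: LIMSEQ_const_iff)
  qed
  have all: "(LINT x:A|M. u x) = 0" if "A \<in> sets M" for A
  proof -
    let ?G = "range (\<lambda>(a, b). {a<..<b::real})"
    have Gs: "sets borel = sigma_sets UNIV ?G"
    proof -
      have "range (\<lambda>(a, b). box a b) = ?G" by (auto simp: image_iff)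
      then have "(borel :: real measure) = sigma UNIV ?G" by (simp only: borel_eq_box)
      then have "sets (borel :: real measure) = sets (sigma UNIV ?G)" by (rule arg_cong)
      also have "\<dots> = sigma_sets UNIV ?G" by (rule sets_measure_of) auto
      finally show ?thesis .
    qed
    have st: "Int_stable ?G"
    proof (rule Int_stableI_image)
      fix i j :: "real \<times> real"
      have "(case i of (a, b) \<Rightarrow> {a<..<b}) \<inter> (case j of (a, b) \<Rightarrow> {a<..<b})
          = (case (max (fst i) (fst j), min (snd i) (snd j)) of (a, b) \<Rightarrow> {a<..<b})"
        by (auto split: prod.splits)
      then show "\<exists>k\<in>UNIV. (case i of (a, b) \<Rightarrow> {a<..<b}) \<inter> (case j of (a, b) \<Rightarrow> {a<..<b}) = (case k of (a, b) \<Rightarrow> {a<..<b})"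
        by blast
    qed
    have "A \<in> sigma_sets UNIV ?G" using that M(2) Gs by simp
    then show ?thesis
    proof (rule sigma_sets_induct_disjoint[OF st, rotated])
      fix A assume "A \<in> ?G"
      then obtain a b where "A = {a<..<b}" by auto
      then show "(LINT x:A|M. u x) = 0" using I[of a b] by (cases "a < b") (auto simp: set_lebesgue_integral_def)
    next
      fix A assume "A \<in> sigma_sets UNIV ?G" and A0: "(LINT x:A|M. u x) = 0"
      then have A: "A \<in> sets borel" using Gs by simp
      have "(LINT x:UNIV|M. u x) = (LINT x:(A \<union> (UNIV - A))|M. u x)" by simp
      also have "\<dots> = (LINT x:A|M. u x) + (LINT x:(UNIV - A)|M. u x)"
        using A by (intro set_integral_Un si) auto
      finally show "(LINT x:(UNIV - A)|M. u x) = 0" using A0 univ by simp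
    next
      fix A :: "nat \<Rightarrow> real set"
      assume "disjoint_family A" "range A \<subseteq> sigma_sets UNIV ?G" "\<And>i. (LINT x:A i|M. u x) = 0"
      then show "(LINT x:(\<Union>i. A i)|M. u x) = 0" using Gs by (intro lim) auto
    qed (auto simp: set_lebesgue_integral_def)
  qed
  show ?thesis by (rule sigma_finite_measure.density_zero[OF M(1) u all])
qed

text \<open>An arc is a superlevel set of the cosine centred at its midpoint. Thus its indicator is
  a limit of continuous functions of \<open>cis x\<close>, to which
  \<open>fc1_zero_continuous\<close> applies.\<close>

lemma cos_gt_cos_iff_arc:
  assumes "0 \<le> a" "a < b" "b \<le> 2 * pi" "0 \<le> x" "x \<le> 2 * pi"
  shows "cos ((b - a) / 2) < cos (x - (a + b) / 2) \<longleftrightarrow> a < x \<and> x < b"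
proof -
  define r y where "r = (b - a) / 2" "y = \<bar>x - (a + b) / 2\<bar>"
  have r: "0 \<le> r" "r \<le> pi" "y \<le> 2 * pi - r" "0 \<le> y" using assms by (auto simp: r_y_def abs_if field_simps)
  have c: "cos (x - (a + b) / 2) = cos y" by (simp add: r_y_def cos_abs_real)
  have "cos r < cos y \<longleftrightarrow> y < r"
  proof (cases "y \<le> pi")
    case True then show ?thesis using r cos_mono_less_eq[of r y] by auto
  next
    case False
    have "cos y = cos (2 * pi - y)" by (simp add: cos_diff)
    then show ?thesis using r False cos_mono_less_eq[of r "2 * pi - y"] by auto
  qed
  moreover have "y < r \<longleftrightarrow> a < x \<and> x < b" by (auto simp: r_y_def abs_if field_simps)
  ultimately show ?thesis unfolding c by (simp add: r_y_def)
qed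

theorem fc1_unique:
  assumes u: "integrable circ u" and fc: "\<And>k. fc1 u k = 0"
  shows "AE x in circ. u x = 0"
proof (rule AE_zero_if_interval_integrals_zero[OF _ _ u])
  have "u \<in> borel_measurable circ" using u by simp
  then have um[measurable]: "u \<in> borel_measurable borel" by simp
  have [measurable]: "cis \<in> borel_measurable borel" by (simp add: cis_conv_exp[abs_def])
  have AEc: "AE x in circ. 0 \<le> x \<and> x \<le> 2 * pi"
    unfolding circ_def by (subst AE_density) (auto simp: indicator_def)
  have main: "(LINT x:{a<..<b}|circ. u x) = 0" if ab: "0 \<le> a" "a < b" "b \<le> 2 * pi" for a b
  proof -
    \<comment> \<open>A continuous ramp on the plane: on the circle it increases with
      \<open>n\<close> to the indicator of the arc from \<open>a\<close> to \<open>b\<close>, since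
      the inner maximum is positive exactly there.\<close>
    define \<phi> where "\<phi> n z = min 1 (real n * max 0 (Re (z * cis (- (a + b) / 2)) - cos ((b - a) / 2)))" for n z
    have cont: "continuous_on UNIV (\<phi> n)" for n unfolding \<phi>_def by (intro continuous_intros)
    have [measurable]: "\<phi> n \<in> borel_measurable borel" for n using cont by (rule borel_measurable_continuous_onI)
    have val: "Re (cis x * cis (- (a + b) / 2)) = cos (x - (a + b) / 2)" for x
      by (simp add: cis_mult) (simp add: field_simps)
    have "(\<lambda>n. LINT x|circ. u x * of_real (\<phi> n (cis x))) \<longlonglongrightarrow> (LINT x|circ. u x * of_real (indicator {a<..<b} x))"
    proof (rule integral_dominated_convergence[where w = "\<lambda>x. norm (u x)"])
      show "AE x in circ. (\<lambda>n. u x * of_real (\<phi> n (cis x))) \<longlonglongrightarrow> u x * of_real (indicator {a<..<b} x)"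
        using AEc
      proof eventually_elim
        case (elim x)
        define d where "d = max 0 (Re (cis x * cis (- (a + b) / 2)) - cos ((b - a) / 2))"
        have d: "d > 0 \<longleftrightarrow> x \<in> {a<..<b}" "d \<ge> 0"
          using cos_gt_cos_iff_arc[OF ab, of x] elim unfolding d_def val by auto
        have "(\<lambda>n. min 1 (real n * d)) \<longlonglongrightarrow> indicator {a<..<b} x"
        proof (cases "d > 0")
          case True
          obtain N where "1 / d < real N" using reals_Archimedean2 by blast
          then have "eventually (\<lambda>n. min 1 (real n * d) = 1) sequentially"
            using True by (intro eventually_sequentiallyI[of N]) (auto simp: min_def field_simps intro: order_trans[OF less_imp_le] mult_right_mono)
          then show ?thesis using True d(1) by (simp add: tendsto_eventually)
        qed (use d in auto)
        then show ?case unfolding \<phi>_def d_def by (intro tendsto_intros)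
      qed
      show "AE x in circ. norm (u x * of_real (\<phi> n (cis x))) \<le> norm (u x)" for n
        by (rule AE_I2) (auto simp: norm_mult \<phi>_def intro!: mult_right_le_one_le)
    qed (use u in auto)
    moreover have "(LINT x|circ. u x * of_real (\<phi> n (cis x))) = 0" for n
      by (rule fc1_zero_continuous(2)[OF u fc cont])
    ultimately have "(LINT x|circ. u x * of_real (indicator {a<..<b} x)) = 0" by (simp add: LIMSEQ_const_iff)
    then show ?thesis unfolding set_lebesgue_integral_def by (simp add: scaleR_conv_of_real mult.commute)
  qed
  fix a b :: real assume "a < b"
  define a' b' where "a' = max 0 a" "b' = min (2 * pi) b"
  have "(LINT x:{a<..<b}|circ. u x) = (LINT x:{a'<..<b'}|circ. u x)"
  proof -
    have "AE x in lborel. x \<noteq> (0::real)" "AE x in lborel. x \<noteq> 2 * pi" by (rule AE_lborel_singleton)+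
    then have "AE x in circ. x \<noteq> 0 \<and> x \<noteq> 2 * pi" by (intro AE_circ) auto
    with AEc have "AE x in circ. indicator {a<..<b} x *\<^sub>R u x = indicator {a'<..<b'} x *\<^sub>R u x"
      by eventually_elim (auto simp: a'_b'_def indicator_def)
    then show ?thesis unfolding set_lebesgue_integral_def by (intro integral_cong_AE) auto
  qed
  also have "\<dots> = 0"
  proof (cases "a' < b'")
    case True then show ?thesis by (intro main) (auto simp: a'_b'_def)
  qed (auto simp: set_lebesgue_integral_def)
  finally show "(LINT x:{a<..<b}|circ. u x) = 0" .
qed (auto intro: circ.sigma_finite_measure_axioms)

text \<open>The part of the Riemann-Lebesgue lemma that is wanted: a limit of the coefficients, if
  there is one, is \<open>0\<close>. The means of the coefficients over
  \<open>n \<le> k < 2 * n\<close> have the same limit and are integrals of \<open>u\<close> against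
  averages \<open>D n\<close> bounded by \<open>1\<close>; these tend to \<open>0\<close> off a null
  set by the geometric sum, so dominated convergence applies.\<close>

lemma fc1_limit_zero:
  assumes u: "integrable circ u" and lim: "(\<lambda>n. fc1 u (int n)) \<longlonglongrightarrow> L"
  shows "L = 0"
proof -
  have "u \<in> borel_measurable circ" using u by simp
  then have um[measurable]: "u \<in> borel_measurable borel" by simp
  have [measurable]: "cis \<in> borel_measurable borel" by (simp add: cis_conv_exp[abs_def])
  define D where "D n x = (\<Sum>k=n..<2*n. cis (- (real k * x))) / of_nat n" for n :: nat and x
  have D_cnj: "D n x = cnj ((\<Sum>k=n..<2*n. cis (real k * x)) / of_nat n)" for n x
    by (simp add: D_def cis_cnj)
  have nD: "norm (D n x) = norm (\<Sum>k=n..<2*n. cis (real k * x)) / real n" for n x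
    by (simp only: D_cnj complex_mod_cnj norm_divide norm_of_nat)
  have "(\<lambda>n. LINT x|circ. u x * D n x) \<longlonglongrightarrow> (LINT x|circ. 0)"
  proof (rule integral_dominated_convergence[where w = "\<lambda>x. norm (u x)"])
    show "AE x in circ. (\<lambda>n. u x * D n x) \<longlonglongrightarrow> 0"
      using AE_circ[OF sig_pos_AE]
    proof eventually_elim
      case (elim x)
      have "(\<lambda>n. D n x) \<longlonglongrightarrow> 0"
      proof (rule Lim_null_comparison)
        show "\<forall>\<^sub>F n in sequentially. norm (D n x) \<le> (1 / sig x) / real n"
          unfolding nD by (intro always_eventually allI divide_right_mono norm_sum_cis_le elim) auto
        show "(\<lambda>n. (1 / sig x) / real n) \<longlonglongrightarrow> 0" by (rule lim_const_over_n)
      qed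
      then show ?case by (rule tendsto_mult_right_zero)
    qed
    show "AE x in circ. norm (u x * D n x) \<le> norm (u x)" for n
    proof (rule AE_I2)
      fix x
      have "norm (\<Sum>k=n..<2*n. cis (real k * x)) \<le> real n" by (rule order_trans[OF norm_sum]) simp
      then have "norm (D n x) \<le> 1" unfolding nD by (simp add: divide_le_eq)
      then show "norm (u x * D n x) \<le> norm (u x)" by (simp add: norm_mult mult_right_le_one_le)
    qed
  qed (use u in \<open>auto simp: D_def\<close>)
  moreover have "(LINT x|circ. u x * D n x) = (\<Sum>k=n..<2*n. fc1 u (int k)) / of_nat n" for n
  proof -
    have "integrable circ (\<lambda>x. u x * cis (- (real k * x)))" for k
      using integrable_mult_cis[OF u, of "- real k"] by simp
    then show ?thesis unfolding D_def fc1_def by (simp add: sum_distrib_left)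
  qed
  ultimately have A: "(\<lambda>n. (\<Sum>k=n..<2*n. fc1 u (int k)) / of_nat n) \<longlonglongrightarrow> 0" by simp
  have "(\<lambda>n. (\<Sum>k=n..<2*n. fc1 u (int k)) / of_nat n) \<longlonglongrightarrow> L"
  proof (rule LIMSEQ_I)
    fix e :: real assume "0 < e"
    then have e2: "0 < e / 2" by simp
    obtain N where N: "\<And>n. n \<ge> N \<Longrightarrow> norm (fc1 u (int n) - L) < e / 2" using LIMSEQ_D[OF lim e2] by blast
    show "\<exists>N. \<forall>n\<ge>N. norm ((\<Sum>k=n..<2*n. fc1 u (int k)) / of_nat n - L) < e"
    proof (intro exI allI impI)
      fix n assume n: "n \<ge> max 1 N"
      have "(\<Sum>k=n..<2*n. fc1 u (int k)) / of_nat n - L = (\<Sum>k=n..<2*n. fc1 u (int k) - L) / of_nat n"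
        using n by (simp add: sum_subtractf field_simps)
      also have "norm \<dots> \<le> (\<Sum>k=n..<2*n. e / 2) / real n"
        unfolding norm_divide norm_of_nat
      proof (intro divide_right_mono order_trans[OF norm_sum] sum_mono)
        fix i assume "i \<in> {n..<2 * n}"
        then show "norm (fc1 u (int i) - L) \<le> e / 2" using N[of i] n by simp
      qed simp
      also have "\<dots> < e" using n \<open>0 < e\<close> by simp
      finally show "norm ((\<Sum>k=n..<2*n. fc1 u (int k)) / of_nat n - L) < e" .
    qed
  qed
  from LIMSEQ_unique[OF this A] show ?thesis .
qed

section \<open>Double Fourier coefficients\<close>

lemma sets_circ2 [measurable_cong, simp]: "sets (circ \<Otimes>\<^sub>M circ) = sets borel"
  by (simp only: sets_pair_measure_cong[OF sets_circ sets_circ] borel_prod)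


definition fc2 :: "(real \<times> real \<Rightarrow> complex) \<Rightarrow> int \<Rightarrow> int \<Rightarrow> complex" where
  "fc2 F k l = (LINT z|(circ \<Otimes>\<^sub>M circ). F z * cis (- (of_int k * fst z + of_int l * snd z)))"

interpretation circ2f: finite_measure "circ \<Otimes>\<^sub>M circ"
  by (rule finite_measure_pair_measure) (rule circ.finite_measure_axioms)+

lemma cis_measurable [measurable]: "cis \<in> borel_measurable borel"
  by (simp add: cis_conv_exp[abs_def])

lemma measurable_circ2 [simp]: "measurable (circ \<Otimes>\<^sub>M circ) M = measurable borel M"
  by (rule measurable_cong_sets[OF sets_circ2 refl])

lemma fst_borel [measurable]: "(fst :: real \<times> real \<Rightarrow> real) \<in> borel_measurable borel"
  and snd_borel [measurable]: "(snd :: real \<times> real \<Rightarrow> real) \<in> borel_measurable borel"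
  by (auto intro!: borel_measurable_continuous_onI continuous_intros)

lemma integrable_circ2_mult_cis:
  assumes "integrable (circ \<Otimes>\<^sub>M circ) F"
  shows "integrable (circ \<Otimes>\<^sub>M circ) (\<lambda>z. F z * cis (a * fst z + b * snd z))"
proof -
  have "F \<in> borel_measurable (circ \<Otimes>\<^sub>M circ)" using assms by simp
  then have [measurable]: "F \<in> borel_measurable borel" by simp
  have "integrable (circ \<Otimes>\<^sub>M circ) (\<lambda>z. cis (a * fst z + b * snd z) * F z)"
    by (rule Bochner_Integration.integrable_bound[OF assms]) (auto simp: norm_mult)
  then show ?thesis by (simp add: mult.commute)
qed

lemma fc2_iterated:
  assumes F: "integrable (circ \<Otimes>\<^sub>M circ) F"
  shows "integrable circ (\<lambda>x. fc1 (\<lambda>y. F (x, y)) l)"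
    and "fc2 F k l = fc1 (\<lambda>x. fc1 (\<lambda>y. F (x, y)) l) k"
proof -
  have I: "integrable (circ \<Otimes>\<^sub>M circ) (\<lambda>(x, y). F (x, y) * cis (- (of_int k * x + of_int l * y)))" for k
    using integrable_circ2_mult_cis[OF F, of "- of_int k" "- of_int l"] by (simp add: case_prod_unfold)
  have eq: "(LINT y|circ. F (x, y) * cis (- (of_int k * x + of_int l * y))) = fc1 (\<lambda>y. F (x, y)) l * cis (- (of_int k * x))" for x k
  proof -
    have "cis (- (of_int k * x + of_int l * y)) = cis (- (of_int l * y)) * cis (- (of_int k * x))" for y
      by (simp add: cis_mult algebra_simps)
    then show ?thesis unfolding fc1_def by (simp flip: mult.assoc)
  qed
  show "integrable circ (\<lambda>x. fc1 (\<lambda>y. F (x, y)) l)"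
    using circ2.integrable_fst[OF I[of 0]] eq[of _ 0] by simp
  show "fc2 F k l = fc1 (\<lambda>x. fc1 (\<lambda>y. F (x, y)) l) k"
    using circ2.integral_fst[OF I[of k]] unfolding eq fc2_def fc1_def[of _ k] by (simp add: case_prod_unfold)
qed

text \<open>One-variable uniqueness is used twice: for each \<open>l\<close> the coefficient in
  \<open>y\<close> is an integrable function of \<open>x\<close> with zero coefficients, and the
  countably many exceptional null sets are joined before \<open>fc1_unique\<close> is applied on
  almost every slice.\<close>

theorem fc2_unique:
  assumes F: "integrable (circ \<Otimes>\<^sub>M circ) F" and fc: "\<And>k l. fc2 F k l = 0"
  shows "AE z in (circ \<Otimes>\<^sub>M circ). F z = 0"
proof -
  have "F \<in> borel_measurable (circ \<Otimes>\<^sub>M circ)" using F by simp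
  then have [measurable]: "F \<in> borel_measurable borel" by simp
  have "AE x in circ. fc1 (\<lambda>y. F (x, y)) l = 0" for l
    using fc2_iterated(1)[OF F, of l] fc2_iterated(2)[OF F, of _ l] fc by (intro fc1_unique) auto
  then have 1: "AE x in circ. \<forall>l. fc1 (\<lambda>y. F (x, y)) l = 0" by (simp add: AE_all_countable)
  have 2: "AE x in circ. integrable circ (\<lambda>y. F (x, y))"
    using circ2.AE_integrable_fst'[OF F] .
  from 1 2 have "AE x in circ. AE y in circ. F (x, y) = 0"
    by eventually_elim (auto intro: fc1_unique)
  moreover have "{z. F z = 0} \<in> sets borel" by measurable
  then have "{z \<in> space (circ \<Otimes>\<^sub>M circ). F z = 0} \<in> sets (circ \<Otimes>\<^sub>M circ)"
    unfolding sets_circ2 by (simp add: space_pair_measure)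
  ultimately show ?thesis by (intro circ2.AE_pair_measure)
qed

subsection \<open>Doubly monotone coefficients\<close>

lemma fc2_swap:
  assumes F: "integrable (circ \<Otimes>\<^sub>M circ) F"
  shows "integrable (circ \<Otimes>\<^sub>M circ) (\<lambda>z. F (snd z, fst z))" "fc2 (\<lambda>z. F (snd z, fst z)) k l = fc2 F l k"
proof -
  show "integrable (circ \<Otimes>\<^sub>M circ) (\<lambda>z. F (snd z, fst z))"
    using circ2.integrable_product_swap[OF F] by (simp add: case_prod_unfold)
  have "F \<in> borel_measurable (circ \<Otimes>\<^sub>M circ)" using F by simp
  then have [measurable]: "F \<in> borel_measurable borel" by simp
  have "(\<lambda>z. F z * cis (- (of_int l * fst z + of_int k * snd z))) \<in> borel_measurable (circ \<Otimes>\<^sub>M circ)" by simp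
  from circ2.integral_product_swap[OF this]
  show "fc2 (\<lambda>z. F (snd z, fst z)) k l = fc2 F l k"
    unfolding fc2_def by (simp add: case_prod_unfold add.commute)
qed

lemma fc2_bound:
  assumes F: "integrable (circ \<Otimes>\<^sub>M circ) F"
  shows "norm (fc2 F k l) \<le> (LINT z|(circ \<Otimes>\<^sub>M circ). norm (F z))"
proof -
  have "norm (fc2 F k l) \<le> (LINT z|(circ \<Otimes>\<^sub>M circ). norm (F z * cis (- (of_int k * fst z + of_int l * snd z))))"
    unfolding fc2_def by (rule integral_norm_bound)
  then show ?thesis by (simp add: norm_mult)
qed

text \<open>The mixed condition says that \<open>a m n - a m (n + 1)\<close> decreases in
  \<open>m\<close>, so this difference exceeds its limit. The limit is that of the Fourier
  coefficients of the integrable function of \<open>x\<close> obtained by subtracting two adjacent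
  coefficients in \<open>y\<close>, hence \<open>0\<close> by \<open>fc1_limit_zero\<close>. No
  decay of the coefficients has to be assumed.\<close>

lemma coefficients_step:
  fixes a :: "nat \<Rightarrow> nat \<Rightarrow> real"
  assumes F: "integrable (circ \<Otimes>\<^sub>M circ) F" and c: "c \<noteq> 0"
    and fc: "\<And>m n. 1 \<le> m \<Longrightarrow> 1 \<le> n \<Longrightarrow> fc2 F (int m) (int n) = of_real c * of_real (a m n)"
    and b: "\<And>m n. 1 \<le> m \<Longrightarrow> 1 \<le> n \<Longrightarrow> 0 \<le> a m n - a (m + 1) n - a m (n + 1) + a (m + 1) (n + 1)"
    and mn: "1 \<le> m" "1 \<le> n"
  shows "a m (n + 1) \<le> a m n"
proof -
  \<comment> \<open>The index is shifted by one because \<open>a\<close> satisfies the monotonicity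
    condition from the index \<open>1\<close> on; \<open>LIMSEQ_offset\<close> removes the shift
    when the limit is identified.\<close>
  define d where "d k = a (k + 1) n - a (k + 1) (n + 1)" for k
  have dec: "decseq d"
    by (rule decseq_SucI) (use b[of "Suc _" n] mn in \<open>simp add: d_def algebra_simps\<close>)
  obtain B where B: "norm (fc2 F k l) \<le> B" for k l using fc2_bound[OF F] by blast
  have bd: "\<bar>a i j\<bar> \<le> B / \<bar>c\<bar>" if "1 \<le> i" "1 \<le> j" for i j
    using B[of "int i" "int j"] c unfolding fc[OF that] by (simp add: norm_mult field_simps)
  have "\<forall>k. - (2 * (B / \<bar>c\<bar>)) \<le> d k"
  proof
    fix k show "- (2 * (B / \<bar>c\<bar>)) \<le> d k"
      using bd[of "k + 1" n] bd[of "k + 1" "n + 1"] mn unfolding d_def by linarith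
  qed
  then obtain L where L: "d \<longlonglongrightarrow> L" "\<And>k. L \<le> d k" using decseq_convergent[OF dec] by blast
  let ?u = "\<lambda>x. fc1 (\<lambda>y. F (x, y)) (int n) - fc1 (\<lambda>y. F (x, y)) (int (n + 1))"
  have int: "integrable circ (\<lambda>x. fc1 (\<lambda>y. F (x, y)) l)" for l by (rule fc2_iterated(1)[OF F])
  have "fc1 ?u (int k) = fc2 F (int k) (int n) - fc2 F (int k) (int (n + 1))" for k
    using integrable_mult_cis[OF int[of "int n"], of "- of_int (int k)"] integrable_mult_cis[OF int[of "int (n + 1)"], of "- of_int (int k)"]
    unfolding fc2_iterated(2)[OF F] fc1_def[of _ "int k"] by (simp add: left_diff_distrib)
  then have "fc1 ?u (int (k + 1)) = of_real c * of_real (d k)" for k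
    using mn fc[of "k + 1" n] fc[of "k + 1" "n + 1"] by (simp only: d_def) (simp add: right_diff_distrib)
  then have "(\<lambda>k. fc1 ?u (int (k + 1))) \<longlonglongrightarrow> of_real c * of_real L"
    using L(1) by (simp add: tendsto_mult_left tendsto_of_real)
  then have "(\<lambda>k. fc1 ?u (int k)) \<longlonglongrightarrow> of_real c * of_real L"
    by (rule LIMSEQ_offset)
  then have "complex_of_real c * of_real L = 0"
    by (intro fc1_limit_zero[of ?u]) (auto intro: int)
  then have "L = 0" using c by simp
  then show ?thesis using L(2)[of "m - 1"] mn by (simp add: d_def)
qed

lemma coefficients_limit:
  fixes a :: "nat \<Rightarrow> nat \<Rightarrow> real"
  assumes F: "integrable (circ \<Otimes>\<^sub>M circ) F" and c: "c \<noteq> 0"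
    and fc: "\<And>m n. 1 \<le> m \<Longrightarrow> 1 \<le> n \<Longrightarrow> fc2 F (int m) (int n) = of_real c * of_real (a m n)"
    and dec: "\<And>m n. 1 \<le> m \<Longrightarrow> 1 \<le> n \<Longrightarrow> a (m + 1) n \<le> a m n"
    and n: "1 \<le> n"
  shows "(\<lambda>m. a m n) \<longlonglongrightarrow> 0"
proof -
  obtain B where B: "norm (fc2 F k l) \<le> B" for k l using fc2_bound[OF F] by blast
  have bd: "\<bar>a i n\<bar> \<le> B / \<bar>c\<bar>" if "1 \<le> i" for i
    using B[of "int i" "int n"] c unfolding fc[OF that n] by (simp add: norm_mult field_simps)
  have "decseq (\<lambda>k. a (k + 1) n)" by (rule decseq_SucI) (use dec[of "Suc _" n] n in simp)
  moreover have "\<forall>k. - (B / \<bar>c\<bar>) \<le> a (k + 1) n"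
  proof
    fix k show "- (B / \<bar>c\<bar>) \<le> a (k + 1) n" using bd[of "k + 1"] by linarith
  qed
  ultimately obtain L where L: "(\<lambda>k. a (k + 1) n) \<longlonglongrightarrow> L" using decseq_convergent by blast
  let ?u = "\<lambda>x. fc1 (\<lambda>y. F (x, y)) (int n)"
  have "fc1 ?u (int (k + 1)) = of_real c * of_real (a (k + 1) n)" for k
    using fc2_iterated(2)[OF F, of "int (k + 1)" "int n"] fc[of "k + 1" n] n by simp
  then have "(\<lambda>k. fc1 ?u (int (k + 1))) \<longlonglongrightarrow> of_real c * of_real L"
    using L by (simp add: tendsto_mult_left tendsto_of_real)
  then have "(\<lambda>k. fc1 ?u (int k)) \<longlonglongrightarrow> of_real c * of_real L" by (rule LIMSEQ_offset)
  then have "complex_of_real c * of_real L = 0"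
    by (intro fc1_limit_zero[of ?u]) (auto intro: fc2_iterated(1)[OF F])
  then have "L = 0" using c by simp
  with L have "(\<lambda>k. a (k + 1) n) \<longlonglongrightarrow> 0" by simp
  then show ?thesis by (rule LIMSEQ_offset)
qed

text \<open>The index \<open>0\<close> carries no coefficient, whence the guards \<open>1 \<le> m\<close> below.\<close>

definition doubly_monotone :: "(nat \<Rightarrow> nat \<Rightarrow> real) \<Rightarrow> bool" where
  "doubly_monotone a \<longleftrightarrow>
     (\<forall>m\<ge>1. \<forall>n\<ge>1. 0 \<le> a m n - a (m + 1) n - a m (n + 1) + a (m + 1) (n + 1)) \<and>
     (\<forall>n\<ge>1. (\<lambda>m. a m n) \<longlonglongrightarrow> 0) \<and> (\<forall>m\<ge>1. (\<lambda>n. a m n) \<longlonglongrightarrow> 0)"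

lemma doubly_monotone_coefficients:
  fixes a :: "nat \<Rightarrow> nat \<Rightarrow> real"
  assumes F: "integrable (circ \<Otimes>\<^sub>M circ) F" and c: "c \<noteq> 0"
    and fc: "\<And>m n. 1 \<le> m \<Longrightarrow> 1 \<le> n \<Longrightarrow> fc2 F (int m) (int n) = of_real c * of_real (a m n)"
    and b: "\<And>m n. 1 \<le> m \<Longrightarrow> 1 \<le> n \<Longrightarrow> 0 \<le> a m n - a (m + 1) n - a m (n + 1) + a (m + 1) (n + 1)"
  shows "doubly_monotone a"
proof -
  let ?F = "\<lambda>z. F (snd z, fst z)" and ?a = "\<lambda>m n. a n m"
  have fc': "fc2 ?F (int m) (int n) = of_real c * of_real (?a m n)" if "1 \<le> m" "1 \<le> n" for m n
    using fc2_swap(2)[OF F] fc that by simp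
  have b': "0 \<le> ?a m n - ?a (m + 1) n - ?a m (n + 1) + ?a (m + 1) (n + 1)" if "1 \<le> m" "1 \<le> n" for m n
    using b[OF that(2,1)] by (simp add: algebra_simps)
  have s: "a m (n + 1) \<le> a m n" "a (m + 1) n \<le> a m n" if "1 \<le> m" "1 \<le> n" for m n
    using coefficients_step[OF F c fc b that] coefficients_step[OF fc2_swap(1)[OF F] c fc' b' that(2,1)] by auto
  have "(\<lambda>m. a m n) \<longlonglongrightarrow> 0" "(\<lambda>m. a n m) \<longlonglongrightarrow> 0" if "1 \<le> n" for n
    using coefficients_limit[OF F c fc s(2) that]
      coefficients_limit[OF fc2_swap(1)[OF F] c fc' s(1) that] by auto
  then show ?thesis using b unfolding doubly_monotone_def by auto
qed

lemma ennreal_telescope: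
  fixes g :: "nat \<Rightarrow> real"
  assumes dec: "\<And>j. l \<le> j \<Longrightarrow> g (Suc j) \<le> g j" and lim: "g \<longlonglongrightarrow> 0"
  shows "(\<Sum>j. ennreal (if l \<le> j then g j - g (Suc j) else 0)) = ennreal (g l)" "0 \<le> g l"
proof -
  have "(\<lambda>n. g (n + l)) \<longlonglongrightarrow> 0" using lim by (rule LIMSEQ_ignore_initial_segment)
  from telescope_sums'[OF this] have s: "(\<lambda>n. g (n + l) - g (Suc n + l)) sums g l" by simp
  have nn: "0 \<le> g (n + l) - g (Suc n + l)" for n using dec[of "n + l"] by simp
  show "0 \<le> g l" by (rule sums_le[OF _ sums_zero s]) (rule nn)
  have "(\<Sum>j. ennreal (if l \<le> j then g j - g (Suc j) else 0)) = (\<Sum>j. ennreal (g (j + l) - g (Suc j + l)))"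
    by (subst suminf_offset[of _ l]) auto
  also have "\<dots> = ennreal (g l)" using suminf_ennreal_eq[OF nn s] .
  finally show "(\<Sum>j. ennreal (if l \<le> j then g j - g (Suc j) else 0)) = ennreal (g l)" .
qed

definition mixed_diff :: "(nat \<Rightarrow> nat \<Rightarrow> real) \<Rightarrow> nat \<Rightarrow> nat \<Rightarrow> real" where
  "mixed_diff a i j = (if 1 \<le> i \<and> 1 \<le> j then a i j - a (i + 1) j - a i (j + 1) + a (i + 1) (j + 1) else 0)"

context
  fixes a :: "nat \<Rightarrow> nat \<Rightarrow> real"
  assumes a: "doubly_monotone a"
begin

lemma mixed_diff_nonneg: "0 \<le> mixed_diff a i j"
  using a by (simp add: mixed_diff_def doubly_monotone_def)

lemma doubly_monotone_row:
  assumes "1 \<le> i" "1 \<le> l"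
  shows "(\<Sum>j. ennreal (if l \<le> j then mixed_diff a i j else 0)) = ennreal (a i l - a (i + 1) l)"
    "a (i + 1) l \<le> a i l"
proof -
  define g where "g j = a i j - a (i + 1) j" for j
  have dec: "g (Suc j) \<le> g j" if "l \<le> j" for j
    using mixed_diff_nonneg[of i j] that assms by (simp add: mixed_diff_def g_def)
  have lim: "g \<longlonglongrightarrow> 0" unfolding g_def
    using a assms by (auto simp: doubly_monotone_def intro!: tendsto_eq_intros)
  have eq: "(if l \<le> j then mixed_diff a i j else 0) = (if l \<le> j then g j - g (Suc j) else 0)" for j
    using assms by (auto simp: mixed_diff_def g_def)
  show "(\<Sum>j. ennreal (if l \<le> j then mixed_diff a i j else 0)) = ennreal (a i l - a (i + 1) l)"
    using ennreal_telescope(1)[OF dec lim] unfolding eq by (simp add: g_def)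
  show "a (i + 1) l \<le> a i l" using ennreal_telescope(2)[OF dec lim] by (simp add: g_def)
qed

text \<open>Telescoping in one index after the other, with limits \<open>0\<close>, writes
  \<open>a k l\<close> as the sum of its mixed differences over the quadrant above
  \<open>(k, l)\<close>. This representation is what Abel summation inverts.\<close>

lemma doubly_monotone_sum:
  assumes "1 \<le> k" "1 \<le> l"
  shows "(\<Sum>i. \<Sum>j. ennreal (if k \<le> i \<and> l \<le> j then mixed_diff a i j else 0)) = ennreal (a k l)" "0 \<le> a k l"
proof -
  have dec: "a (Suc i) l \<le> a i l" if "k \<le> i" for i using doubly_monotone_row(2)[of i l] that assms by simp
  have lim: "(\<lambda>i. a i l) \<longlonglongrightarrow> 0" using a assms by (auto simp: doubly_monotone_def)
  have "(\<Sum>j. ennreal (if k \<le> i \<and> l \<le> j then mixed_diff a i j else 0)) = ennreal (if k \<le> i then a i l - a (Suc i) l else 0)" for i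
    using doubly_monotone_row(1)[of i l] assms by (cases "k \<le> i") auto
  then show "(\<Sum>i. \<Sum>j. ennreal (if k \<le> i \<and> l \<le> j then mixed_diff a i j else 0)) = ennreal (a k l)"
    using ennreal_telescope(1)[OF dec lim] by simp
  show "0 \<le> a k l" by (rule ennreal_telescope(2)[OF dec lim])
qed

text \<open>Passing to larger indices shrinks the quadrant over which nonnegative differences are
  summed.\<close>

lemma doubly_monotone_antimono:
  assumes "1 \<le> k" "1 \<le> l" "k \<le> k'" "l \<le> l'"
  shows "a k' l' \<le> a k l"
proof -
  have "ennreal (a k' l') \<le> ennreal (a k l)"
    using assms by (subst (1 2) doubly_monotone_sum(1)[symmetric])
      (auto intro!: ennreal_suminf_le ennreal_leI mixed_diff_nonneg)
  then show ?thesis using doubly_monotone_sum(2)[of k l] assms by (simp add: ennreal_le_iff)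
qed

end

subsection \<open>The multiplier of a fractional difference\<close>

definition bcoef :: "real \<Rightarrow> nat \<Rightarrow> real" where
  "bcoef \<beta> \<nu> = (- 1) ^ \<nu> * (\<beta> gchoose \<nu>)"

lemma bcoef_0 [simp]: "bcoef \<beta> 0 = 1" by (simp add: bcoef_def)

lemma bcoef_Suc: "(real \<nu> + 1) * bcoef \<beta> (Suc \<nu>) = (real \<nu> - \<beta>) * bcoef \<beta> \<nu>"
  using arg_cong[OF gbinomial_mult_1[of \<beta> \<nu>], of "(*) ((- 1) ^ \<nu>)"] by (simp add: bcoef_def algebra_simps)

text \<open>The sequence \<open>\<nu> \<bar>bcoef \<beta> \<nu>\<bar>\<close> decreases by \<open>\<beta> \<bar>bcoef \<beta> \<nu>\<bar>\<close> from \<open>\<nu>\<close> to \<open>\<nu> + 1\<close>, once \<open>\<nu> \<ge> \<beta>\<close>.\<close>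

lemma summable_bcoef:
  assumes \<beta>: "0 < \<beta>"
  shows "summable (\<lambda>\<nu>. \<bar>bcoef \<beta> \<nu>\<bar>)"
proof -
  define N where "N = nat \<lceil>\<beta>\<rceil>"
  define t where "t n = real (n + N) * \<bar>bcoef \<beta> (n + N)\<bar>" for n
  have step: "t n - t (Suc n) = \<beta> * \<bar>bcoef \<beta> (n + N)\<bar>" for n
  proof -
    have N: "\<beta> \<le> real (n + N)" unfolding N_def by linarith
    have "t (Suc n) = (real (n + N) + 1) * \<bar>bcoef \<beta> (Suc (n + N))\<bar>" by (simp add: t_def add_ac)
    also have "\<dots> = \<bar>(real (n + N) + 1) * bcoef \<beta> (Suc (n + N))\<bar>" by (simp only: abs_mult)
    also have "\<dots> = (real (n + N) - \<beta>) * \<bar>bcoef \<beta> (n + N)\<bar>" unfolding bcoef_Suc using N by (simp add: abs_mult)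
    finally show ?thesis by (simp add: t_def algebra_simps)
  qed
  have "decseq t" by (rule decseq_SucI) (use step \<beta> in \<open>smt (verit) mult_nonneg_nonneg\<close>)
  moreover have "\<forall>n. 0 \<le> t n" by (simp add: t_def)
  ultimately obtain L where "t \<longlonglongrightarrow> L" using decseq_convergent by blast
  from telescope_sums'[OF this] have "summable (\<lambda>n. \<beta> * \<bar>bcoef \<beta> (n + N)\<bar>)" unfolding step by (rule sums_summable)
  then show ?thesis using \<beta> summable_iff_shift[of "\<lambda>\<nu>. \<bar>bcoef \<beta> \<nu>\<bar>" N] by (simp add: summable_cmult_iff)
qed

text \<open>The boundary value of the binomial series, that is \<open>(1 - cis (- u))\<close> to the
  power \<open>\<beta>\<close>. The phase produced by the translation by \<open>\<beta> * h\<close>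
  is kept apart, in \<open>dmult\<close>.\<close>

definition mu :: "real \<Rightarrow> real \<Rightarrow> complex" where
  "mu \<beta> u = (\<Sum>\<nu>. bcoef \<beta> \<nu> *\<^sub>R cis (- (real \<nu> * u)))"

definition bsum :: "real \<Rightarrow> real" where "bsum \<beta> = (\<Sum>\<nu>. \<bar>bcoef \<beta> \<nu>\<bar>)"

context
  fixes \<beta> :: real
  assumes \<beta>: "0 < \<beta>"
begin

lemma summable_bcoef_mult:
  fixes f :: "nat \<Rightarrow> 'b::banach"
  assumes "\<And>\<nu>. norm (f \<nu>) \<le> B"
  shows "summable (\<lambda>\<nu>. bcoef \<beta> \<nu> *\<^sub>R f \<nu>)"
proof (rule summable_norm_cancel, rule summable_comparison_test')
  show "summable (\<lambda>\<nu>. \<bar>bcoef \<beta> \<nu>\<bar> * B)" by (intro summable_mult2 summable_bcoef \<beta>)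
  show "norm (norm (bcoef \<beta> \<nu> *\<^sub>R f \<nu>)) \<le> \<bar>bcoef \<beta> \<nu>\<bar> * B" for \<nu> using assms[of \<nu>] by (simp add: mult_left_mono)
qed

lemma summable_mu: "summable (\<lambda>\<nu>. bcoef \<beta> \<nu> *\<^sub>R cis (- (real \<nu> * u)))"
  by (rule summable_bcoef_mult[of _ 1]) simp

lemma norm_mu_le: "norm (mu \<beta> u) \<le> bsum \<beta>"
  unfolding mu_def bsum_def by (rule norm_suminf_le) (auto intro: summable_bcoef \<beta>)

lemma bsum_ge_1: "1 \<le> bsum \<beta>"
proof -
  have "(\<Sum>\<nu><1. \<bar>bcoef \<beta> \<nu>\<bar>) \<le> bsum \<beta>" unfolding bsum_def by (intro sum_le_suminf summable_bcoef \<beta>) auto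
  then show ?thesis by simp
qed

lemma mu_minus: "mu \<beta> (- u) = cnj (mu \<beta> u)"
proof -
  have "cnj (mu \<beta> u) = (\<Sum>\<nu>. cnj (bcoef \<beta> \<nu> *\<^sub>R cis (- (real \<nu> * u))))"
    unfolding mu_def by (rule bounded_linear.suminf[OF bounded_linear_cnj summable_mu])
  then show ?thesis by (simp add: mu_def cis_cnj)
qed

lemma continuous_on_mu: "continuous_on A (mu \<beta>)"
proof -
  have "uniform_limit UNIV (\<lambda>n u. \<Sum>\<nu><n. bcoef \<beta> \<nu> *\<^sub>R cis (- (real \<nu> * u))) (\<lambda>u. \<Sum>\<nu>. bcoef \<beta> \<nu> *\<^sub>R cis (- (real \<nu> * u))) sequentially"
    by (rule Weierstrass_m_test[OF _ summable_bcoef[OF \<beta>]]) simp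
  then have "continuous_on UNIV (mu \<beta>)" unfolding mu_def[abs_def]
    by (rule uniform_limit_theorem[rotated]) (auto intro!: always_eventually continuous_intros)
  then show ?thesis by (rule continuous_on_subset) simp
qed

text \<open>The binomial theorem holds inside the unit disc only. Along the radius to
  \<open>- cis (- u)\<close> the series converges uniformly up to the boundary because the
  coefficients are absolutely summable, and the principal power is continuous at the end point since
  \<open>1 - cis (- u)\<close> has positive real part.\<close>

lemma mu_eq_powr:
  assumes u: "0 < u" "u < 2 * pi"
  shows "mu \<beta> u = (1 - cis (- u)) powr of_real \<beta>"
proof -
  define z where "z = - cis (- u)"
  have c: "of_real (\<beta> gchoose n) = (complex_of_real \<beta> gchoose n)" for n
    by (simp add: gbinomial_prod_rev)
  have zn: "(\<beta> gchoose n) *\<^sub>R z ^ n = bcoef \<beta> n *\<^sub>R cis (- (real n * u))" for n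
    unfolding z_def power_minus[of "cis (- u)"] by (simp add: bcoef_def Complex.DeMoivre scaleR_conv_of_real mult_ac)
  define f where "f t = (\<Sum>n. ((\<beta> gchoose n) *\<^sub>R z ^ n) * of_real t ^ n)" for t :: real
  have "uniform_limit {0..1} (\<lambda>N t. \<Sum>n<N. ((\<beta> gchoose n) *\<^sub>R z ^ n) * of_real t ^ n) f sequentially"
    unfolding f_def
  proof (rule Weierstrass_m_test[OF _ summable_bcoef[OF \<beta>]])
    fix n t assume "t \<in> {0..1::real}"
    then have "\<bar>t\<bar> ^ n \<le> 1" by (intro power_le_one) auto
    then show "norm (((\<beta> gchoose n) *\<^sub>R z ^ n) * of_real t ^ n) \<le> \<bar>bcoef \<beta> n\<bar>"
      unfolding zn by (simp add: norm_mult norm_power mult_right_le_one_le)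
  qed
  then have "continuous_on {0..1} f"
    by (rule uniform_limit_theorem[rotated]) (auto intro!: always_eventually continuous_intros)
  then have "(f \<longlongrightarrow> f 1) (at 1 within {0..1})" by (simp add: continuous_on_def)
  then have 1: "(f \<longlongrightarrow> f 1) (at_left 1)" by (simp add: at_within_Icc_at_left)
  have 2: "f t = (1 + z * of_real t) powr of_real \<beta>" if "0 \<le> t" "t < 1" for t
  proof -
    have "norm (z * of_real t) < 1" using that by (simp add: z_def norm_mult)
    from gen_binomial_complex[OF this, of "of_real \<beta>"] show ?thesis
      unfolding f_def by (simp add: sums_iff scaleR_conv_of_real c power_mult_distrib mult.assoc)
  qed
  have re: "0 < Re (1 + z)"
  proof -
    have "cos u < 1"
    proof -
      have "0 < sin (u / 2)" using u by (intro sin_gt_zero) auto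
      then show ?thesis using cos_double_sin[of "u / 2"] by simp
    qed
    then show ?thesis by (simp add: z_def)
  qed
  have "((\<lambda>t. (1 + z * of_real t) powr of_real \<beta>) \<longlongrightarrow> (1 + z * of_real 1) powr of_real \<beta>) (at_left 1)"
    using re by (intro tendsto_intros) (auto simp: complex_nonpos_Reals_iff)
  moreover have "eventually (\<lambda>t. f t = (1 + z * of_real t) powr of_real \<beta>) (at_left 1)"
    by (rule eventually_mono[OF eventually_at_left_real[of 0 1]]) (auto intro: 2)
  ultimately have "(f \<longlongrightarrow> (1 + z * of_real 1) powr of_real \<beta>) (at_left 1)"
    using tendsto_cong by fastforce
  with 1 have "f 1 = (1 + z * of_real 1) powr of_real \<beta>" by (intro tendsto_unique[OF _ 1]) auto
  then show ?thesis unfolding f_def zn by (simp add: mu_def z_def)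
qed

text \<open>In polar form \<open>1 - cis (- u)\<close> has modulus \<open>2 * sin (u / 2)\<close>
  and argument \<open>(pi - u) / 2\<close>. For \<open>0 < u < 2 * pi\<close> the latter lies within
  \<open>- pi / 2\<close> and \<open>pi / 2\<close>, so it is the principal one.\<close>

lemma mu_eq:
  assumes u: "0 < u" "u < 2 * pi"
  shows "mu \<beta> u = of_real ((2 * sin (u / 2)) powr \<beta>) * cis (\<beta> * (pi - u) / 2)"
proof -
  have s: "0 < sin (u / 2)" using u by (intro sin_gt_zero) auto
  have "1 - cis (- u) = of_real (2 * sin (u / 2)) * cis ((pi - u) / 2)"
  proof (rule complex_eqI)
    have c: "cos ((pi - u) / 2) = sin (u / 2)" "sin ((pi - u) / 2) = cos (u / 2)"
      using cos_sin_eq[of "u / 2"] sin_cos_eq[of "u / 2"] by (simp_all add: diff_divide_distrib)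
    show "Re (1 - cis (- u)) = Re (of_real (2 * sin (u / 2)) * cis ((pi - u) / 2))"
      using cos_double_sin[of "u / 2"] by (simp add: c power2_eq_square)
    show "Im (1 - cis (- u)) = Im (of_real (2 * sin (u / 2)) * cis ((pi - u) / 2))"
      using sin_double[of "u / 2"] by (simp add: c)
  qed
  also have "\<dots> = exp (of_real (ln (2 * sin (u / 2))) + \<i> * of_real ((pi - u) / 2))"
    using s by (simp only: exp_add exp_of_real exp_ln cis_conv_exp mult_pos_pos zero_less_numeral)
  finally have e: "1 - cis (- u) = exp (of_real (ln (2 * sin (u / 2))) + \<i> * of_real ((pi - u) / 2))" .
  have "Ln (1 - cis (- u)) = of_real (ln (2 * sin (u / 2))) + \<i> * of_real ((pi - u) / 2)"
    unfolding e using u by (intro Ln_exp) auto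
  moreover have "1 - cis (- u) \<noteq> 0" unfolding e by simp
  ultimately have "(1 - cis (- u)) powr of_real \<beta> = exp (of_real \<beta> * (of_real (ln (2 * sin (u / 2))) + \<i> * of_real ((pi - u) / 2)))"
    by (simp add: powr_def)
  also have "\<dots> = exp (of_real (\<beta> * ln (2 * sin (u / 2))) + \<i> * of_real (\<beta> * (pi - u) / 2))"
    by (simp add: algebra_simps add_divide_distrib diff_divide_distrib)
  also have "\<dots> = of_real ((2 * sin (u / 2)) powr \<beta>) * cis (\<beta> * (pi - u) / 2)"
    using s by (simp only: exp_add exp_of_real cis_conv_exp powr_def) simp
  finally show ?thesis using mu_eq_powr[OF u] by simp
qed

lemma norm_mu:
  assumes u: "0 < u" "u < 2 * pi"
  shows "norm (mu \<beta> u) = (2 * sin (u / 2)) powr \<beta>"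
  unfolding mu_eq[OF u] by (simp add: norm_mult)

lemma mu_0: "mu \<beta> 0 = 0"
proof -
  have "(mu \<beta> \<longlongrightarrow> mu \<beta> 0) (at 0 within {0..})"
    using continuous_on_mu[of "{0..}"] by (simp add: continuous_on_def)
  then have "(mu \<beta> \<longlongrightarrow> mu \<beta> 0) (at_right 0)" by (simp add: at_within_Ici_at_right)
  then have 1: "((\<lambda>u. norm (mu \<beta> u)) \<longlongrightarrow> norm (mu \<beta> 0)) (at_right 0)" by (rule tendsto_norm)
  have "((\<lambda>u. (2 * sin (u / 2)) powr \<beta>) \<longlongrightarrow> 0) (at_right 0)"
  proof (rule tendsto_zero_powrI[where b = \<beta>])
    have "((\<lambda>u::real. 2 * sin (u / 2)) \<longlongrightarrow> 2 * sin (0 / 2)) (at_right 0)" by (intro tendsto_intros) simp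
    then show "((\<lambda>u::real. 2 * sin (u / 2)) \<longlongrightarrow> 0) (at_right 0)" by simp
    show "\<forall>\<^sub>F u in at_right 0. 0 \<le> 2 * sin (u / 2 :: real)"
      by (rule eventually_mono[OF eventually_at_right_real[of 0 "2 * pi"]]) (auto intro!: sin_ge_zero)
  qed (use \<beta> in auto)
  moreover have "eventually (\<lambda>u. norm (mu \<beta> u) = (2 * sin (u / 2)) powr \<beta>) (at_right 0)"
    by (rule eventually_mono[OF eventually_at_right_real[of 0 "2 * pi"]]) (auto simp: norm_mu)
  ultimately have "((\<lambda>u. norm (mu \<beta> u)) \<longlongrightarrow> 0) (at_right 0)" using tendsto_cong by fastforce
  from tendsto_unique[OF _ 1 this] show ?thesis by simp
qed

lemma norm_mu_le_powr:
  assumes "0 \<le> u" "u \<le> 1"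
  shows "norm (mu \<beta> u) \<le> u powr \<beta>"
proof (cases "u = 0")
  case False
  have u: "0 < u" "u < 2 * pi" using assms False pi_gt3 by auto
  have "2 * sin (u / 2) \<le> u" using sin_x_le_x[of "u / 2"] assms by simp
  moreover have "0 < sin (u / 2)" using u by (intro sin_gt_zero) auto
  ultimately show ?thesis unfolding norm_mu[OF u] using \<beta> by (intro powr_mono2) auto
qed (simp add: mu_0)

text \<open>On \<open>u \<le> 1\<close> the variation of \<open>t\<^sup>r mu \<beta> (t h)\<close> is dominated by that of \<open>t\<^sup>r\<^sup>+\<^sup>\<beta> h\<^sup>\<beta>\<close>.\<close>

lemma mu_variation:
  assumes r: "0 \<le> r" and h: "0 < h" and ab: "0 < a" "a < b" "b * h \<le> 1"
  shows "norm (of_real (b powr r) * mu \<beta> (b * h) - of_real (a powr r) * mu \<beta> (a * h))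
    \<le> 5 / 2 * (h powr \<beta> * b powr (r + \<beta>)) - 5 / 2 * (h powr \<beta> * a powr (r + \<beta>))"
proof -
  define E where "E t = of_real (t powr r * (2 * sin (t * h / 2)) powr \<beta>) * cis (\<beta> * (pi - t * h) / 2)" for t
  define P where "P t = r * t powr (r - 1) * (2 * sin (t * h / 2)) powr \<beta>
      + t powr r * (\<beta> * (2 * sin (t * h / 2)) powr (\<beta> - 1) * (cos (t * h / 2) * h))" for t
  define E' where "E' t = of_real (P t) * cis (\<beta> * (pi - t * h) / 2)
      + of_real (t powr r * (2 * sin (t * h / 2)) powr \<beta>) * (of_real (- (\<beta> * h / 2)) * (\<i> * cis (\<beta> * (pi - t * h) / 2)))" for t
  have rng: "0 < t * h" "t * h \<le> 1" "t * h < 2 * pi" "0 < sin (t * h / 2)" "0 < t" if "a \<le> t" "t \<le> b" for t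
  proof -
    show t: "0 < t" using that ab by simp
    then show *: "0 < t * h" using h by simp
    have "t * h \<le> b * h" using that h by simp
    then show "t * h \<le> 1" using ab by simp
    then show "t * h < 2 * pi" using pi_gt3 by simp
    then show "0 < sin (t * h / 2)" using * by (intro sin_gt_zero) auto
  qed
  have Eeq: "E t = of_real (t powr r) * mu \<beta> (t * h)" if "a \<le> t" "t \<le> b" for t
    using mu_eq[of "t * h"] rng[OF that] by (simp add: E_def mult_ac)
  have dE: "(E has_vector_derivative E' t) (at t)" if t: "a \<le> t" "t \<le> b" for t
  proof -
    have "((\<lambda>t. t powr r * (2 * sin (t * h / 2)) powr \<beta>) has_real_derivative P t) (at t)"
      using rng[OF t] unfolding P_def
      by (auto intro!: derivative_eq_intros simp: powr_diff field_simps)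
    then have 1: "((\<lambda>t. complex_of_real (t powr r * (2 * sin (t * h / 2)) powr \<beta>)) has_vector_derivative of_real (P t)) (at t)"
      by (intro has_vector_derivative_of_real) (simp add: has_real_derivative_iff_has_vector_derivative)
    have 2: "((\<lambda>t. cis (\<beta> * (pi - t * h) / 2)) has_vector_derivative (of_real (- (\<beta> * h / 2)) * (\<i> * cis (\<beta> * (pi - t * h) / 2)))) (at t)"
    proof -
      have "((\<lambda>t. \<beta> * (pi - t * h) / 2) has_real_derivative (- (\<beta> * h / 2))) (at t)"
        by (auto intro!: derivative_eq_intros)
      then have "((\<lambda>t. \<i> * complex_of_real (\<beta> * (pi - t * h) / 2)) has_vector_derivative \<i> * of_real (- (\<beta> * h / 2))) (at t)"
        by (intro has_vector_derivative_mult_right has_vector_derivative_of_real) (simp add: has_real_derivative_iff_has_vector_derivative)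
      from field_vector_diff_chain_at[OF this DERIV_exp]
      show ?thesis by (simp add: cis_conv_exp o_def mult_ac)
    qed
    show ?thesis unfolding E_def E'_def
      using has_vector_derivative_mult[OF 1 2] by (simp add: add.commute)
  qed
  have bnd: "norm (E' t) \<le> 5 / 2 * (h powr \<beta> * ((r + \<beta>) * t powr (r + \<beta> - 1)))" if t: "a \<le> t" "t \<le> b" for t
  proof -
    note R = rng[OF t]
    define w where "w = t * h"
    have w: "0 < w" "w \<le> 1" using R by (auto simp: w_def)
    define y where "y = 2 * sin (w / 2)"
    have y: "y \<le> w" "w / 2 \<le> y" "0 < y"
    proof -
      show "y \<le> w" using sin_x_le_x[of "w / 2"] w by (simp add: y_def)
      have "w / pi \<le> sin (w / 2)" using jordan_sin[of w] w pi_gt3 by simp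
      moreover have "w / 4 \<le> w / pi" using w pi_less_4 by (intro divide_left_mono) auto
      ultimately show "w / 2 \<le> y" unfolding y_def by linarith
      then show "0 < y" using w by simp
    qed
    have y1: "y powr \<beta> \<le> w powr \<beta>" using y \<beta> by (intro powr_mono2) auto
    \<comment> \<open>For \<open>\<beta> < 1\<close> the exponent is negative and a lower bound for
      \<open>y\<close> is required: \<open>w / 2 \<le> y\<close> loses the factor
      \<open>2 powr (1 - \<beta>)\<close>, at most \<open>2\<close>.\<close>
    have y2: "y powr (\<beta> - 1) \<le> 2 * w powr (\<beta> - 1)"
    proof (cases "1 \<le> \<beta>")
      case True
      then have "y powr (\<beta> - 1) \<le> w powr (\<beta> - 1)" using y by (intro powr_mono2) auto
      then show ?thesis by (smt (verit) powr_ge_zero)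
    next
      case False
      then have "y powr (\<beta> - 1) \<le> (w / 2) powr (\<beta> - 1)" using y w by (intro powr_mono2') auto
      also have "\<dots> = w powr (\<beta> - 1) * 2 powr (1 - \<beta>)" using w by (simp add: powr_divide powr_diff)
      also have "2 powr (1 - \<beta>) \<le> 2 powr (1::real)" using \<beta> by (intro powr_mono) auto
      finally show ?thesis using w by (simp add: mult_left_mono mult.commute)
    qed
    have wt: "w powr (\<beta> - 1) * h = w powr \<beta> / t" "t powr (r - 1) = t powr r / t"
      using R h w by (auto simp: w_def powr_diff)
    have Pb: "norm (P t) \<le> r * t powr (r - 1) * w powr \<beta> + t powr r * (\<beta> * (2 * w powr (\<beta> - 1)) * h)"
    proof -
      have "norm (P t) \<le> norm (r * t powr (r - 1) * y powr \<beta>) + norm (t powr r * (\<beta> * y powr (\<beta> - 1) * (cos (t * h / 2) * h)))"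
        unfolding P_def y_def w_def by (rule norm_triangle_ineq)
      also have "\<dots> \<le> r * t powr (r - 1) * w powr \<beta> + t powr r * (\<beta> * (2 * w powr (\<beta> - 1)) * (1 * h))"
        using r \<beta> h y1 y2 unfolding real_norm_def abs_mult
        by (intro add_mono mult_mono) (auto intro: abs_cos_le_one)
      finally show ?thesis by simp
    qed
    have "norm (E' t) \<le> norm (P t) + t powr r * y powr \<beta> * (\<beta> * h / 2)"
      unfolding E'_def y_def w_def using \<beta> h
      by (intro order_trans[OF norm_triangle_ineq]) (simp add: norm_mult)
    also have "\<dots> \<le> (r * t powr (r - 1) * w powr \<beta> + t powr r * (\<beta> * (2 * w powr (\<beta> - 1)) * h)) + t powr r * w powr \<beta> * (\<beta> * h / 2)"
      using Pb y1 \<beta> h by (intro add_mono mult_right_mono mult_left_mono) auto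
    also have "\<dots> = t powr r * w powr \<beta> / t * (r + 2 * \<beta> + \<beta> * w / 2)"
    proof -
      have "t powr r * (\<beta> * (2 * w powr (\<beta> - 1)) * h) = t powr r * (\<beta> * 2 * (w powr (\<beta> - 1) * h))" by (simp add: mult_ac)
      then show ?thesis unfolding wt using R by (simp add: w_def field_simps)
    qed
    \<comment> \<open>Source of the constant \<open>5 / 2\<close>: the contributions
      \<open>2 * \<beta>\<close> of the modulus and \<open>\<beta> * w / 2\<close> of the phase add
      up to at most \<open>5 / 2 * \<beta>\<close> for \<open>w \<le> 1\<close>. The bound is
      arranged to be the derivative of a multiple of \<open>t powr (r + \<beta>)\<close>.\<close>
    also have "\<dots> \<le> t powr r * w powr \<beta> / t * (5 / 2 * (r + \<beta>))"
    proof (rule mult_left_mono)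
      define z where "z = \<beta> * w"
      have "z \<le> \<beta>" using \<beta> w by (simp add: z_def mult_left_le)
      then have "r + 2 * \<beta> + z / 2 \<le> 5 / 2 * (r + \<beta>)" using r by (simp add: field_simps)
      then show "r + 2 * \<beta> + \<beta> * w / 2 \<le> 5 / 2 * (r + \<beta>)" by (simp only: z_def)
      show "0 \<le> t powr r * w powr \<beta> / t" using R by simp
    qed
    also have "t powr r * w powr \<beta> / t = h powr \<beta> * t powr (r + \<beta> - 1)"
      using R h by (simp add: w_def powr_mult powr_add powr_diff)
    finally show ?thesis by (simp add: algebra_simps)
  qed
  \<comment> \<open>Mean value inequality in its differential form: the norm of \<open>E'\<close> is
    below the derivative of the comparison function, so increments of \<open>E\<close> are below
    increments of that function.\<close>
  have "norm (E b - E a) \<le> 5 / 2 * (h powr \<beta> * b powr (r + \<beta>)) - 5 / 2 * (h powr \<beta> * a powr (r + \<beta>))"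
  proof (rule differentiable_bound_general[of a b E "\<lambda>t. 5 / 2 * (h powr \<beta> * t powr (r + \<beta>))" E' "\<lambda>t. 5 / 2 * (h powr \<beta> * ((r + \<beta>) * t powr (r + \<beta> - 1)))"])
    show "continuous_on {a..b} E"
      using dE by (intro continuous_at_imp_continuous_on ballI) (auto intro: has_vector_derivative_continuous)
    show "continuous_on {a..b} (\<lambda>t. 5 / 2 * (h powr \<beta> * t powr (r + \<beta>)))"
      using ab by (intro continuous_intros) auto
    show "((\<lambda>t. 5 / 2 * (h powr \<beta> * t powr (r + \<beta>))) has_vector_derivative 5 / 2 * (h powr \<beta> * ((r + \<beta>) * t powr (r + \<beta> - 1)))) (at t)" if "a < t" "t < b" for t
      unfolding has_real_derivative_iff_has_vector_derivative[symmetric]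
      using that ab by (intro DERIV_cmult has_real_derivative_powr) auto
  qed (use dE bnd ab in auto)
  then show ?thesis using Eeq[of a] Eeq[of b] ab by simp
qed

end

subsection \<open>Exponential sums with monotone and differenced weights\<close>

lemma abel_sum:
  fixes v e :: "nat \<Rightarrow> complex"
  assumes "m \<le> n"
  shows "(\<Sum>k=m..<Suc n. v k * e k) = v n * (\<Sum>k=m..<Suc n. e k) - (\<Sum>k=m..<n. (v (Suc k) - v k) * (\<Sum>j=m..<Suc k. e j))"
  using assms
proof (induction n rule: dec_induct)
  case (step n)
  then show ?case by (simp add: algebra_simps)
qed simp

text \<open>The weights \<open>v\<close> may be complex; their increments are dominated by those of
  the real sequence \<open>\<psi>\<close>, which telescope. Together with the boundary term this
  costs \<open>2 * \<psi> (n - 1)\<close>, while monotonicity of \<open>B\<close> replaces all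
  partial sums of \<open>e\<close> by the bound at \<open>n\<close>.\<close>

lemma norm_abel_sum:
  fixes v e :: "nat \<Rightarrow> complex"
  assumes E: "\<And>j. norm (\<Sum>k=m..<j. e k) \<le> B j" and B: "mono B"
    and var: "\<And>k. m \<le> k \<Longrightarrow> Suc k < n \<Longrightarrow> norm (v (Suc k) - v k) \<le> \<psi> (Suc k) - \<psi> k"
    and bnd: "\<And>k. m \<le> k \<Longrightarrow> k < n \<Longrightarrow> norm (v k) \<le> \<psi> k"
    and mn: "m < n"
  shows "norm (\<Sum>k=m..<n. v k * e k) \<le> 2 * \<psi> (n - 1) * B n"
proof -
  obtain n' where n': "n = Suc n'" "m \<le> n'" using mn by (cases n) auto
  have B0: "0 \<le> B j" for j using E[of j] norm_ge_zero order_trans by blast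
  have "norm (\<Sum>k=m..<n. v k * e k) \<le> norm (v n') * B n + (\<Sum>k=m..<n'. (\<psi> (Suc k) - \<psi> k) * B n)"
    unfolding n'(1) abel_sum[OF n'(2)]
  proof (intro order_trans[OF norm_triangle_ineq4] add_mono order_trans[OF norm_sum] sum_mono)
    show "norm (v n' * (\<Sum>k=m..<Suc n'. e k)) \<le> norm (v n') * B (Suc n')"
      unfolding norm_mult by (intro mult_left_mono E) auto
    fix k assume k: "k \<in> {m..<n'}"
    have "norm (v (Suc k) - v k) \<le> \<psi> (Suc k) - \<psi> k" using k n' by (intro var) auto
    moreover have "norm (\<Sum>j=m..<Suc k. e j) \<le> B (Suc n')"
      using k by (intro order_trans[OF E] monoD[OF B]) auto
    ultimately show "norm ((v (Suc k) - v k) * (\<Sum>j=m..<Suc k. e j)) \<le> (\<psi> (Suc k) - \<psi> k) * B (Suc n')"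
      unfolding norm_mult using order_trans[OF norm_ge_zero, of "v (Suc k) - v k" "\<psi> (Suc k) - \<psi> k"]
      by (intro mult_mono) (blast | simp)+
  qed
  also have "\<dots> = (norm (v n') + (\<psi> n' - \<psi> m)) * B n"
    using sum_Suc_diff'[of m n' \<psi>] n' by (simp add: sum_distrib_right[symmetric] distrib_right)
  also have "\<dots> \<le> (2 * \<psi> (n - 1)) * B n"
  proof (intro mult_right_mono B0)
    have "norm (v n') \<le> \<psi> n'" "norm (v m) \<le> \<psi> m" using bnd n' by auto
    moreover have "n - 1 = n'" using n' by simp
    ultimately show "norm (v n') + (\<psi> n' - \<psi> m) \<le> 2 * \<psi> (n - 1)"
      using norm_ge_zero[of "v m"] by (simp del: norm_ge_zero)
  qed
  finally show ?thesis .
qed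

lemma mono_mult_wker: "mono (\<lambda>n. real n * wker n x)"
proof (rule monoI)
  fix i j :: nat assume ij: "i \<le> j"
  have "real i * (1 + real j * sig x) \<le> real j * (1 + real i * sig x)"
    using ij by (simp add: algebra_simps)
  then show "real i * wker i x \<le> real j * wker j x"
    by (simp add: wker_def frac_le_eq divide_le_cancel frac_le pos_divide_le_eq pos_le_divide_eq add_pos_nonneg field_simps)
qed

text \<open>The constant \<open>8\<close> is \<open>2\<close> from Abel summation, \<open>2\<close>
  from \<open>norm_sum_cis_wker\<close>, and \<open>2\<close> from replacing \<open>Suc i\<close> by
  \<open>i\<close>, for which \<open>i\<close> must be positive; for \<open>i < m\<close> the sum is
  empty.\<close>

lemma norm_power_sum_le:
  assumes r: "0 \<le> r" and m: "1 \<le> m"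
  shows "norm (\<Sum>k=m..<Suc i. of_real (real k powr r) * cis (real k * x)) \<le> 8 * real i powr r * (real i * wker i x)"
proof (cases "m \<le> i")
  case True
  have "norm (\<Sum>k=m..<Suc i. of_real (real k powr r) * cis (real k * x)) \<le> 2 * (real (Suc i - 1) powr r) * (2 * real (Suc i) * wker (Suc i) x)"
  proof (rule norm_abel_sum[where B = "\<lambda>n. 2 * real n * wker n x" and \<psi> = "\<lambda>k. real k powr r"])
    show "norm (\<Sum>k=m..<j. cis (real k * x)) \<le> 2 * real j * wker j x" for j by (rule norm_sum_cis_wker)
    show "mono (\<lambda>n. 2 * real n * wker n x)" using mono_mult_wker[of x] by (auto simp: mono_def)
    show "norm (complex_of_real (real (Suc k) powr r) - complex_of_real (real k powr r)) \<le> real (Suc k) powr r - real k powr r" for k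
      using r powr_mono2[of r "real k" "real (Suc k)"] by (simp only: of_real_diff[symmetric] norm_of_real) simp
  qed (use True in auto)
  also have "\<dots> \<le> 2 * real i powr r * (4 * (real i * wker i x))"
  proof -
    have "real (Suc i) * wker (Suc i) x \<le> (2 * real i) * wker i x"
      using True m wker_antimono[of i "Suc i" x] wker_pos[of "Suc i" x] by (intro mult_mono) auto
    then have "4 * real i powr r * (real (Suc i) * wker (Suc i) x) \<le> 4 * real i powr r * (2 * real i * wker i x)"
      by (intro mult_left_mono) auto
    then show ?thesis by (simp add: algebra_simps)
  qed
  finally show ?thesis by (simp add: mult_ac)
next
  case False
  then have "{m..<Suc i} = {}" by auto
  then show ?thesis using wker_pos[of i x] by (simp del: atLeastLessThan_empty_iff)
qed

declare sum.op_ivl_Suc [simp del]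

text \<open>The expected size, over the steps of length at most \<open>\<delta>\<close>, of the
  multiplier of a difference of order \<open>\<beta>\<close> applied to a derivative of order
  \<open>r\<close>: the derivative gives \<open>k powr r\<close>, the difference gives
  \<open>(k * \<delta>) powr \<beta>\<close> until this saturates at \<open>1\<close>.\<close>

definition Vw :: "real \<Rightarrow> real \<Rightarrow> real \<Rightarrow> nat \<Rightarrow> real" where
  "Vw r \<beta> \<delta> k = real k powr r * min 1 (real k * \<delta>) powr \<beta>"

text \<open>Weights of the translates by \<open>\<nu> * h\<close>. The extra \<open>20\<close> at
  \<open>\<nu> = 0\<close> pays for the frequencies below \<open>1 / \<delta>\<close>, the multiples
  of the binomial coefficients for those above.\<close>

definition dsh :: "real \<Rightarrow> nat \<Rightarrow> real" where
  "dsh \<beta> \<nu> = (if \<nu> = 0 then 20 else 0) + 8 * \<bar>bcoef \<beta> \<nu>\<bar>"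

lemma dsh_nonneg: "0 \<le> dsh \<beta> \<nu>" by (simp add: dsh_def)

lemma dsh_sums: "0 < \<beta> \<Longrightarrow> dsh \<beta> sums (20 + 8 * bsum \<beta>)"
proof -
  assume \<beta>: "0 < \<beta>"
  have 1: "(\<lambda>\<nu>. if \<nu> = 0 then 20 else 0 :: real) sums 20" using sums_single[of 0 "\<lambda>_. 20::real"] by (simp add: eq_commute)
  have "(\<lambda>\<nu>. 8 * \<bar>bcoef \<beta> \<nu>\<bar>) sums (8 * bsum \<beta>)"
    unfolding bsum_def by (intro sums_mult summable_sums summable_bcoef \<beta>)
  from sums_add[OF 1 this] show ?thesis by (simp add: dsh_def[abs_def])
qed

lemma Vw_nonneg: "0 \<le> Vw r \<beta> \<delta> k" by (simp add: Vw_def)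

lemma Vw_doubling:
  assumes r: "0 \<le> r" "0 \<le> \<beta>" "0 \<le> \<delta>" and ik: "i \<le> 2 * k"
  shows "Vw r \<beta> \<delta> i \<le> 2 powr (r + \<beta>) * Vw r \<beta> \<delta> k"
proof -
  have "real i powr r \<le> (2 * real k) powr r" using r ik by (intro powr_mono2) auto
  moreover have "min 1 (real i * \<delta>) powr \<beta> \<le> (2 * min 1 (real k * \<delta>)) powr \<beta>"
  proof (intro powr_mono2 r)
    have "real i * \<delta> \<le> 2 * (real k * \<delta>)" using ik r mult_right_mono[of "real i" "2 * real k" \<delta>] by simp
    then show "min 1 (real i * \<delta>) \<le> 2 * min 1 (real k * \<delta>)" using r by (auto simp: min_def)
  qed (use r in auto)
  ultimately have "Vw r \<beta> \<delta> i \<le> (2 * real k) powr r * (2 * min 1 (real k * \<delta>)) powr \<beta>"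
    unfolding Vw_def by (intro mult_mono) auto
  also have "\<dots> = 2 powr (r + \<beta>) * Vw r \<beta> \<delta> k" using r by (simp add: Vw_def powr_mult powr_add)
  finally show ?thesis .
qed

text \<open>Below the frequency \<open>1 / \<delta>\<close> Abel summation uses the smoothness of \<open>mu\<close>; above it
  the multiplier oscillates, and the difference is expanded into translates instead.\<close>

lemma norm_diff_sum_le_pos:
  assumes \<beta>: "0 < \<beta>" and r: "0 \<le> r" and h: "0 < h" "h \<le> \<delta>"
  shows "norm (\<Sum>k=1..<Suc i. of_real (real k powr r) * mu \<beta> (real k * h) * cis (real k * x))
    \<le> Vw r \<beta> \<delta> i * (\<Sum>\<nu>. dsh \<beta> \<nu> * (real i * wker i (x - real \<nu> * h)))"
proof -
  \<comment> \<open>The frequencies are cut at \<open>1 / \<delta>\<close> and not at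
    \<open>1 / \<bar>h\<bar>\<close>, because the final weight must depend on
    \<open>\<delta>\<close> alone. Below the cut \<open>k * h \<le> k * \<delta> \<le> 1\<close>,
    which is the range of \<open>mu_variation\<close>.\<close>
  define M where "M = nat \<lfloor>1 / \<delta>\<rfloor>"
  have \<delta>: "0 < \<delta>" using h by simp
  have M: "k \<le> M \<longleftrightarrow> real k * \<delta> \<le> 1" for k
    using \<delta> unfolding M_def by (simp add: le_nat_iff le_floor_iff field_simps)
  define i' where "i' = min i M"
  define T where "T k = of_real (real k powr r) * mu \<beta> (real k * h) * cis (real k * x)" for k
  have w0: "0 \<le> wker k y" for k y using wker_pos[of k y] by simp
  have smw: "summable (\<lambda>\<nu>. \<bar>bcoef \<beta> \<nu>\<bar> * (real i * wker i (x - real \<nu> * h)))"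
  proof (rule summable_comparison_test')
    show "summable (\<lambda>\<nu>. \<bar>bcoef \<beta> \<nu>\<bar> * real i)" by (intro summable_mult2 summable_bcoef \<beta>)
    show "norm (\<bar>bcoef \<beta> \<nu>\<bar> * (real i * wker i (x - real \<nu> * h))) \<le> \<bar>bcoef \<beta> \<nu>\<bar> * real i" for \<nu>
      using wker_le_1[of i] w0 by (simp add: abs_mult mult_left_mono mult_right_le_one_le)
  qed
  \<comment> \<open>The constant \<open>20\<close>: \<open>norm_abel_sum\<close> and the factor
    \<open>5 / 2\<close> give \<open>5\<close>, \<open>norm_sum_cis_wker\<close> gives
    \<open>2\<close>, and replacing \<open>Suc i'\<close> by \<open>i'\<close> another
    \<open>2\<close>.\<close>
  have low: "norm (\<Sum>k=1..<Suc i'. T k) \<le> 20 * Vw r \<beta> \<delta> i * (real i * wker i x)"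
  proof (cases "i' = 0")
    case True
    then show ?thesis using w0 Vw_nonneg by simp
  next
    case False
    have i'M: "real k * h \<le> 1" if "k \<le> i'" for k
    proof -
      have "real k * h \<le> real k * \<delta>" using h by (intro mult_left_mono) auto
      also have "\<dots> \<le> 1" using that M[of k] by (simp add: i'_def)
      finally show ?thesis .
    qed
    have "norm (\<Sum>k=1..<Suc i'. (of_real (real k powr r) * mu \<beta> (real k * h)) * cis (real k * x))
      \<le> 2 * (5 / 2 * (h powr \<beta> * real (Suc i' - 1) powr (r + \<beta>))) * (2 * real (Suc i') * wker (Suc i') x)"
    proof (rule norm_abel_sum[where B = "\<lambda>n. 2 * real n * wker n x" and \<psi> = "\<lambda>k. 5 / 2 * (h powr \<beta> * real k powr (r + \<beta>))"])
      show "norm (\<Sum>k=1..<j. cis (real k * x)) \<le> 2 * real j * wker j x" for j by (rule norm_sum_cis_wker)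
      show "mono (\<lambda>n. 2 * real n * wker n x)" using mono_mult_wker[of x] by (auto simp: mono_def)
      fix k :: nat assume k: "1 \<le> k" "Suc k < Suc i'"
      show "norm (of_real (real (Suc k) powr r) * mu \<beta> (real (Suc k) * h) - of_real (real k powr r) * mu \<beta> (real k * h))
        \<le> 5 / 2 * (h powr \<beta> * real (Suc k) powr (r + \<beta>)) - 5 / 2 * (h powr \<beta> * real k powr (r + \<beta>))"
        using k h by (intro mu_variation \<beta> r i'M) auto
    next
      fix k :: nat assume k: "1 \<le> k" "k < Suc i'"
      have "norm (mu \<beta> (real k * h)) \<le> (real k * h) powr \<beta>" using k h by (intro norm_mu_le_powr \<beta> i'M) auto
      then have "norm (of_real (real k powr r) * mu \<beta> (real k * h)) \<le> real k powr r * (real k * h) powr \<beta>"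
        by (simp add: norm_mult mult_left_mono)
      also have "\<dots> = h powr \<beta> * real k powr (r + \<beta>)" using h by (simp add: powr_mult powr_add)
      finally show "norm (of_real (real k powr r) * mu \<beta> (real k * h)) \<le> 5 / 2 * (h powr \<beta> * real k powr (r + \<beta>))"
      proof -
        assume "norm (of_real (real k powr r) * mu \<beta> (real k * h)) \<le> h powr \<beta> * real k powr (r + \<beta>)"
        moreover have "0 \<le> h powr \<beta> * real k powr (r + \<beta>)" by simp
        ultimately show ?thesis by linarith
      qed
    qed (use False in auto)
    also have "\<dots> = 10 * (h powr \<beta> * real i' powr (r + \<beta>)) * (real (Suc i') * wker (Suc i') x)" by (simp add: mult_ac)
    also have "\<dots> \<le> 10 * Vw r \<beta> \<delta> i * (2 * (real i * wker i x))"
    proof -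
      have "h powr \<beta> * real i' powr (r + \<beta>) = real i' powr r * (real i' * h) powr \<beta>"
        using h by (simp add: powr_mult powr_add)
      also have "\<dots> \<le> real i powr r * min 1 (real i * \<delta>) powr \<beta>"
      proof (intro mult_mono powr_mono2)
        have "real i' * h \<le> real i * \<delta>" using h by (intro mult_mono) (auto simp: i'_def)
        then show "real i' * h \<le> min 1 (real i * \<delta>)" using i'M[of i'] by simp
      qed (use r \<beta> h in \<open>auto simp: i'_def\<close>)
      finally have A: "h powr \<beta> * real i' powr (r + \<beta>) \<le> Vw r \<beta> \<delta> i" by (simp add: Vw_def)
      have "real (Suc i') * wker (Suc i') x \<le> (2 * real i') * wker i' x"
        using False wker_antimono[of i' "Suc i'" x] w0 by (intro mult_mono) auto
      also have "\<dots> \<le> 2 * (real i * wker i x)" using monoD[OF mono_mult_wker[of x], of i' i] by (simp add: i'_def)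
      finally have B: "real (Suc i') * wker (Suc i') x \<le> 2 * (real i * wker i x)" .
      show ?thesis
        by (rule mult_mono[OF mult_left_mono[OF A] B]) (use w0 Vw_nonneg in auto)
    qed
    finally show ?thesis by (simp add: T_def mult_ac)
  qed
  \<comment> \<open>Here the series of \<open>mu\<close> is expanded and interchanged with the
    finite sum over \<open>k\<close>. For each \<open>\<nu>\<close> there remains an exponential sum
    at \<open>x - \<nu> * h\<close> with monotone weights, bounded by
    \<open>norm_power_sum_le\<close>. Above the cut the weight
    \<open>Vw r \<beta> \<delta> i\<close> is just \<open>i powr r\<close>.\<close>
  have high: "norm (\<Sum>k=Suc i'..<Suc i. T k) \<le> 8 * Vw r \<beta> \<delta> i * (\<Sum>\<nu>. \<bar>bcoef \<beta> \<nu>\<bar> * (real i * wker i (x - real \<nu> * h)))"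
  proof (cases "i \<le> M")
    case True
    then have "{Suc i'..<Suc i} = {}" by (auto simp: i'_def)
    then show ?thesis using w0 by (auto intro!: mult_nonneg_nonneg Vw_nonneg suminf_nonneg smw)
  next
    case False
    then have "1 < real i * \<delta>" using M[of i] by simp
    then have V: "Vw r \<beta> \<delta> i = real i powr r" by (simp add: Vw_def)
    have "(\<lambda>\<nu>. \<Sum>k=Suc i'..<Suc i. of_real (real k powr r) * (bcoef \<beta> \<nu> *\<^sub>R cis (- (real \<nu> * (real k * h)))) * cis (real k * x))
        sums (\<Sum>k=Suc i'..<Suc i. T k)"
      unfolding T_def mu_def by (intro sums_sum sums_mult sums_mult2 summable_sums summable_mu \<beta>)
    moreover have "(\<Sum>k=Suc i'..<Suc i. of_real (real k powr r) * (bcoef \<beta> \<nu> *\<^sub>R cis (- (real \<nu> * (real k * h)))) * cis (real k * x))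
      = bcoef \<beta> \<nu> *\<^sub>R (\<Sum>k=Suc i'..<Suc i. of_real (real k powr r) * cis (real k * (x - real \<nu> * h)))" for \<nu>
    proof -
      have "cis (- (real \<nu> * (real k * h))) * cis (real k * x) = cis (real k * (x - real \<nu> * h))" for k
        by (simp add: cis_mult algebra_simps)
      then show ?thesis by (simp add: scaleR_sum_right mult.assoc)
    qed
    ultimately have s: "(\<Sum>k=Suc i'..<Suc i. T k) = (\<Sum>\<nu>. bcoef \<beta> \<nu> *\<^sub>R (\<Sum>k=Suc i'..<Suc i. of_real (real k powr r) * cis (real k * (x - real \<nu> * h))))"
      by (simp add: sums_iff)
    have "norm (\<Sum>k=Suc i'..<Suc i. T k) \<le> (\<Sum>\<nu>. 8 * real i powr r * (\<bar>bcoef \<beta> \<nu>\<bar> * (real i * wker i (x - real \<nu> * h))))"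
      unfolding s
    proof (rule norm_suminf_le)
      fix \<nu>
      have "norm (bcoef \<beta> \<nu> *\<^sub>R (\<Sum>k=Suc i'..<Suc i. of_real (real k powr r) * cis (real k * (x - real \<nu> * h))))
        \<le> \<bar>bcoef \<beta> \<nu>\<bar> * (8 * real i powr r * (real i * wker i (x - real \<nu> * h)))"
        unfolding norm_scaleR by (intro mult_left_mono norm_power_sum_le r) auto
      then show "norm (bcoef \<beta> \<nu> *\<^sub>R (\<Sum>k=Suc i'..<Suc i. of_real (real k powr r) * cis (real k * (x - real \<nu> * h))))
        \<le> 8 * real i powr r * (\<bar>bcoef \<beta> \<nu>\<bar> * (real i * wker i (x - real \<nu> * h)))" by (simp only: mult_ac)
    qed (intro summable_mult smw)
    also have "\<dots> = 8 * Vw r \<beta> \<delta> i * (\<Sum>\<nu>. \<bar>bcoef \<beta> \<nu>\<bar> * (real i * wker i (x - real \<nu> * h)))"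
      unfolding V by (rule suminf_mult[OF smw])
    finally show ?thesis .
  qed
  have split: "(\<Sum>k=1..<Suc i. T k) = (\<Sum>k=1..<Suc i'. T k) + (\<Sum>k=Suc i'..<Suc i. T k)"
    by (rule sum.atLeastLessThan_concat[symmetric]) (auto simp: i'_def)
  have "(\<lambda>\<nu>. (if \<nu> = 0 then 20 * (real i * wker i x) else 0) + 8 * (\<bar>bcoef \<beta> \<nu>\<bar> * (real i * wker i (x - real \<nu> * h))))
    sums (20 * (real i * wker i x) + 8 * (\<Sum>\<nu>. \<bar>bcoef \<beta> \<nu>\<bar> * (real i * wker i (x - real \<nu> * h))))"
    using sums_single[of 0 "\<lambda>_. 20 * (real i * wker i x)"]
    by (intro sums_add sums_mult summable_sums smw) (simp add: eq_commute)
  moreover have "(if \<nu> = 0 then 20 * (real i * wker i x) else 0) + 8 * (\<bar>bcoef \<beta> \<nu>\<bar> * (real i * wker i (x - real \<nu> * h)))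
    = dsh \<beta> \<nu> * (real i * wker i (x - real \<nu> * h))" for \<nu>
    by (simp add: dsh_def algebra_simps)
  ultimately have "(\<Sum>\<nu>. dsh \<beta> \<nu> * (real i * wker i (x - real \<nu> * h)))
    = 20 * (real i * wker i x) + 8 * (\<Sum>\<nu>. \<bar>bcoef \<beta> \<nu>\<bar> * (real i * wker i (x - real \<nu> * h)))"
    by (simp add: sums_iff)
  then show ?thesis
    using order_trans[OF norm_triangle_ineq add_mono[OF low high]] unfolding split[unfolded T_def] T_def
    by (simp add: algebra_simps)
qed

lemma wker_minus: "wker k (- x) = wker k x"
  by (simp add: wker_def sig_def)

text \<open>A negative step is reduced to a positive one by complex conjugation, which turns
  \<open>h\<close> into \<open>- h\<close> and \<open>x\<close> into \<open>- x\<close>; the kernel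
  is even.\<close>

lemma norm_diff_sum_le:
  assumes \<beta>: "0 < \<beta>" and r: "0 \<le> r" and h: "\<bar>h\<bar> \<le> \<delta>"
  shows "norm (\<Sum>k=1..<Suc i. of_real (real k powr r) * mu \<beta> (real k * h) * cis (real k * x))
    \<le> Vw r \<beta> \<delta> i * (\<Sum>\<nu>. dsh \<beta> \<nu> * (real i * wker i (x - real \<nu> * h)))"
proof -
  consider "0 < h" | "h = 0" | "h < 0" by linarith
  then show ?thesis
  proof cases
    case 1 then show ?thesis using norm_diff_sum_le_pos[OF \<beta> r 1, of \<delta>] h by simp
  next
    case 2
    have "summable (\<lambda>\<nu>. dsh \<beta> \<nu> * (real i * wker i x))"
      by (intro summable_mult2 sums_summable[OF dsh_sums] \<beta>)
    then show ?thesis using 2 wker_pos[of i x]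
      by (auto simp: mu_0[OF \<beta>] intro!: mult_nonneg_nonneg Vw_nonneg suminf_nonneg dsh_nonneg)
  next
    case 3
    have "(\<Sum>k=1..<Suc i. of_real (real k powr r) * mu \<beta> (real k * h) * cis (real k * x))
      = cnj (\<Sum>k=1..<Suc i. of_real (real k powr r) * mu \<beta> (real k * (- h)) * cis (real k * (- x)))"
      using mu_minus[OF \<beta>, of "real _ * h"] by (simp add: cis_cnj)
    then have "norm (\<Sum>k=1..<Suc i. of_real (real k powr r) * mu \<beta> (real k * h) * cis (real k * x))
      \<le> Vw r \<beta> \<delta> i * (\<Sum>\<nu>. dsh \<beta> \<nu> * (real i * wker i (- x - real \<nu> * (- h))))"
      using norm_diff_sum_le_pos[OF \<beta> r, of "- h" \<delta> "- x" i] 3 h by (simp only: complex_mod_cnj)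
    moreover have "wker i (- x - real \<nu> * (- h)) = wker i (x - real \<nu> * h)" for \<nu>
      using wker_minus[of i "x - real \<nu> * h"] by simp
    ultimately show ?thesis by simp
  qed
qed

section \<open>Multipliers of derivatives and differences, and symmetric exponential sums\<close>

text \<open>The principal power \<open>(i k) powr r\<close>. At \<open>k = 0\<close> it is
  \<open>0\<close> for every \<open>r\<close>, even \<open>r = 0\<close>, because
  \<open>0 powr 0 = 0\<close>: thus \<open>ipow 0\<close> is the indicator of nonzero frequencies
  and encodes vanishing means.\<close>

definition ipow :: "real \<Rightarrow> int \<Rightarrow> complex" where
  "ipow r k = (\<i> * of_int k) powr of_real r"

lemma ipow_0 [simp]: "ipow r 0 = 0" by (simp add: ipow_def)

lemma ipow_eq:
  assumes "0 < k"
  shows "ipow r (int k) = of_real (real k powr r) * cis (pi * r / 2)"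
proof -
  have "\<i> * of_int (int k) = exp (of_real (ln (real k)) + \<i> * of_real (pi / 2))"
    using assms by (simp only: exp_add exp_of_real cis_conv_exp[symmetric] cis_pi_half) simp
  moreover have "Ln (exp (of_real (ln (real k)) + \<i> * of_real (pi / 2))) = of_real (ln (real k)) + \<i> * of_real (pi / 2)"
    by (rule Ln_exp) auto
  ultimately have "ipow r (int k) = exp (of_real r * (of_real (ln (real k)) + \<i> * of_real (pi / 2)))"
    by (simp add: ipow_def powr_def)
  also have "\<dots> = exp (of_real (r * ln (real k)) + \<i> * of_real (pi * r / 2))" by (simp add: algebra_simps)
  finally show ?thesis using assms by (simp only: exp_add exp_of_real cis_conv_exp powr_def) simp
qed

lemma ipow_minus: "ipow r (- int k) = cnj (ipow r (int k))"
proof (cases "k = 0")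
  case False
  have "\<i> * of_int (- int k) = exp (of_real (ln (real k)) + \<i> * of_real (- (pi / 2)))"
    using False by (simp only: exp_add exp_of_real cis_conv_exp[symmetric] cis_minus_pi_half) simp
  moreover have "Ln (exp (of_real (ln (real k)) + \<i> * of_real (- (pi / 2)))) = of_real (ln (real k)) + \<i> * of_real (- (pi / 2))"
    by (rule Ln_exp) (use pi_gt_zero in \<open>auto simp del: pi_gt_zero\<close>)
  ultimately have "ipow r (- int k) = exp (of_real r * (of_real (ln (real k)) + \<i> * of_real (- (pi / 2))))"
    using False by (simp only: ipow_def powr_def) simp
  also have "\<dots> = exp (of_real (r * ln (real k)) + \<i> * of_real (- (pi * r / 2)))" by (simp add: algebra_simps)
  also have "\<dots> = of_real (real k powr r) * cis (- (pi * r / 2))"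
    using False by (simp only: exp_add exp_of_real cis_conv_exp powr_def) simp
  finally show ?thesis using False by (simp add: ipow_eq cis_cnj)
qed simp

text \<open>The weight \<open>V\<close> and the kernels \<open>H\<close> control the exponential sums with coefficients \<open>c\<close>
  in a way that survives Abel summation against a monotone sequence.\<close>

definition dominated :: "(int \<Rightarrow> complex) \<Rightarrow> (nat \<Rightarrow> real) \<Rightarrow> (nat \<Rightarrow> real \<Rightarrow> ennreal) \<Rightarrow> bool" where
  "dominated c V H \<longleftrightarrow> (\<forall>i x. ennreal (norm (\<Sum>k\<in>{- int i..int i}. c k * cis (of_int k * x)))
     \<le> (\<Sum>k=1..<Suc i. ennreal (V k) * H k x))"

lemma sum_symmetric_int:
  fixes f :: "int \<Rightarrow> complex"
  assumes "f 0 = 0"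
  shows "(\<Sum>k\<in>{- int i..int i}. f k) = (\<Sum>k=1..<Suc i. f (int k)) + (\<Sum>k=1..<Suc i. f (- int k))"
proof (induction i)
  case (Suc i)
  have "{- int (Suc i)..int (Suc i)} = insert (int (Suc i)) (insert (- int (Suc i)) {- int i..int i})" by auto
  then show ?case using Suc by (simp add: sum.op_ivl_Suc)
qed (simp add: assms)

text \<open>A bound of the form \<open>V i * i * H i\<close> depends on the length \<open>i\<close>
  as a whole and would be useless after Abel summation. Since \<open>V\<close> is doubling and
  \<open>H\<close> decreases in the index, it is spread over the indices \<open>k\<close> between
  \<open>i / 2\<close> and \<open>i\<close>, giving a sum of terms \<open>V k * H k\<close> over
  \<open>k \<le> i\<close> that do not depend on \<open>i\<close>. The constant \<open>4\<close> is
  \<open>2\<close> for the negative frequencies and \<open>2\<close> for the size of that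
  range.\<close>

lemma dominatedI:
  fixes d a :: "nat \<Rightarrow> real"
  assumes c0: "c 0 = 0" and d: "\<And>\<nu>. 0 \<le> d \<nu>" "summable d"
    and V: "\<And>k. 0 \<le> V k" "\<And>i k. k \<le> i \<Longrightarrow> i \<le> 2 * k \<Longrightarrow> V i \<le> K * V k" and K: "0 \<le> K"
    and pos: "\<And>i x. 1 \<le> i \<Longrightarrow> norm (\<Sum>k=1..<Suc i. c (int k) * cis (real k * x)) \<le> V i * (\<Sum>\<nu>. d \<nu> * (real i * wker i (x + a \<nu>)))"
    and neg: "\<And>k. c (- int k) = cnj (c (int k))"
    and even: "\<And>i x. norm (\<Sum>k=1..<Suc i. c (int k) * cis (real k * x)) = norm (\<Sum>k=1..<Suc i. cnj (c (int k)) * cis (- (real k * x)))"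
  shows "dominated c (\<lambda>k. 4 * K * V k) (\<lambda>k x. \<Sum>\<nu>. ennreal (d \<nu>) * ennreal (wker k (x + a \<nu>)))"
  unfolding dominated_def
proof (intro allI)
  fix i x
  define H where "H k = (\<Sum>\<nu>. ennreal (d \<nu>) * ennreal (wker k (x + a \<nu>)))" for k
  have w0: "0 \<le> wker k y" for k y using wker_pos[of k y] by simp
  have Hanti: "H i \<le> H k" if "k \<le> i" for k
    unfolding H_def using that by (intro ennreal_suminf_le mult_left_mono ennreal_leI wker_antimono) auto
  show "ennreal (norm (\<Sum>k\<in>{- int i..int i}. c k * cis (of_int k * x))) \<le> (\<Sum>k=1..<Suc i. ennreal (4 * K * V k) * H k)"
  proof (cases "i = 0")
    case False
    have sm: "summable (\<lambda>\<nu>. d \<nu> * (real i * wker i (x + a \<nu>)))"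
    proof (rule summable_comparison_test')
      show "summable (\<lambda>\<nu>. d \<nu> * real i)" by (intro summable_mult2 d)
      show "norm (d \<nu> * (real i * wker i (x + a \<nu>))) \<le> d \<nu> * real i" for \<nu>
        using wker_le_1[of i] w0 d by (simp add: abs_mult mult_left_mono mult_right_le_one_le)
    qed
    have "norm (\<Sum>k\<in>{- int i..int i}. c k * cis (of_int k * x)) \<le> 2 * norm (\<Sum>k=1..<Suc i. c (int k) * cis (real k * x))"
      using norm_triangle_ineq[of "\<Sum>k=1..<Suc i. c (int k) * cis (real k * x)" "\<Sum>k=1..<Suc i. cnj (c (int k)) * cis (- (real k * x))"]
      unfolding even[symmetric] by (subst sum_symmetric_int) (auto simp: c0 neg)
    also have "\<dots> \<le> 2 * (V i * (\<Sum>\<nu>. d \<nu> * (real i * wker i (x + a \<nu>))))"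
      using pos[of i x] False by (intro mult_left_mono) auto
    finally have "ennreal (norm (\<Sum>k\<in>{- int i..int i}. c k * cis (of_int k * x)))
      \<le> ennreal (2 * (V i * (\<Sum>\<nu>. d \<nu> * (real i * wker i (x + a \<nu>)))))" by (rule ennreal_leI)
    also have "\<dots> = ennreal (2 * V i) * (\<Sum>\<nu>. ennreal (d \<nu> * (real i * wker i (x + a \<nu>))))"
      using V(1) d(1) w0 by (subst suminf_ennreal2[OF _ sm]) (auto simp: ennreal_mult' mult.assoc simp flip: ennreal_mult)
    also have "(\<Sum>\<nu>. ennreal (d \<nu> * (real i * wker i (x + a \<nu>)))) = ennreal (real i) * H i"
      unfolding H_def using d(1) w0 by (simp add: ennreal_mult mult.left_commute)
    also have "ennreal (2 * V i) * (ennreal (real i) * H i) = ennreal (real i / 2) * (ennreal (4 * V i) * H i)"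
      using V(1) by (simp add: mult.assoc[symmetric] mult.commute[of _ "real i"] flip: ennreal_mult)
    \<comment> \<open>The range \<open>{(i + 1) div 2..<Suc i}\<close> has at least
      \<open>i / 2\<close> elements and lies within the positive indices, and
      \<open>i \<le> 2 * k\<close> on it, as the doubling of \<open>V\<close> requires.\<close>
    also have "\<dots> \<le> of_nat (card {(i + 1) div 2..<Suc i}) * (ennreal (4 * V i) * H i)"
    proof (rule mult_right_mono)
      have "i \<le> 2 * card {(i + 1) div 2..<Suc i}" by simp
      then have "ennreal (real i / 2) \<le> ennreal (real (card {(i + 1) div 2..<Suc i}))"
        by (intro ennreal_leI) (simp add: field_simps del: card_atLeastLessThan)
      then show "ennreal (real i / 2) \<le> of_nat (card {(i + 1) div 2..<Suc i})" by (simp add: ennreal_of_nat_eq_real_of_nat)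
    qed simp
    also have "\<dots> = (\<Sum>k\<in>{(i + 1) div 2..<Suc i}. ennreal (4 * V i) * H i)" by simp
    also have "\<dots> \<le> (\<Sum>k\<in>{(i + 1) div 2..<Suc i}. ennreal (4 * K * V k) * H k)"
    proof (rule sum_mono)
      fix k assume "k \<in> {(i + 1) div 2..<Suc i}"
      then have k: "k \<le> i" "i \<le> 2 * k" by auto
      have "ennreal (4 * V i) \<le> ennreal (4 * K * V k)" using V(2)[OF k] by (intro ennreal_leI) simp
      then show "ennreal (4 * V i) * H i \<le> ennreal (4 * K * V k) * H k" using Hanti[OF k(1)] by (rule mult_mono) auto
    qed
    also have "\<dots> \<le> (\<Sum>k=1..<Suc i. ennreal (4 * K * V k) * H k)"
      using False by (intro sum_mono2) auto
    finally show ?thesis .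
  qed (simp add: c0)
qed

lemma dominated_ipow:
  assumes r: "0 \<le> r"
  shows "dominated (ipow r) (\<lambda>k. 4 * 2 powr r * (8 * real k powr r)) (\<lambda>k x. ennreal (wker k x))"
proof -
  have s1: "(\<lambda>\<nu>. (if \<nu> = 0 then 1 else 0) * f \<nu>) sums f 0" for f :: "nat \<Rightarrow> real"
    using sums_single[of 0 f] by (simp add: if_distrib[of "\<lambda>x. x * _"] eq_commute cong: if_cong)
  have "dominated (ipow r) (\<lambda>k. 4 * 2 powr r * (8 * real k powr r)) (\<lambda>k x. \<Sum>\<nu>. ennreal (if \<nu> = 0 then 1 else 0) * ennreal (wker k (x + 0)))"
  proof (rule dominatedI)
    show "summable (\<lambda>\<nu>::nat. if \<nu> = 0 then 1 else 0 :: real)" using s1[of "\<lambda>_. 1"] by (simp add: sums_iff)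
    show "8 * real i powr r \<le> 2 powr r * (8 * real k powr r)" if "i \<le> 2 * k" for i k
      using powr_mono2[of r "real i" "2 * real k"] that r by (simp add: powr_mult)
    show "norm (\<Sum>k=1..<Suc i. ipow r (int k) * cis (real k * x))
      \<le> 8 * real i powr r * (\<Sum>\<nu>. (if \<nu> = 0 then 1 else 0) * (real i * wker i (x + 0)))" for i x
    proof -
      have "(\<Sum>k=1..<Suc i. ipow r (int k) * cis (real k * x)) = cis (pi * r / 2) * (\<Sum>k=1..<Suc i. of_real (real k powr r) * cis (real k * x))"
        unfolding sum_distrib_left by (intro sum.cong) (auto simp: ipow_eq)
      then show ?thesis using norm_power_sum_le[OF r, of 1 x i] s1[of "\<lambda>_. real i * wker i (x + 0)"] by (simp add: norm_mult sums_iff)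
    qed
    show "norm (\<Sum>k=1..<Suc i. ipow r (int k) * cis (real k * x)) = norm (\<Sum>k=1..<Suc i. cnj (ipow r (int k)) * cis (- (real k * x)))" for i x
    proof -
      have "(\<Sum>k=1..<Suc i. cnj (ipow r (int k)) * cis (- (real k * x))) = cnj (\<Sum>k=1..<Suc i. ipow r (int k) * cis (real k * x))"
        by (simp add: cis_cnj)
      then show ?thesis by (simp only: complex_mod_cnj)
    qed
  qed (auto simp: ipow_minus)
  moreover have "(\<Sum>\<nu>::nat. ennreal (if \<nu> = 0 then 1 else 0) * ennreal (wker k (x + 0))) = ennreal (wker k x)" for k x
    by (subst suminf_finite[of "{0}"]) auto
  ultimately show ?thesis by simp
qed

definition dmult :: "real \<Rightarrow> real \<Rightarrow> int \<Rightarrow> complex" where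
  "dmult \<beta> h k = cis (of_int k * (\<beta> * h)) * mu \<beta> (of_int k * h)"

lemma dominated_dmult:
  assumes \<beta>: "0 < \<beta>" and r: "0 \<le> r" and h: "\<bar>h\<bar> \<le> \<delta>"
  shows "dominated (\<lambda>k. ipow r k * dmult \<beta> h k) (\<lambda>k. 4 * 2 powr (r + \<beta>) * Vw r \<beta> \<delta> k)
    (\<lambda>k x. \<Sum>\<nu>. ennreal (dsh \<beta> \<nu>) * ennreal (wker k (x + (\<beta> - real \<nu>) * h)))"
proof (rule dominatedI)
  show "summable (dsh \<beta>)" by (rule sums_summable[OF dsh_sums[OF \<beta>]])
  show "norm (\<Sum>k=1..<Suc i. ipow r (int k) * dmult \<beta> h (int k) * cis (real k * x))
    \<le> Vw r \<beta> \<delta> i * (\<Sum>\<nu>. dsh \<beta> \<nu> * (real i * wker i (x + (\<beta> - real \<nu>) * h)))" for i x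
  proof -
    have c: "cis (real k * (\<beta> * h)) * cis (real k * x) = cis (real k * (x + \<beta> * h))" for k
      by (simp add: cis_mult algebra_simps)
    have "(\<Sum>k=1..<Suc i. ipow r (int k) * dmult \<beta> h (int k) * cis (real k * x))
      = cis (pi * r / 2) * (\<Sum>k=1..<Suc i. of_real (real k powr r) * mu \<beta> (real k * h) * cis (real k * (x + \<beta> * h)))"
      unfolding sum_distrib_left by (intro sum.cong) (auto simp: ipow_eq dmult_def c[symmetric])
    moreover have "wker i (x + (\<beta> - real \<nu>) * h) = wker i (x + \<beta> * h - real \<nu> * h)" for \<nu>
      by (simp add: algebra_simps)
    ultimately show ?thesis using norm_diff_sum_le[OF \<beta> r h, of "x + \<beta> * h" i] by (simp add: norm_mult)
  qed
  show "norm (\<Sum>k=1..<Suc i. ipow r (int k) * dmult \<beta> h (int k) * cis (real k * x))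
    = norm (\<Sum>k=1..<Suc i. cnj (ipow r (int k) * dmult \<beta> h (int k)) * cis (- (real k * x)))" for i x
  proof -
    have "(\<Sum>k=1..<Suc i. cnj (ipow r (int k) * dmult \<beta> h (int k)) * cis (- (real k * x)))
      = cnj (\<Sum>k=1..<Suc i. ipow r (int k) * dmult \<beta> h (int k) * cis (real k * x))"
      by (simp add: cis_cnj)
    then show ?thesis by (simp only: complex_mod_cnj)
  qed
  show "ipow r (- int k) * dmult \<beta> h (- int k) = cnj (ipow r (int k) * dmult \<beta> h (int k))" for k
    using mu_minus[OF \<beta>, of "real k * h"] by (simp add: ipow_minus dmult_def cis_cnj)
  show "Vw r \<beta> \<delta> i \<le> 2 powr (r + \<beta>) * Vw r \<beta> \<delta> k" if "i \<le> 2 * k" for i k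
    using that r \<beta> h by (intro Vw_doubling) auto
qed (auto simp: dsh_nonneg Vw_nonneg)

subsection \<open>Averages of the difference multiplier\<close>

text \<open>The uniform probability measure for the relative length \<open>s\<close> of a step.
  Keeping \<open>s\<close> away from \<open>0\<close> preserves the size of the multiplier at low
  frequencies; the spread of \<open>s\<close> cancels its oscillation at high ones.\<close>

definition havg :: "real measure" where
  "havg = density lborel (\<lambda>s. ennreal (2 * indicator {1/2..1} s))"

lemma sets_havg [measurable_cong, simp]: "sets havg = sets borel"
  and space_havg [simp]: "space havg = UNIV"
  by (auto simp: havg_def)

lemma emeasure_havg: "emeasure havg UNIV = 1"
proof -
  have "emeasure havg UNIV = (\<integral>\<^sup>+s. ennreal 2 * indicator {1/2..1::real} s \<partial>lborel)"
    unfolding havg_def by (subst emeasure_density) (auto simp: ennreal_mult ennreal_indicator simp del: ennreal_numeral intro!: nn_integral_cong)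
  also have "\<dots> = ennreal 2 * ennreal (1 / 2)"
    by (subst nn_integral_cmult_indicator) (auto simp del: ennreal_numeral)
  also have "\<dots> = 1" by (simp only: ennreal_mult[symmetric]) simp
  finally show ?thesis .
qed

interpretation havg: finite_measure havg by standard (simp add: emeasure_havg)

lemma measure_havg [simp]: "measure havg UNIV = 1"
  by (simp add: measure_def emeasure_havg)

lemma AE_havg: "AE s in havg. 1 / 2 \<le> s \<and> s \<le> 1"
  unfolding havg_def by (subst AE_density) (auto simp: indicator_def)

lemma integrable_havg:
  fixes f :: "real \<Rightarrow> 'b::euclidean_space"
  assumes "continuous_on UNIV f" "\<And>s. norm (f s) \<le> B"
  shows "integrable havg f"
  using assms borel_measurable_continuous_onI[OF assms(1)]
  by (intro havg.integrable_const_bound[of _ B]) auto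

lemma integral_havg_cis:
  assumes t: "0 < t"
  shows "norm (LINT s|havg. cis (- (t * s))) \<le> 4 / t"
proof -
  define F where "F s = \<i> / of_real t * cis (- (t * s))" for s
  have m: "(\<lambda>s. cis (- (t * s))) \<in> borel_measurable borel" by measurable
  have eq: "(LINT s|havg. cis (- (t * s))) = 2 *\<^sub>R (LINT s|lborel. indicator {1/2..1} s *\<^sub>R cis (- (t * s)))"
    unfolding havg_def using m
    by (subst integral_density) (auto simp flip: integral_scaleR_right intro!: Bochner_Integration.integral_cong)
  have "(LINT s|lborel. indicator {1/2..1} s *\<^sub>R cis (- (t * s))) = F 1 - F (1 / 2)"
  proof (rule integral_FTC_Icc)
    show "continuous_on {1/2..1} (\<lambda>s. cis (- (t * s)))" by (intro continuous_intros)
    fix s :: real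
    have "((\<lambda>s. \<i> * complex_of_real (- (t * s))) has_vector_derivative \<i> * of_real (- t)) (at s within {1/2..1})"
      by (intro has_vector_derivative_mult_right has_vector_derivative_of_real)
        (auto intro!: derivative_eq_intros simp flip: has_real_derivative_iff_has_vector_derivative)
    from field_vector_diff_chain_within[OF this has_field_derivative_at_within[OF DERIV_exp]]
    have "((\<lambda>s. cis (- (t * s))) has_vector_derivative (\<i> * of_real (- t)) * cis (- (t * s))) (at s within {1/2..1})"
      by (simp add: cis_conv_exp o_def)
    then have "(F has_vector_derivative \<i> / of_real t * ((\<i> * of_real (- t)) * cis (- (t * s)))) (at s within {1/2..1})"
      unfolding F_def by (rule has_vector_derivative_mult_right)
    then show "(F has_vector_derivative cis (- (t * s))) (at s within {1/2..1})" using t by simp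
  qed simp
  moreover have "norm (F 1 - F (1 / 2)) \<le> 1 / t + 1 / t"
    by (rule order_trans[OF norm_triangle_ineq4]) (use t in \<open>auto simp: F_def norm_mult norm_divide\<close>)
  ultimately show ?thesis unfolding eq by simp
qed

definition muavg :: "real \<Rightarrow> real \<Rightarrow> complex" where
  "muavg \<beta> t = (LINT s|havg. mu \<beta> (t * s))"

lemma integrable_mu_havg: "0 < \<beta> \<Longrightarrow> integrable havg (\<lambda>s. mu \<beta> (t * s))"
  by (rule integrable_havg[OF continuous_on_compose2[OF continuous_on_mu[of \<beta> UNIV]] norm_mu_le])
    (auto intro!: continuous_intros)

text \<open>The term \<open>\<nu> = 0\<close> of the series of \<open>mu\<close> is the constant
  \<open>1\<close>. All others oscillate at frequency at least \<open>t\<close> and average to at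
  most \<open>4 / t\<close> times their coefficient, so the average cannot vanish for large
  \<open>t\<close>.\<close>

lemma muavg_large:
  assumes \<beta>: "0 < \<beta>" and t: "0 < t"
  shows "norm (muavg \<beta> t - 1) \<le> 4 * bsum \<beta> / t"
proof -
  have c: "continuous_on UNIV (\<lambda>s. cis (- (real \<nu> * (t * s))))" for \<nu> by (intro continuous_intros)
  have int: "integrable havg (\<lambda>s. cis (- (real \<nu> * (t * s))))" for \<nu>
    by (rule integrable_havg[OF c]) auto
  have sm: "summable (\<lambda>\<nu>. \<bar>bcoef \<beta> \<nu>\<bar>)" by (rule summable_bcoef[OF \<beta>])
  have sm1: "summable (\<lambda>\<nu>. \<bar>bcoef \<beta> (Suc \<nu>)\<bar>)"
    using sm summable_Suc_iff[of "\<lambda>\<nu>. \<bar>bcoef \<beta> \<nu>\<bar>"] by simp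
  have "(\<lambda>\<nu>. LINT s|havg. bcoef \<beta> \<nu> *\<^sub>R cis (- (real \<nu> * (t * s)))) sums muavg \<beta> t"
    unfolding muavg_def mu_def
    by (intro sums_integral) (use int sm in \<open>auto intro!: integrable_scaleR_right AE_I2\<close>)
  then have s: "(\<lambda>\<nu>. bcoef \<beta> \<nu> *\<^sub>R (LINT s|havg. cis (- (real \<nu> * (t * s))))) sums muavg \<beta> t" by simp
  then have "(\<lambda>\<nu>. bcoef \<beta> (Suc \<nu>) *\<^sub>R (LINT s|havg. cis (- (real (Suc \<nu>) * (t * s))))) sums (muavg \<beta> t - 1)"
    by (subst sums_Suc_iff) simp
  then have "norm (muavg \<beta> t - 1) = norm (\<Sum>\<nu>. bcoef \<beta> (Suc \<nu>) *\<^sub>R (LINT s|havg. cis (- (real (Suc \<nu>) * (t * s)))))"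
    by (simp add: sums_iff)
  also have "\<dots> \<le> (\<Sum>\<nu>. \<bar>bcoef \<beta> (Suc \<nu>)\<bar> * (4 / t))"
  proof (rule norm_suminf_le)
    fix \<nu>
    have "norm (LINT s|havg. cis (- (real (Suc \<nu>) * t * s))) \<le> 4 / (real (Suc \<nu>) * t)"
      using t by (intro integral_havg_cis) auto
    also have "\<dots> \<le> 4 / t" using t by (intro divide_left_mono) auto
    finally show "norm (bcoef \<beta> (Suc \<nu>) *\<^sub>R (LINT s|havg. cis (- (real (Suc \<nu>) * (t * s))))) \<le> \<bar>bcoef \<beta> (Suc \<nu>)\<bar> * (4 / t)"
      by (simp only: norm_scaleR mult.assoc mult_left_mono abs_ge_zero)
  next
    show "summable (\<lambda>\<nu>. \<bar>bcoef \<beta> (Suc \<nu>)\<bar> * (4 / t))" by (intro summable_mult2 sm1)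
  qed
  also have "\<dots> = (\<Sum>\<nu>. \<bar>bcoef \<beta> (Suc \<nu>)\<bar>) * (4 / t)"
    by (rule suminf_mult2[symmetric, OF sm1])
  also have "\<dots> \<le> bsum \<beta> * (4 / t)"
    using t suminf_split_head[OF sm] by (intro mult_right_mono) (auto simp: bsum_def)
  finally show ?thesis by (simp add: mult.commute)
qed

text \<open>By \<open>mu_eq\<close> the argument of \<open>mu \<beta> u\<close> differs from
  \<open>\<beta> * pi / 2\<close> by \<open>\<beta> * u / 2\<close>. As
  \<open>u \<le> 1 / (2 * \<beta>)\<close>, this is at most \<open>1 / 4\<close>, so after one fixed
  rotation all values under the average are close to positive reals. The witness is the average of
  the moduli; it is bounded below through \<open>t / 2 \<le> u\<close>.\<close>

lemma muavg_small:
  assumes \<beta>: "0 < \<beta>" and t: "0 < t" "t \<le> 1" "t \<le> 1 / (2 * \<beta>)"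
  shows "\<exists>\<rho>\<ge>(t / pi) powr \<beta>. norm (cis (- (\<beta> * pi / 2)) * muavg \<beta> t - of_real \<rho>) \<le> \<rho> / 4"
proof -
  define R where "R s = norm (mu \<beta> (t * s))" for s
  define \<rho> where "\<rho> = (LINT s|havg. R s)"
  have int: "integrable havg (\<lambda>s. mu \<beta> (t * s))" by (rule integrable_mu_havg[OF \<beta>])
  then have intR: "integrable havg R" unfolding R_def by (rule integrable_norm)
  have pt: "AE s in havg. (t / pi) powr \<beta> \<le> R s \<and> norm (cis (- (\<beta> * pi / 2)) * mu \<beta> (t * s) - of_real (R s)) \<le> R s / 4"
    using AE_havg
  proof eventually_elim
    case (elim s)
    define u where "u = t * s"
    have u: "0 < u" "u \<le> 1" "u \<le> 1 / (2 * \<beta>)" "t / 2 \<le> u"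
    proof -
      show "0 < u" "t / 2 \<le> u" using elim t by (auto simp: u_def)
      have "u \<le> t" using elim t by (simp add: u_def mult_left_le)
      then show "u \<le> 1" "u \<le> 1 / (2 * \<beta>)" using t by linarith+
    qed
    have u2: "u < 2 * pi" using u pi_gt3 by linarith
    have Ru: "R s = (2 * sin (u / 2)) powr \<beta>" unfolding R_def u_def[symmetric] by (rule norm_mu[OF \<beta> u(1) u2])
    have "u / pi \<le> sin (u / 2)" using jordan_sin[of u] u pi_gt3 by auto
    moreover have "t / pi \<le> 2 * (u / pi)" using u by (simp add: field_simps)
    ultimately have "t / pi \<le> 2 * sin (u / 2)" by linarith
    then have 1: "(t / pi) powr \<beta> \<le> R s" unfolding Ru using \<beta> t by (intro powr_mono2) auto
    have "- (\<beta> * pi / 2) + \<beta> * (pi - u) / 2 = - (\<beta> * u / 2)" by (simp add: field_simps)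
    then have "cis (- (\<beta> * pi / 2)) * cis (\<beta> * (pi - u) / 2) = cis (- (\<beta> * u / 2))" by (simp only: cis_mult)
    then have "cis (- (\<beta> * pi / 2)) * mu \<beta> u = of_real (R s) * cis (- (\<beta> * u / 2))"
      unfolding mu_eq[OF \<beta> u(1) u2] Ru by (simp only: mult.left_commute[of "cis _"])
    then have "norm (cis (- (\<beta> * pi / 2)) * mu \<beta> u - of_real (R s)) = norm (of_real (R s) * (1 - cis (- (\<beta> * u / 2))))"
      by (simp add: algebra_simps norm_minus_commute)
    also have "\<dots> = R s * (2 * sig (- (\<beta> * u / 2)))"
      by (simp add: norm_mult norm_one_minus_cis R_def)
    also have "\<dots> \<le> R s * (1 / 4)"
    proof (rule mult_left_mono)
      have "sig (- (\<beta> * u / 2)) \<le> \<beta> * u / 4" using abs_sin_x_le_abs_x[of "\<beta> * u / 4"] \<beta> u by (simp add: sig_def)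
      moreover have "\<beta> * u \<le> 1 / 2" using u \<beta> by (simp add: field_simps)
      ultimately show "2 * sig (- (\<beta> * u / 2)) \<le> 1 / 4" by linarith
    qed (simp add: R_def)
    finally show ?case using 1 by (simp add: u_def)
  qed
  have "(LINT s|havg. (t / pi) powr \<beta>) \<le> \<rho>"
    unfolding \<rho>_def by (rule integral_mono_AE) (use pt intR in \<open>auto elim!: eventually_mono\<close>)
  then have 1: "(t / pi) powr \<beta> \<le> \<rho>" by simp
  have "cis (- (\<beta> * pi / 2)) * muavg \<beta> t - of_real \<rho> = (LINT s|havg. cis (- (\<beta> * pi / 2)) * mu \<beta> (t * s) - of_real (R s))"
    using int intR by (simp add: muavg_def \<rho>_def)
  also have "norm \<dots> \<le> (LINT s|havg. R s / 4)"
    by (rule order_trans[OF integral_norm_bound integral_mono_AE]) (use pt int intR in \<open>auto elim!: eventually_mono\<close>)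
  also have "\<dots> = \<rho> / 4" by (simp add: \<rho>_def)
  finally show ?thesis using 1 by blast
qed

text \<open>At the scale \<open>\<delta>\<close>, if \<open>m \<delta>\<close> is large, and at the scale \<open>\<kappa> \<delta>\<close> otherwise, the average of
  the multiplier is close to a positive multiple of a fixed complex number of modulus one.\<close>

lemma muavg_block:
  assumes \<beta>: "0 < \<beta>"
  shows "\<exists>\<kappa> c. 0 < \<kappa> \<and> \<kappa> \<le> 1 \<and> 0 < c \<and> (\<forall>\<delta>>0. \<forall>m\<ge>1. \<exists>\<eta>\<in>{\<delta>, \<kappa> * \<delta>}. \<exists>\<epsilon>. norm \<epsilon> = 1 \<and>
    (\<forall>k. m \<le> 2 * k \<longrightarrow> k \<le> m \<longrightarrow> (\<exists>\<rho>\<ge>c * min 1 (real m * \<delta>) powr \<beta>.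
       norm (\<epsilon> * muavg \<beta> (real k * \<eta>) - of_real \<rho>) \<le> \<rho> / 4)))"
proof -
  \<comment> \<open>If \<open>m * \<delta>\<close> exceeds \<open>K\<close>, then
    \<open>k * \<delta>\<close> is at least \<open>16 * bsum \<beta>\<close> on the block and
    \<open>muavg_large\<close> leaves an error of \<open>1 / 4\<close>. Otherwise the factor
    \<open>\<kappa>\<close> brings \<open>k * (\<kappa> * \<delta>)\<close> below \<open>u0\<close>,
    the range of \<open>muavg_small\<close>; \<open>c\<close> absorbs \<open>\<kappa>\<close>, the
    \<open>pi\<close> of that lemma and the \<open>2\<close> from
    \<open>m \<le> 2 * k\<close>.\<close>
  define K where "K = 32 * bsum \<beta>"
  define u0 where "u0 = min 1 (1 / (2 * \<beta>))"
  define \<kappa> where "\<kappa> = u0 / K"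
  define c where "c = (\<kappa> / (2 * pi)) powr \<beta>"
  have K: "32 \<le> K" using bsum_ge_1[OF \<beta>] by (simp add: K_def)
  have u0: "0 < u0" "u0 \<le> 1" "u0 \<le> 1 / (2 * \<beta>)" using \<beta> by (auto simp: u0_def)
  have \<kappa>: "0 < \<kappa>" "\<kappa> \<le> 1" using u0 K by (auto simp: \<kappa>_def field_simps)
  have "c \<le> 1 powr \<beta>" unfolding c_def using \<kappa> \<beta> pi_gt3 by (intro powr_mono2) (auto simp: field_simps)
  then have c: "0 < c" "c \<le> 1" using \<kappa> by (auto simp: c_def)
  have main: "\<exists>\<eta>\<in>{\<delta>, \<kappa> * \<delta>}. \<exists>\<epsilon>. norm \<epsilon> = 1 \<and>
    (\<forall>k. m \<le> 2 * k \<longrightarrow> k \<le> m \<longrightarrow> (\<exists>\<rho>\<ge>c * min 1 (real m * \<delta>) powr \<beta>.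
       norm (\<epsilon> * muavg \<beta> (real k * \<eta>) - of_real \<rho>) \<le> \<rho> / 4))" if \<delta>: "0 < \<delta>" and m: "1 \<le> m" for \<delta> :: real and m :: nat
  proof (cases "real m * \<delta> \<le> K")
    case False
    have "\<exists>\<rho>\<ge>c * min 1 (real m * \<delta>) powr \<beta>. norm (1 * muavg \<beta> (real k * \<delta>) - of_real \<rho>) \<le> \<rho> / 4"
      if k: "m \<le> 2 * k" "k \<le> m" for k
    proof (intro exI[of _ 1] conjI)
      have "real m * \<delta> \<le> (2 * real k) * \<delta>" using k \<delta> by (intro mult_right_mono) auto
      then have t: "K / 2 \<le> real k * \<delta>" using False by simp
      then have t0: "0 < real k * \<delta>" using K by linarith
      have "norm (muavg \<beta> (real k * \<delta>) - 1) \<le> 4 * bsum \<beta> / (real k * \<delta>)" by (rule muavg_large[OF \<beta> t0])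
      also have "\<dots> \<le> 4 * bsum \<beta> / (K / 2)"
        using t t0 K bsum_ge_1[OF \<beta>] by (intro divide_left_mono) auto
      also have "\<dots> = 1 / 4" using bsum_ge_1[OF \<beta>] by (simp add: K_def)
      finally show "norm (1 * muavg \<beta> (real k * \<delta>) - of_real 1) \<le> 1 / 4" by simp
      have "c * min 1 (real m * \<delta>) powr \<beta> \<le> 1 * 1 powr \<beta>"
        using c \<delta> \<beta> by (intro mult_mono powr_mono2) auto
      then show "c * min 1 (real m * \<delta>) powr \<beta> \<le> 1" by simp
    qed
    then show ?thesis by (intro bexI[of _ \<delta>] exI[of _ 1]) auto
  next
    case True
    have "\<exists>\<rho>\<ge>c * min 1 (real m * \<delta>) powr \<beta>. norm (cis (- (\<beta> * pi / 2)) * muavg \<beta> (real k * (\<kappa> * \<delta>)) - of_real \<rho>) \<le> \<rho> / 4"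
      if k: "m \<le> 2 * k" "k \<le> m" for k
    proof -
      define t where "t = real k * (\<kappa> * \<delta>)"
      have t0: "0 < t" using k m \<kappa> \<delta> by (auto simp: t_def)
      have "t \<le> real m * (\<kappa> * \<delta>)" unfolding t_def using k \<kappa> \<delta> by (intro mult_right_mono) auto
      also have "\<dots> = \<kappa> * (real m * \<delta>)" by simp
      also have "\<dots> \<le> \<kappa> * K" using True \<kappa> by (intro mult_left_mono) auto
      also have "\<dots> = u0" using K by (simp add: \<kappa>_def)
      finally have "t \<le> 1" "t \<le> 1 / (2 * \<beta>)" using u0 by linarith+
      from muavg_small[OF \<beta> t0 this] obtain \<rho> where \<rho>: "(t / pi) powr \<beta> \<le> \<rho>"
        "norm (cis (- (\<beta> * pi / 2)) * muavg \<beta> t - of_real \<rho>) \<le> \<rho> / 4" by blast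
      have "c * min 1 (real m * \<delta>) powr \<beta> \<le> c * (real m * \<delta>) powr \<beta>"
        using c \<beta> \<delta> by (intro mult_left_mono powr_mono2) auto
      also have "\<dots> = (\<kappa> / (2 * pi) * (real m * \<delta>)) powr \<beta>" unfolding c_def by (rule powr_mult[symmetric])
      also have "\<dots> \<le> (t / pi) powr \<beta>"
      proof (intro powr_mono2)
        have "real m * (\<kappa> * \<delta>) \<le> (2 * real k) * (\<kappa> * \<delta>)" using k \<kappa> \<delta> by (intro mult_right_mono) auto
        then show "\<kappa> / (2 * pi) * (real m * \<delta>) \<le> t / pi" by (simp add: t_def field_simps)
      qed (use \<beta> \<kappa> \<delta> in auto)
      finally show ?thesis using \<rho> by (auto simp: t_def intro: order_trans)
    qed
    then show ?thesis by (intro bexI[of _ "\<kappa> * \<delta>"] exI[of _ "cis (- (\<beta> * pi / 2))"]) auto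
  qed
  show ?thesis using \<kappa> c main by blast
qed

subsection \<open>Lower bound for the norm by Fourier coefficients\<close>

lemma norm_block_sum_cis: "1 \<le> m \<Longrightarrow> norm (\<Sum>k=(m + 1) div 2..<Suc m. cis (real k * x)) \<le> 4 * real m * wker m x"
proof -
  assume m: "1 \<le> m"
  have "norm (\<Sum>k=(m + 1) div 2..<Suc m. cis (real k * x)) \<le> 2 * (real (Suc m) * wker (Suc m) x)"
    using norm_sum_cis_wker[where m = "(m + 1) div 2" and n = "Suc m" and x = x] by (simp only: mult.assoc)
  also have "real (Suc m) * wker (Suc m) x \<le> (2 * real m) * wker m x"
    using m wker_antimono[of m "Suc m" x] wker_pos[of "Suc m" x] by (intro mult_mono) auto
  finally show ?thesis by simp
qed

text \<open>There is a block for every \<open>m\<close>, not only for powers of two, so that sums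
  over blocks have the same index set as the coefficient sums. The overlaps are compensated by the
  weight \<open>m powr (-2)\<close> in \<open>block_fourier_lower\<close>.\<close>

definition block :: "nat \<Rightarrow> nat set" where "block m = {(m + 1) div 2..<Suc m}"

lemma block_iff: "k \<in> block m \<longleftrightarrow> m \<le> 2 * k \<and> k \<le> m"
  by (auto simp: block_def)

lemma finite_block [simp]: "finite (block m)" by (simp add: block_def)

lemma card_block: "real m \<le> 2 * real (card (block m))"
  unfolding block_def by simp

text \<open>A block sum is the integral of \<open>G\<close> against a product of two exponential
  sums, which is at most \<open>16 * m * n\<close> times the product of the kernels. Then
  \<open>hardy_dual_2d\<close> applies; \<open>m powr (p - 2)\<close> splits into
  \<open>m powr (-2)\<close> and the \<open>m powr p\<close> of the kernel bound.\<close>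

lemma block_fourier_lower:
  assumes p: "1 < p"
  shows "\<exists>K>0. \<forall>G. integrable (circ \<Otimes>\<^sub>M circ) G \<longrightarrow>
    (\<Sum>m. \<Sum>n. ennreal (real m powr (-2) * real n powr (-2)) *
       enn_powr (ennreal (norm (\<Sum>k\<in>block m. \<Sum>l\<in>block n. fc2 G (int k) (int l)))) p)
    \<le> ennreal K * (\<integral>\<^sup>+z. enn_powr (ennreal (norm (G z))) p \<partial>(circ \<Otimes>\<^sub>M circ))"
proof -
  define K where "K = (2 * pi * (p + p / (p - 1))) powr (p - 1) * (p + p / (p - 1))"
  have K: "0 < K" unfolding K_def using p by (smt (verit) divide_pos_pos mult_pos_pos pi_gt_zero powr_gt_zero)
  have main: "(\<Sum>m. \<Sum>n. ennreal (real m powr (-2) * real n powr (-2)) *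
       enn_powr (ennreal (norm (\<Sum>k\<in>block m. \<Sum>l\<in>block n. fc2 G (int k) (int l)))) p)
    \<le> ennreal (16 powr p * (K * K)) * (\<integral>\<^sup>+z. enn_powr (ennreal (norm (G z))) p \<partial>(circ \<Otimes>\<^sub>M circ))"
    if G: "integrable (circ \<Otimes>\<^sub>M circ) G" for G
  proof -
    have "G \<in> borel_measurable (circ \<Otimes>\<^sub>M circ)" using G by simp
    then have [measurable]: "G \<in> borel_measurable borel" by simp
    have w0: "0 \<le> wker k x" for k x using wker_pos[of k x] by simp
    define J where "J m n = (\<integral>\<^sup>+x. \<integral>\<^sup>+y. ennreal (norm (G (x, y))) * ennreal (wker m x * wker n y) \<partial>circ \<partial>circ)" for m n
    have bd: "ennreal (norm (\<Sum>k\<in>block m. \<Sum>l\<in>block n. fc2 G (int k) (int l))) \<le> ennreal (16 * (real m * real n)) * J m n"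
      if mn: "1 \<le> m" "1 \<le> n" for m n
    proof -
      define E where "E m x = (\<Sum>k\<in>block m. cis (- (real k * x)))" for m x
      have En: "norm (E m x) \<le> 4 * real m * wker m x" if "1 \<le> m" for m x
      proof -
        have "E m x = cnj (\<Sum>k\<in>block m. cis (real k * x))" by (simp add: E_def cis_cnj)
        then show ?thesis using norm_block_sum_cis[OF that, of x] by (simp only: complex_mod_cnj block_def)
      qed
      have int: "integrable (circ \<Otimes>\<^sub>M circ) (\<lambda>z. G z * cis (- (real k * fst z + real l * snd z)))" for k l
        using integrable_circ2_mult_cis[OF G, of "- real k" "- real l"] by simp
      have "(\<Sum>k\<in>block m. \<Sum>l\<in>block n. fc2 G (int k) (int l))
        = (LINT z|(circ \<Otimes>\<^sub>M circ). (\<Sum>k\<in>block m. \<Sum>l\<in>block n. G z * cis (- (real k * fst z + real l * snd z))))"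
        unfolding fc2_def using int by (simp add: integrable_sum)
      also have sumE: "(\<lambda>z. \<Sum>k\<in>block m. \<Sum>l\<in>block n. G z * cis (- (real k * fst z + real l * snd z))) = (\<lambda>z. G z * (E m (fst z) * E n (snd z)))"
      proof
        fix z :: "real \<times> real"
        have "cis (- (real k * fst z + real l * snd z)) = cis (- (real k * fst z)) * cis (- (real l * snd z))" for k l
          by (simp add: cis_mult)
        then show "(\<Sum>k\<in>block m. \<Sum>l\<in>block n. G z * cis (- (real k * fst z + real l * snd z))) = G z * (E m (fst z) * E n (snd z))"
          unfolding E_def by (subst sum_product) (simp only: sum_distrib_left)
      qed
      finally have eq: "(\<Sum>k\<in>block m. \<Sum>l\<in>block n. fc2 G (int k) (int l)) = (LINT z|(circ \<Otimes>\<^sub>M circ). G z * (E m (fst z) * E n (snd z)))" .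
      have intE: "integrable (circ \<Otimes>\<^sub>M circ) (\<lambda>z. G z * (E m (fst z) * E n (snd z)))"
        unfolding sumE[symmetric] by (intro Bochner_Integration.integrable_sum int)
      have "ennreal (norm (\<Sum>k\<in>block m. \<Sum>l\<in>block n. fc2 G (int k) (int l)))
        \<le> (\<integral>\<^sup>+z. ennreal (norm (G z * (E m (fst z) * E n (snd z)))) \<partial>(circ \<Otimes>\<^sub>M circ))"
        unfolding eq by (rule integral_norm_bound_ennreal[OF intE])
      also have "\<dots> \<le> (\<integral>\<^sup>+z. ennreal (16 * (real m * real n)) * (ennreal (norm (G z)) * ennreal (wker m (fst z) * wker n (snd z))) \<partial>(circ \<Otimes>\<^sub>M circ))"
      proof (intro nn_integral_mono)
        fix z :: "real \<times> real"
        have "norm (G z * (E m (fst z) * E n (snd z))) \<le> norm (G z) * ((4 * real m * wker m (fst z)) * (4 * real n * wker n (snd z)))"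
          unfolding norm_mult using w0 by (intro mult_left_mono mult_mono En mn) auto
        also have "\<dots> = 16 * (real m * real n) * (norm (G z) * (wker m (fst z) * wker n (snd z)))" by simp
        finally show "ennreal (norm (G z * (E m (fst z) * E n (snd z))))
          \<le> ennreal (16 * (real m * real n)) * (ennreal (norm (G z)) * ennreal (wker m (fst z) * wker n (snd z)))"
          using w0 by (simp flip: ennreal_mult)
      qed
      also have "\<dots> = ennreal (16 * (real m * real n)) * J m n"
        unfolding J_def by (simp add: nn_integral_cmult circ.nn_integral_fst[symmetric])
      finally show ?thesis .
    qed
    have "(\<Sum>m. \<Sum>n. ennreal (real m powr (-2) * real n powr (-2)) *
       enn_powr (ennreal (norm (\<Sum>k\<in>block m. \<Sum>l\<in>block n. fc2 G (int k) (int l)))) p)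
      \<le> (\<Sum>m. \<Sum>n. ennreal (16 powr p) * (ennreal (real m powr (p - 2) * real n powr (p - 2)) * enn_powr (J m n) p))"
    proof (intro ennreal_suminf_le)
      fix m n
      show "ennreal (real m powr (-2) * real n powr (-2)) * enn_powr (ennreal (norm (\<Sum>k\<in>block m. \<Sum>l\<in>block n. fc2 G (int k) (int l)))) p
        \<le> ennreal (16 powr p) * (ennreal (real m powr (p - 2) * real n powr (p - 2)) * enn_powr (J m n) p)"
      proof (cases "1 \<le> m \<and> 1 \<le> n")
        case True
        have "ennreal (real m powr (-2) * real n powr (-2)) * enn_powr (ennreal (norm (\<Sum>k\<in>block m. \<Sum>l\<in>block n. fc2 G (int k) (int l)))) p
          \<le> ennreal (real m powr (-2) * real n powr (-2)) * enn_powr (ennreal (16 * (real m * real n)) * J m n) p"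
          using True p by (intro mult_left_mono enn_powr_mono bd) auto
        also have "\<dots> = ennreal (real m powr (-2) * real n powr (-2) * (16 * (real m * real n)) powr p) * enn_powr (J m n) p"
        proof -
          have "enn_powr (ennreal (16 * (real m * real n)) * J m n) p = ennreal ((16 * (real m * real n)) powr p) * enn_powr (J m n) p"
            using p by (subst enn_powr_mult) auto
          then show ?thesis by (simp only: ennreal_mult' mult.assoc powr_ge_zero mult_nonneg_nonneg)
        qed
        also have "real m powr (-2) * real n powr (-2) * (16 * (real m * real n)) powr p = 16 powr p * (real m powr (p - 2) * real n powr (p - 2))"
          using True by (simp add: powr_mult powr_diff powr_minus field_simps)
        finally show ?thesis by (simp add: ennreal_mult mult.assoc)
      qed (cases "m = 0"; cases "n = 0"; simp)
    qed
    also have "\<dots> = ennreal (16 powr p) * (\<Sum>m. \<Sum>n. ennreal (real m powr (p - 2) * real n powr (p - 2)) * enn_powr (J m n) p)"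
      by (simp only: ennreal_suminf_cmult)
    also have "\<dots> \<le> ennreal (16 powr p) * (ennreal K * ennreal K * (\<integral>\<^sup>+x. \<integral>\<^sup>+y. enn_powr (ennreal (norm (G (x, y)))) p \<partial>circ \<partial>circ))"
      unfolding J_def K_def by (intro mult_left_mono hardy_dual_2d[OF p, of "\<lambda>x y. ennreal (norm (G (x, y)))"]) (auto simp: borel_prod)
    also have "\<dots> = ennreal (16 powr p * (K * K)) * (\<integral>\<^sup>+z. enn_powr (ennreal (norm (G z))) p \<partial>(circ \<Otimes>\<^sub>M circ))"
      using K by (simp add: circ.nn_integral_fst[symmetric] ennreal_mult mult.assoc)
    finally show ?thesis .
  qed
  show ?thesis using K p main by (intro exI[of _ "16 powr p * (K * K)"]) auto
qed

subsection \<open>Synthesis of functions with doubly monotone coefficients\<close>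

lemma integral_circ_cis: "(LINT x|circ. cis (of_int m * x)) = (if m = 0 then of_real (2 * pi) else 0)"
proof (cases "m = 0")
  case True
  then show ?thesis using emeasure_circ by (simp add: measure_def scaleR_conv_of_real)
next
  case False
  define F where "F s = - \<i> / of_int m * cis (of_int m * s)" for s
  have m: "(\<lambda>s. cis (of_int m * s)) \<in> borel_measurable borel" by measurable
  have "(LINT x|circ. cis (of_int m * x)) = (LINT s|lborel. indicator {0..2 * pi} s *\<^sub>R cis (of_int m * s))"
    unfolding circ_def ennreal_indicator[symmetric] using m by (subst integral_density) auto
  also have "\<dots> = F (2 * pi) - F 0"
  proof (rule integral_FTC_Icc)
    show "continuous_on {0..2 * pi} (\<lambda>s. cis (of_int m * s))" by (intro continuous_intros)
    fix s :: real
    have "((\<lambda>s. \<i> * complex_of_real (of_int m * s)) has_vector_derivative \<i> * of_real (of_int m)) (at s within {0..2 * pi})"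
      by (intro has_vector_derivative_mult_right has_vector_derivative_of_real)
        (auto intro!: derivative_eq_intros simp flip: has_real_derivative_iff_has_vector_derivative)
    from field_vector_diff_chain_within[OF this has_field_derivative_at_within[OF DERIV_exp]]
    have "((\<lambda>s. cis (of_int m * s)) has_vector_derivative (\<i> * of_real (of_int m)) * cis (of_int m * s)) (at s within {0..2 * pi})"
      by (simp add: cis_conv_exp o_def)
    then have "(F has_vector_derivative - \<i> / of_int m * ((\<i> * of_real (of_int m)) * cis (of_int m * s))) (at s within {0..2 * pi})"
      unfolding F_def by (rule has_vector_derivative_mult_right)
    then show "(F has_vector_derivative cis (of_int m * s)) (at s within {0..2 * pi})" using False by simp
  qed simp
  also have "\<dots> = 0"
  proof -
    have "cis (of_int m * (2 * pi)) = 1" using cis_multiple_2pi[of "of_int m"] by (simp add: mult_ac)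
    then show ?thesis by (simp add: F_def)
  qed
  finally show ?thesis using False by simp
qed

lemma integrable_circ_bounded:
  fixes f :: "real \<Rightarrow> complex"
  assumes "continuous_on UNIV f" "\<And>s. norm (f s) \<le> B"
  shows "integrable circ f"
  using assms borel_measurable_continuous_onI[OF assms(1)] by (intro circ.integrable_const_bound[of _ B]) auto

lemma fc1_trig_polynomial:
  "fc1 (\<lambda>x. \<Sum>j\<in>{- int i..int i}. c j * cis (of_int j * x)) k = (if \<bar>k\<bar> \<le> int i then of_real (2 * pi) * c k else 0)"
proof -
  have int: "integrable circ (\<lambda>x. cis (of_int (j - k) * x))" for j
    by (rule integrable_circ_bounded[of _ 1]) (auto intro!: continuous_intros)
  have c: "cis (of_int j * x) * cis (- (of_int k * x)) = cis (of_int (j - k) * x)" for j x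
    by (simp add: cis_mult algebra_simps)
  have "fc1 (\<lambda>x. \<Sum>j\<in>{- int i..int i}. c j * cis (of_int j * x)) k
    = (LINT x|circ. (\<Sum>j\<in>{- int i..int i}. c j * cis (of_int (j - k) * x)))"
    unfolding fc1_def sum_distrib_right by (simp only: mult.assoc c)
  also have "\<dots> = (\<Sum>j\<in>{- int i..int i}. c j * (LINT x|circ. cis (of_int (j - k) * x)))"
    using int by (subst Bochner_Integration.integral_sum) auto
  also have "\<dots> = (\<Sum>j\<in>{- int i..int i}. if j = k then c j * of_real (2 * pi) else 0)"
    unfolding integral_circ_cis by (intro sum.cong) auto
  also have "\<dots> = (if \<bar>k\<bar> \<le> int i then of_real (2 * pi) * c k else 0)"
    by (subst sum.delta) (auto simp: mult.commute)
  finally show ?thesis .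
qed

lemma fc2_product:
  assumes "integrable (circ \<Otimes>\<^sub>M circ) (\<lambda>z. u (fst z) * v (snd z))"
  shows "fc2 (\<lambda>z. u (fst z) * v (snd z)) k l = fc1 u k * fc1 v l"
proof -
  have "fc1 (\<lambda>y. u x * v y) l = u x * fc1 v l" for x
    unfolding fc1_def by (simp add: mult.assoc)
  moreover have "fc1 (\<lambda>x. u x * C) k = fc1 u k * C" for C
  proof -
    have "u x * C * cis (- (of_int k * x)) = u x * cis (- (of_int k * x)) * C" for x by simp
    then show ?thesis unfolding fc1_def by (simp only: integral_mult_left_zero)
  qed
  ultimately show ?thesis unfolding fc2_iterated(2)[OF assms] by simp
qed

lemma nn_integral_circ2_finite:
  assumes p: "1 < p" and [measurable]: "P \<in> borel_measurable borel"
    and fin: "(\<integral>\<^sup>+z. enn_powr (P z) p \<partial>(circ \<Otimes>\<^sub>M circ)) < \<infinity>"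
  shows "(\<integral>\<^sup>+z. P z \<partial>(circ \<Otimes>\<^sub>M circ)) < \<infinity>"
proof -
  have "enn_powr (\<integral>\<^sup>+z. 1 * P z \<partial>(circ \<Otimes>\<^sub>M circ)) p
    \<le> enn_powr (\<integral>\<^sup>+z. 1 \<partial>(circ \<Otimes>\<^sub>M circ)) (p - 1) * (\<integral>\<^sup>+z. 1 * enn_powr (P z) p \<partial>(circ \<Otimes>\<^sub>M circ))"
    by (rule enn_jensen[OF _ _ p]) auto
  also have "\<dots> < \<infinity>" using fin circ2f.emeasure_finite
    by (auto simp: ennreal_mult_eq_top_iff less_top[symmetric])
  finally show ?thesis by (auto simp: less_top[symmetric])
qed

text \<open>Indices \<open>0\<close> contribute nothing, since \<open>0 powr (p - 2) = 0\<close>.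
  The absolute value keeps the base of the power nonnegative also where \<open>a\<close> is not
  known to be so.\<close>

definition pdsum :: "real \<Rightarrow> (nat \<Rightarrow> nat \<Rightarrow> real) \<Rightarrow> (nat \<Rightarrow> real) \<Rightarrow> (nat \<Rightarrow> real) \<Rightarrow> ennreal" where
  "pdsum p a V W = (\<Sum>k. \<Sum>l. ennreal ((\<bar>a k l\<bar> * V k * W l) powr p * (real k powr (p - 2) * real l powr (p - 2))))"

text \<open>The function is the series of the products \<open>D i x * D' j y\<close> of symmetric
  partial sums, weighted with the nonnegative mixed differences of \<open>a\<close>. Domination
  bounds each product by sums over \<open>k \<le> i\<close> and \<open>l \<le> j\<close>; after
  interchange the differences add up to \<open>a k l\<close> again, and the Hardy families bound the
  resulting majorant in \<open>L\<^sub>p\<close>. Finiteness of the majorant gives absolute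
  convergence almost everywhere and in \<open>L\<^sub>1\<close>, so coefficients may be computed
  termwise.\<close>

theorem synthesis:
  fixes a :: "nat \<Rightarrow> nat \<Rightarrow> real" and c c' :: "int \<Rightarrow> complex"
  assumes p: "1 < p" and a: "doubly_monotone a"
    and dom: "dominated c V H" "dominated c' V' H'" and hf: "hardy_family p C H" "hardy_family p C' H'"
    and nn: "\<And>k. 0 \<le> V k" "\<And>k. 0 \<le> V' k" "0 \<le> C" "0 \<le> C'" and c0: "c 0 = 0" "c' 0 = 0"
    and fin: "pdsum p a V V' < \<infinity>"
  shows "\<exists>G. integrable (circ \<Otimes>\<^sub>M circ) G \<and> G \<in> borel_measurable borel \<and>
    (\<forall>x y. G (x + 2 * pi, y) = G (x, y) \<and> G (x, y + 2 * pi) = G (x, y)) \<and>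
    (\<integral>\<^sup>+z. enn_powr (ennreal (norm (G z))) p \<partial>(circ \<Otimes>\<^sub>M circ)) \<le> ennreal (C * C') * pdsum p a V V' \<and>
    (\<forall>k l. fc2 G k l = of_real ((2 * pi)\<^sup>2 * a (nat \<bar>k\<bar>) (nat \<bar>l\<bar>)) * (c k * c' l))"
proof -
  have [measurable]: "H k \<in> borel_measurable borel" "H' k \<in> borel_measurable borel" for k
    using hf by (auto simp: hardy_family_def)
  \<comment> \<open>The double series is enumerated as a single one, so that the convergence
    theorems for series of functions apply.\<close>
  define I J where "I n = fst (prod_decode n)" and "J n = snd (prod_decode n)" for n
  define b where "b n = mixed_diff a (I n) (J n)" for n
  have b0: "0 \<le> b n" for n unfolding b_def by (rule mixed_diff_nonneg[OF a])
  define D where "D i x = (\<Sum>k\<in>{- int i..int i}. c k * cis (of_int k * x))" for i x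
  define D' where "D' i x = (\<Sum>k\<in>{- int i..int i}. c' k * cis (of_int k * x))" for i x
  define t where "t n z = (of_real (b n) * D (I n) (fst z)) * D' (J n) (snd z)" for n and z :: "real \<times> real"
  define G where "G z = (\<Sum>n. t n z)" for z
  have contD: "continuous_on UNIV (D i)" "continuous_on UNIV (D' i)" for i
    unfolding D_def D'_def by (intro continuous_intros)+
  then have [measurable]: "D i \<in> borel_measurable borel" "D' i \<in> borel_measurable borel" for i
    by (auto intro: borel_measurable_continuous_onI)
  have [measurable]: "t n \<in> borel_measurable borel" for n unfolding t_def by measurable
  \<comment> \<open>Truncation at the index \<open>0\<close>, where \<open>a\<close> is arbitrary;
    it provides the nonnegativity and the vanishing that the Hardy families ask for.\<close>
  define A where "A k l = (if 1 \<le> k \<and> 1 \<le> l then a k l else 0)" for k l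
  have bsum: "(\<Sum>n. ennreal (if k \<le> I n \<and> l \<le> J n then b n else 0)) = ennreal (a k l)" if "1 \<le> k" "1 \<le> l" for k l
  proof -
    define f where "f q = ennreal (if k \<le> fst q \<and> l \<le> snd q then mixed_diff a (fst q) (snd q) else 0)" for q
    have "(\<Sum>n. f (prod_decode n)) = (\<Sum>i. \<Sum>j. f (i, j))" by (rule suminf_ennreal_2dimen) simp
    then show ?thesis using doubly_monotone_sum(1)[OF a that] by (simp add: f_def I_def J_def b_def cong: if_cong)
  qed
  define u where "u k x = ennreal (V k) * H k x" for k x
  define v where "v l y = ennreal (V' l) * H' l y" for l y
  define P where "P z = (\<Sum>k. \<Sum>l. ennreal (A k l * V k * V' l) * H k (fst z) * H' l (snd z))" for z :: "real \<times> real"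
  have [measurable]: "P \<in> borel_measurable borel" unfolding P_def by measurable
  have A0: "0 \<le> A k l" for k l using doubly_monotone_sum(2)[OF a] by (simp add: A_def)
  have fs: "(\<Sum>k=1..<Suc i. f k) = (\<Sum>k. if 1 \<le> k \<and> k \<le> i then f k else 0)" for f :: "nat \<Rightarrow> ennreal" and i
  proof -
    have "(\<Sum>k. if 1 \<le> k \<and> k \<le> i then f k else 0) = (\<Sum>k\<in>{1..<Suc i}. if 1 \<le> k \<and> k \<le> i then f k else 0)"
      by (rule suminf_finite) auto
    then show ?thesis by simp
  qed
  have bound: "(\<Sum>n. ennreal (norm (t n z))) \<le> P z" for z
  proof -
    obtain x y where z: "z = (x, y)" by (cases z)
    have "(\<Sum>n. ennreal (norm (t n z))) \<le> (\<Sum>n. ennreal (b n) * ((\<Sum>k=1..<Suc (I n). u k x) * (\<Sum>l=1..<Suc (J n). v l y)))"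
    proof (rule ennreal_suminf_le)
      fix n
      have "ennreal (norm (t n z)) = ennreal (b n) * (ennreal (norm (D (I n) x)) * ennreal (norm (D' (J n) y)))"
        using b0 by (simp add: t_def z norm_mult ennreal_mult mult.assoc)
      also have "\<dots> \<le> ennreal (b n) * ((\<Sum>k=1..<Suc (I n). u k x) * (\<Sum>l=1..<Suc (J n). v l y))"
        using dom unfolding dominated_def u_def v_def D_def D'_def by (intro mult_left_mono mult_mono) auto
      finally show "ennreal (norm (t n z)) \<le> ennreal (b n) * ((\<Sum>k=1..<Suc (I n). u k x) * (\<Sum>l=1..<Suc (J n). v l y))" .
    qed
    also have "\<dots> = (\<Sum>n. \<Sum>k. \<Sum>l. (if 1 \<le> k \<and> 1 \<le> l then ennreal (if k \<le> I n \<and> l \<le> J n then b n else 0) else 0) * (u k x * v l y))"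
    proof (rule suminf_cong)
      fix n
      have "ennreal (b n) * ((\<Sum>k=1..<Suc (I n). u k x) * (\<Sum>l=1..<Suc (J n). v l y))
        = (\<Sum>k. \<Sum>l. ennreal (b n) * ((if 1 \<le> k \<and> k \<le> I n then u k x else 0) * (if 1 \<le> l \<and> l \<le> J n then v l y else 0)))"
        unfolding fs by (simp only: ennreal_suminf_cmult ennreal_suminf_multc)
      also have "\<dots> = (\<Sum>k. \<Sum>l. (if 1 \<le> k \<and> 1 \<le> l then ennreal (if k \<le> I n \<and> l \<le> J n then b n else 0) else 0) * (u k x * v l y))"
        by (intro suminf_cong) auto
      finally show "ennreal (b n) * ((\<Sum>k=1..<Suc (I n). u k x) * (\<Sum>l=1..<Suc (J n). v l y))
        = (\<Sum>k. \<Sum>l. (if 1 \<le> k \<and> 1 \<le> l then ennreal (if k \<le> I n \<and> l \<le> J n then b n else 0) else 0) * (u k x * v l y))" .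
    qed
    also have "\<dots> = (\<Sum>k. \<Sum>n. \<Sum>l. (if 1 \<le> k \<and> 1 \<le> l then ennreal (if k \<le> I n \<and> l \<le> J n then b n else 0) else 0) * (u k x * v l y))"
      by (rule ennreal_suminf_commute)
    also have "\<dots> = (\<Sum>k. \<Sum>l. \<Sum>n. (if 1 \<le> k \<and> 1 \<le> l then ennreal (if k \<le> I n \<and> l \<le> J n then b n else 0) else 0) * (u k x * v l y))"
      by (intro suminf_cong ennreal_suminf_commute)
    also have "\<dots> = P z"
      unfolding P_def
    proof (intro suminf_cong)
      fix k l
      have "(\<Sum>n. (if 1 \<le> k \<and> 1 \<le> l then ennreal (if k \<le> I n \<and> l \<le> J n then b n else 0) else 0) * (u k x * v l y)) = ennreal (A k l) * (u k x * v l y)"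
        using bsum[of k l] by (cases "1 \<le> k \<and> 1 \<le> l") (auto simp: A_def)
      also have "\<dots> = ennreal (A k l * V k * V' l) * H k (fst z) * H' l (snd z)"
        using A0 nn unfolding z u_def v_def by (simp add: ennreal_mult mult_ac)
      finally show "(\<Sum>n. (if 1 \<le> k \<and> 1 \<le> l then ennreal (if k \<le> I n \<and> l \<le> J n then b n else 0) else 0) * (u k x * v l y))
        = ennreal (A k l * V k * V' l) * H k (fst z) * H' l (snd z)" .
    qed
    finally show ?thesis .
  qed
  have Pp: "(\<integral>\<^sup>+z. enn_powr (P z) p \<partial>(circ \<Otimes>\<^sub>M circ)) \<le> ennreal (C * C') * pdsum p a V V'"
  proof -
    have "(\<integral>\<^sup>+z. enn_powr (P z) p \<partial>(circ \<Otimes>\<^sub>M circ)) = (\<integral>\<^sup>+y. \<integral>\<^sup>+x. enn_powr (P (x, y)) p \<partial>circ \<partial>circ)"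
      by (rule circ2.nn_integral_snd[symmetric]) simp
    also have "\<dots> \<le> ennreal C * ennreal C' * (\<Sum>k. \<Sum>l. enn_powr (ennreal (A k l * V k * V' l)) p * ennreal (real k powr (p - 2) * real l powr (p - 2)))"
      unfolding P_def fst_conv snd_conv
      by (rule hardy_family_2d[OF p hf, of "\<lambda>k l. ennreal (A k l * V k * V' l)"]) (auto simp: A_def)
    also have "\<dots> \<le> ennreal (C * C') * pdsum p a V V'"
      unfolding pdsum_def ennreal_mult[OF nn(3,4)]
    proof (intro mult_left_mono ennreal_suminf_le)
      fix k l
      have "A k l * V k * V' l \<le> \<bar>a k l\<bar> * V k * V' l" using nn by (intro mult_right_mono) (auto simp: A_def)
      then have "(A k l * V k * V' l) powr p \<le> (\<bar>a k l\<bar> * V k * V' l) powr p" using A0 nn p by (intro powr_mono2) auto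
      then show "enn_powr (ennreal (A k l * V k * V' l)) p * ennreal (real k powr (p - 2) * real l powr (p - 2))
        \<le> ennreal ((\<bar>a k l\<bar> * V k * V' l) powr p * (real k powr (p - 2) * real l powr (p - 2)))"
        using A0 nn by (simp add: mult_right_mono flip: ennreal_mult)
    qed auto
    finally show ?thesis .
  qed
  also have "\<dots> < \<infinity>" using fin by (simp add: ennreal_mult_less_top)
  finally have Pfin: "(\<integral>\<^sup>+z. enn_powr (P z) p \<partial>(circ \<Otimes>\<^sub>M circ)) < \<infinity>" .
  have "P \<in> borel_measurable borel" by measurable
  from nn_integral_circ2_finite[OF p this Pfin]
  have P1: "(\<integral>\<^sup>+z. P z \<partial>(circ \<Otimes>\<^sub>M circ)) < \<infinity>" .
  have GP: "ennreal (norm (G z)) \<le> P z" for z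
  proof (cases "(\<Sum>n. ennreal (norm (t n z))) = top")
    case True then show ?thesis using bound[of z] by (simp add: top_unique)
  next
    case False
    then have s: "summable (\<lambda>n. norm (t n z))" by (intro summable_suminf_not_top) auto
    have "ennreal (norm (G z)) \<le> ennreal (\<Sum>n. norm (t n z))" unfolding G_def by (intro ennreal_leI summable_norm s)
    also have "\<dots> = (\<Sum>n. ennreal (norm (t n z)))" by (rule suminf_ennreal2[symmetric]) (auto simp: s)
    finally show ?thesis using bound[of z] by simp
  qed
  have tint: "integrable (circ \<Otimes>\<^sub>M circ) (t n)" for n
  proof (rule integrableI_bounded)
    have tP: "ennreal (norm (t n z)) \<le> P z" for z
    proof -
      have "(\<Sum>n\<in>{n}. ennreal (norm (t n z))) \<le> (\<Sum>n. ennreal (norm (t n z)))"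
        by (intro sum_le_suminf) auto
      then have "ennreal (norm (t n z)) \<le> (\<Sum>n. ennreal (norm (t n z)))" by simp
      then show ?thesis using bound by (rule order_trans)
    qed
    have "(\<integral>\<^sup>+z. ennreal (norm (t n z)) \<partial>(circ \<Otimes>\<^sub>M circ)) \<le> (\<integral>\<^sup>+z. P z \<partial>(circ \<Otimes>\<^sub>M circ))" by (rule nn_integral_mono) (rule tP)
    then show "(\<integral>\<^sup>+z. ennreal (norm (t n z)) \<partial>(circ \<Otimes>\<^sub>M circ)) < \<infinity>" using P1 by (rule order_le_less_trans)
    show "t n \<in> borel_measurable (circ \<Otimes>\<^sub>M circ)" unfolding measurable_circ2 by measurable
  qed
  have AEs: "AE z in (circ \<Otimes>\<^sub>M circ). summable (\<lambda>n. norm (t n z))"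
  proof -
    have "AE z in (circ \<Otimes>\<^sub>M circ). P z \<noteq> \<infinity>" using P1 by (intro nn_integral_noteq_infinite) auto
    then show ?thesis
    proof eventually_elim
      case (elim z)
      then have "(\<Sum>n. ennreal (norm (t n z))) \<noteq> top" using bound[of z] by (auto simp: top_unique)
      then show ?case by (intro summable_suminf_not_top) auto
    qed
  qed
  have sumn: "summable (\<lambda>n. LINT z|(circ \<Otimes>\<^sub>M circ). norm (t n z))"
  proof (rule summable_suminf_not_top)
    have "(\<Sum>n. ennreal (LINT z|(circ \<Otimes>\<^sub>M circ). norm (t n z))) = (\<Sum>n. \<integral>\<^sup>+z. ennreal (norm (t n z)) \<partial>(circ \<Otimes>\<^sub>M circ))"
      using tint by (intro suminf_cong nn_integral_eq_integral[symmetric]) auto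
    also have "\<dots> = (\<integral>\<^sup>+z. (\<Sum>n. ennreal (norm (t n z))) \<partial>(circ \<Otimes>\<^sub>M circ))" by (rule nn_integral_suminf[symmetric]) simp
    also have "\<dots> \<le> (\<integral>\<^sup>+z. P z \<partial>(circ \<Otimes>\<^sub>M circ))" by (intro nn_integral_mono bound)
    finally show "(\<Sum>n. ennreal (LINT z|(circ \<Otimes>\<^sub>M circ). norm (t n z))) \<noteq> top" using P1 by (auto simp: top_unique)
  qed auto
  have Gint: "integrable (circ \<Otimes>\<^sub>M circ) G" unfolding G_def by (rule integrable_suminf[OF tint AEs sumn])
  have Gm: "G \<in> borel_measurable borel" unfolding G_def by measurable
  have per: "G (x + 2 * pi, y) = G (x, y)" "G (x, y + 2 * pi) = G (x, y)" for x y
  proof -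
    have "cis (of_int k * (x + 2 * pi)) = cis (of_int k * x)" for k :: int and x
      using cis_multiple_2pi[of "of_int k"] by (simp add: distrib_left cis_mult[symmetric] mult_ac)
    then have "D i (x + 2 * pi) = D i x" "D' i (x + 2 * pi) = D' i x" for i x by (simp_all add: D_def D'_def)
    then show "G (x + 2 * pi, y) = G (x, y)" "G (x, y + 2 * pi) = G (x, y)" by (simp_all add: G_def t_def)
  qed
  have fc: "fc2 G k l = of_real ((2 * pi)\<^sup>2 * a (nat \<bar>k\<bar>) (nat \<bar>l\<bar>)) * (c k * c' l)" for k l
  proof -
    let ?e = "\<lambda>z. cis (- (of_int k * fst z + of_int l * snd z))"
    have "(\<lambda>n. LINT z|(circ \<Otimes>\<^sub>M circ). t n z * ?e z) sums (LINT z|(circ \<Otimes>\<^sub>M circ). (\<Sum>n. t n z * ?e z))"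
    proof (rule sums_integral)
      show "integrable (circ \<Otimes>\<^sub>M circ) (\<lambda>z. t n z * ?e z)" for n
        using integrable_circ2_mult_cis[OF tint, of n "- of_int k" "- of_int l"] by simp
      show "AE z in (circ \<Otimes>\<^sub>M circ). summable (\<lambda>n. norm (t n z * ?e z))"
        using AEs by (simp only: norm_mult norm_cis mult_1_right)
      show "summable (\<lambda>n. LINT z|(circ \<Otimes>\<^sub>M circ). norm (t n z * ?e z))"
        using sumn by (simp only: norm_mult norm_cis mult_1_right)
    qed
    moreover have "(LINT z|(circ \<Otimes>\<^sub>M circ). (\<Sum>n. t n z * ?e z)) = fc2 G k l"
      unfolding fc2_def G_def
    proof (rule integral_cong_AE)
      show "(\<lambda>z. \<Sum>n. t n z * ?e z) \<in> borel_measurable (circ \<Otimes>\<^sub>M circ)"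
        "(\<lambda>z. (\<Sum>n. t n z) * ?e z) \<in> borel_measurable (circ \<Otimes>\<^sub>M circ)"
        unfolding measurable_circ2 by measurable
      show "AE z in (circ \<Otimes>\<^sub>M circ). (\<Sum>n. t n z * ?e z) = (\<Sum>n. t n z) * ?e z"
        using AEs by eventually_elim (rule suminf_mult2[symmetric], rule summable_norm_cancel)
    qed
    moreover have "(LINT z|(circ \<Otimes>\<^sub>M circ). t n z * ?e z)
      = of_real (if nat \<bar>k\<bar> \<le> I n \<and> nat \<bar>l\<bar> \<le> J n then b n else 0) * (of_real ((2 * pi)\<^sup>2) * (c k * c' l))" for n
    proof -
      have "(LINT z|(circ \<Otimes>\<^sub>M circ). t n z * ?e z) = fc2 (t n) k l" by (simp add: fc2_def)
      also have "\<dots> = fc1 (\<lambda>x. of_real (b n) * D (I n) x) k * fc1 (D' (J n)) l"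
        using fc2_product[of "\<lambda>x. of_real (b n) * D (I n) x" "D' (J n)" k l] tint[of n] unfolding t_def by simp
      also have "fc1 (\<lambda>x. of_real (b n) * D (I n) x) k = of_real (b n) * fc1 (D (I n)) k"
        by (simp add: fc1_def mult.assoc)
      finally show ?thesis
        unfolding D_def D'_def fc1_trig_polynomial by (auto simp: nat_le_iff power2_eq_square)
    qed
    ultimately have S: "(\<lambda>n. of_real (if nat \<bar>k\<bar> \<le> I n \<and> nat \<bar>l\<bar> \<le> J n then b n else 0) * (of_real ((2 * pi)\<^sup>2) * (c k * c' l))) sums fc2 G k l"
      by simp
    \<comment> \<open>For \<open>k = 0\<close> or \<open>l = 0\<close> the sum of the differences
      says nothing about the value of \<open>a\<close> at index \<open>0\<close>; there the factors
      \<open>c 0 = 0\<close> and \<open>c' 0 = 0\<close> settle the claim.\<close>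
    show ?thesis
    proof (cases "k = 0 \<or> l = 0")
      case True
      then have z: "c k * c' l = 0" using c0 by auto
      have "fc2 G k l = 0" using S unfolding z by (simp add: sums_iff)
      then show ?thesis unfolding z by simp
    next
      case False
      then have kl: "1 \<le> nat \<bar>k\<bar>" "1 \<le> nat \<bar>l\<bar>" by auto
      let ?f = "\<lambda>n. if nat \<bar>k\<bar> \<le> I n \<and> nat \<bar>l\<bar> \<le> J n then b n else 0"
      have f0: "0 \<le> ?f n" for n using b0 by simp
      have "(\<Sum>n. ennreal (?f n)) \<noteq> top" unfolding bsum[OF kl] by simp
      then have sf: "summable ?f" by (rule summable_suminf_not_top[OF f0])
      have "ennreal (suminf ?f) = ennreal (a (nat \<bar>k\<bar>) (nat \<bar>l\<bar>))"
        using suminf_ennreal2[OF f0 sf] bsum[OF kl] by simp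
      then have "suminf ?f = a (nat \<bar>k\<bar>) (nat \<bar>l\<bar>)"
        by (rule ennreal_inj[THEN iffD1, rotated 2]) (rule suminf_nonneg[OF sf f0], rule doubly_monotone_sum(2)[OF a kl])
      then have "?f sums a (nat \<bar>k\<bar>) (nat \<bar>l\<bar>)" using sf by (simp add: sums_iff)
      then have T: "(\<lambda>n. complex_of_real (?f n) * (of_real ((2 * pi)\<^sup>2) * (c k * c' l))) sums (of_real (a (nat \<bar>k\<bar>) (nat \<bar>l\<bar>)) * (of_real ((2 * pi)\<^sup>2) * (c k * c' l)))"
        by (intro sums_mult2 sums_of_real)
      have "fc2 G k l = of_real (a (nat \<bar>k\<bar>) (nat \<bar>l\<bar>)) * (of_real ((2 * pi)\<^sup>2) * (c k * c' l))"
        by (rule sums_unique2, rule S, rule T)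
      then show ?thesis by (simp add: mult_ac)
    qed
  qed
  have le: "(\<integral>\<^sup>+z. enn_powr (ennreal (norm (G z))) p \<partial>(circ \<Otimes>\<^sub>M circ)) \<le> (\<integral>\<^sup>+z. enn_powr (P z) p \<partial>(circ \<Otimes>\<^sub>M circ))"
    using p by (intro nn_integral_mono enn_powr_mono[OF GP]) simp
  show ?thesis
    by (intro exI[of _ G] conjI allI Gint Gm per fc order_trans[OF le Pp])
qed

subsection \<open>Periodic functions on the torus\<close>

lemma circ2_density: "circ \<Otimes>\<^sub>M circ = density lborel (indicator torus)"
proof -
  have "circ \<Otimes>\<^sub>M circ = density (lborel \<Otimes>\<^sub>M lborel) (\<lambda>(x, y). indicator {0..2 * pi} x * indicator {0..2 * pi} y)"
    unfolding circ_def using circ.sigma_finite_measure_axioms[unfolded circ_def] lborel.sigma_finite_measure_axioms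
    by (intro pair_measure_density) auto
  also have "(\<lambda>(x, y). indicator {0..2 * pi} x * indicator {0..2 * pi} y) = (indicator torus :: _ \<Rightarrow> ennreal)"
    by (auto simp: torus_def indicator_def fun_eq_iff)
  finally show ?thesis by (simp only: lborel_prod)
qed

lemma torus_borel [measurable]: "torus \<in> sets borel"
  unfolding torus_def by (intro borel_closed closed_Times) auto

lemma nn_integral_torus:
  "f \<in> borel_measurable borel \<Longrightarrow> (\<integral>\<^sup>+z\<in>torus. f z \<partial>lebesgue) = (\<integral>\<^sup>+z. f z \<partial>(circ \<Otimes>\<^sub>M circ))"
  unfolding circ2_density by (subst nn_integral_density) (auto simp: nn_integral_completion mult.commute)

lemma integral_torus:
  fixes f g :: "real \<times> real \<Rightarrow> complex"
  assumes [measurable]: "g \<in> borel_measurable borel" and eq: "AE z in lborel. f z = g z" and f: "f \<in> borel_measurable lebesgue"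
  shows "(LINT z:torus|lebesgue. f z) = (LINT z|(circ \<Otimes>\<^sub>M circ). g z)"
proof -
  have gl: "g \<in> borel_measurable lebesgue" by (rule measurable_completion) simp
  have tl: "torus \<in> sets lebesgue" by simp
  have "(LINT z:torus|lebesgue. f z) = (LINT z:torus|lebesgue. g z)"
    unfolding set_lebesgue_integral_def
    by (intro integral_cong_AE borel_measurable_scaleR borel_measurable_indicator f gl tl)
      (use AE_completion[OF eq] in \<open>auto elim!: eventually_mono\<close>)
  also have "\<dots> = (LINT z|lborel. indicator torus z *\<^sub>R g z)"
    unfolding set_lebesgue_integral_def by (rule integral_completion) measurable
  also have "\<dots> = (LINT z|density lborel (\<lambda>z. ennreal (indicator torus z)). g z)"
    by (subst integral_density) auto
  finally show ?thesis unfolding circ2_density by (simp add: ennreal_indicator)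
qed

lemma AE_lborel_translate:
  fixes v :: "'a::euclidean_space"
  assumes "AE z in lborel. P z"
  shows "AE z in lborel. P (z + v)"
proof -
  have "AE z in distr lborel borel ((+) v). P z" by (subst lborel_distr_plus) (rule assms)
  from AE_distrD[OF _ this] have "AE z in lborel. P (v + z)" by simp
  then show ?thesis by (simp add: add.commute)
qed

lemma lebesgue_borel_version:
  fixes f :: "'a::euclidean_space \<Rightarrow> complex"
  assumes f: "f \<in> borel_measurable lebesgue"
  shows "\<exists>f'\<in>borel_measurable borel. AE z in lborel. f z = f' z"
proof -
  have "(\<lambda>z. Re (f z)) \<in> borel_measurable lebesgue" "(\<lambda>z. Im (f z)) \<in> borel_measurable lebesgue"
    using f by (auto simp: borel_measurable_complex_iff)
  then obtain u v where uv: "u \<in> borel_measurable lborel" "v \<in> borel_measurable lborel"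
    "AE z in lborel. Re (f z) = u z" "AE z in lborel. Im (f z) = v z"
    using completion_ex_borel_measurable_real by metis
  have ae: "AE z in lborel. f z = complex_of_real (u z) + \<i> * complex_of_real (v z)"
    using uv(3,4) by eventually_elim (simp add: complex_eq_iff)
  note [measurable] = uv(1,2)[unfolded measurable_lborel1]
  have m: "(\<lambda>z. complex_of_real (u z) + \<i> * complex_of_real (v z)) \<in> borel_measurable borel"
    by measurable
  show ?thesis by (rule bexI[where x = "\<lambda>z. complex_of_real (u z) + \<i> * complex_of_real (v z)"]) (rule ae, rule m)
qed

definition wrap :: "real \<Rightarrow> real" where "wrap x = x - 2 * pi * of_int \<lfloor>x / (2 * pi)\<rfloor>"

lemma wrap_measurable [measurable]: "wrap \<in> borel_measurable borel"
  unfolding wrap_def by measurable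

lemma wrap_periodic: "wrap (x + 2 * pi) = wrap x"
proof -
  have "(x + 2 * pi) / (2 * pi) = x / (2 * pi) + 1" by (simp add: add_divide_distrib)
  then show ?thesis by (simp add: wrap_def algebra_simps)
qed

lemma wrap_id: "0 \<le> x \<Longrightarrow> x < 2 * pi \<Longrightarrow> wrap x = x"
  by (simp add: wrap_def floor_eq_iff)

definition periodic2 :: "(real \<times> real \<Rightarrow> 'a) \<Rightarrow> bool" where
  "periodic2 f \<longleftrightarrow> (\<forall>x y. f (x + 2 * pi, y) = f (x, y) \<and> f (x, y + 2 * pi) = f (x, y))"

lemma periodic_int:
  fixes u :: "real \<Rightarrow> 'a"
  assumes "\<And>x. u (x + 2 * pi) = u x"
  shows "u (x - 2 * pi * of_int n) = u x"
proof (induction n rule: int_induct[where k = 0])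
  case (step1 i) then show ?case using assms[of "x - 2 * pi * of_int (i + 1)"] by (simp add: algebra_simps)
next
  case (step2 i) then show ?case using assms[of "x - 2 * pi * of_int i"] by (simp add: algebra_simps)
qed simp

lemma periodic2_int:
  assumes "periodic2 f"
  shows "f (x - 2 * pi * of_int i, y - 2 * pi * of_int j) = f (x, y)"
proof -
  have "f (x - 2 * pi * of_int i, y') = f (x, y')" for y'
    using assms by (intro periodic_int[where u = "\<lambda>x. f (x, y')"]) (auto simp: periodic2_def)
  moreover have "f (x, y - 2 * pi * of_int j) = f (x, y)"
    using assms by (intro periodic_int[where u = "\<lambda>y. f (x, y)"]) (auto simp: periodic2_def)
  ultimately show ?thesis by simp
qed

text \<open>A Borel version need not be periodic. Composition with \<open>wrap\<close> makes it so,
  and almost everywhere equality survives because only countably many translates of one null set are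
  involved.\<close>

lemma periodic_borel_version:
  fixes f :: "real \<times> real \<Rightarrow> complex"
  assumes f: "f \<in> borel_measurable lebesgue" and per: "periodic2 f"
  shows "\<exists>f'\<in>borel_measurable borel. periodic2 f' \<and> (AE z in lborel. f z = f' z)"
proof -
  obtain f0 where [measurable]: "f0 \<in> borel_measurable borel" and f0: "AE z in lborel. f z = f0 z"
    using lebesgue_borel_version[OF f] by blast
  define f' where "f' z = f0 (wrap (fst z), wrap (snd z))" for z
  have m: "(\<lambda>z::real \<times> real. (wrap (fst z), wrap (snd z))) \<in> borel \<rightarrow>\<^sub>M (borel \<Otimes>\<^sub>M borel)" by measurable
  have "f' \<in> borel_measurable borel"
    unfolding f'_def using measurable_compose[OF m, of f0] by (simp add: borel_prod)
  moreover have "periodic2 f'" by (simp add: periodic2_def f'_def wrap_periodic)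
  moreover have "AE z in lborel. f z = f' z"
  proof -
    have "AE z in lborel. f (z + (- 2 * pi * of_int i, - 2 * pi * of_int j)) = f0 (z + (- 2 * pi * of_int i, - 2 * pi * of_int j))" for i j :: int
      by (rule AE_lborel_translate[OF f0])
    then have "AE z in lborel. \<forall>i j :: int. f (z + (- 2 * pi * of_int i, - 2 * pi * of_int j)) = f0 (z + (- 2 * pi * of_int i, - 2 * pi * of_int j))"
      by (simp add: AE_all_countable)
    then show ?thesis
    proof eventually_elim
      case (elim z)
      define i j where "i = \<lfloor>fst z / (2 * pi)\<rfloor>" "j = \<lfloor>snd z / (2 * pi)\<rfloor>"
      have "f' z = f0 (z + (- 2 * pi * of_int i, - 2 * pi * of_int j))" by (cases z) (simp add: f'_def wrap_def i_j_def)
      also have "\<dots> = f (z + (- 2 * pi * of_int i, - 2 * pi * of_int j))" using elim by simp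
      also have "\<dots> = f z" using periodic2_int[OF per, of "fst z" i "snd z" j] by (cases z) simp
      finally show ?case by simp
    qed
  qed
  ultimately show ?thesis by blast
qed

lemma nn_integral_circ2_shift:
  fixes f :: "real \<times> real \<Rightarrow> ennreal"
  assumes [measurable]: "f \<in> borel_measurable borel" and per: "periodic2 f"
  shows "(\<integral>\<^sup>+z. f (z + v) \<partial>(circ \<Otimes>\<^sub>M circ)) = (\<integral>\<^sup>+z. f z \<partial>(circ \<Otimes>\<^sub>M circ))"
proof -
  have f': "f \<in> borel_measurable (borel \<Otimes>\<^sub>M borel)" by (simp add: borel_prod)
  have slice: "(\<lambda>y. f (x, y)) \<in> borel_measurable borel" for x
    using measurable_compose[OF measurable_Pair1' f', of x] by simp
  define g where "g x = (\<integral>\<^sup>+y. f (x, y) \<partial>circ)" for x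
  have gm: "g \<in> borel_measurable borel"
    unfolding g_def using circ.borel_measurable_nn_integral_fst[of f circ] by simp
  have gper: "g (x + 2 * pi) = g x" for x using per by (simp add: g_def periodic2_def)
  have tm: "(\<lambda>z. f (z + v)) \<in> borel_measurable borel" by measurable
  have "(\<integral>\<^sup>+z. f (z + v) \<partial>(circ \<Otimes>\<^sub>M circ)) = (\<integral>\<^sup>+x. \<integral>\<^sup>+y. f ((x, y) + v) \<partial>circ \<partial>circ)"
    by (rule circ.nn_integral_fst[symmetric]) (simp add: tm)
  also have "\<dots> = (\<integral>\<^sup>+x. g (x + fst v) \<partial>circ)"
  proof (rule nn_integral_cong)
    fix x
    have "(\<integral>\<^sup>+y. f ((x, y) + v) \<partial>circ) = (\<integral>\<^sup>+y. f (x + fst v, y + snd v) \<partial>circ)" by (cases v) simp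
    also have "\<dots> = g (x + fst v)" unfolding g_def
      by (rule nn_integral_circ_shift[where f = "\<lambda>y. f (x + fst v, y)", OF slice]) (use per in \<open>simp add: periodic2_def\<close>)
    finally show "(\<integral>\<^sup>+y. f ((x, y) + v) \<partial>circ) = g (x + fst v)" .
  qed
  also have "\<dots> = (\<integral>\<^sup>+x. g x \<partial>circ)" by (rule nn_integral_circ_shift[OF gm gper])
  also have "\<dots> = (\<integral>\<^sup>+z. f z \<partial>(circ \<Otimes>\<^sub>M circ))" unfolding g_def by (rule circ.nn_integral_fst) simp
  finally show ?thesis .
qed

text \<open>Translation followed by reduction modulo \<open>2 * pi\<close> preserves the measure of
  the torus. This is checked on indicators with the nonnegative version, and image measures then
  transfer both integrals and integrability of complex functions.\<close>

lemma integral_circ2_shift: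
  fixes F :: "real \<times> real \<Rightarrow> complex"
  assumes F[measurable]: "F \<in> borel_measurable borel" and per: "periodic2 F"
  shows "(LINT z|(circ \<Otimes>\<^sub>M circ). F (z + v)) = (LINT z|(circ \<Otimes>\<^sub>M circ). F z)"
    "integrable (circ \<Otimes>\<^sub>M circ) F \<Longrightarrow> integrable (circ \<Otimes>\<^sub>M circ) (\<lambda>z. F (z + v))"
proof -
  define T where "T z = (wrap (fst (z + v)), wrap (snd (z + v)))" for z
  have Tm: "T \<in> borel \<rightarrow>\<^sub>M borel"
  proof -
    have "(\<lambda>z::real \<times> real. (wrap (fst (z + v)), wrap (snd (z + v)))) \<in> borel \<rightarrow>\<^sub>M (borel \<Otimes>\<^sub>M borel)" by measurable
    then show ?thesis unfolding T_def by (simp add: borel_prod)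
  qed
  then have Tm2: "T \<in> (circ \<Otimes>\<^sub>M circ) \<rightarrow>\<^sub>M borel" by simp
  have Wm: "(\<lambda>z::real \<times> real. (wrap (fst z), wrap (snd z))) \<in> borel \<rightarrow>\<^sub>M borel"
  proof -
    have "(\<lambda>z::real \<times> real. (wrap (fst z), wrap (snd z))) \<in> borel \<rightarrow>\<^sub>M (borel \<Otimes>\<^sub>M borel)" by measurable
    then show ?thesis by (simp add: borel_prod)
  qed
  have FT: "F (T z) = F (z + v)" for z
    using periodic2_int[OF per, of "fst (z + v)" "\<lfloor>fst (z + v) / (2 * pi)\<rfloor>" "snd (z + v)" "\<lfloor>snd (z + v) / (2 * pi)\<rfloor>"]
    by (cases z; cases v) (simp add: T_def wrap_def)
  have D: "distr (circ \<Otimes>\<^sub>M circ) borel T = circ \<Otimes>\<^sub>M circ"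
  proof (rule measure_eqI)
    show "sets (distr (circ \<Otimes>\<^sub>M circ) borel T) = sets (circ \<Otimes>\<^sub>M circ)" unfolding sets_circ2 by simp
    fix A assume "A \<in> sets (distr (circ \<Otimes>\<^sub>M circ) borel T)"
    then have A[measurable]: "A \<in> sets borel" by simp
    define f where "f z = (indicator A (wrap (fst z), wrap (snd z)) :: ennreal)" for z
    have fm: "f \<in> borel_measurable borel"
      unfolding f_def by (rule measurable_compose[OF Wm]) measurable
    have fp: "periodic2 f" by (simp add: periodic2_def f_def wrap_periodic)
    have "emeasure (distr (circ \<Otimes>\<^sub>M circ) borel T) A = (\<integral>\<^sup>+z. indicator A z \<partial>distr (circ \<Otimes>\<^sub>M circ) borel T)"
      by (subst nn_integral_indicator) simp_all
    also have "\<dots> = (\<integral>\<^sup>+z. f (z + v) \<partial>(circ \<Otimes>\<^sub>M circ))"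
      by (subst nn_integral_distr[OF Tm2]) (simp_all add: f_def T_def)
    also have "\<dots> = (\<integral>\<^sup>+z. f z \<partial>(circ \<Otimes>\<^sub>M circ))" by (rule nn_integral_circ2_shift[OF fm fp])
    also have "\<dots> = (\<integral>\<^sup>+z. indicator A z \<partial>(circ \<Otimes>\<^sub>M circ))"
    proof (rule nn_integral_cong_AE)
      have c: "AE x in circ. 0 \<le> x \<and> x < 2 * pi"
      proof -
        have "AE x in circ. x \<noteq> 2 * pi" by (intro AE_circ AE_lborel_singleton)
        moreover have "AE x in circ. 0 \<le> x \<and> x \<le> 2 * pi"
          unfolding circ_def by (subst AE_density) (auto simp: indicator_def)
        ultimately show ?thesis by eventually_elim auto
      qed
      have "{z \<in> space (circ \<Otimes>\<^sub>M circ). 0 \<le> fst z \<and> fst z < 2 * pi \<and> 0 \<le> snd z \<and> snd z < 2 * pi} \<in> sets (circ \<Otimes>\<^sub>M circ)"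
      proof -
        have "{z :: real \<times> real. 0 \<le> fst z \<and> fst z < 2 * pi \<and> 0 \<le> snd z \<and> snd z < 2 * pi} \<in> sets borel" by measurable
        then show ?thesis unfolding sets_circ2 by (simp add: space_pair_measure)
      qed
      moreover have "AE x in circ. AE y in circ. 0 \<le> fst (x, y) \<and> fst (x, y) < 2 * pi \<and> 0 \<le> snd (x, y) \<and> snd (x, y) < 2 * pi"
        using c
      proof eventually_elim
        case (elim x)
        then show ?case using c by (auto elim!: eventually_mono)
      qed
      ultimately have "AE z in (circ \<Otimes>\<^sub>M circ). 0 \<le> fst z \<and> fst z < 2 * pi \<and> 0 \<le> snd z \<and> snd z < 2 * pi"
        by (rule circ2.AE_pair_measure)
      then show "AE z in (circ \<Otimes>\<^sub>M circ). f z = indicator A z"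
        by eventually_elim (auto simp: f_def wrap_id)
    qed
    also have "\<dots> = emeasure (circ \<Otimes>\<^sub>M circ) A" by (subst nn_integral_indicator) (unfold sets_circ2, simp_all)
    finally show "emeasure (distr (circ \<Otimes>\<^sub>M circ) borel T) A = emeasure (circ \<Otimes>\<^sub>M circ) A" .
  qed
  have "(LINT z|(circ \<Otimes>\<^sub>M circ). F z) = (LINT z|distr (circ \<Otimes>\<^sub>M circ) borel T. F z)" by (simp only: D)
  also have "\<dots> = (LINT z|(circ \<Otimes>\<^sub>M circ). F (T z))" by (rule integral_distr[OF Tm2 F])
  finally show "(LINT z|(circ \<Otimes>\<^sub>M circ). F (z + v)) = (LINT z|(circ \<Otimes>\<^sub>M circ). F z)" by (simp add: FT)
  assume "integrable (circ \<Otimes>\<^sub>M circ) F"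
  then have "integrable (distr (circ \<Otimes>\<^sub>M circ) borel T) F" by (simp only: D)
  then have "integrable (circ \<Otimes>\<^sub>M circ) (\<lambda>z. F (T z))" by (subst (asm) integrable_distr_eq[OF Tm2 F])
  then show "integrable (circ \<Otimes>\<^sub>M circ) (\<lambda>z. F (z + v))" by (simp add: FT)
qed

text \<open>The \<open>p\<close>-th power of the norm; the root is kept outside so that estimates
  stay additive.\<close>

definition Lnorm :: "real \<Rightarrow> (real \<times> real \<Rightarrow> complex) \<Rightarrow> ennreal" where
  "Lnorm p f = (\<integral>\<^sup>+z. enn_powr (ennreal (norm (f z))) p \<partial>(circ \<Otimes>\<^sub>M circ))"

definition Lpb :: "real \<Rightarrow> (real \<times> real \<Rightarrow> complex) set" where
  "Lpb p = {f. f \<in> borel_measurable borel \<and> periodic2 f \<and> Lnorm p f < \<infinity>}"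

lemma Lpb_integrable:
  assumes "1 < p" "f \<in> Lpb p"
  shows "integrable (circ \<Otimes>\<^sub>M circ) f"
proof (rule integrableI_bounded)
  have [measurable]: "f \<in> borel_measurable borel" using assms by (simp add: Lpb_def)
  show "f \<in> borel_measurable (circ \<Otimes>\<^sub>M circ)" unfolding measurable_circ2 by measurable
  have "(\<lambda>z. ennreal (norm (f z))) \<in> borel_measurable borel" by measurable
  from nn_integral_circ2_finite[OF assms(1) this] show "(\<integral>\<^sup>+z. ennreal (norm (f z)) \<partial>(circ \<Otimes>\<^sub>M circ)) < \<infinity>"
    using assms(2) by (simp add: Lpb_def Lnorm_def)
qed

lemma Lp_norm_eq:
  assumes [measurable]: "f' \<in> borel_measurable borel" and eq: "AE z in lborel. f z = f' z"
  shows "Lp_norm p f = enn_powr (Lnorm p f') (1 / p)"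
proof -
  have "(\<integral>\<^sup>+z\<in>torus. ennreal (norm (f z) powr p) \<partial>lebesgue) = (\<integral>\<^sup>+z\<in>torus. ennreal (norm (f' z) powr p) \<partial>lebesgue)"
    using AE_completion[OF eq] by (intro nn_integral_cong_AE) (auto elim!: eventually_mono)
  also have "\<dots> = Lnorm p f'" unfolding Lnorm_def by (subst nn_integral_torus) simp_all
  finally show ?thesis by (simp add: Lp_norm_def)
qed

lemma Lp_space_borel_version:
  assumes p: "0 < p" and f: "f \<in> Lp_space p"
  shows "\<exists>f'\<in>Lpb p. AE z in lborel. f z = f' z"
proof -
  have "periodic2 f" "f \<in> borel_measurable lebesgue" using f by (auto simp: Lp_space_def periodic2_def)
  then obtain f' where f': "f' \<in> borel_measurable borel" "periodic2 f'" "AE z in lborel. f z = f' z"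
    using periodic_borel_version by blast
  have "Lnorm p f' < \<infinity>"
    using f Lp_norm_eq[OF f'(1,3), of p] by (auto simp: Lp_space_def less_top[symmetric])
  with f' show ?thesis by (auto simp: Lpb_def)
qed

lemma Lpb_Lp_space:
  assumes "f \<in> Lpb p"
  shows "f \<in> Lp_space p"
proof -
  have m: "f \<in> borel_measurable borel" using assms by (simp add: Lpb_def)
  have "Lp_norm p f = enn_powr (Lnorm p f) (1 / p)" by (rule Lp_norm_eq[OF m]) simp
  then show ?thesis using assms m
    by (auto simp: Lpb_def Lp_space_def periodic2_def less_top[symmetric] intro: measurable_completion)
qed

subsection \<open>Fractional differences\<close>

definition gdiff :: "(nat \<Rightarrow> real) \<Rightarrow> (nat \<Rightarrow> real \<times> real) \<Rightarrow> (real \<times> real \<Rightarrow> complex) \<Rightarrow> real \<times> real \<Rightarrow> complex" where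
  "gdiff c v f z = (\<Sum>k. c k *\<^sub>R f (z + v k))"

lemma frac_diff_x_gdiff: "frac_diff_x \<alpha> h f = gdiff (bcoef \<alpha>) (\<lambda>k. ((\<alpha> - real k) * h, 0)) f"
  by (simp add: frac_diff_x_def gdiff_def bcoef_def fun_eq_iff)

lemma frac_diff_y_gdiff: "frac_diff_y \<alpha> h f = gdiff (bcoef \<alpha>) (\<lambda>k. (0, (\<alpha> - real k) * h)) f"
  by (simp add: frac_diff_y_def gdiff_def bcoef_def fun_eq_iff)

lemma gdiff_AE_cong:
  assumes "AE z in lborel. f z = g z"
  shows "AE z in lborel. gdiff c v f z = gdiff c v g z"
proof -
  have "AE z in lborel. \<forall>k. f (z + v k) = g (z + v k)"
    using AE_lborel_translate[OF assms] by (simp add: AE_all_countable)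
  then show ?thesis by eventually_elim (simp add: gdiff_def)
qed

text \<open>Absolute summability of \<open>c\<close> gives, by Jensen and translation invariance, a
  bound in \<open>L\<^sub>p\<close> uniform in the shifts. The majorant \<open>Q\<close> is
  integrable for the same reason and justifies computing coefficients termwise, where each translate
  contributes a character.\<close>

lemma gdiff_Lpb:
  assumes p: "1 < p" and c: "summable (\<lambda>k. \<bar>c k\<bar>)" and f: "f \<in> Lpb p"
  shows "gdiff c v f \<in> Lpb p"
    and "fc2 (gdiff c v f) k l = (\<Sum>j. c j *\<^sub>R cis (of_int k * fst (v j) + of_int l * snd (v j))) * fc2 f k l"
proof -
  have fm[measurable]: "f \<in> borel_measurable borel" and per: "periodic2 f" and fin: "Lnorm p f < \<infinity>"
    using f by (auto simp: Lpb_def)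
  have fi: "integrable (circ \<Otimes>\<^sub>M circ) f" by (rule Lpb_integrable[OF p f])
  have tm[measurable]: "(\<lambda>z. f (z + v j)) \<in> borel_measurable borel" for j by measurable
  have gm: "gdiff c v f \<in> borel_measurable borel" unfolding gdiff_def[abs_def] by measurable
  have sh: "(x + 2 * pi, y) + w = (x + fst w + 2 * pi, y + snd w)" "(x, y + 2 * pi) + w = (x + fst w, y + snd w + 2 * pi)"
    "(x, y) + w = (x + fst w, y + snd w)" for x y and w :: "real \<times> real" by (cases w; simp)+
  have "f (x + 2 * pi + a, y) = f (x + a, y)" "f (x, y + 2 * pi + a) = f (x, y + a)" for x y a
    using per[unfolded periodic2_def, rule_format, of "x + a" y] per[unfolded periodic2_def, rule_format, of x "y + a"]
    by (simp_all add: add_ac)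
  then have gper: "periodic2 (gdiff c v f)" by (simp add: periodic2_def gdiff_def sh(3))
  have pern: "periodic2 (\<lambda>z. enn_powr (ennreal (norm (f z))) p)" "periodic2 (\<lambda>z. ennreal (norm (f z)))"
    using per by (simp_all add: periodic2_def)
  define S where "S = (\<Sum>j. \<bar>c j\<bar>)"
  have S: "(\<Sum>j. ennreal \<bar>c j\<bar>) = ennreal S" "0 \<le> S"
    unfolding S_def using c by (auto intro!: suminf_ennreal2 suminf_nonneg)
  define Q where "Q z = (\<Sum>j. ennreal \<bar>c j\<bar> * ennreal (norm (f (z + v j))))" for z
  have Qnorm: "ennreal (norm (gdiff c v f z)) \<le> Q z" for z
  proof (cases "Q z = top")
    case False
    then have s: "summable (\<lambda>j. norm (c j *\<^sub>R f (z + v j)))"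
      by (intro summable_suminf_not_top) (auto simp: Q_def ennreal_mult)
    have "ennreal (norm (gdiff c v f z)) \<le> ennreal (\<Sum>j. norm (c j *\<^sub>R f (z + v j)))"
      unfolding gdiff_def by (intro ennreal_leI summable_norm s)
    also have "\<dots> = Q z" unfolding Q_def
      by (subst suminf_ennreal2[symmetric, OF _ s]) (auto simp: ennreal_mult)
    finally show ?thesis .
  qed simp
  have "Lnorm p (gdiff c v f) \<le> (\<integral>\<^sup>+z. enn_powr (ennreal S) (p - 1) * (\<Sum>j. ennreal \<bar>c j\<bar> * enn_powr (ennreal (norm (f (z + v j)))) p) \<partial>(circ \<Otimes>\<^sub>M circ))"
    unfolding Lnorm_def
  proof (rule nn_integral_mono)
    fix z
    have "enn_powr (ennreal (norm (gdiff c v f z))) p \<le> enn_powr (Q z) p" using p by (intro enn_powr_mono Qnorm) simp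
    also have "\<dots> \<le> enn_powr (ennreal S) (p - 1) * (\<Sum>j. ennreal \<bar>c j\<bar> * enn_powr (ennreal (norm (f (z + v j)))) p)"
      unfolding Q_def S(1)[symmetric] by (rule enn_jensen_suminf[OF p])
    finally show "enn_powr (ennreal (norm (gdiff c v f z))) p \<le> enn_powr (ennreal S) (p - 1) * (\<Sum>j. ennreal \<bar>c j\<bar> * enn_powr (ennreal (norm (f (z + v j)))) p)" .
  qed
  also have "\<dots> = enn_powr (ennreal S) (p - 1) * (\<Sum>j. ennreal \<bar>c j\<bar> * (\<integral>\<^sup>+z. enn_powr (ennreal (norm (f (z + v j)))) p \<partial>(circ \<Otimes>\<^sub>M circ)))"
    by (simp add: nn_integral_cmult nn_integral_suminf)
  also have "\<dots> = enn_powr (ennreal S) (p - 1) * (ennreal S * Lnorm p f)"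
  proof -
    have "(\<integral>\<^sup>+z. enn_powr (ennreal (norm (f (z + v j)))) p \<partial>(circ \<Otimes>\<^sub>M circ)) = Lnorm p f" for j
      unfolding Lnorm_def by (rule nn_integral_circ2_shift[OF _ pern(1)]) measurable
    then show ?thesis by (simp add: S)
  qed
  also have "\<dots> < \<infinity>" using fin S by (simp add: ennreal_mult_less_top)
  finally show "gdiff c v f \<in> Lpb p" using gm gper by (simp add: Lpb_def)
  have Nf: "(\<integral>\<^sup>+z. ennreal (norm (f z)) \<partial>(circ \<Otimes>\<^sub>M circ)) < \<infinity>" using fi by (simp add: integrable_iff_bounded)
  have shn: "(\<integral>\<^sup>+z. ennreal (norm (f (z + v j))) \<partial>(circ \<Otimes>\<^sub>M circ)) = (\<integral>\<^sup>+z. ennreal (norm (f z)) \<partial>(circ \<Otimes>\<^sub>M circ))" for j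
    by (rule nn_integral_circ2_shift[OF _ pern(2)]) measurable
  have QI: "(\<integral>\<^sup>+z. Q z \<partial>(circ \<Otimes>\<^sub>M circ)) < \<infinity>"
  proof -
    have "(\<integral>\<^sup>+z. Q z \<partial>(circ \<Otimes>\<^sub>M circ)) = ennreal S * (\<integral>\<^sup>+z. ennreal (norm (f z)) \<partial>(circ \<Otimes>\<^sub>M circ))"
      unfolding Q_def by (simp add: nn_integral_suminf nn_integral_cmult shn S)
    then show ?thesis using Nf by (simp add: ennreal_mult_less_top)
  qed
  have Qm: "Q \<in> borel_measurable borel" unfolding Q_def by measurable
  let ?e = "\<lambda>z. cis (- (of_int k * fst z + of_int l * snd z))"
  let ?t = "\<lambda>j z. (c j *\<^sub>R f (z + v j)) * ?e z"
  have "AE z in (circ \<Otimes>\<^sub>M circ). Q z \<noteq> \<infinity>" using QI Qm by (intro nn_integral_noteq_infinite) (unfold measurable_circ2, auto)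
  then have AEs: "AE z in (circ \<Otimes>\<^sub>M circ). summable (\<lambda>j. norm (c j *\<^sub>R f (z + v j)))"
  proof eventually_elim
    case (elim z)
    then show ?case by (intro summable_suminf_not_top) (auto simp: Q_def ennreal_mult)
  qed
  have fsi: "integrable (circ \<Otimes>\<^sub>M circ) (\<lambda>z. f (z + v j))" for j
    by (rule integral_circ2_shift(2)[OF fm per fi])
  have ti: "integrable (circ \<Otimes>\<^sub>M circ) (?t j)" for j
    using integrable_circ2_mult_cis[OF integrable_scaleR_right[OF fsi[of j]], of "c j" "- of_int k" "- of_int l"] by simp
  have nt: "norm (?t j z) = \<bar>c j\<bar> * norm (f (z + v j))" for j z by (simp add: norm_mult)
  have A: "(\<lambda>j. LINT z|(circ \<Otimes>\<^sub>M circ). ?t j z) sums (LINT z|(circ \<Otimes>\<^sub>M circ). (\<Sum>j. ?t j z))"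
  proof (rule sums_integral[OF ti])
    show "AE z in (circ \<Otimes>\<^sub>M circ). summable (\<lambda>j. norm (?t j z))" using AEs unfolding nt norm_scaleR .
    have "(LINT z|(circ \<Otimes>\<^sub>M circ). norm (?t j z)) = \<bar>c j\<bar> * (LINT z|(circ \<Otimes>\<^sub>M circ). norm (f z))" for j
    proof -
      have "ennreal (LINT z|(circ \<Otimes>\<^sub>M circ). norm (f (z + v j))) = ennreal (LINT z|(circ \<Otimes>\<^sub>M circ). norm (f z))"
        using shn[of j] nn_integral_eq_integral[OF integrable_norm[OF fsi[of j]]] nn_integral_eq_integral[OF integrable_norm[OF fi]] by simp
      then show ?thesis unfolding nt by (simp add: ennreal_inj integral_nonneg_AE)
    qed
    then show "summable (\<lambda>j. LINT z|(circ \<Otimes>\<^sub>M circ). norm (?t j z))" by (simp only:) (intro summable_mult2 c)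
  qed
  have B: "(LINT z|(circ \<Otimes>\<^sub>M circ). (\<Sum>j. ?t j z)) = fc2 (gdiff c v f) k l"
    unfolding fc2_def
  proof (rule integral_cong_AE)
    show "(\<lambda>z. \<Sum>j. ?t j z) \<in> borel_measurable (circ \<Otimes>\<^sub>M circ)" "(\<lambda>z. gdiff c v f z * ?e z) \<in> borel_measurable (circ \<Otimes>\<^sub>M circ)"
      unfolding measurable_circ2 gdiff_def by measurable
    show "AE z in (circ \<Otimes>\<^sub>M circ). (\<Sum>j. ?t j z) = gdiff c v f z * ?e z"
      using AEs unfolding gdiff_def by eventually_elim (rule suminf_mult2[symmetric], rule summable_norm_cancel)
  qed
  \<comment> \<open>The translation is moved from \<open>f\<close> to the exponential, which
    produces the character, and the remaining integrand is a translate of the periodic function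
    \<open>F\<close>.\<close>
  have C: "(LINT z|(circ \<Otimes>\<^sub>M circ). ?t j z) = (c j *\<^sub>R cis (of_int k * fst (v j) + of_int l * snd (v j))) * fc2 f k l" for j
  proof -
    define F where "F z = f z * ?e z" for z
    have e: "?e z = cis (of_int k * fst (v j) + of_int l * snd (v j)) * ?e (z + v j)" for z
      by (simp add: cis_mult algebra_simps)
    have "?t j z = (c j *\<^sub>R cis (of_int k * fst (v j) + of_int l * snd (v j))) * F (z + v j)" for z
      by (subst e) (simp add: F_def)
    then have "(LINT z|(circ \<Otimes>\<^sub>M circ). ?t j z) = (c j *\<^sub>R cis (of_int k * fst (v j) + of_int l * snd (v j))) * (LINT z|(circ \<Otimes>\<^sub>M circ). F (z + v j))"
      by (simp only:) (rule integral_mult_right_zero)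
    also have "(LINT z|(circ \<Otimes>\<^sub>M circ). F (z + v j)) = (LINT z|(circ \<Otimes>\<^sub>M circ). F z)"
    proof (rule integral_circ2_shift(1))
      show "F \<in> borel_measurable borel" unfolding F_def by measurable
      have c1: "cis (- (of_int n * (x + 2 * pi))) = cis (- (of_int n * x))" for n :: int and x
      proof -
        have "cis (- (of_int n * (x + 2 * pi))) = cis (- (of_int n * x)) * cis (2 * pi * of_int (- n))"
          unfolding cis_mult by (rule arg_cong[where f = cis]) (simp add: algebra_simps)
        also have "cis (2 * pi * of_int (- n)) = 1" by (rule cis_multiple_2pi) simp
        finally show ?thesis by simp
      qed
      have sp: "?e (x, y) = cis (- (of_int k * x)) * cis (- (of_int l * y))" for x y
        unfolding cis_mult by (rule arg_cong[where f = cis]) simp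
      have "?e (x + 2 * pi, y) = ?e (x, y)" "?e (x, y + 2 * pi) = ?e (x, y)" for x y
        unfolding sp c1 by (rule refl)+
      then show "periodic2 F" using per by (simp add: periodic2_def F_def)
    qed
    finally show ?thesis by (simp add: F_def fc2_def)
  qed
  have 1: "(\<lambda>j. (c j *\<^sub>R cis (of_int k * fst (v j) + of_int l * snd (v j))) * fc2 f k l) sums fc2 (gdiff c v f) k l"
    using A unfolding B C .
  have "summable (\<lambda>j. c j *\<^sub>R cis (of_int k * fst (v j) + of_int l * snd (v j)))"
    using c by (intro summable_norm_cancel[OF summable_comparison_test'[OF c]]) simp
  from sums_mult2[OF summable_sums[OF this], of "fc2 f k l"]
  show "fc2 (gdiff c v f) k l = (\<Sum>j. c j *\<^sub>R cis (of_int k * fst (v j) + of_int l * snd (v j))) * fc2 f k l"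
    by (rule sums_unique2[OF 1])
qed

subsection \<open>The mixed modulus of smoothness and the coefficients\<close>

definition mdiff :: "real \<Rightarrow> real \<Rightarrow> real \<Rightarrow> real \<Rightarrow> (real \<times> real \<Rightarrow> complex) \<Rightarrow> real \<times> real \<Rightarrow> complex" where
  "mdiff \<beta>1 \<beta>2 h1 h2 f = frac_diff_x \<beta>1 h1 (frac_diff_y \<beta>2 h2 f)"

text \<open>The translation by \<open>(\<beta>1 h1, \<beta>2 h2)\<close> does not change the norm, so it is dropped here.\<close>

definition udiff :: "real \<Rightarrow> real \<Rightarrow> real \<Rightarrow> real \<Rightarrow> (real \<times> real \<Rightarrow> complex) \<Rightarrow> real \<times> real \<Rightarrow> complex" where
  "udiff \<beta>1 \<beta>2 h1 h2 f = gdiff (bcoef \<beta>1) (\<lambda>j. (- (real j * h1), 0)) (gdiff (bcoef \<beta>2) (\<lambda>j. (0, - (real j * h2))) f)"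

lemma mdiff_udiff: "mdiff \<beta>1 \<beta>2 h1 h2 f z = udiff \<beta>1 \<beta>2 h1 h2 f (z + (\<beta>1 * h1, \<beta>2 * h2))"
proof (cases z)
  case (Pair x y)
  have "x + (\<beta>1 - real j) * h1 = x + \<beta>1 * h1 + - (real j * h1)" "y + (\<beta>2 - real j) * h2 = y + \<beta>2 * h2 + - (real j * h2)" for j
    by (simp_all add: algebra_simps)
  then show ?thesis
    unfolding Pair by (simp add: mdiff_def udiff_def frac_diff_x_gdiff frac_diff_y_gdiff gdiff_def add_diff_eq)
qed

context
  fixes p \<beta>1 \<beta>2 :: real
  assumes p: "1 < p" and \<beta>: "0 < \<beta>1" "0 < \<beta>2"
begin

lemma mdiff_Lpb:
  assumes f: "f \<in> Lpb p"
  shows "mdiff \<beta>1 \<beta>2 h1 h2 f \<in> Lpb p"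
    and "fc2 (mdiff \<beta>1 \<beta>2 h1 h2 f) k l = dmult \<beta>1 h1 k * dmult \<beta>2 h2 l * fc2 f k l"
proof -
  have d: "(\<Sum>j. bcoef \<beta> j *\<^sub>R cis (of_int k * ((\<beta> - real j) * h))) = dmult \<beta> h k" if "0 < \<beta>" for \<beta> h k
  proof -
    have "cis (of_int k * ((\<beta> - real j) * h)) = cis (of_int k * (\<beta> * h)) * cis (- (real j * (of_int k * h)))" for j
      unfolding cis_mult by (rule arg_cong[where f = cis]) (simp add: algebra_simps)
    then have "(\<Sum>j. bcoef \<beta> j *\<^sub>R cis (of_int k * ((\<beta> - real j) * h))) = (\<Sum>j. cis (of_int k * (\<beta> * h)) * (bcoef \<beta> j *\<^sub>R cis (- (real j * (of_int k * h)))))"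
      by simp
    also have "\<dots> = dmult \<beta> h k" unfolding dmult_def mu_def by (rule suminf_mult[OF summable_mu[OF that]])
    finally show ?thesis .
  qed
  have 1: "frac_diff_y \<beta>2 h2 f \<in> Lpb p" "fc2 (frac_diff_y \<beta>2 h2 f) k l = dmult \<beta>2 h2 l * fc2 f k l" for k l
    unfolding frac_diff_y_gdiff using gdiff_Lpb[OF p summable_bcoef[OF \<beta>(2)] f, of "\<lambda>j. (0, (\<beta>2 - real j) * h2)"]
    by (simp_all add: d \<beta>)
  show "mdiff \<beta>1 \<beta>2 h1 h2 f \<in> Lpb p" "fc2 (mdiff \<beta>1 \<beta>2 h1 h2 f) k l = dmult \<beta>1 h1 k * dmult \<beta>2 h2 l * fc2 f k l"
    unfolding mdiff_def frac_diff_x_gdiff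
    using gdiff_Lpb[OF p summable_bcoef[OF \<beta>(1)] 1(1), of "\<lambda>j. ((\<beta>1 - real j) * h1, 0)"]
    by (simp_all add: d \<beta> 1(2))
qed

lemma udiff_Lpb:
  assumes f: "f \<in> Lpb p"
  shows "udiff \<beta>1 \<beta>2 h1 h2 f \<in> Lpb p"
    and "fc2 (udiff \<beta>1 \<beta>2 h1 h2 f) k l = mu \<beta>1 (of_int k * h1) * mu \<beta>2 (of_int l * h2) * fc2 f k l"
proof -
  have d: "(\<Sum>j. bcoef \<beta> j *\<^sub>R cis (- (of_int k * (real j * h)))) = mu \<beta> (of_int k * h)" for \<beta> h k
    unfolding mu_def by (simp add: mult_ac)
  have 1: "gdiff (bcoef \<beta>2) (\<lambda>j. (0, - (real j * h2))) f \<in> Lpb p"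
    "fc2 (gdiff (bcoef \<beta>2) (\<lambda>j. (0, - (real j * h2))) f) k l = mu \<beta>2 (of_int l * h2) * fc2 f k l" for k l
    using gdiff_Lpb[OF p summable_bcoef[OF \<beta>(2)] f, of "\<lambda>j. (0, - (real j * h2))"] by (simp_all add: d)
  show "udiff \<beta>1 \<beta>2 h1 h2 f \<in> Lpb p"
    "fc2 (udiff \<beta>1 \<beta>2 h1 h2 f) k l = mu \<beta>1 (of_int k * h1) * mu \<beta>2 (of_int l * h2) * fc2 f k l"
    unfolding udiff_def
    using gdiff_Lpb[OF p summable_bcoef[OF \<beta>(1)] 1(1), of "\<lambda>j. (- (real j * h1), 0)"] by (simp_all add: d 1(2))
qed

lemma Lnorm_mdiff_udiff:
  assumes f: "f \<in> Lpb p"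
  shows "Lnorm p (mdiff \<beta>1 \<beta>2 h1 h2 f) = Lnorm p (udiff \<beta>1 \<beta>2 h1 h2 f)"
proof -
  have [measurable]: "udiff \<beta>1 \<beta>2 h1 h2 f \<in> borel_measurable borel" and per: "periodic2 (udiff \<beta>1 \<beta>2 h1 h2 f)"
    using udiff_Lpb(1)[OF f] by (auto simp: Lpb_def)
  show ?thesis unfolding Lnorm_def mdiff_udiff
    by (rule nn_integral_circ2_shift[of "\<lambda>z. enn_powr (ennreal (norm (udiff \<beta>1 \<beta>2 h1 h2 f z))) p"]) (use per in \<open>simp_all add: periodic2_def\<close>)
qed

lemma mixed_modulus_eq:
  assumes f': "f' \<in> Lpb p" and eq: "AE z in lborel. f z = f' z"
  shows "mixed_modulus p \<beta>1 \<beta>2 f \<delta>1 \<delta>2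
    = (SUP h1\<in>{h. \<bar>h\<bar> \<le> \<delta>1}. SUP h2\<in>{h. \<bar>h\<bar> \<le> \<delta>2}. enn_powr (Lnorm p (mdiff \<beta>1 \<beta>2 h1 h2 f')) (1 / p))"
proof -
  have "AE z in lborel. mdiff \<beta>1 \<beta>2 h1 h2 f z = mdiff \<beta>1 \<beta>2 h1 h2 f' z" for h1 h2
    unfolding mdiff_def frac_diff_x_gdiff frac_diff_y_gdiff by (intro gdiff_AE_cong eq)
  moreover have "mdiff \<beta>1 \<beta>2 h1 h2 f' \<in> borel_measurable borel" for h1 h2
    using mdiff_Lpb(1)[OF f'] by (auto simp: Lpb_def)
  ultimately have "Lp_norm p (mdiff \<beta>1 \<beta>2 h1 h2 f) = enn_powr (Lnorm p (mdiff \<beta>1 \<beta>2 h1 h2 f')) (1 / p)" for h1 h2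
    by (intro Lp_norm_eq) auto
  then show ?thesis unfolding mixed_modulus_def mdiff_def by simp
qed

end

section \<open>Comparison of the modulus of smoothness with the coefficient sum\<close>

lemma pdsum_scale:
  assumes p: "1 < p" and K: "0 \<le> K" "0 \<le> L" and V: "\<And>k. 0 \<le> V k" "\<And>k. 0 \<le> W k"
  shows "pdsum p a (\<lambda>k. K * V k) (\<lambda>k. L * W k) = ennreal ((K * L) powr p) * pdsum p a V W"
proof -
  have "ennreal ((\<bar>a k l\<bar> * (K * V k) * (L * W l)) powr p * (real k powr (p - 2) * real l powr (p - 2)))
    = ennreal ((K * L) powr p) * ennreal ((\<bar>a k l\<bar> * V k * W l) powr p * (real k powr (p - 2) * real l powr (p - 2)))" for k l
  proof -
    have "(\<bar>a k l\<bar> * (K * V k) * (L * W l)) powr p = ((K * L) * (\<bar>a k l\<bar> * V k * W l)) powr p" by (simp add: mult_ac)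
    also have "\<dots> = (K * L) powr p * (\<bar>a k l\<bar> * V k * W l) powr p" by (rule powr_mult)
    finally show ?thesis by (simp add: mult.assoc flip: ennreal_mult)
  qed
  then show ?thesis unfolding pdsum_def by (simp only: ennreal_suminf_cmult)
qed

text \<open>The exponential form of the coefficients of a Weyl derivative of the cosine series with
  coefficients \<open>a\<close>. For \<open>r1 = r2 = 0\<close> it describes the function itself,
  the factors \<open>ipow 0\<close> removing the frequencies on the axes.\<close>

definition weyl_coefficients :: "(nat \<Rightarrow> nat \<Rightarrow> real) \<Rightarrow> real \<Rightarrow> real \<Rightarrow> (real \<times> real \<Rightarrow> complex) \<Rightarrow> bool" where
  "weyl_coefficients a r1 r2 g \<longleftrightarrow> (\<forall>k l. fc2 g k l = of_real (pi\<^sup>2 * a (nat \<bar>k\<bar>) (nat \<bar>l\<bar>)) * (ipow r1 k * ipow r2 l))"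

lemma fc2_AE_unique:
  assumes "integrable (circ \<Otimes>\<^sub>M circ) f" "integrable (circ \<Otimes>\<^sub>M circ) g" "\<And>k l. fc2 f k l = fc2 g k l"
  shows "AE z in (circ \<Otimes>\<^sub>M circ). f z = g z"
proof -
  have "fc2 (\<lambda>z. f z - g z) k l = 0" for k l
    using integrable_circ2_mult_cis[OF assms(1), of "- of_int k" "- of_int l"]
      integrable_circ2_mult_cis[OF assms(2), of "- of_int k" "- of_int l"] assms(3)[of k l]
    unfolding fc2_def by (simp add: left_diff_distrib)
  then have "AE z in (circ \<Otimes>\<^sub>M circ). f z - g z = 0"
    by (intro fc2_unique Bochner_Integration.integrable_diff assms)
  then show ?thesis by eventually_elim simp
qed

lemma fc2_cmult: "fc2 (\<lambda>z. c * G z) k l = c * fc2 G k l"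
  unfolding fc2_def by (simp only: mult.assoc integral_mult_right_zero)

lemma Lnorm_divide4:
  assumes "G \<in> borel_measurable borel" "0 < p"
  shows "Lnorm p (\<lambda>z. of_real (1 / 4) * G z) \<le> Lnorm p G"
  unfolding Lnorm_def using assms by (intro nn_integral_mono enn_powr_mono ennreal_leI) (auto simp: norm_mult)

text \<open>A function with the coefficients of the difference is built by \<open>synthesis\<close>
  and identified with the difference by uniqueness. The factor \<open>1 / 4\<close> is the quotient
  of the normalisations \<open>pi\<^sup>2\<close> and \<open>(2 * pi)\<^sup>2\<close>. Synthesis
  presupposes a finite coefficient sum; otherwise the bound is trivial.\<close>

lemma modulus_upper:
  assumes p: "1 < p" and \<beta>: "0 < \<beta>1" "0 < \<beta>2" and r: "0 \<le> r1" "0 \<le> r2"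
  shows "\<exists>K>0. \<forall>a g \<delta>1 \<delta>2 h1 h2. doubly_monotone a \<longrightarrow> g \<in> Lpb p \<longrightarrow> weyl_coefficients a r1 r2 g \<longrightarrow>
    \<bar>h1\<bar> \<le> \<delta>1 \<longrightarrow> \<bar>h2\<bar> \<le> \<delta>2 \<longrightarrow>
    Lnorm p (mdiff \<beta>1 \<beta>2 h1 h2 g) \<le> ennreal K * pdsum p a (Vw r1 \<beta>1 \<delta>1) (Vw r2 \<beta>2 \<delta>2)"
proof -
  define C where "C \<beta> = (20 + 8 * bsum \<beta>) powr p * hardy_const p" for \<beta>
  define E where "E r \<beta> = 4 * 2 powr (r + \<beta>)" for r \<beta> :: real
  have C: "0 < C \<beta>" if "0 < \<beta>" for \<beta> unfolding C_def using bsum_ge_1[OF that] hardy_const_pos[OF p] by simp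
  have E: "0 < E r \<beta>" for r \<beta> by (simp add: E_def)
  define K where "K = C \<beta>1 * C \<beta>2 * (E r1 \<beta>1 * E r2 \<beta>2) powr p"
  have K: "0 < K" unfolding K_def using C[OF \<beta>(1)] C[OF \<beta>(2)] E[of r1 \<beta>1] E[of r2 \<beta>2] by simp
  have main: "Lnorm p (mdiff \<beta>1 \<beta>2 h1 h2 g) \<le> ennreal K * pdsum p a (Vw r1 \<beta>1 \<delta>1) (Vw r2 \<beta>2 \<delta>2)"
    if a: "doubly_monotone a" and g: "g \<in> Lpb p" and wc: "weyl_coefficients a r1 r2 g" and h: "\<bar>h1\<bar> \<le> \<delta>1" "\<bar>h2\<bar> \<le> \<delta>2" for a g \<delta>1 \<delta>2 h1 h2
  proof (cases "pdsum p a (Vw r1 \<beta>1 \<delta>1) (Vw r2 \<beta>2 \<delta>2) = top")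
    case True
    then show ?thesis using K by (simp add: ennreal_mult_top)
  next
    case False
    let ?c1 = "\<lambda>k. ipow r1 k * dmult \<beta>1 h1 k" and ?c2 = "\<lambda>k. ipow r2 k * dmult \<beta>2 h2 k"
    let ?V1 = "\<lambda>k. E r1 \<beta>1 * Vw r1 \<beta>1 \<delta>1 k" and ?V2 = "\<lambda>k. E r2 \<beta>2 * Vw r2 \<beta>2 \<delta>2 k"
    have sc: "pdsum p a ?V1 ?V2 = ennreal ((E r1 \<beta>1 * E r2 \<beta>2) powr p) * pdsum p a (Vw r1 \<beta>1 \<delta>1) (Vw r2 \<beta>2 \<delta>2)"
      using E by (intro pdsum_scale p Vw_nonneg) (auto intro: less_imp_le)
    have fin: "pdsum p a ?V1 ?V2 < \<infinity>" unfolding sc using False by (simp add: ennreal_mult_less_top less_top)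
    have hf: "hardy_family p (C \<beta>) (\<lambda>k x. \<Sum>\<nu>. ennreal (dsh \<beta> \<nu>) * ennreal (wker k (x + (\<beta> - real \<nu>) * h)))" if "0 < \<beta>" for \<beta> h
      unfolding C_def using hardy_family_shifts[OF p dsh_nonneg dsh_sums[OF that]] .
    have V0: "0 \<le> ?V1 k" "0 \<le> ?V2 k" for k by (rule mult_nonneg_nonneg[OF less_imp_le[OF E] Vw_nonneg])+
    have z: "?c1 0 = 0" "?c2 0 = 0" by simp_all
    have C0: "0 \<le> C \<beta>1" "0 \<le> C \<beta>2" using C \<beta> by (auto intro: less_imp_le)
    obtain G where G: "integrable (circ \<Otimes>\<^sub>M circ) G" "G \<in> borel_measurable borel"
      "Lnorm p G \<le> ennreal (C \<beta>1 * C \<beta>2) * pdsum p a ?V1 ?V2"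
      "\<And>k l. fc2 G k l = of_real ((2 * pi)\<^sup>2 * a (nat \<bar>k\<bar>) (nat \<bar>l\<bar>)) * (?c1 k * ?c2 l)"
      using synthesis[OF p a dominated_dmult[OF \<beta>(1) r(1) h(1), folded E_def] dominated_dmult[OF \<beta>(2) r(2) h(2), folded E_def]
        hf[OF \<beta>(1)] hf[OF \<beta>(2)] V0 C0 z fin] unfolding Lnorm_def by blast
    have "AE z in (circ \<Otimes>\<^sub>M circ). mdiff \<beta>1 \<beta>2 h1 h2 g z = of_real (1 / 4) * G z"
    proof (rule fc2_AE_unique)
      show "integrable (circ \<Otimes>\<^sub>M circ) (mdiff \<beta>1 \<beta>2 h1 h2 g)" by (rule Lpb_integrable[OF p mdiff_Lpb(1)[OF p \<beta> g]])
      show "integrable (circ \<Otimes>\<^sub>M circ) (\<lambda>z. of_real (1 / 4) * G z)" using G(1) by (rule integrable_mult_right)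
      fix k l
      show "fc2 (mdiff \<beta>1 \<beta>2 h1 h2 g) k l = fc2 (\<lambda>z. of_real (1 / 4) * G z) k l"
        unfolding fc2_cmult G(4) mdiff_Lpb(2)[OF p \<beta> g] using wc
        by (simp add: weyl_coefficients_def power2_eq_square mult_ac)
    qed
    then have "Lnorm p (mdiff \<beta>1 \<beta>2 h1 h2 g) = Lnorm p (\<lambda>z. of_real (1 / 4) * G z)"
      unfolding Lnorm_def by (intro nn_integral_cong_AE) (erule eventually_mono, simp only:)
    also have "\<dots> \<le> Lnorm p G" using G(2) p by (intro Lnorm_divide4) auto
    also note G(3)
    also have "ennreal (C \<beta>1 * C \<beta>2) * pdsum p a ?V1 ?V2 = ennreal K * pdsum p a (Vw r1 \<beta>1 \<delta>1) (Vw r2 \<beta>2 \<delta>2)"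
      unfolding sc K_def using C0 by (simp add: ennreal_mult mult.assoc)
    finally show ?thesis .
  qed
  show ?thesis using K main by blast
qed

lemma havg_jensen:
  assumes p: "1 < p" and f: "f \<in> borel_measurable borel"
  shows "enn_powr (\<integral>\<^sup>+s. f s \<partial>havg) p \<le> (\<integral>\<^sup>+s. enn_powr (f s) p \<partial>havg)"
proof -
  have "enn_powr (\<integral>\<^sup>+s. 1 * f s \<partial>havg) p \<le> enn_powr (\<integral>\<^sup>+s. 1 \<partial>havg) (p - 1) * (\<integral>\<^sup>+s. 1 * enn_powr (f s) p \<partial>havg)"
    by (rule enn_jensen[OF _ _ p]) (use f in auto)
  then show ?thesis using enn_powr_ennreal[of 1 "p - 1"] by (simp add: emeasure_havg)
qed

text \<open>The real parts are at least \<open>3 / 4\<close> and the imaginary parts at most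
  \<open>1 / 4\<close> of \<open>\<rho>\<close> and \<open>\<sigma>\<close>. Products of averaged
  multipliers thus point in one half-plane, which excludes cancellation within a block.\<close>

lemma norm_product_near_real:
  fixes z w :: complex and \<rho> \<sigma> :: real
  assumes "norm (z - of_real \<rho>) \<le> \<rho> / 4" "norm (w - of_real \<sigma>) \<le> \<sigma> / 4"
  shows "7 / 16 * (\<rho> * \<sigma>) \<le> Re (z * w)"
proof -
  have "\<bar>Re z - \<rho>\<bar> \<le> \<rho> / 4" "\<bar>Im z\<bar> \<le> \<rho> / 4" "\<bar>Re w - \<sigma>\<bar> \<le> \<sigma> / 4" "\<bar>Im w\<bar> \<le> \<sigma> / 4"
    using assms abs_Re_le_cmod[of "z - of_real \<rho>"] abs_Im_le_cmod[of "z - of_real \<rho>"]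
      abs_Re_le_cmod[of "w - of_real \<sigma>"] abs_Im_le_cmod[of "w - of_real \<sigma>"] by auto
  then have b: "3 / 4 * \<rho> \<le> Re z" "3 / 4 * \<sigma> \<le> Re w" "0 \<le> \<rho>" "0 \<le> \<sigma>" "\<bar>Im z\<bar> \<le> \<rho> / 4" "\<bar>Im w\<bar> \<le> \<sigma> / 4" by linarith+
  have "(3 / 4 * \<rho>) * (3 / 4 * \<sigma>) \<le> Re z * Re w" using b by (intro mult_mono) auto
  moreover have "\<bar>Im z\<bar> * \<bar>Im w\<bar> \<le> (\<rho> / 4) * (\<sigma> / 4)" using b by (intro mult_mono) auto
  then have "Im z * Im w \<le> (\<rho> / 4) * (\<sigma> / 4)" by (metis abs_mult abs_ge_self order_trans)
  ultimately have "9 / 16 * (\<rho> * \<sigma>) - 1 / 16 * (\<rho> * \<sigma>) \<le> Re (z * w)" by simp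
  moreover have "0 \<le> \<rho> * \<sigma>" using b by simp
  ultimately show ?thesis by linarith
qed

text \<open>Averaging a block sum of the coefficients of the difference over both steps turns its
  multipliers into \<open>muavg\<close>; on a block these are nearly aligned, so the average has
  modulus at least the number of terms times the smallest one, with \<open>a k l\<close> bounded
  below by \<open>a m n\<close>. Jensen moves the power \<open>p\<close> inside the average, and for
  each fixed pair of steps \<open>block_fourier_lower\<close> bounds all blocks at once.\<close>

lemma modulus_lower:
  assumes p: "1 < p" and \<beta>: "0 < \<beta>1" "0 < \<beta>2" and r: "0 \<le> r1" "0 \<le> r2"
  shows "\<exists>K>0. \<forall>a g \<delta>1 \<delta>2 X. doubly_monotone a \<longrightarrow> g \<in> Lpb p \<longrightarrow> weyl_coefficients a r1 r2 g \<longrightarrow>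
    0 < \<delta>1 \<longrightarrow> 0 < \<delta>2 \<longrightarrow> (\<forall>h1 h2. \<bar>h1\<bar> \<le> \<delta>1 \<longrightarrow> \<bar>h2\<bar> \<le> \<delta>2 \<longrightarrow> Lnorm p (mdiff \<beta>1 \<beta>2 h1 h2 g) \<le> X) \<longrightarrow>
    pdsum p a (Vw r1 \<beta>1 \<delta>1) (Vw r2 \<beta>2 \<delta>2) \<le> ennreal K * X"
proof -
  obtain \<kappa>1 c1 where k1: "0 < \<kappa>1" "\<kappa>1 \<le> 1" "0 < c1" and B1: "\<And>\<delta> m. 0 < \<delta> \<Longrightarrow> 1 \<le> m \<Longrightarrow> \<exists>\<eta>\<in>{\<delta>, \<kappa>1 * \<delta>}. \<exists>\<epsilon>. norm \<epsilon> = 1 \<and>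
    (\<forall>k. m \<le> 2 * k \<longrightarrow> k \<le> m \<longrightarrow> (\<exists>\<rho>\<ge>c1 * min 1 (real m * \<delta>) powr \<beta>1. norm (\<epsilon> * muavg \<beta>1 (real k * \<eta>) - of_real \<rho>) \<le> \<rho> / 4))"
    using muavg_block[OF \<beta>(1)] by metis
  obtain \<kappa>2 c2 where k2: "0 < \<kappa>2" "\<kappa>2 \<le> 1" "0 < c2" and B2: "\<And>\<delta> m. 0 < \<delta> \<Longrightarrow> 1 \<le> m \<Longrightarrow> \<exists>\<eta>\<in>{\<delta>, \<kappa>2 * \<delta>}. \<exists>\<epsilon>. norm \<epsilon> = 1 \<and>
    (\<forall>k. m \<le> 2 * k \<longrightarrow> k \<le> m \<longrightarrow> (\<exists>\<rho>\<ge>c2 * min 1 (real m * \<delta>) powr \<beta>2. norm (\<epsilon> * muavg \<beta>2 (real k * \<eta>) - of_real \<rho>) \<le> \<rho> / 4))"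
    using muavg_block[OF \<beta>(2)] by metis
  obtain K0 where K0: "0 < K0" and KG: "\<forall>G. integrable (circ \<Otimes>\<^sub>M circ) G \<longrightarrow>
    (\<Sum>m. \<Sum>n. ennreal (real m powr (-2) * real n powr (-2)) *
       enn_powr (ennreal (norm (\<Sum>k\<in>block m. \<Sum>l\<in>block n. fc2 G (int k) (int l)))) p) \<le> ennreal K0 * Lnorm p G"
    using block_fourier_lower[OF p, folded Lnorm_def] by (elim exE conjE)
  \<comment> \<open>Collected losses: \<open>7 / 16\<close> from the alignment,
    \<open>c1 * c2\<close> from the averaged multipliers, \<open>4\<close> from block sizes of at
    least half of \<open>m\<close> and of \<open>n\<close>, and \<open>2 powr r\<close> in each
    variable from \<open>m \<le> 2 * k\<close>.\<close>
  define c where "c = pi\<^sup>2 * (7 / 16) * (c1 * c2) / (4 * 2 powr r1 * 2 powr r2)"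
  have c: "0 < c" unfolding c_def using k1 k2 by simp
  define K where "K = 4 * K0 / c powr p"
  have K: "0 < K" using K0 c by (simp add: K_def)
  have main: "pdsum p a (Vw r1 \<beta>1 \<delta>1) (Vw r2 \<beta>2 \<delta>2) \<le> ennreal K * X"
    if a: "doubly_monotone a" and g: "g \<in> Lpb p" and wc: "weyl_coefficients a r1 r2 g" and \<delta>: "0 < \<delta>1" "0 < \<delta>2"
      and X: "\<And>h1 h2. \<bar>h1\<bar> \<le> \<delta>1 \<Longrightarrow> \<bar>h2\<bar> \<le> \<delta>2 \<Longrightarrow> Lnorm p (mdiff \<beta>1 \<beta>2 h1 h2 g) \<le> X" for a g \<delta>1 \<delta>2 X
  proof -
    \<comment> \<open>The untranslated difference is essential here: the phases
      \<open>cis (k * \<beta> * h)\<close> of the translation vary with \<open>k\<close> and would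
      destroy the common direction on a block.\<close>
    define q where "q m n h1 h2 = (\<Sum>k\<in>block m. \<Sum>l\<in>block n. mu \<beta>1 (real k * h1) * mu \<beta>2 (real l * h2) * fc2 g (int k) (int l))" for m n h1 h2
    have qU: "q m n h1 h2 = (\<Sum>k\<in>block m. \<Sum>l\<in>block n. fc2 (udiff \<beta>1 \<beta>2 h1 h2 g) (int k) (int l))" for m n h1 h2
      unfolding q_def udiff_Lpb(2)[OF p \<beta> g] by simp
    define N where "N m n \<eta>1 \<eta>2 = (\<integral>\<^sup>+s1. \<integral>\<^sup>+s2. enn_powr (ennreal (norm (q m n (\<eta>1 * s1) (\<eta>2 * s2)))) p \<partial>havg \<partial>havg)" for m n \<eta>1 \<eta>2
    have muc: "continuous_on UNIV (mu \<beta>1)" "continuous_on UNIV (mu \<beta>2)" by (rule continuous_on_mu \<beta>)+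
    then have mum[measurable]: "mu \<beta>1 \<in> borel_measurable borel" "mu \<beta>2 \<in> borel_measurable borel"
      by (auto intro: borel_measurable_continuous_onI)
    have qm[measurable]: "(\<lambda>(s1, s2). q m n (\<eta>1 * s1) (\<eta>2 * s2)) \<in> borel_measurable (borel \<Otimes>\<^sub>M borel)" for m n \<eta>1 \<eta>2
      unfolding q_def by measurable
    have qm2[measurable]: "(\<lambda>s2. q m n h (\<eta>2 * s2)) \<in> borel_measurable borel" for m n h \<eta>2
      unfolding q_def by measurable
    have step: "\<exists>\<eta>1\<in>{\<delta>1, \<kappa>1 * \<delta>1}. \<exists>\<eta>2\<in>{\<delta>2, \<kappa>2 * \<delta>2}.
      ennreal (c * (a m n * Vw r1 \<beta>1 \<delta>1 m * Vw r2 \<beta>2 \<delta>2 n) * (real m * real n)) \<le> (\<integral>\<^sup>+s1. \<integral>\<^sup>+s2. ennreal (norm (q m n (\<eta>1 * s1) (\<eta>2 * s2))) \<partial>havg \<partial>havg)"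
      if mn: "1 \<le> m" "1 \<le> n" for m n
    proof -
      obtain \<eta>1 \<epsilon>1 where e1: "\<eta>1 \<in> {\<delta>1, \<kappa>1 * \<delta>1}" "norm \<epsilon>1 = 1"
        "\<And>k. k \<in> block m \<Longrightarrow> \<exists>\<rho>\<ge>c1 * min 1 (real m * \<delta>1) powr \<beta>1. norm (\<epsilon>1 * muavg \<beta>1 (real k * \<eta>1) - of_real \<rho>) \<le> \<rho> / 4"
        using B1[OF \<delta>(1) mn(1)] unfolding block_iff by metis
      obtain \<eta>2 \<epsilon>2 where e2: "\<eta>2 \<in> {\<delta>2, \<kappa>2 * \<delta>2}" "norm \<epsilon>2 = 1"
        "\<And>k. k \<in> block n \<Longrightarrow> \<exists>\<rho>\<ge>c2 * min 1 (real n * \<delta>2) powr \<beta>2. norm (\<epsilon>2 * muavg \<beta>2 (real k * \<eta>2) - of_real \<rho>) \<le> \<rho> / 4"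
        using B2[OF \<delta>(2) mn(2)] unfolding block_iff by metis
      define I where "I = (\<Sum>k\<in>block m. \<Sum>l\<in>block n. muavg \<beta>1 (real k * \<eta>1) * muavg \<beta>2 (real l * \<eta>2) * fc2 g (int k) (int l))"
      have int1: "integrable havg (\<lambda>s. mu \<beta>1 (real k * (\<eta>1 * s)))" "integrable havg (\<lambda>s. mu \<beta>2 (real k * (\<eta>2 * s)))" for k
        using integrable_mu_havg[OF \<beta>(1), of "real k * \<eta>1"] integrable_mu_havg[OF \<beta>(2), of "real k * \<eta>2"] by (simp_all only: mult.assoc)
      have ma: "muavg \<beta>1 (real k * \<eta>1) = (LINT s|havg. mu \<beta>1 (real k * (\<eta>1 * s)))" "muavg \<beta>2 (real k * \<eta>2) = (LINT s|havg. mu \<beta>2 (real k * (\<eta>2 * s)))" for k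
        unfolding muavg_def by (simp_all only: mult.assoc)
      have inn: "integrable havg (\<lambda>s2. q m n h (\<eta>2 * s2))" for h
        unfolding q_def by (intro Bochner_Integration.integrable_sum integrable_mult_left integrable_mult_right int1)
      have inner: "(LINT s2|havg. q m n h (\<eta>2 * s2)) = (\<Sum>k\<in>block m. \<Sum>l\<in>block n. mu \<beta>1 (real k * h) * muavg \<beta>2 (real l * \<eta>2) * fc2 g (int k) (int l))" for h
        unfolding q_def ma
        by (subst Bochner_Integration.integral_sum, intro Bochner_Integration.integrable_sum integrable_mult_left integrable_mult_right int1,
            subst Bochner_Integration.integral_sum, intro integrable_mult_left integrable_mult_right int1, simp)
      have outn: "integrable havg (\<lambda>s1. LINT s2|havg. q m n (\<eta>1 * s1) (\<eta>2 * s2))"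
        unfolding inner by (intro Bochner_Integration.integrable_sum integrable_mult_left int1)
      have outer: "(LINT s1|havg. LINT s2|havg. q m n (\<eta>1 * s1) (\<eta>2 * s2)) = I"
        unfolding inner I_def ma(1)
        by (subst Bochner_Integration.integral_sum, intro Bochner_Integration.integrable_sum integrable_mult_left int1,
            subst Bochner_Integration.integral_sum, intro integrable_mult_left int1, simp)
      have "ennreal (norm I) \<le> (\<integral>\<^sup>+s1. ennreal (norm (LINT s2|havg. q m n (\<eta>1 * s1) (\<eta>2 * s2))) \<partial>havg)"
        unfolding outer[symmetric] by (rule integral_norm_bound_ennreal[OF outn])
      also have "\<dots> \<le> (\<integral>\<^sup>+s1. \<integral>\<^sup>+s2. ennreal (norm (q m n (\<eta>1 * s1) (\<eta>2 * s2))) \<partial>havg \<partial>havg)"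
        by (intro nn_integral_mono integral_norm_bound_ennreal inn)
      finally have up: "ennreal (norm I) \<le> (\<integral>\<^sup>+s1. \<integral>\<^sup>+s2. ennreal (norm (q m n (\<eta>1 * s1) (\<eta>2 * s2))) \<partial>havg \<partial>havg)" .
      \<comment> \<open>A rotation common to the whole block: it undoes the phases of
        \<open>ipow\<close> and supplies the unimodular factors that turn the averaged multipliers
        towards the positive axis.\<close>
      define \<zeta> where "\<zeta> = (\<epsilon>1 * \<epsilon>2) * (cis (- (pi * r1 / 2)) * cis (- (pi * r2 / 2)))"
      define b where "b = pi\<^sup>2 * a m n * (real m powr r1 / 2 powr r1 * (real n powr r2 / 2 powr r2)) * (7 / 16 * ((c1 * min 1 (real m * \<delta>1) powr \<beta>1) * (c2 * min 1 (real n * \<delta>2) powr \<beta>2)))"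
      have amn: "0 \<le> a m n" by (rule doubly_monotone_sum(2)[OF a mn])
      have b0: "0 \<le> b" unfolding b_def using amn k1 k2 by (intro mult_nonneg_nonneg) auto
      have low: "b \<le> Re (\<zeta> * (muavg \<beta>1 (real k * \<eta>1) * muavg \<beta>2 (real l * \<eta>2) * fc2 g (int k) (int l)))"
        if kl: "k \<in> block m" "l \<in> block n" for k l
      proof -
        have k: "m \<le> 2 * k" "k \<le> m" "1 \<le> k" and l: "n \<le> 2 * l" "l \<le> n" "1 \<le> l" using kl mn by (auto simp: block_iff)
        obtain \<rho> where \<rho>: "c1 * min 1 (real m * \<delta>1) powr \<beta>1 \<le> \<rho>" "norm (\<epsilon>1 * muavg \<beta>1 (real k * \<eta>1) - of_real \<rho>) \<le> \<rho> / 4"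
          using e1(3)[OF kl(1)] by blast
        obtain \<sigma> where \<sigma>: "c2 * min 1 (real n * \<delta>2) powr \<beta>2 \<le> \<sigma>" "norm (\<epsilon>2 * muavg \<beta>2 (real l * \<eta>2) - of_real \<sigma>) \<le> \<sigma> / 4"
          using e2(3)[OF kl(2)] by blast
        have fc: "fc2 g (int k) (int l) = of_real (pi\<^sup>2 * a k l * (real k powr r1 * real l powr r2)) * (cis (pi * r1 / 2) * cis (pi * r2 / 2))"
          using wc k l by (simp add: weyl_coefficients_def ipow_eq mult_ac)
        have cc: "cis (- x) * cis x = 1" for x by (simp add: cis_mult)
        have "\<zeta> * (muavg \<beta>1 (real k * \<eta>1) * muavg \<beta>2 (real l * \<eta>2) * fc2 g (int k) (int l))
          = (cis (- (pi * r1 / 2)) * cis (pi * r1 / 2)) * (cis (- (pi * r2 / 2)) * cis (pi * r2 / 2)) *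
            (of_real (pi\<^sup>2 * a k l * (real k powr r1 * real l powr r2)) * ((\<epsilon>1 * muavg \<beta>1 (real k * \<eta>1)) * (\<epsilon>2 * muavg \<beta>2 (real l * \<eta>2))))"
          unfolding fc \<zeta>_def by (simp only: mult_ac)
        moreover have "Re (of_real x * w) = x * Re w" for x :: real and w by simp
        ultimately have "Re (\<zeta> * (muavg \<beta>1 (real k * \<eta>1) * muavg \<beta>2 (real l * \<eta>2) * fc2 g (int k) (int l)))
          = pi\<^sup>2 * a k l * (real k powr r1 * real l powr r2) * Re ((\<epsilon>1 * muavg \<beta>1 (real k * \<eta>1)) * (\<epsilon>2 * muavg \<beta>2 (real l * \<eta>2)))"
          unfolding cc by (simp only: mult_1_left)
        moreover have "b \<le> pi\<^sup>2 * a k l * (real k powr r1 * real l powr r2) * Re ((\<epsilon>1 * muavg \<beta>1 (real k * \<eta>1)) * (\<epsilon>2 * muavg \<beta>2 (real l * \<eta>2)))"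
          unfolding b_def
        proof (intro mult_mono)
          show "a m n \<le> a k l" using doubly_monotone_antimono[OF a k(3) l(3) k(2) l(2)] .
          have "real m powr r1 \<le> (2 * real k) powr r1" using k r by (intro powr_mono2) auto
          then show "real m powr r1 / 2 powr r1 \<le> real k powr r1" by (simp add: powr_mult field_simps)
          have "real n powr r2 \<le> (2 * real l) powr r2" using l r by (intro powr_mono2) auto
          then show "real n powr r2 / 2 powr r2 \<le> real l powr r2" by (simp add: powr_mult field_simps)
          have "7 / 16 * (c1 * min 1 (real m * \<delta>1) powr \<beta>1 * (c2 * min 1 (real n * \<delta>2) powr \<beta>2)) \<le> 7 / 16 * (\<rho> * \<sigma>)"
            using \<rho>(1) \<sigma>(1) k1 k2 by (intro mult_left_mono mult_mono) (auto intro: order_trans[rotated])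
          also have "\<dots> \<le> Re ((\<epsilon>1 * muavg \<beta>1 (real k * \<eta>1)) * (\<epsilon>2 * muavg \<beta>2 (real l * \<eta>2)))"
            by (rule norm_product_near_real[OF \<rho>(2) \<sigma>(2)])
          finally show "7 / 16 * (c1 * min 1 (real m * \<delta>1) powr \<beta>1 * (c2 * min 1 (real n * \<delta>2) powr \<beta>2)) \<le> \<dots>" .
        qed (use amn k1 k2 doubly_monotone_sum(2)[OF a k(3) l(3)] in auto)
        ultimately show ?thesis by simp
      qed
      have n\<zeta>: "norm \<zeta> = 1" using e1 e2 by (simp add: \<zeta>_def norm_mult)
      have "(real m / 2) * (real n / 2) * b \<le> real (card (block m)) * real (card (block n)) * b"
        using card_block[of m] card_block[of n] b0 by (intro mult_right_mono mult_mono) auto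
      also have "\<dots> = (\<Sum>k\<in>block m. \<Sum>l\<in>block n. b)" by simp
      also have "\<dots> \<le> (\<Sum>k\<in>block m. \<Sum>l\<in>block n. Re (\<zeta> * (muavg \<beta>1 (real k * \<eta>1) * muavg \<beta>2 (real l * \<eta>2) * fc2 g (int k) (int l))))"
        by (intro sum_mono low)
      also have "\<dots> = Re (\<zeta> * I)" unfolding I_def by (simp only: sum_distrib_left Re_sum)
      also have "\<dots> \<le> norm (\<zeta> * I)" by (rule complex_Re_le_cmod)
      also have "\<dots> = norm I" by (simp add: norm_mult n\<zeta>)
      also have "(real m / 2) * (real n / 2) * b = c * (a m n * Vw r1 \<beta>1 \<delta>1 m * Vw r2 \<beta>2 \<delta>2 n) * (real m * real n)"
        by (simp add: b_def c_def Vw_def field_simps)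
      finally have "ennreal (c * (a m n * Vw r1 \<beta>1 \<delta>1 m * Vw r2 \<beta>2 \<delta>2 n) * (real m * real n)) \<le> ennreal (norm I)" by (rule ennreal_leI)
      with up e1(1) e2(1) show ?thesis using order_trans by blast
    qed
    \<comment> \<open>The admissible scale depends on the block, whereas summing over all blocks
      requires fixed steps. Adding up all the pairs of scales, at most four, removes the dependence
      and costs the factor \<open>4\<close> in \<open>K\<close>.\<close>
    have stepp: "ennreal (c powr p) * ennreal ((\<bar>a m n\<bar> * Vw r1 \<beta>1 \<delta>1 m * Vw r2 \<beta>2 \<delta>2 n) powr p * (real m powr (p - 2) * real n powr (p - 2)))
      \<le> ennreal (real m powr (-2) * real n powr (-2)) * (\<Sum>\<eta>1\<in>{\<delta>1, \<kappa>1 * \<delta>1}. \<Sum>\<eta>2\<in>{\<delta>2, \<kappa>2 * \<delta>2}. N m n \<eta>1 \<eta>2)" for m n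
    proof (cases "m = 0 \<or> n = 0")
      case False
      then have mn: "1 \<le> m" "1 \<le> n" by auto
      have amn: "0 \<le> a m n" by (rule doubly_monotone_sum(2)[OF a mn])
      obtain \<eta>1 \<eta>2 where \<eta>: "\<eta>1 \<in> {\<delta>1, \<kappa>1 * \<delta>1}" "\<eta>2 \<in> {\<delta>2, \<kappa>2 * \<delta>2}"
        and le: "ennreal (c * (a m n * Vw r1 \<beta>1 \<delta>1 m * Vw r2 \<beta>2 \<delta>2 n) * (real m * real n)) \<le> (\<integral>\<^sup>+s1. \<integral>\<^sup>+s2. ennreal (norm (q m n (\<eta>1 * s1) (\<eta>2 * s2))) \<partial>havg \<partial>havg)"
        using step[OF mn] by blast
      have nn: "0 \<le> c * (a m n * Vw r1 \<beta>1 \<delta>1 m * Vw r2 \<beta>2 \<delta>2 n) * (real m * real n)"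
        using c amn Vw_nonneg by (intro mult_nonneg_nonneg) auto
      have jm: "(\<lambda>s1. \<integral>\<^sup>+s2. ennreal (norm (q m n (\<eta>1 * s1) (\<eta>2 * s2))) \<partial>havg) \<in> borel_measurable borel" by measurable
      have "ennreal ((c * (a m n * Vw r1 \<beta>1 \<delta>1 m * Vw r2 \<beta>2 \<delta>2 n) * (real m * real n)) powr p)
        \<le> enn_powr (\<integral>\<^sup>+s1. \<integral>\<^sup>+s2. ennreal (norm (q m n (\<eta>1 * s1) (\<eta>2 * s2))) \<partial>havg \<partial>havg) p"
        using enn_powr_mono[OF le, of p] p nn by simp
      also have "\<dots> \<le> (\<integral>\<^sup>+s1. enn_powr (\<integral>\<^sup>+s2. ennreal (norm (q m n (\<eta>1 * s1) (\<eta>2 * s2))) \<partial>havg) p \<partial>havg)"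
        by (rule havg_jensen[OF p jm])
      also have "\<dots> \<le> N m n \<eta>1 \<eta>2"
        unfolding N_def by (intro nn_integral_mono havg_jensen p) measurable
      also have "\<dots> \<le> (\<Sum>\<eta>2\<in>{\<delta>2, \<kappa>2 * \<delta>2}. N m n \<eta>1 \<eta>2)"
        using \<eta>(2) by (intro member_le_sum) auto
      also have "\<dots> \<le> (\<Sum>\<eta>1\<in>{\<delta>1, \<kappa>1 * \<delta>1}. \<Sum>\<eta>2\<in>{\<delta>2, \<kappa>2 * \<delta>2}. N m n \<eta>1 \<eta>2)"
        using \<eta>(1) by (intro member_le_sum[of \<eta>1 _ "\<lambda>\<eta>1. \<Sum>\<eta>2\<in>{\<delta>2, \<kappa>2 * \<delta>2}. N m n \<eta>1 \<eta>2"]) auto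
      finally have "ennreal (real m powr (-2) * real n powr (-2)) * ennreal ((c * (a m n * Vw r1 \<beta>1 \<delta>1 m * Vw r2 \<beta>2 \<delta>2 n) * (real m * real n)) powr p)
        \<le> ennreal (real m powr (-2) * real n powr (-2)) * (\<Sum>\<eta>1\<in>{\<delta>1, \<kappa>1 * \<delta>1}. \<Sum>\<eta>2\<in>{\<delta>2, \<kappa>2 * \<delta>2}. N m n \<eta>1 \<eta>2)"
        by (rule mult_left_mono) simp
      moreover have "(real m powr (-2) * real n powr (-2)) * (c * (a m n * Vw r1 \<beta>1 \<delta>1 m * Vw r2 \<beta>2 \<delta>2 n) * (real m * real n)) powr p
        = c powr p * ((\<bar>a m n\<bar> * Vw r1 \<beta>1 \<delta>1 m * Vw r2 \<beta>2 \<delta>2 n) powr p * (real m powr (p - 2) * real n powr (p - 2)))"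
      proof -
        have "(c * (a m n * Vw r1 \<beta>1 \<delta>1 m * Vw r2 \<beta>2 \<delta>2 n) * (real m * real n)) powr p
          = c powr p * (a m n * Vw r1 \<beta>1 \<delta>1 m * Vw r2 \<beta>2 \<delta>2 n) powr p * (real m powr p * real n powr p)"
          by (simp only: powr_mult)
        moreover have "real m powr (-2) * real m powr p = real m powr (p - 2)" "real n powr (-2) * real n powr p = real n powr (p - 2)"
          by (simp_all add: powr_add[symmetric])
        ultimately show ?thesis using amn by (simp add: mult_ac) (metis mult.assoc mult.left_commute)
      qed
      ultimately show ?thesis by (simp flip: ennreal_mult)
    qed auto
    have tot: "(\<Sum>m. \<Sum>n. ennreal (real m powr (-2) * real n powr (-2)) * N m n \<eta>1 \<eta>2) \<le> ennreal K0 * X"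
      if \<eta>: "\<eta>1 \<in> {\<delta>1, \<kappa>1 * \<delta>1}" "\<eta>2 \<in> {\<delta>2, \<kappa>2 * \<delta>2}" for \<eta>1 \<eta>2
    proof -
      have e: "0 < \<eta>1" "\<eta>1 \<le> \<delta>1" "0 < \<eta>2" "\<eta>2 \<le> \<delta>2" using \<eta> \<delta> k1 k2 by (auto simp: mult_le_cancel_right1 mult_left_le_one_le)
      have "(\<Sum>m. \<Sum>n. ennreal (real m powr (-2) * real n powr (-2)) * N m n \<eta>1 \<eta>2)
        = (\<integral>\<^sup>+s1. \<integral>\<^sup>+s2. (\<Sum>m. \<Sum>n. ennreal (real m powr (-2) * real n powr (-2)) * enn_powr (ennreal (norm (q m n (\<eta>1 * s1) (\<eta>2 * s2)))) p) \<partial>havg \<partial>havg)"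
        unfolding N_def by (simp add: nn_integral_suminf nn_integral_cmult)
      also have "\<dots> \<le> (\<integral>\<^sup>+s1. \<integral>\<^sup>+s2. ennreal K0 * X \<partial>havg \<partial>havg)"
      proof (intro nn_integral_mono_AE)
        show "AE s1 in havg. (\<integral>\<^sup>+s2. (\<Sum>m. \<Sum>n. ennreal (real m powr (-2) * real n powr (-2)) * enn_powr (ennreal (norm (q m n (\<eta>1 * s1) (\<eta>2 * s2)))) p) \<partial>havg) \<le> (\<integral>\<^sup>+s2. ennreal K0 * X \<partial>havg)"
          using AE_havg
        proof eventually_elim
          case (elim s1)
          show ?case
          proof (intro nn_integral_mono_AE)
            show "AE s2 in havg. (\<Sum>m. \<Sum>n. ennreal (real m powr (-2) * real n powr (-2)) * enn_powr (ennreal (norm (q m n (\<eta>1 * s1) (\<eta>2 * s2)))) p) \<le> ennreal K0 * X"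
              using AE_havg
            proof eventually_elim
              case s2: (elim s2)
              have h: "\<bar>\<eta>1 * s1\<bar> \<le> \<delta>1" "\<bar>\<eta>2 * s2\<bar> \<le> \<delta>2"
                using elim s2 e mult_mono[of \<eta>1 \<delta>1 s1 1] mult_mono[of \<eta>2 \<delta>2 s2 1] by (auto simp: abs_mult)
              have "(\<Sum>m. \<Sum>n. ennreal (real m powr (-2) * real n powr (-2)) * enn_powr (ennreal (norm (q m n (\<eta>1 * s1) (\<eta>2 * s2)))) p)
                \<le> ennreal K0 * Lnorm p (udiff \<beta>1 \<beta>2 (\<eta>1 * s1) (\<eta>2 * s2) g)"
                unfolding qU by (rule KG[rule_format, OF Lpb_integrable[OF p udiff_Lpb(1)[OF p \<beta> g]]])
              also have "\<dots> \<le> ennreal K0 * X"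
                using X[OF h] unfolding Lnorm_mdiff_udiff[OF p \<beta> g] by (rule mult_left_mono) simp
              finally show ?case .
            qed
          qed
        qed
      qed
      also have "\<dots> = ennreal K0 * X" by (simp add: emeasure_havg)
      finally show ?thesis .
    qed
    have "ennreal (c powr p) * pdsum p a (Vw r1 \<beta>1 \<delta>1) (Vw r2 \<beta>2 \<delta>2)
      \<le> (\<Sum>m. \<Sum>n. ennreal (real m powr (-2) * real n powr (-2)) * (\<Sum>\<eta>1\<in>{\<delta>1, \<kappa>1 * \<delta>1}. \<Sum>\<eta>2\<in>{\<delta>2, \<kappa>2 * \<delta>2}. N m n \<eta>1 \<eta>2))"
      unfolding pdsum_def ennreal_suminf_cmult[symmetric] by (intro ennreal_suminf_le stepp)
    also have "\<dots> = (\<Sum>\<eta>1\<in>{\<delta>1, \<kappa>1 * \<delta>1}. \<Sum>\<eta>2\<in>{\<delta>2, \<kappa>2 * \<delta>2}. (\<Sum>m. \<Sum>n. ennreal (real m powr (-2) * real n powr (-2)) * N m n \<eta>1 \<eta>2))"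
      by (simp only: sum_distrib_left suminf_sum[OF summableI])
    also have "\<dots> \<le> (\<Sum>\<eta>1\<in>{\<delta>1, \<kappa>1 * \<delta>1}. \<Sum>\<eta>2\<in>{\<delta>2, \<kappa>2 * \<delta>2}. ennreal K0 * X)"
      by (intro sum_mono tot)
    also have "\<dots> \<le> ennreal 4 * (ennreal K0 * X)"
    proof -
      have "card {\<delta>1, \<kappa>1 * \<delta>1} * card {\<delta>2, \<kappa>2 * \<delta>2} \<le> 2 * 2" by (intro mult_mono card_insert_le_m1) auto
      then have "of_nat (card {\<delta>1, \<kappa>1 * \<delta>1} * card {\<delta>2, \<kappa>2 * \<delta>2}) \<le> (of_nat 4 :: ennreal)" by (intro of_nat_mono) simp
      then have "of_nat (card {\<delta>1, \<kappa>1 * \<delta>1} * card {\<delta>2, \<kappa>2 * \<delta>2}) * (ennreal K0 * X) \<le> of_nat 4 * (ennreal K0 * X)"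
        by (rule mult_right_mono) simp
      then show ?thesis by (simp only: sum_constant of_nat_mult mult.assoc) simp
    qed
    finally have fin: "ennreal (c powr p) * pdsum p a (Vw r1 \<beta>1 \<delta>1) (Vw r2 \<beta>2 \<delta>2) \<le> ennreal 4 * (ennreal K0 * X)" .
    have "pdsum p a (Vw r1 \<beta>1 \<delta>1) (Vw r2 \<beta>2 \<delta>2) = ennreal (1 / c powr p) * (ennreal (c powr p) * pdsum p a (Vw r1 \<beta>1 \<delta>1) (Vw r2 \<beta>2 \<delta>2))"
      using c by (simp add: mult.assoc[symmetric] flip: ennreal_mult)
    also have "\<dots> \<le> ennreal (1 / c powr p) * (ennreal 4 * (ennreal K0 * X))" by (rule mult_left_mono[OF fin]) simp
    also have "\<dots> = ennreal K * X"
    proof -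
      have "ennreal K = ennreal (1 / c powr p) * (ennreal 4 * ennreal K0)"
        using K0 c by (simp add: K_def flip: ennreal_mult del: ennreal_numeral)
      then show ?thesis by (simp only: mult.assoc)
    qed
    finally show ?thesis .
  qed
  show ?thesis using K main by blast
qed

subsection \<open>The integral of the moduli\<close>

lemma Vw_measurable [measurable]: "(\<lambda>t. Vw r \<beta> t k) \<in> borel_measurable borel"
  unfolding Vw_def by measurable

text \<open>The weight saturates at \<open>t = 1 / m\<close>. Below
  \<open>e = min \<delta> (1 / m)\<close> the integrand is a multiple of
  \<open>t powr (\<beta> * p - 1)\<close>, above it is \<open>t powr (- r * p - 1)\<close>. Since
  \<open>m * e = min 1 (m * \<delta>)\<close>, the lower part equals
  \<open>Vw r \<beta> \<delta> m powr p\<close> divided by \<open>\<beta> * p\<close>; the upper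
  part occurs only for \<open>m * \<delta> > 1\<close> and is of no larger order.\<close>

lemma nn_integral_weight:
  fixes r \<beta> p \<delta> :: real and m :: nat
  assumes p: "0 < p" and r: "0 < r" and \<beta>: "0 < \<beta>" and \<delta>: "0 < \<delta>"
  defines "J \<equiv> (\<integral>\<^sup>+t\<in>{0<..<\<delta>}. ennreal (t powr (- r * p - 1) * Vw 0 (r + \<beta>) t m powr p) \<partial>lborel)"
  shows "ennreal (1 / (\<beta> * p) * Vw r \<beta> \<delta> m powr p) \<le> J"
    and "J \<le> ennreal ((1 / (\<beta> * p) + 1 / (r * p)) * Vw r \<beta> \<delta> m powr p)"
proof -
  have "ennreal (1 / (\<beta> * p) * Vw r \<beta> \<delta> m powr p) \<le> J \<and> J \<le> ennreal ((1 / (\<beta> * p) + 1 / (r * p)) * Vw r \<beta> \<delta> m powr p)"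
  proof (cases "m = 0")
    case True
    then show ?thesis by (simp add: J_def Vw_def)
  next
    case False
    define \<mu> where "\<mu> = real m"
    have \<mu>: "0 < \<mu>" using False by (simp add: \<mu>_def)
    define e where "e = min \<delta> (1 / \<mu>)"
    have e: "0 < e" "e \<le> \<delta>" "\<mu> * e \<le> 1" using \<delta> \<mu> by (auto simp: e_def field_simps min_def)
    have V: "Vw 0 (r + \<beta>) t m = min 1 (\<mu> * t) powr (r + \<beta>)" for t using False by (simp add: Vw_def \<mu>_def)
    have low: "t powr (- r * p - 1) * Vw 0 (r + \<beta>) t m powr p = \<mu> powr ((r + \<beta>) * p) * t powr (\<beta> * p - 1)" if "0 < t" "\<mu> * t \<le> 1" for t
    proof -
      have "t powr (- r * p - 1) * t powr ((r + \<beta>) * p) = t powr (\<beta> * p - 1)"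
        unfolding powr_add[symmetric] by (rule arg_cong[where f = "(powr) t"]) (simp add: algebra_simps)
      moreover have "min 1 (\<mu> * t) = \<mu> * t" using that by simp
      ultimately show ?thesis unfolding V powr_powr by (simp only: powr_mult mult.left_commute[of "t powr _"])
    qed
    have intlow: "(\<integral>\<^sup>+t\<in>{0..e}. ennreal (\<mu> powr ((r + \<beta>) * p) * t powr (\<beta> * p - 1)) \<partial>lborel)
      = ennreal (\<mu> powr ((r + \<beta>) * p) * (e powr (\<beta> * p) / (\<beta> * p)))"
      using nn_integral_powr_from_0[of "\<beta> * p - 1" e] p \<beta> e
      by (simp add: ennreal_mult mult.assoc nn_integral_cmult) (simp flip: ennreal_mult)
    have E: "\<mu> powr ((r + \<beta>) * p) * e powr (\<beta> * p) = Vw r \<beta> \<delta> m powr p"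
    proof -
      have me: "\<mu> * e = min 1 (\<mu> * \<delta>)" using \<mu> by (auto simp: e_def min_def field_simps)
      have "\<mu> powr ((r + \<beta>) * p) * e powr (\<beta> * p) = \<mu> powr (r * p) * (\<mu> * e) powr (\<beta> * p)"
        using \<mu> e by (simp add: powr_mult powr_add distrib_right)
      then show ?thesis unfolding me by (simp add: Vw_def \<mu>_def powr_mult powr_powr)
    qed
    have ne: "AE t in lborel. t \<noteq> 0 \<and> t \<noteq> e \<and> t \<noteq> \<delta>"
      using AE_lborel_singleton[of "0::real"] AE_lborel_singleton[of e] AE_lborel_singleton[of \<delta>] by eventually_elim auto
    have "ennreal (1 / (\<beta> * p) * Vw r \<beta> \<delta> m powr p) = (\<integral>\<^sup>+t\<in>{0..e}. ennreal (\<mu> powr ((r + \<beta>) * p) * t powr (\<beta> * p - 1)) \<partial>lborel)"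
      unfolding intlow E[symmetric] by simp
    also have "\<dots> \<le> J"
      unfolding J_def
    proof (rule nn_integral_mono_AE, use ne in eventually_elim)
      case (elim t)
      have "ennreal (\<mu> powr ((r + \<beta>) * p) * t powr (\<beta> * p - 1)) \<le> ennreal (t powr (- r * p - 1) * Vw 0 (r + \<beta>) t m powr p)" if "0 < t" "t < e"
      proof -
        have "\<mu> * t \<le> \<mu> * e" using that \<mu> by simp
        then show ?thesis using low[of t] that e by simp
      qed
      then show ?case using elim e by (auto simp: indicator_def)
    qed
    finally have 1: "ennreal (1 / (\<beta> * p) * Vw r \<beta> \<delta> m powr p) \<le> J" .
    have J2: "J \<le> (\<integral>\<^sup>+t. ennreal (\<mu> powr ((r + \<beta>) * p) * t powr (\<beta> * p - 1)) * indicator {0..e} t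
        + ennreal (t powr (- r * p - 1)) * (indicator {1 / \<mu>..} t * indicator {0<..<\<delta>} t) \<partial>lborel)"
      unfolding J_def
    proof (rule nn_integral_mono)
      fix t
      show "ennreal (t powr (- r * p - 1) * Vw 0 (r + \<beta>) t m powr p) * indicator {0<..<\<delta>} t
        \<le> ennreal (\<mu> powr ((r + \<beta>) * p) * t powr (\<beta> * p - 1)) * indicator {0..e} t
        + ennreal (t powr (- r * p - 1)) * (indicator {1 / \<mu>..} t * indicator {0<..<\<delta>} t)"
      proof (cases "0 < t \<and> t < \<delta>")
        case T: True
        show ?thesis
        proof (cases "\<mu> * t \<le> 1")
          case True
          then have "t \<le> e" using T \<mu> by (simp add: e_def field_simps)
          then show ?thesis using low[of t] T True by (simp add: add_increasing2)
        next
          case F: False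
          then have "1 / \<mu> \<le> t" using \<mu> by (simp add: field_simps)
          moreover have "Vw 0 (r + \<beta>) t m = 1" unfolding V using F by simp
          ultimately show ?thesis using T by (simp add: add_increasing)
        qed
      qed auto
    qed
    also have "\<dots> = (\<integral>\<^sup>+t\<in>{0..e}. ennreal (\<mu> powr ((r + \<beta>) * p) * t powr (\<beta> * p - 1)) \<partial>lborel)
        + (\<integral>\<^sup>+t. ennreal (t powr (- r * p - 1)) * (indicator {1 / \<mu>..} t * indicator {0<..<\<delta>} t) \<partial>lborel)"
      by (rule nn_integral_add) measurable
    also have "\<dots> \<le> ennreal (1 / (\<beta> * p) * Vw r \<beta> \<delta> m powr p) + ennreal (1 / (r * p) * Vw r \<beta> \<delta> m powr p)"
    proof (rule add_mono)
      show "(\<integral>\<^sup>+t\<in>{0..e}. ennreal (\<mu> powr ((r + \<beta>) * p) * t powr (\<beta> * p - 1)) \<partial>lborel) \<le> ennreal (1 / (\<beta> * p) * Vw r \<beta> \<delta> m powr p)"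
        unfolding intlow E[symmetric] by simp
      show "(\<integral>\<^sup>+t. ennreal (t powr (- r * p - 1)) * (indicator {1 / \<mu>..} t * indicator {0<..<\<delta>} t) \<partial>lborel) \<le> ennreal (1 / (r * p) * Vw r \<beta> \<delta> m powr p)"
      proof (cases "\<delta> \<le> 1 / \<mu>")
        case True
        have "(\<integral>\<^sup>+t. ennreal (t powr (- r * p - 1)) * (indicator {1 / \<mu>..} t * indicator {0<..<\<delta>} t) \<partial>lborel) = (\<integral>\<^sup>+t. 0 \<partial>(lborel :: real measure))"
          using True by (intro nn_integral_cong) (auto simp: indicator_def)
        then show ?thesis by simp
      next
        case F: False
        have "(\<integral>\<^sup>+t. ennreal (t powr (- r * p - 1)) * (indicator {1 / \<mu>..} t * indicator {0<..<\<delta>} t) \<partial>lborel)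
          \<le> (\<integral>\<^sup>+t\<in>{1 / \<mu>..}. ennreal (t powr (- r * p - 1)) \<partial>lborel)"
          by (intro nn_integral_mono) (auto simp: indicator_def)
        also have "\<dots> = ennreal (- ((1 / \<mu>) powr (- r * p - 1 + 1)) / (- r * p - 1 + 1))"
          using r p \<mu> by (intro nn_integral_powr_to_inf) auto
        also have "- ((1 / \<mu>) powr (- r * p - 1 + 1)) / (- r * p - 1 + 1) = 1 / (r * p) * \<mu> powr (r * p)"
          using r p \<mu> by (simp add: powr_divide powr_minus field_simps)
        also have "\<mu> powr (r * p) = Vw r \<beta> \<delta> m powr p"
        proof -
          have "1 < real m * \<delta>" using F \<mu> by (simp add: \<mu>_def field_simps)
          then show ?thesis by (simp add: Vw_def \<mu>_def powr_powr)
        qed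
        finally show ?thesis .
      qed
    qed
    also have "\<dots> = ennreal ((1 / (\<beta> * p) + 1 / (r * p)) * Vw r \<beta> \<delta> m powr p)"
      using r p \<beta> by (simp add: distrib_right flip: ennreal_plus)
    finally show ?thesis using 1 by blast
  qed
  then show "ennreal (1 / (\<beta> * p) * Vw r \<beta> \<delta> m powr p) \<le> J"
    and "J \<le> ennreal ((1 / (\<beta> * p) + 1 / (r * p)) * Vw r \<beta> \<delta> m powr p)" by auto
qed

text \<open>For each pair of indices the integrand is a product of a function of \<open>t1\<close>
  and one of \<open>t2\<close>, so Tonelli reduces the claim to \<open>nn_integral_weight\<close> in
  each variable.\<close>

lemma pdsum_integral:
  fixes p r1 r2 \<beta>1 \<beta>2 :: real
  assumes p: "1 < p" and r: "0 < r1" "0 < r2" and \<beta>: "0 < \<beta>1" "0 < \<beta>2"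
  defines "S \<equiv> \<lambda>a \<delta>1 \<delta>2. (\<integral>\<^sup>+t1\<in>{0<..<\<delta>1}. (\<integral>\<^sup>+t2\<in>{0<..<\<delta>2}. ennreal (t1 powr (- r1 * p - 1) * t2 powr (- r2 * p - 1)) *
      pdsum p a (Vw 0 (r1 + \<beta>1) t1) (Vw 0 (r2 + \<beta>2) t2) \<partial>lborel) \<partial>lborel)"
  shows "\<exists>K>0. \<forall>a \<delta>1 \<delta>2. 0 < \<delta>1 \<longrightarrow> 0 < \<delta>2 \<longrightarrow>
    pdsum p a (Vw r1 \<beta>1 \<delta>1) (Vw r2 \<beta>2 \<delta>2) \<le> ennreal K * S a \<delta>1 \<delta>2 \<and>
    S a \<delta>1 \<delta>2 \<le> ennreal K * pdsum p a (Vw r1 \<beta>1 \<delta>1) (Vw r2 \<beta>2 \<delta>2)"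
proof -
  define c1 c2 d1 d2 where "c1 = 1 / (\<beta>1 * p)" and "c2 = 1 / (\<beta>2 * p)"
    and "d1 = 1 / (\<beta>1 * p) + 1 / (r1 * p)" and "d2 = 1 / (\<beta>2 * p) + 1 / (r2 * p)"
  have pos: "0 < c1" "0 < c2" "0 < d1" "0 < d2" using p r \<beta> by (auto simp: c1_def c2_def d1_def d2_def intro!: add_pos_pos)
  define K where "K = max (1 / (c1 * c2)) (d1 * d2)"
  have K: "0 < K" "1 / (c1 * c2) \<le> K" "d1 * d2 \<le> K" using pos by (auto simp: K_def less_max_iff_disj)
  have main: "pdsum p a (Vw r1 \<beta>1 \<delta>1) (Vw r2 \<beta>2 \<delta>2) \<le> ennreal K * S a \<delta>1 \<delta>2 \<and>
    S a \<delta>1 \<delta>2 \<le> ennreal K * pdsum p a (Vw r1 \<beta>1 \<delta>1) (Vw r2 \<beta>2 \<delta>2)" if \<delta>: "0 < \<delta>1" "0 < \<delta>2" for a \<delta>1 \<delta>2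
  proof -
    define J1 where "J1 m = (\<integral>\<^sup>+t\<in>{0<..<\<delta>1}. ennreal (t powr (- r1 * p - 1) * Vw 0 (r1 + \<beta>1) t m powr p) \<partial>lborel)" for m
    define J2 where "J2 m = (\<integral>\<^sup>+t\<in>{0<..<\<delta>2}. ennreal (t powr (- r2 * p - 1) * Vw 0 (r2 + \<beta>2) t m powr p) \<partial>lborel)" for m
    define A where "A k l = \<bar>a k l\<bar> powr p * (real k powr (p - 2) * real l powr (p - 2))" for k l
    have A0: "0 \<le> A k l" for k l by (simp add: A_def)
    have pd: "ennreal ((\<bar>a k l\<bar> * V * W) powr p * (real k powr (p - 2) * real l powr (p - 2))) = ennreal (A k l) * (ennreal (V powr p) * ennreal (W powr p))" for k l V W
      using A0 by (simp add: A_def powr_mult mult_ac flip: ennreal_mult)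
    have J1b: "ennreal (c1 * Vw r1 \<beta>1 \<delta>1 m powr p) \<le> J1 m" "J1 m \<le> ennreal (d1 * Vw r1 \<beta>1 \<delta>1 m powr p)" for m
      unfolding J1_def c1_def d1_def using nn_integral_weight[of p r1 \<beta>1 \<delta>1 m] p r \<beta> \<delta> by auto
    have J2b: "ennreal (c2 * Vw r2 \<beta>2 \<delta>2 m powr p) \<le> J2 m" "J2 m \<le> ennreal (d2 * Vw r2 \<beta>2 \<delta>2 m powr p)" for m
      unfolding J2_def c2_def d2_def using nn_integral_weight[of p r2 \<beta>2 \<delta>2 m] p r \<beta> \<delta> by auto
    define u1 where "u1 k t = ennreal (t powr (- r1 * p - 1) * Vw 0 (r1 + \<beta>1) t k powr p) * indicator {0<..<\<delta>1} t" for k t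
    define u2 where "u2 l t = ennreal (t powr (- r2 * p - 1) * Vw 0 (r2 + \<beta>2) t l powr p) * indicator {0<..<\<delta>2} t" for l t
    have [measurable]: "u1 k \<in> borel_measurable borel" "u2 k \<in> borel_measurable borel" for k unfolding u1_def u2_def by measurable
    have "S a \<delta>1 \<delta>2 = (\<integral>\<^sup>+t1. (\<integral>\<^sup>+t2. (\<Sum>k. \<Sum>l. ennreal (A k l) * (u1 k t1 * u2 l t2)) \<partial>lborel) \<partial>lborel)"
      unfolding S_def
    proof (intro nn_integral_cong)
      fix t1 :: real
      have "(\<integral>\<^sup>+t2\<in>{0<..<\<delta>2}. ennreal (t1 powr (- r1 * p - 1) * t2 powr (- r2 * p - 1)) * pdsum p a (Vw 0 (r1 + \<beta>1) t1) (Vw 0 (r2 + \<beta>2) t2) \<partial>lborel) * indicator {0<..<\<delta>1} t1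
        = (\<integral>\<^sup>+t2. (ennreal (t1 powr (- r1 * p - 1) * t2 powr (- r2 * p - 1)) * pdsum p a (Vw 0 (r1 + \<beta>1) t1) (Vw 0 (r2 + \<beta>2) t2) * indicator {0<..<\<delta>2} t2) * indicator {0<..<\<delta>1} t1 \<partial>lborel)"
        unfolding pdsum_def by (rule nn_integral_multc[symmetric]) measurable
      also have "\<dots> = (\<integral>\<^sup>+t2. (\<Sum>k. \<Sum>l. ennreal (A k l) * (u1 k t1 * u2 l t2)) \<partial>lborel)"
        unfolding pdsum_def pd u1_def u2_def
        by (intro nn_integral_cong) (simp add: ennreal_mult mult_ac flip: ennreal_suminf_cmult)
      finally show "(\<integral>\<^sup>+t2\<in>{0<..<\<delta>2}. ennreal (t1 powr (- r1 * p - 1) * t2 powr (- r2 * p - 1)) * pdsum p a (Vw 0 (r1 + \<beta>1) t1) (Vw 0 (r2 + \<beta>2) t2) \<partial>lborel) * indicator {0<..<\<delta>1} t1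
        = (\<integral>\<^sup>+t2. (\<Sum>k. \<Sum>l. ennreal (A k l) * (u1 k t1 * u2 l t2)) \<partial>lborel)" .
    qed
    also have "\<dots> = (\<Sum>k. \<Sum>l. ennreal (A k l) * (J1 k * J2 l))"
    proof -
      have "(\<integral>\<^sup>+t2. (\<Sum>k. \<Sum>l. ennreal (A k l) * (u1 k t1 * u2 l t2)) \<partial>lborel) = (\<Sum>k. \<Sum>l. ennreal (A k l) * (u1 k t1 * J2 l))" for t1
        unfolding J2_def u2_def[symmetric] by (simp add: nn_integral_suminf nn_integral_cmult)
      then have "(\<integral>\<^sup>+t1. (\<integral>\<^sup>+t2. (\<Sum>k. \<Sum>l. ennreal (A k l) * (u1 k t1 * u2 l t2)) \<partial>lborel) \<partial>lborel)
        = (\<integral>\<^sup>+t1. (\<Sum>k. \<Sum>l. ennreal (A k l) * (u1 k t1 * J2 l)) \<partial>lborel)" by simp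
      also have "\<dots> = (\<Sum>k. \<Sum>l. ennreal (A k l) * (J1 k * J2 l))"
        unfolding J1_def u1_def[symmetric] by (simp add: nn_integral_suminf nn_integral_cmult nn_integral_multc)
      finally show ?thesis .
    qed
    finally have S: "S a \<delta>1 \<delta>2 = (\<Sum>k. \<Sum>l. ennreal (A k l) * (J1 k * J2 l))" .
    have "pdsum p a (Vw r1 \<beta>1 \<delta>1) (Vw r2 \<beta>2 \<delta>2) \<le> (\<Sum>k. \<Sum>l. ennreal K * (ennreal (A k l) * (J1 k * J2 l)))"
      unfolding pdsum_def pd
    proof (intro ennreal_suminf_le)
      fix k l
      have "ennreal (Vw r1 \<beta>1 \<delta>1 k powr p) * ennreal (Vw r2 \<beta>2 \<delta>2 l powr p)
        = ennreal (1 / (c1 * c2)) * (ennreal (c1 * Vw r1 \<beta>1 \<delta>1 k powr p) * ennreal (c2 * Vw r2 \<beta>2 \<delta>2 l powr p))"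
        using pos by (simp flip: ennreal_mult)
      also have "\<dots> \<le> ennreal K * (J1 k * J2 l)"
        using K by (intro mult_mono J1b J2b ennreal_leI) auto
      finally show "ennreal (A k l) * (ennreal (Vw r1 \<beta>1 \<delta>1 k powr p) * ennreal (Vw r2 \<beta>2 \<delta>2 l powr p)) \<le> ennreal K * (ennreal (A k l) * (J1 k * J2 l))"
        unfolding mult.left_commute[of "ennreal K"] by (rule mult_left_mono) simp
    qed
    moreover have "S a \<delta>1 \<delta>2 \<le> (\<Sum>k. \<Sum>l. ennreal K * (ennreal (A k l) * (ennreal (Vw r1 \<beta>1 \<delta>1 k powr p) * ennreal (Vw r2 \<beta>2 \<delta>2 l powr p))))"
      unfolding S
    proof (intro ennreal_suminf_le)
      fix k l
      have "J1 k * J2 l \<le> ennreal (d1 * Vw r1 \<beta>1 \<delta>1 k powr p) * ennreal (d2 * Vw r2 \<beta>2 \<delta>2 l powr p)"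
        by (intro mult_mono J1b J2b) auto
      also have "\<dots> = ennreal (d1 * d2) * (ennreal (Vw r1 \<beta>1 \<delta>1 k powr p) * ennreal (Vw r2 \<beta>2 \<delta>2 l powr p))"
        using pos by (simp add: mult_ac flip: ennreal_mult)
      also have "\<dots> \<le> ennreal K * (ennreal (Vw r1 \<beta>1 \<delta>1 k powr p) * ennreal (Vw r2 \<beta>2 \<delta>2 l powr p))"
        using K by (intro mult_right_mono ennreal_leI) auto
      finally show "ennreal (A k l) * (J1 k * J2 l) \<le> ennreal K * (ennreal (A k l) * (ennreal (Vw r1 \<beta>1 \<delta>1 k powr p) * ennreal (Vw r2 \<beta>2 \<delta>2 l powr p)))"
        unfolding mult.left_commute[of "ennreal K"] by (rule mult_left_mono) simp
    qed
    ultimately show ?thesis unfolding S pdsum_def pd by (simp only: ennreal_suminf_cmult)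
  qed
  show ?thesis using K(1) main by blast
qed

text \<open>For \<open>f\<close> itself the coefficients are weighted with the exponents \<open>0\<close>, for its Weyl derivative with
  \<open>r1\<close> and \<open>r2\<close>.\<close>

lemma modulus_two_sided:
  assumes p: "1 < p" and \<beta>: "0 < \<beta>1" "0 < \<beta>2" and r: "0 \<le> r1" "0 \<le> r2"
  shows "\<exists>K>0. \<forall>a f f' \<delta>1 \<delta>2. doubly_monotone a \<longrightarrow> f' \<in> Lpb p \<longrightarrow> (AE z in lborel. f z = f' z) \<longrightarrow>
    weyl_coefficients a r1 r2 f' \<longrightarrow> 0 < \<delta>1 \<longrightarrow> 0 < \<delta>2 \<longrightarrow>
    enn_powr (mixed_modulus p \<beta>1 \<beta>2 f \<delta>1 \<delta>2) p \<le> ennreal K * pdsum p a (Vw r1 \<beta>1 \<delta>1) (Vw r2 \<beta>2 \<delta>2) \<and>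
    pdsum p a (Vw r1 \<beta>1 \<delta>1) (Vw r2 \<beta>2 \<delta>2) \<le> ennreal K * enn_powr (mixed_modulus p \<beta>1 \<beta>2 f \<delta>1 \<delta>2) p"
proof -
  obtain Ku where Ku: "0 < Ku" and U: "\<forall>a g \<delta>1 \<delta>2 h1 h2. doubly_monotone a \<longrightarrow> g \<in> Lpb p \<longrightarrow> weyl_coefficients a r1 r2 g \<longrightarrow>
    \<bar>h1\<bar> \<le> \<delta>1 \<longrightarrow> \<bar>h2\<bar> \<le> \<delta>2 \<longrightarrow>
    Lnorm p (mdiff \<beta>1 \<beta>2 h1 h2 g) \<le> ennreal Ku * pdsum p a (Vw r1 \<beta>1 \<delta>1) (Vw r2 \<beta>2 \<delta>2)"
    using modulus_upper[OF p \<beta> r] by (elim exE conjE)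
  obtain Kl where Kl: "0 < Kl" and L: "\<forall>a g \<delta>1 \<delta>2 X. doubly_monotone a \<longrightarrow> g \<in> Lpb p \<longrightarrow> weyl_coefficients a r1 r2 g \<longrightarrow>
    0 < \<delta>1 \<longrightarrow> 0 < \<delta>2 \<longrightarrow> (\<forall>h1 h2. \<bar>h1\<bar> \<le> \<delta>1 \<longrightarrow> \<bar>h2\<bar> \<le> \<delta>2 \<longrightarrow> Lnorm p (mdiff \<beta>1 \<beta>2 h1 h2 g) \<le> X) \<longrightarrow>
    pdsum p a (Vw r1 \<beta>1 \<delta>1) (Vw r2 \<beta>2 \<delta>2) \<le> ennreal Kl * X"
    using modulus_lower[OF p \<beta> r] by (elim exE conjE)
  have main: "enn_powr (mixed_modulus p \<beta>1 \<beta>2 f \<delta>1 \<delta>2) p \<le> ennreal (max Ku Kl) * pdsum p a (Vw r1 \<beta>1 \<delta>1) (Vw r2 \<beta>2 \<delta>2) \<and>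
    pdsum p a (Vw r1 \<beta>1 \<delta>1) (Vw r2 \<beta>2 \<delta>2) \<le> ennreal (max Ku Kl) * enn_powr (mixed_modulus p \<beta>1 \<beta>2 f \<delta>1 \<delta>2) p"
    if a: "doubly_monotone a" and f': "f' \<in> Lpb p" and eq: "AE z in lborel. f z = f' z" and wc: "weyl_coefficients a r1 r2 f'" and \<delta>: "0 < \<delta>1" "0 < \<delta>2" for a f f' \<delta>1 \<delta>2
  proof
    let ?P = "pdsum p a (Vw r1 \<beta>1 \<delta>1) (Vw r2 \<beta>2 \<delta>2)"
    let ?M = "mixed_modulus p \<beta>1 \<beta>2 f \<delta>1 \<delta>2"
    have M: "?M = (SUP h1\<in>{h. \<bar>h\<bar> \<le> \<delta>1}. SUP h2\<in>{h. \<bar>h\<bar> \<le> \<delta>2}. enn_powr (Lnorm p (mdiff \<beta>1 \<beta>2 h1 h2 f')) (1 / p))"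
      by (rule mixed_modulus_eq[OF p \<beta> f' eq])
    have "?M \<le> enn_powr (ennreal Ku * ?P) (1 / p)"
      unfolding M using U a f' wc p by (intro SUP_least enn_powr_mono) auto
    then have "enn_powr ?M p \<le> enn_powr (enn_powr (ennreal Ku * ?P) (1 / p)) p" using p by (intro enn_powr_mono) auto
    also have "\<dots> = ennreal Ku * ?P" using p by (intro enn_powr_inverse) simp
    also have "\<dots> \<le> ennreal (max Ku Kl) * ?P" by (intro mult_right_mono ennreal_leI) auto
    finally show "enn_powr ?M p \<le> ennreal (max Ku Kl) * ?P" .
    have "Lnorm p (mdiff \<beta>1 \<beta>2 h1 h2 f') \<le> enn_powr ?M p" if h: "\<bar>h1\<bar> \<le> \<delta>1" "\<bar>h2\<bar> \<le> \<delta>2" for h1 h2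
    proof -
      have "enn_powr (Lnorm p (mdiff \<beta>1 \<beta>2 h1 h2 f')) (1 / p) \<le> ?M"
        unfolding M using h by (intro SUP_upper2[of h1] SUP_upper2[of h2]) auto
      then have "enn_powr (enn_powr (Lnorm p (mdiff \<beta>1 \<beta>2 h1 h2 f')) (1 / p)) p \<le> enn_powr ?M p" using p by (intro enn_powr_mono) auto
      then show ?thesis using p by (subst (asm) enn_powr_inverse) auto
    qed
    then have "?P \<le> ennreal Kl * enn_powr ?M p" using L a f' wc \<delta> by blast
    also have "\<dots> \<le> ennreal (max Ku Kl) * enn_powr ?M p" by (intro mult_right_mono ennreal_leI) auto
    finally show "?P \<le> ennreal (max Ku Kl) * enn_powr ?M p" .
  qed
  show ?thesis using Ku main by (intro exI[of _ "max Ku Kl"]) (auto simp: less_max_iff_disj)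
qed

lemma smoothness_integral_two_sided:
  assumes p: "1 < p" and \<beta>: "0 < \<beta>1" "0 < \<beta>2" and r: "0 < r1" "0 < r2"
  shows "\<exists>K>0. \<forall>a f f' \<delta>1 \<delta>2. doubly_monotone a \<longrightarrow> f' \<in> Lpb p \<longrightarrow> (AE z in lborel. f z = f' z) \<longrightarrow>
    weyl_coefficients a 0 0 f' \<longrightarrow> 0 < \<delta>1 \<longrightarrow> 0 < \<delta>2 \<longrightarrow>
    enn_powr (smoothness_integral p r1 r2 \<beta>1 \<beta>2 f \<delta>1 \<delta>2) p \<le> ennreal K * pdsum p a (Vw r1 \<beta>1 \<delta>1) (Vw r2 \<beta>2 \<delta>2) \<and>
    pdsum p a (Vw r1 \<beta>1 \<delta>1) (Vw r2 \<beta>2 \<delta>2) \<le> ennreal K * enn_powr (smoothness_integral p r1 r2 \<beta>1 \<beta>2 f \<delta>1 \<delta>2) p"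
proof -
  have rb: "0 < r1 + \<beta>1" "0 < r2 + \<beta>2" using r \<beta> by auto
  obtain K where K: "0 < K" and M: "\<forall>a f f' \<delta>1 \<delta>2. doubly_monotone a \<longrightarrow> f' \<in> Lpb p \<longrightarrow> (AE z in lborel. f z = f' z) \<longrightarrow>
    weyl_coefficients a 0 0 f' \<longrightarrow> 0 < \<delta>1 \<longrightarrow> 0 < \<delta>2 \<longrightarrow>
    enn_powr (mixed_modulus p (r1 + \<beta>1) (r2 + \<beta>2) f \<delta>1 \<delta>2) p \<le> ennreal K * pdsum p a (Vw 0 (r1 + \<beta>1) \<delta>1) (Vw 0 (r2 + \<beta>2) \<delta>2) \<and>
    pdsum p a (Vw 0 (r1 + \<beta>1) \<delta>1) (Vw 0 (r2 + \<beta>2) \<delta>2) \<le> ennreal K * enn_powr (mixed_modulus p (r1 + \<beta>1) (r2 + \<beta>2) f \<delta>1 \<delta>2) p"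
    using modulus_two_sided[OF p rb order_refl order_refl] by (elim exE conjE)
  define S where "S a \<delta>1 \<delta>2 = (\<integral>\<^sup>+t1\<in>{0<..<\<delta>1}. (\<integral>\<^sup>+t2\<in>{0<..<\<delta>2}. ennreal (t1 powr (- r1 * p - 1) * t2 powr (- r2 * p - 1)) *
      pdsum p a (Vw 0 (r1 + \<beta>1) t1) (Vw 0 (r2 + \<beta>2) t2) \<partial>lborel) \<partial>lborel)" for a and \<delta>1 \<delta>2 :: real
  obtain L where L: "0 < L" and S: "\<forall>a \<delta>1 \<delta>2. 0 < \<delta>1 \<longrightarrow> 0 < \<delta>2 \<longrightarrow>
    pdsum p a (Vw r1 \<beta>1 \<delta>1) (Vw r2 \<beta>2 \<delta>2) \<le> ennreal L * S a \<delta>1 \<delta>2 \<and>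
    S a \<delta>1 \<delta>2 \<le> ennreal L * pdsum p a (Vw r1 \<beta>1 \<delta>1) (Vw r2 \<beta>2 \<delta>2)"
    using pdsum_integral[OF p r \<beta>, folded S_def] by (elim exE conjE)
  have main: "enn_powr (smoothness_integral p r1 r2 \<beta>1 \<beta>2 f \<delta>1 \<delta>2) p \<le> ennreal (K * L) * pdsum p a (Vw r1 \<beta>1 \<delta>1) (Vw r2 \<beta>2 \<delta>2) \<and>
    pdsum p a (Vw r1 \<beta>1 \<delta>1) (Vw r2 \<beta>2 \<delta>2) \<le> ennreal (K * L) * enn_powr (smoothness_integral p r1 r2 \<beta>1 \<beta>2 f \<delta>1 \<delta>2) p"
    if a: "doubly_monotone a" and f': "f' \<in> Lpb p" and eq: "AE z in lborel. f z = f' z" and wc: "weyl_coefficients a 0 0 f'" and \<delta>: "0 < \<delta>1" "0 < \<delta>2" for a f f' \<delta>1 \<delta>2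
  proof
    let ?P = "pdsum p a (Vw r1 \<beta>1 \<delta>1) (Vw r2 \<beta>2 \<delta>2)"
    let ?M = "\<lambda>t1 t2. enn_powr (mixed_modulus p (r1 + \<beta>1) (r2 + \<beta>2) f t1 t2) p"
    let ?w = "\<lambda>t1 t2. ennreal (t1 powr (- r1 * p - 1) * t2 powr (- r2 * p - 1))"
    let ?Q = "\<lambda>t1 t2. pdsum p a (Vw 0 (r1 + \<beta>1) t1) (Vw 0 (r2 + \<beta>2) t2)"
    let ?J = "\<integral>\<^sup>+t1\<in>{0<..<\<delta>1}. (\<integral>\<^sup>+t2\<in>{0<..<\<delta>2}. ?w t1 t2 * ?M t1 t2 \<partial>lborel) \<partial>lborel"
    have J: "enn_powr (smoothness_integral p r1 r2 \<beta>1 \<beta>2 f \<delta>1 \<delta>2) p = ?J"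
      unfolding smoothness_integral_def using p by (intro enn_powr_inverse) simp
    have MQ: "?M t1 t2 \<le> ennreal K * ?Q t1 t2" "?Q t1 t2 \<le> ennreal K * ?M t1 t2" if "0 < t1" "0 < t2" for t1 t2
      using M a f' eq wc that by blast+
    have cQ: "(\<integral>\<^sup>+t1\<in>{0<..<\<delta>1}. (\<integral>\<^sup>+t2\<in>{0<..<\<delta>2}. ?w t1 t2 * (ennreal c * ?Q t1 t2) \<partial>lborel) \<partial>lborel) = ennreal c * S a \<delta>1 \<delta>2" for c
    proof -
      have qm: "(\<lambda>t2. ?w t1 t2 * ?Q t1 t2 * indicator {0<..<\<delta>2} t2) \<in> borel_measurable lborel" for t1
        unfolding pdsum_def by measurable
      have qm2: "(\<lambda>t1. (\<integral>\<^sup>+t2\<in>{0<..<\<delta>2}. ?w t1 t2 * ?Q t1 t2 \<partial>lborel) * indicator {0<..<\<delta>1} t1) \<in> borel_measurable lborel"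
        unfolding pdsum_def by measurable
      have "(\<integral>\<^sup>+t2\<in>{0<..<\<delta>2}. ?w t1 t2 * (ennreal c * ?Q t1 t2) \<partial>lborel) = ennreal c * (\<integral>\<^sup>+t2\<in>{0<..<\<delta>2}. ?w t1 t2 * ?Q t1 t2 \<partial>lborel)" for t1
        unfolding nn_integral_cmult[OF qm, symmetric] by (simp only: mult_ac)
      then have "(\<integral>\<^sup>+t1\<in>{0<..<\<delta>1}. (\<integral>\<^sup>+t2\<in>{0<..<\<delta>2}. ?w t1 t2 * (ennreal c * ?Q t1 t2) \<partial>lborel) \<partial>lborel)
        = (\<integral>\<^sup>+t1. ennreal c * ((\<integral>\<^sup>+t2\<in>{0<..<\<delta>2}. ?w t1 t2 * ?Q t1 t2 \<partial>lborel) * indicator {0<..<\<delta>1} t1) \<partial>lborel)"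
        by (simp only: mult.assoc)
      also have "\<dots> = ennreal c * S a \<delta>1 \<delta>2" unfolding S_def by (rule nn_integral_cmult[OF qm2])
      finally show ?thesis .
    qed
    have "?J \<le> (\<integral>\<^sup>+t1\<in>{0<..<\<delta>1}. (\<integral>\<^sup>+t2\<in>{0<..<\<delta>2}. ?w t1 t2 * (ennreal K * ?Q t1 t2) \<partial>lborel) \<partial>lborel)"
    proof (intro nn_integral_mono)
      fix t1
      have "(\<integral>\<^sup>+t2\<in>{0<..<\<delta>2}. ?w t1 t2 * ?M t1 t2 \<partial>lborel) \<le> (\<integral>\<^sup>+t2\<in>{0<..<\<delta>2}. ?w t1 t2 * (ennreal K * ?Q t1 t2) \<partial>lborel)" if "0 < t1"
        using MQ(1)[OF that] by (intro nn_integral_mono) (auto simp: indicator_def intro!: mult_left_mono)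
      then show "(\<integral>\<^sup>+t2\<in>{0<..<\<delta>2}. ?w t1 t2 * ?M t1 t2 \<partial>lborel) * indicator {0<..<\<delta>1} t1
        \<le> (\<integral>\<^sup>+t2\<in>{0<..<\<delta>2}. ?w t1 t2 * (ennreal K * ?Q t1 t2) \<partial>lborel) * indicator {0<..<\<delta>1} t1"
        by (cases "t1 \<in> {0<..<\<delta>1}") auto
    qed
    also have "\<dots> = ennreal K * S a \<delta>1 \<delta>2" by (rule cQ)
    also have "\<dots> \<le> ennreal K * (ennreal L * ?P)" using S \<delta> by (intro mult_left_mono) auto
    also have "\<dots> = ennreal (K * L) * ?P" using K L by (simp add: ennreal_mult mult.assoc)
    finally show "enn_powr (smoothness_integral p r1 r2 \<beta>1 \<beta>2 f \<delta>1 \<delta>2) p \<le> ennreal (K * L) * ?P" unfolding J .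
    \<comment> \<open>The constant is carried through the integral of the coefficient sums, whose
      measurability is clear. Of the integrand built from the modulus, a supremum over uncountably
      many steps, only monotonicity of the integral is used.\<close>
    have "ennreal (1 / K) * S a \<delta>1 \<delta>2 = (\<integral>\<^sup>+t1\<in>{0<..<\<delta>1}. (\<integral>\<^sup>+t2\<in>{0<..<\<delta>2}. ?w t1 t2 * (ennreal (1 / K) * ?Q t1 t2) \<partial>lborel) \<partial>lborel)"
      by (rule cQ[symmetric])
    also have "\<dots> \<le> ?J"
    proof (intro nn_integral_mono)
      fix t1
      have MQ': "ennreal (1 / K) * ?Q t1 t2 \<le> ?M t1 t2" if "0 < t1" "0 < t2" for t2
      proof -
        have "ennreal (1 / K) * ?Q t1 t2 \<le> ennreal (1 / K) * (ennreal K * ?M t1 t2)" by (intro mult_left_mono MQ that) simp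
        also have "\<dots> = ?M t1 t2" using K by (simp add: mult.assoc[symmetric] flip: ennreal_mult)
        finally show ?thesis .
      qed
      have "(\<integral>\<^sup>+t2\<in>{0<..<\<delta>2}. ?w t1 t2 * (ennreal (1 / K) * ?Q t1 t2) \<partial>lborel) \<le> (\<integral>\<^sup>+t2\<in>{0<..<\<delta>2}. ?w t1 t2 * ?M t1 t2 \<partial>lborel)" if "0 < t1"
        using MQ'[OF that] by (intro nn_integral_mono) (auto simp: indicator_def intro!: mult_left_mono)
      then show "(\<integral>\<^sup>+t2\<in>{0<..<\<delta>2}. ?w t1 t2 * (ennreal (1 / K) * ?Q t1 t2) \<partial>lborel) * indicator {0<..<\<delta>1} t1
        \<le> (\<integral>\<^sup>+t2\<in>{0<..<\<delta>2}. ?w t1 t2 * ?M t1 t2 \<partial>lborel) * indicator {0<..<\<delta>1} t1"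
        by (cases "t1 \<in> {0<..<\<delta>1}") auto
    qed
    finally have le: "ennreal (1 / K) * S a \<delta>1 \<delta>2 \<le> ?J" .
    have "?P \<le> ennreal L * S a \<delta>1 \<delta>2" using S \<delta> by blast
    also have "\<dots> = ennreal (K * L) * (ennreal (1 / K) * S a \<delta>1 \<delta>2)"
      using K L by (simp add: mult.assoc[symmetric] flip: ennreal_mult)
    also have "\<dots> \<le> ennreal (K * L) * ?J" by (rule mult_left_mono[OF le]) simp
    finally show "?P \<le> ennreal (K * L) * enn_powr (smoothness_integral p r1 r2 \<beta>1 \<beta>2 f \<delta>1 \<delta>2) p" unfolding J .
  qed
  show ?thesis using K L main by (intro exI[of _ "K * L"]) auto
qed

subsection \<open>Weyl integrals\<close>

text \<open>Interpolation between the bounds \<open>1\<close> and \<open>1 / (k * sig x)\<close>: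
  for \<open>0 \<le> \<theta> \<le> 1\<close> one has
  \<open>y powr \<theta> \<le> 1 + y\<close>.\<close>

lemma wker_le_powr:
  assumes \<theta>: "0 \<le> \<theta>" "\<theta> \<le> 1" and k: "0 < real k * sig x"
  shows "wker k x \<le> (real k * sig x) powr (- \<theta>)"
proof -
  define y where "y = real k * sig x"
  have y: "0 < y" using k by (simp add: y_def)
  have "y powr \<theta> \<le> 1 + y"
  proof (cases "y \<le> 1")
    case True
    then have "y powr \<theta> \<le> 1 powr \<theta>" using y \<theta> by (intro powr_mono2) auto
    then show ?thesis using y by simp
  next
    case False
    then have "y powr \<theta> \<le> y powr 1" using \<theta> by (intro powr_mono) auto
    then show ?thesis using y by simp
  qed
  then show ?thesis using y by (simp add: wker_def y_def[symmetric] powr_minus field_simps)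
qed

definition psum :: "real \<Rightarrow> nat \<Rightarrow> real \<Rightarrow> complex" where
  "psum \<alpha> n x = (\<Sum>k=1..<Suc n. of_real (real k powr (- \<alpha>)) * cis (real k * x))"

text \<open>With \<open>s = \<alpha> / 2\<close>, summation by parts leaves the sum of
  \<open>(k powr (- 2 s) - (k + 1) powr (- 2 s)) (k + 1) powr s \<le> 3 (k powr (- s) - (k + 1) powr (- s))\<close>, which telescopes.\<close>

lemma norm_psum_le:
  assumes \<alpha>: "0 < \<alpha>" "\<alpha> \<le> 1" and x: "0 < sig x"
  shows "norm (psum \<alpha> n x) \<le> 10 * sig x powr (\<alpha> / 2 - 1)"
proof (cases "n = 0")
  case True
  then show ?thesis by (simp add: psum_def)
next
  case False
  then have n: "1 \<le> n" by simp
  define s where "s = \<alpha> / 2"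
  have s: "0 < s" "s \<le> 1 / 2" "\<alpha> = s + s" using \<alpha> by (auto simp: s_def)
  define \<sigma> where "\<sigma> = sig x powr (s - 1)"
  have \<sigma>: "0 \<le> \<sigma>" by (simp add: \<sigma>_def)
  have E: "norm (\<Sum>j=1..<Suc k. cis (real j * x)) \<le> 2 * (real (Suc k) powr s * \<sigma>)" for k
  proof -
    have "norm (\<Sum>j=1..<Suc k. cis (real j * x)) \<le> 2 * real (Suc k) * wker (Suc k) x" by (rule norm_sum_cis_wker)
    also have "\<dots> \<le> 2 * real (Suc k) * (real (Suc k) * sig x) powr (- (1 - s))"
      using s x by (intro mult_left_mono wker_le_powr) auto
    also have "\<dots> = 2 * (real (Suc k) powr s * \<sigma>)"
    proof -
      define K where "K = real (Suc k)"
      have "0 < K" by (simp add: K_def)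
      then have "2 * K * (K * sig x) powr (- (1 - s)) = 2 * (K powr s * \<sigma>)"
        using x by (simp add: \<sigma>_def powr_mult powr_diff)
      then show ?thesis by (simp only: K_def)
    qed
    finally show ?thesis .
  qed
  define v where "v k = real k powr (- \<alpha>)" for k
  define w where "w k = real k powr (- s)" for k
  have vw: "v k = w k * w k" for k by (simp add: v_def w_def s powr_add[symmetric])
  have two: "real (Suc k) powr s \<le> 2 * real k powr s" if "1 \<le> k" for k
  proof -
    have "real (Suc k) powr s \<le> (2 * real k) powr s" using that s by (intro powr_mono2) auto
    also have "\<dots> = 2 powr s * real k powr s" by (rule powr_mult)
    also have "2 powr s \<le> 2 powr (1::real)" using s by (intro powr_mono) auto
    finally show ?thesis by (simp add: mult_right_mono)
  qed
  have wm: "w (Suc k) \<le> w k" "0 < w (Suc k)" "0 < w k" "real k powr s * w k = 1" if "1 \<le> k" for k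
    using that s by (auto simp: w_def powr_add[symmetric] intro!: powr_mono2')
  have diff: "norm ((of_real (v (Suc k)) - of_real (v k)) * (\<Sum>j=1..<Suc k. cis (real j * x))) \<le> 6 * \<sigma> * (w k - w (Suc k))" if k: "1 \<le> k" for k
  proof -
    have "real (Suc k) powr s * w k \<le> 2 * (real k powr s * w k)" using mult_right_mono[OF two[OF k] less_imp_le[OF wm(3)[OF k]]] by (simp only: mult.assoc)
    then have a: "real (Suc k) powr s * w k \<le> 2" using wm[OF k] by simp
    have b: "real (Suc k) powr s * w (Suc k) = 1" using wm(4)[of "Suc k"] by simp
    have "v (Suc k) \<le> v k" unfolding vw using wm[OF k] by (intro mult_mono) auto
    then have "norm (complex_of_real (v (Suc k)) - of_real (v k)) = v k - v (Suc k)"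
      by (simp only: of_real_diff[symmetric] norm_of_real abs_minus_commute abs_of_nonneg diff_ge_0_iff_ge)
    then have "norm ((of_real (v (Suc k)) - of_real (v k)) * (\<Sum>j=1..<Suc k. cis (real j * x))) \<le> (v k - v (Suc k)) * (2 * (real (Suc k) powr s * \<sigma>))"
      unfolding norm_mult using E[of k] \<open>v (Suc k) \<le> v k\<close> by (simp add: mult_left_mono)
    also have "\<dots> = 2 * \<sigma> * ((w k - w (Suc k)) * (real (Suc k) powr s * w k + real (Suc k) powr s * w (Suc k)))"
      unfolding vw by (simp add: algebra_simps)
    also have "\<dots> \<le> 2 * \<sigma> * ((w k - w (Suc k)) * (2 + 1))"
      using a b \<sigma> wm[OF k] by (intro mult_left_mono) auto
    also have "\<dots> = 6 * \<sigma> * (w k - w (Suc k))" by (simp add: algebra_simps)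
    finally show ?thesis .
  qed
  have "norm (psum \<alpha> n x) \<le> norm (of_real (v n) * (\<Sum>k=1..<Suc n. cis (real k * x))) + (\<Sum>k=1..<n. 6 * \<sigma> * (w k - w (Suc k)))"
    unfolding psum_def v_def[symmetric] abel_sum[OF n]
    by (intro order_trans[OF norm_triangle_ineq4] add_left_mono order_trans[OF norm_sum] sum_mono diff) auto
  also have "norm (of_real (v n) * (\<Sum>k=1..<Suc n. cis (real k * x))) \<le> v n * (2 * ((2 * real n powr s) * \<sigma>))"
    unfolding norm_mult using E[of n] mult_right_mono[OF two[OF n] \<sigma>] by (simp add: v_def mult_left_mono order_trans)
  also have "v n * (2 * ((2 * real n powr s) * \<sigma>)) = 4 * \<sigma> * w n * (real n powr s * w n)" by (simp add: vw)
  also have "\<dots> \<le> 4 * \<sigma>"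
  proof -
    have "w n \<le> 1" using n s by (auto simp: w_def powr_minus inverse_le_1_iff ge_one_powr_ge_zero)
    then show ?thesis using wm[OF n] \<sigma> by (simp add: mult_left_le)
  qed
  also have "(\<Sum>k=1..<n. 6 * \<sigma> * (w k - w (Suc k))) = 6 * \<sigma> * (w 1 - w n)"
    using sum_Suc_diff'[of 1 n "\<lambda>k. - w k"] n by (simp add: sum_distrib_left[symmetric])
  also have "\<dots> \<le> 6 * \<sigma> * 1" using \<sigma> wm[OF n] by (intro mult_left_mono) (auto simp: w_def)
  finally show ?thesis by (simp add: \<sigma>_def s_def)
qed

lemma psum_convergent:
  assumes \<alpha>: "0 < \<alpha>" and x: "0 < sig x"
  shows "convergent (\<lambda>n. psum \<alpha> n x)"
proof -
  define f where "f k = of_real (real (Suc k) powr (- \<alpha>)) * cis (real (Suc k) * x)" for k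
  have "summable f"
    unfolding summable_Cauchy
  proof (intro allI impI)
    fix e :: real assume e: "0 < e"
    have "((\<lambda>m. 4 * (1 / sig x) * real (Suc m) powr (- \<alpha>)) \<longlongrightarrow> 4 * (1 / sig x) * 0) sequentially"
      using \<alpha> by (intro tendsto_mult_left tendsto_neg_powr filterlim_compose[OF filterlim_real_sequentially filterlim_Suc]) auto
    then have "eventually (\<lambda>m. 4 * (1 / sig x) * real (Suc m) powr (- \<alpha>) < e) sequentially"
      using e by (auto dest: order_tendstoD)
    then obtain N where N: "\<And>m. N \<le> m \<Longrightarrow> 4 * (1 / sig x) * real (Suc m) powr (- \<alpha>) < e"
      by (auto simp: eventually_sequentially)
    have "norm (sum f {m..<n}) < e" if m: "N \<le> m" for m n
    proof (cases "m < n")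
      case True
      have "sum f {m..<n} = (\<Sum>k=Suc m..<Suc n. of_real (real k powr (- \<alpha>)) * cis (real k * x))"
        unfolding f_def by (rule sum.shift_bounds_Suc_ivl[symmetric])
      \<comment> \<open>Dirichlet's test in Cauchy form. \<open>norm_abel_sum\<close> wants an
        increasing comparison sequence, while the weights decrease; their reflection at the initial
        value has the same increments up to sign and still bounds the weights.\<close>
      also have "norm \<dots> \<le> 2 * (2 * real (Suc m) powr (- \<alpha>) - real (Suc n - 1) powr (- \<alpha>)) * (1 / sig x)"
      proof (rule norm_abel_sum[where B = "\<lambda>_. 1 / sig x" and \<psi> = "\<lambda>k. 2 * real (Suc m) powr (- \<alpha>) - real k powr (- \<alpha>)"])
        show "norm (\<Sum>k=Suc m..<j. cis (real k * x)) \<le> 1 / sig x" for j by (rule norm_sum_cis_le[OF x])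
        fix k assume k: "Suc m \<le> k"
        have d: "real (Suc k) powr (- \<alpha>) \<le> real k powr (- \<alpha>)" using k \<alpha> by (intro powr_mono2') auto
        then show "norm (complex_of_real (real (Suc k) powr (- \<alpha>)) - of_real (real k powr (- \<alpha>)))
          \<le> 2 * real (Suc m) powr (- \<alpha>) - real (Suc k) powr (- \<alpha>) - (2 * real (Suc m) powr (- \<alpha>) - real k powr (- \<alpha>))"
          by (simp only: of_real_diff[symmetric] norm_of_real abs_of_nonpos diff_le_0_iff_le)
        have "real k powr (- \<alpha>) \<le> real (Suc m) powr (- \<alpha>)" using k \<alpha> by (intro powr_mono2') auto
        then show "norm (complex_of_real (real k powr (- \<alpha>))) \<le> 2 * real (Suc m) powr (- \<alpha>) - real k powr (- \<alpha>)" by simp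
      qed (use True in \<open>auto simp: mono_def\<close>)
      also have "\<dots> \<le> 2 * (2 * real (Suc m) powr (- \<alpha>)) * (1 / sig x)"
        using x by (intro mult_right_mono mult_left_mono) auto
      also have "\<dots> < e" using N[OF m] by (simp add: mult_ac)
      finally show ?thesis .
    qed (use e in simp)
    then show "\<exists>N. \<forall>m\<ge>N. \<forall>n. norm (sum f {m..<n}) < e" by blast
  qed
  then have "convergent (\<lambda>n. sum f {..<n})" by (simp only: summable_iff_convergent)
  moreover have "(\<lambda>n. sum f {..<n}) = (\<lambda>n. psum \<alpha> n x)"
  proof
    show "sum f {..<n} = psum \<alpha> n x" for n
      unfolding psum_def f_def One_nat_def lessThan_atLeast0
      by (rule sum.shift_bounds_Suc_ivl[symmetric])
  qed
  ultimately show ?thesis by (rule subst[where P = convergent, rotated])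
qed

text \<open>Symmetric partial sums of the kernel. The index \<open>0\<close> may stay in the range,
  since \<open>1 / ipow \<alpha> 0\<close> is \<open>0\<close>.\<close>

definition wsum :: "real \<Rightarrow> nat \<Rightarrow> real \<Rightarrow> complex" where
  "wsum \<alpha> n x = (\<Sum>k\<in>{- int n..int n}. (1 / ipow \<alpha> k) * cis (of_int k * x))"

lemma wsum_psum: "wsum \<alpha> n x = cis (- (pi * \<alpha> / 2)) * psum \<alpha> n x + cnj (cis (- (pi * \<alpha> / 2)) * psum \<alpha> n x)"
proof -
  have a: "1 / ipow \<alpha> (int k) = cis (- (pi * \<alpha> / 2)) * of_real (real k powr (- \<alpha>))" if "1 \<le> k" for k
  proof -
    have i: "ipow \<alpha> (int k) = of_real (real k powr \<alpha>) * cis (pi * \<alpha> / 2)" using that by (intro ipow_eq) simp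
    show ?thesis unfolding i divide_inverse mult_1 inverse_mult_distrib cis_inverse powr_minus of_real_inverse by (rule mult.commute)
  qed
  have "wsum \<alpha> n x = (\<Sum>k=1..<Suc n. (1 / ipow \<alpha> (int k)) * cis (real k * x)) + (\<Sum>k=1..<Suc n. (1 / ipow \<alpha> (- int k)) * cis (- (real k * x)))"
  proof -
    have "of_int (int k) * x = real k * x" "of_int (- int k) * x = - (real k * x)" for k by simp_all
    note s = this
    show ?thesis
      unfolding wsum_def sum_symmetric_int[of "\<lambda>k. (1 / ipow \<alpha> k) * cis (of_int k * x)" n, simplified ipow_0 div_by_0 mult_zero_left, OF refl] s ..
  qed
  also have "(\<Sum>k=1..<Suc n. (1 / ipow \<alpha> (- int k)) * cis (- (real k * x))) = cnj (\<Sum>k=1..<Suc n. (1 / ipow \<alpha> (int k)) * cis (real k * x))"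
    by (simp add: ipow_minus cis_cnj)
  also have "(\<Sum>k=1..<Suc n. (1 / ipow \<alpha> (int k)) * cis (real k * x)) = cis (- (pi * \<alpha> / 2)) * psum \<alpha> n x"
    unfolding psum_def sum_distrib_left by (intro sum.cong) (auto simp: a)
  finally show ?thesis .
qed

lemma weyl_kernel_eq: "weyl_kernel \<alpha> x = lim (\<lambda>n. wsum \<alpha> n x)"
proof -
  have "(\<Sum>k\<in>{- int n..int n} - {0}. cis (of_int k * x) / (\<i> * of_int k) powr of_real \<alpha>) = wsum \<alpha> n x" for n
    unfolding wsum_def ipow_def[symmetric]
    by (rule sum.mono_neutral_cong_left) auto
  then show ?thesis by (simp add: weyl_kernel_def)
qed

lemma wsum_measurable [measurable]: "wsum \<alpha> n \<in> borel_measurable borel"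
  unfolding wsum_def[abs_def] by (intro borel_measurable_continuous_onI continuous_intros)

lemma weyl_kernel_measurable [measurable]: "weyl_kernel \<alpha> \<in> borel_measurable borel"
  unfolding weyl_kernel_eq[abs_def] by (rule borel_measurable_lim_metric) measurable

lemma weyl_kernel_periodic: "weyl_kernel \<alpha> (x + 2 * pi) = weyl_kernel \<alpha> x"
proof -
  have "cis (of_int k * (x + 2 * pi)) = cis (of_int k * x)" for k :: int
    using cis_multiple_2pi[of "of_int k"] by (simp add: distrib_left cis_mult[symmetric] mult_ac)
  then show ?thesis by (simp add: weyl_kernel_eq wsum_def)
qed

context
  fixes \<alpha> :: real
  assumes \<alpha>: "0 < \<alpha>" "\<alpha> \<le> 1"
begin

lemma norm_wsum_le: "0 < sig x \<Longrightarrow> norm (wsum \<alpha> n x) \<le> 20 * sig x powr (\<alpha> / 2 - 1)"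
  unfolding wsum_psum
  by (rule order_trans[OF norm_triangle_ineq]) (use norm_psum_le[OF \<alpha>, of x n] in \<open>simp add: norm_mult\<close>)

lemma wsum_tendsto:
  assumes x: "0 < sig x"
  shows "(\<lambda>n. wsum \<alpha> n x) \<longlonglongrightarrow> weyl_kernel \<alpha> x"
proof -
  obtain L where "(\<lambda>n. psum \<alpha> n x) \<longlonglongrightarrow> L" using psum_convergent[OF \<alpha>(1) x] by (auto simp: convergent_def)
  then have "(\<lambda>n. wsum \<alpha> n x) \<longlonglongrightarrow> cis (- (pi * \<alpha> / 2)) * L + cnj (cis (- (pi * \<alpha> / 2)) * L)"
    unfolding wsum_psum by (intro tendsto_intros)
  then show ?thesis unfolding weyl_kernel_eq by (simp add: limI)
qed

text \<open>The exponent lies strictly between \<open>-1\<close> and \<open>0\<close>. As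
  \<open>wker 1\<close> is at least \<open>1 / 2\<close>, inserting it reduces the claim to
  \<open>nn_integral_sig_wker\<close>. The function serves as majorant of all the partial sums of
  the kernel.\<close>

lemma integrable_sig_powr: "integrable circ (\<lambda>x. 20 * sig x powr (\<alpha> / 2 - 1))"
proof (rule integrableI_nonneg)
  define s where "s = 1 - \<alpha> / 2"
  have s: "0 < s" "s < 1" using \<alpha> by (auto simp: s_def)
  have "(\<integral>\<^sup>+x. ennreal (20 * sig x powr (\<alpha> / 2 - 1)) \<partial>circ) \<le> (\<integral>\<^sup>+x. ennreal 40 * ennreal (sig x powr (- s) * wker 1 x) \<partial>circ)"
  proof (rule nn_integral_mono)
    fix x
    have "1 / 2 \<le> wker 1 x" by (simp add: wker_def sig_def field_simps add_pos_nonneg)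
    then have "20 * sig x powr (- s) \<le> 40 * (sig x powr (- s) * wker 1 x)"
      using mult_left_mono[of "1 / 2" "wker 1 x" "40 * sig x powr (- s)"] by simp
    then show "ennreal (20 * sig x powr (\<alpha> / 2 - 1)) \<le> ennreal 40 * ennreal (sig x powr (- s) * wker 1 x)"
      using wker_pos[of 1 x] by (subst ennreal_mult[symmetric]) (auto simp: s_def intro!: ennreal_leI)
  qed
  also have "\<dots> = ennreal 40 * (\<integral>\<^sup>+x. ennreal (sig x powr (- s) * wker 1 x) \<partial>circ)" by (rule nn_integral_cmult) simp
  also have "\<dots> < \<infinity>"
    using order_le_less_trans[OF nn_integral_sig_wker[OF s, of 1] ennreal_less_top]
    by (simp add: ennreal_mult_less_top del: ennreal_numeral)
  finally show "(\<integral>\<^sup>+x. ennreal (20 * sig x powr (\<alpha> / 2 - 1)) \<partial>circ) < \<infinity>" .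
qed auto

lemma integrable_weyl_kernel: "integrable circ (weyl_kernel \<alpha>)"
proof (rule Bochner_Integration.integrable_bound[OF integrable_sig_powr])
  show "AE x in circ. norm (weyl_kernel \<alpha> x) \<le> norm (20 * sig x powr (\<alpha> / 2 - 1))"
    using AE_circ[OF sig_pos_AE]
  proof eventually_elim
    case (elim x)
    have "norm (weyl_kernel \<alpha> x) \<le> 20 * sig x powr (\<alpha> / 2 - 1)"
      by (rule tendsto_upperbound[OF tendsto_norm[OF wsum_tendsto[OF elim]]])
        (auto intro!: always_eventually norm_wsum_le elim)
    then show ?case by simp
  qed
qed simp

text \<open>The coefficients of the partial sums are eventually constant, and dominated convergence
  passes them to the limit. For \<open>k = 0\<close> both sides are \<open>0\<close>.\<close>

lemma fc1_weyl_kernel: "fc1 (weyl_kernel \<alpha>) k = of_real (2 * pi) / ipow \<alpha> k"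
proof -
  have "(\<lambda>n. fc1 (wsum \<alpha> n) k) \<longlonglongrightarrow> fc1 (weyl_kernel \<alpha>) k"
    unfolding fc1_def
  proof (rule integral_dominated_convergence[OF _ _ integrable_sig_powr])
    show "AE x in circ. (\<lambda>n. wsum \<alpha> n x * cis (- (of_int k * x))) \<longlonglongrightarrow> weyl_kernel \<alpha> x * cis (- (of_int k * x))"
      using AE_circ[OF sig_pos_AE] by eventually_elim (intro tendsto_intros wsum_tendsto)
    show "AE x in circ. norm (wsum \<alpha> n x * cis (- (of_int k * x))) \<le> 20 * sig x powr (\<alpha> / 2 - 1)" for n
      using AE_circ[OF sig_pos_AE] by eventually_elim (simp add: norm_mult norm_wsum_le)
  qed measurable
  moreover have "eventually (\<lambda>n. fc1 (wsum \<alpha> n) k = of_real (2 * pi) / ipow \<alpha> k) sequentially"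
    using eventually_ge_at_top[of "nat \<bar>k\<bar>"]
    by eventually_elim (simp only: wsum_def[abs_def] fc1_trig_polynomial nat_le_iff if_True, simp)
  ultimately show ?thesis by (rule LIMSEQ_unique[OF _ tendsto_eventually])
qed

end

section \<open>Translations and convolution with the Weyl kernel\<close>

lemma fc1_shift:
  fixes u :: "real \<Rightarrow> complex"
  assumes u: "integrable circ u" and um: "u \<in> borel_measurable borel" and per: "\<And>x. u (x + 2 * pi) = u x"
  shows "integrable circ (\<lambda>x. u (x + a))" "fc1 (\<lambda>x. u (x + a)) k = cis (of_int k * a) * fc1 u k"
proof -
  note [measurable] = um
  have 1: "(\<integral>\<^sup>+x. ennreal (norm (u (x + a))) \<partial>circ) = (\<integral>\<^sup>+x. ennreal (norm (u x)) \<partial>circ)"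
    by (rule nn_integral_circ_shift[of "\<lambda>x. ennreal (norm (u x))"]) (simp_all add: per)
  show int: "integrable circ (\<lambda>x. u (x + a))"
    using u 1 unfolding integrable_iff_bounded by simp
  \<comment> \<open>The translation invariance available for complex functions is that on the torus;
    functions of the first variable alone embed the circle there, at the cost of a factor
    \<open>2 * pi\<close>.\<close>
  have C: "(LINT z|(circ \<Otimes>\<^sub>M circ). f (fst z)) = of_real (2 * pi) * (LINT x|circ. f x)" if f: "f \<in> borel_measurable borel" "integrable circ f" for f :: "real \<Rightarrow> complex"
  proof -
    have fm: "(\<lambda>z. f (fst z)) \<in> borel_measurable (circ \<Otimes>\<^sub>M circ)"
      unfolding measurable_circ2 by (rule measurable_compose[OF fst_borel f(1)])
    have "integrable (circ \<Otimes>\<^sub>M circ) (\<lambda>z. f (fst z))"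
    proof (rule integrableI_bounded[OF fm])
      have "(\<integral>\<^sup>+z. ennreal (norm (f (fst z))) \<partial>(circ \<Otimes>\<^sub>M circ)) = (\<integral>\<^sup>+x. \<integral>\<^sup>+y. ennreal (norm (f x)) \<partial>circ \<partial>circ)"
        using fm by (subst circ.nn_integral_fst[symmetric]) auto
      also have "\<dots> = (\<integral>\<^sup>+x. ennreal (norm (f x)) \<partial>circ) * emeasure circ UNIV"
        using f(1) by (simp add: nn_integral_multc)
      also have "\<dots> < \<infinity>" using f(2) by (simp add: integrable_iff_bounded emeasure_circ ennreal_mult_less_top)
      finally show "(\<integral>\<^sup>+z. ennreal (norm (f (fst z))) \<partial>(circ \<Otimes>\<^sub>M circ)) < \<infinity>" .
    qed
    from circ2.integral_fst'[OF this] have "(LINT z|(circ \<Otimes>\<^sub>M circ). f (fst z)) = (LINT x|circ. LINT y|circ. f x)" by simp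
    also have "\<dots> = of_real (2 * pi) * (LINT x|circ. f x)"
      using emeasure_circ by (simp add: measure_def scaleR_conv_of_real)
    finally show ?thesis .
  qed
  define e where "e x = cis (- (of_int k * x))" for x
  have [measurable]: "e \<in> borel_measurable borel" unfolding e_def by measurable
  define F where "F z = u (fst z) * e (fst z)" for z :: "real \<times> real"
  have eper: "e (x + 2 * pi) = e x" for x
  proof -
    have "e (x + 2 * pi) = e x * cis (2 * pi * of_int (- k))"
      unfolding e_def cis_mult by (rule arg_cong[where f = cis]) (simp add: algebra_simps)
    also have "cis (2 * pi * of_int (- k)) = 1" by (rule cis_multiple_2pi) simp
    finally show ?thesis by simp
  qed
  have "(LINT z|(circ \<Otimes>\<^sub>M circ). F (z + (a, 0))) = (LINT z|(circ \<Otimes>\<^sub>M circ). F z)"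
    by (rule integral_circ2_shift(1)) (simp_all add: F_def periodic2_def per eper)
  then have "of_real (2 * pi) * (LINT x|circ. u (x + a) * e (x + a)) = of_real (2 * pi) * (LINT x|circ. u x * e x)"
    unfolding F_def using C[of "\<lambda>x. u (x + a) * e (x + a)"] C[of "\<lambda>x. u x * e x"]
      integrable_mult_cis[OF u, of "- of_int k"] integrable_mult_cis[OF int, of "- of_int k"]
  proof -
    have e': "e (x + a) = cis (- (of_int k * a)) * e x" for x
      unfolding e_def cis_mult by (rule arg_cong[where f = cis]) (simp add: algebra_simps)
    have i1: "integrable circ (\<lambda>x. u x * e x)" using integrable_mult_cis[OF u, of "- of_int k"] by (simp add: e_def)
    have "integrable circ (\<lambda>x. cis (- (of_int k * a)) * (u (x + a) * e x))"
      using integrable_mult_cis[OF int, of "- of_int k"] by (intro integrable_mult_right) (simp add: e_def)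
    then have i2: "integrable circ (\<lambda>x. u (x + a) * e (x + a))" unfolding e' by (simp add: mult_ac)
    assume "(LINT z|(circ \<Otimes>\<^sub>M circ). u (fst (z + (a, 0))) * e (fst (z + (a, 0)))) = (LINT z|(circ \<Otimes>\<^sub>M circ). u (fst z) * e (fst z))"
    then show ?thesis using C[OF _ i1] C[OF _ i2] by simp
  qed
  then have eq: "(LINT x|circ. u (x + a) * e (x + a)) = fc1 u k" by (simp add: fc1_def e_def)
  have "u (x + a) * cis (- (of_int k * x)) = cis (of_int k * a) * (u (x + a) * e (x + a))" for x
  proof -
    have "cis (- (of_int k * x)) = cis (of_int k * a) * e (x + a)"
      unfolding e_def cis_mult by (rule arg_cong[where f = cis]) (simp add: algebra_simps)
    then show ?thesis by simp
  qed
  then have "fc1 (\<lambda>x. u (x + a)) k = (LINT x|circ. cis (of_int k * a) * (u (x + a) * e (x + a)))" by (simp only: fc1_def)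
  also have "\<dots> = cis (of_int k * a) * fc1 u k" unfolding eq[symmetric] by (rule integral_mult_right_zero)
  finally show "fc1 (\<lambda>x. u (x + a)) k = cis (of_int k * a) * fc1 u k" .
qed

lemma integral_circ_lborel:
  fixes v :: "real \<Rightarrow> complex"
  assumes [measurable]: "v \<in> borel_measurable borel"
  shows "(LINT x|circ. v x) = (LINT x:{0..2 * pi}|lborel. v x)"
    "integrable circ v \<longleftrightarrow> set_integrable lborel {0..2 * pi} v"
proof -
  show "(LINT x|circ. v x) = (LINT x:{0..2 * pi}|lborel. v x)"
    unfolding circ_def ennreal_indicator[symmetric] set_lebesgue_integral_def by (rule integral_density) auto
  show "integrable circ v \<longleftrightarrow> set_integrable lborel {0..2 * pi} v"
    unfolding circ_def ennreal_indicator[symmetric] set_integrable_def by (rule integrable_density) auto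
qed

lemma set_integral_lborel:
  fixes u v :: "real \<Rightarrow> complex"
  assumes S: "S \<in> sets borel" and v: "v \<in> borel_measurable borel" and eq: "AE x in lborel. x \<in> S \<longrightarrow> u x = v x"
  shows "(LINT x:S|lebesgue. u x) = (LINT x:S|lborel. v x)"
    "set_integrable lebesgue S u \<longleftrightarrow> set_integrable lborel S v"
proof -
  note [measurable] = v S
  have m: "(\<lambda>x. indicator S x *\<^sub>R v x) \<in> borel_measurable lborel" by measurable
  have ae: "AE x in lebesgue. indicator S x *\<^sub>R u x = indicator S x *\<^sub>R v x"
    using AE_completion[OF eq] by eventually_elim (auto simp: indicator_def)
  have vl: "(\<lambda>x. indicator S x *\<^sub>R v x) \<in> borel_measurable lebesgue"
    by (rule measurable_completion[OF m])
  have u: "(\<lambda>x. indicator S x *\<^sub>R u x) \<in> borel_measurable lebesgue"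
    by (rule borel_measurable_AE[OF vl]) (use ae in \<open>eventually_elim, simp only:\<close>)
  have "(LINT x:S|lebesgue. u x) = (LINT x|lebesgue. indicator S x *\<^sub>R v x)"
    unfolding set_lebesgue_integral_def by (rule integral_cong_AE[OF u vl ae])
  also have "\<dots> = (LINT x:S|lborel. v x)" unfolding set_lebesgue_integral_def by (rule integral_completion[OF m])
  finally show "(LINT x:S|lebesgue. u x) = (LINT x:S|lborel. v x)" .
  have "set_integrable lebesgue S u \<longleftrightarrow> integrable lebesgue (\<lambda>x. indicator S x *\<^sub>R v x)"
    unfolding set_integrable_def by (rule integrable_cong_AE[OF u vl ae])
  also have "\<dots> \<longleftrightarrow> set_integrable lborel S v" unfolding set_integrable_def by (rule integrable_completion[OF m])
  finally show "set_integrable lebesgue S u \<longleftrightarrow> set_integrable lborel S v" .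
qed

lemma set_integral_circ:
  fixes u v :: "real \<Rightarrow> complex"
  assumes v: "v \<in> borel_measurable borel" and eq: "AE x in lborel. u x = v x"
  shows "(LINT x:{0..2 * pi}|lebesgue. u x) = (LINT x|circ. v x)"
    "set_integrable lebesgue {0..2 * pi} u \<longleftrightarrow> integrable circ v"
proof -
  have eq': "AE x in lborel. x \<in> {0..2 * pi} \<longrightarrow> u x = v x" using eq by eventually_elim simp
  note * = set_integral_lborel[OF _ v eq', simplified]
  show "(LINT x:{0..2 * pi}|lebesgue. u x) = (LINT x|circ. v x)" unfolding integral_circ_lborel[OF v] by (rule *)
  show "set_integrable lebesgue {0..2 * pi} u \<longleftrightarrow> integrable circ v" unfolding integral_circ_lborel[OF v] by (rule *)
qed

lemma weyl_integral_circ: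
  assumes v: "v \<in> borel_measurable borel" and eq: "AE x in lborel. u x = v x"
  shows "weyl_integral \<alpha> u x = (LINT t|circ. v t * weyl_kernel \<alpha> (x - t)) / (2 * pi)"
proof -
  note [measurable] = v
  have "(LINT t:{0..2 * pi}|lebesgue. u t * weyl_kernel \<alpha> (x - t)) = (LINT t|circ. v t * weyl_kernel \<alpha> (x - t))"
  proof (rule set_integral_circ(1))
    show "(\<lambda>t. v t * weyl_kernel \<alpha> (x - t)) \<in> borel_measurable borel" by measurable
    show "AE t in lborel. u t * weyl_kernel \<alpha> (x - t) = v t * weyl_kernel \<alpha> (x - t)"
      using eq by eventually_elim simp
  qed
  then show ?thesis by (simp add: weyl_integral_def)
qed

lemma convolution_fc1:
  fixes v :: "real \<Rightarrow> complex"
  assumes \<alpha>: "0 < \<alpha>" "\<alpha> \<le> 1" and v: "v \<in> borel_measurable borel" "integrable circ v"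
    and F_def: "F = (\<lambda>x. (LINT t|circ. v t * weyl_kernel \<alpha> (x - t)) / (2 * pi))"
  shows "F \<in> borel_measurable borel" "integrable circ F" "F (x + 2 * pi) = F x" "fc1 F k = fc1 v k / ipow \<alpha> k"
proof -
  note [measurable] = v(1)
  define H where "H z = v (snd z) * weyl_kernel \<alpha> (fst z - snd z)" for z
  have Hm: "H \<in> borel_measurable borel" unfolding H_def by measurable
  have shift_ker: "integrable circ (\<lambda>x. weyl_kernel \<alpha> (x - t))" "fc1 (\<lambda>x. weyl_kernel \<alpha> (x - t)) k = cis (- (of_int k * t)) * fc1 (weyl_kernel \<alpha>) k" for t k
    using fc1_shift(1)[OF integrable_weyl_kernel[OF \<alpha>] weyl_kernel_measurable weyl_kernel_periodic, of "- t"]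
      fc1_shift(2)[OF integrable_weyl_kernel[OF \<alpha>] weyl_kernel_measurable weyl_kernel_periodic, of "- t" k] by simp_all
  \<comment> \<open>Integrability is checked with the kernel integrated first: its norm has the same
    integral for every translation, so the double integral is a product.\<close>
  have "integrable (circ \<Otimes>\<^sub>M circ) (\<lambda>z. H (snd z, fst z))"
  proof (rule integrableI_bounded)
    have sw: "(\<lambda>z. H (snd z, fst z)) \<in> borel_measurable borel" unfolding H_def by measurable
    then show "(\<lambda>z. H (snd z, fst z)) \<in> borel_measurable (circ \<Otimes>\<^sub>M circ)" by simp
    define B where "B = (\<integral>\<^sup>+x. ennreal (norm (weyl_kernel \<alpha> x)) \<partial>circ)"
    have "(\<integral>\<^sup>+z. ennreal (norm (H (snd z, fst z))) \<partial>(circ \<Otimes>\<^sub>M circ)) = (\<integral>\<^sup>+t. \<integral>\<^sup>+x. ennreal (norm (H (x, t))) \<partial>circ \<partial>circ)"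
      using sw by (subst circ.nn_integral_fst[symmetric]) auto
    also have "\<dots> = (\<integral>\<^sup>+t. ennreal (norm (v t)) * B \<partial>circ)"
    proof (rule nn_integral_cong)
      fix t
      have "(\<integral>\<^sup>+x. ennreal (norm (weyl_kernel \<alpha> (x + (- t)))) \<partial>circ) = B"
        unfolding B_def by (rule nn_integral_circ_shift[of "\<lambda>x. ennreal (norm (weyl_kernel \<alpha> x))"]) (simp_all add: weyl_kernel_periodic)
      then show "(\<integral>\<^sup>+x. ennreal (norm (H (x, t))) \<partial>circ) = ennreal (norm (v t)) * B"
        by (simp add: H_def norm_mult ennreal_mult nn_integral_cmult)
    qed
    also have "\<dots> = (\<integral>\<^sup>+t. ennreal (norm (v t)) \<partial>circ) * B" by (rule nn_integral_multc) simp
    also have "\<dots> < \<infinity>" using v(2) integrable_weyl_kernel[OF \<alpha>] by (simp add: integrable_iff_bounded B_def ennreal_mult_less_top)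
    finally show "(\<integral>\<^sup>+z. ennreal (norm (H (snd z, fst z))) \<partial>(circ \<Otimes>\<^sub>M circ)) < \<infinity>" .
  qed
  note sint = this
  have Hint: "integrable (circ \<Otimes>\<^sub>M circ) H" using fc2_swap(1)[OF sint] by simp
  have F0: "F = (\<lambda>x. fc1 (\<lambda>t. H (x, t)) 0 / (2 * pi))" by (simp add: F_def H_def fc1_def)
  have Fi: "integrable circ F" unfolding F0 by (intro Bochner_Integration.integrable_divide fc2_iterated(1)[OF Hint])
  then show "integrable circ F" .
  then have "F \<in> borel_measurable circ" by simp
  then show "F \<in> borel_measurable borel" by simp
  show "F (x + 2 * pi) = F x"
  proof -
    have "weyl_kernel \<alpha> (x + 2 * pi - t) = weyl_kernel \<alpha> (x - t)" for t
      using weyl_kernel_periodic[of \<alpha> "x - t"] by (simp add: algebra_simps)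
    then show ?thesis by (simp add: F_def)
  qed
  have "fc1 F k = fc2 H k 0 / (2 * pi)"
    unfolding F0 fc2_iterated(2)[OF Hint] by (simp add: fc1_def[of _ k])
  also have "fc2 H k 0 = fc2 (\<lambda>z. H (snd z, fst z)) 0 k" using fc2_swap(2)[OF Hint] by simp
  also have "\<dots> = fc1 (\<lambda>t. fc1 (\<lambda>x. H (x, t)) k) 0" by (subst fc2_iterated(2)[OF sint]) simp
  also have "(\<lambda>t. fc1 (\<lambda>x. H (x, t)) k) = (\<lambda>t. v t * cis (- (of_int k * t)) * fc1 (weyl_kernel \<alpha>) k)"
  proof
    fix t
    have "fc1 (\<lambda>x. H (x, t)) k = v t * fc1 (\<lambda>x. weyl_kernel \<alpha> (x - t)) k"
      unfolding fc1_def H_def by (simp add: mult.assoc)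
    then show "fc1 (\<lambda>x. H (x, t)) k = v t * cis (- (of_int k * t)) * fc1 (weyl_kernel \<alpha>) k" by (simp add: shift_ker)
  qed
  also have "fc1 (\<lambda>t. v t * cis (- (of_int k * t)) * fc1 (weyl_kernel \<alpha>) k) 0 = fc1 v k * fc1 (weyl_kernel \<alpha>) k"
    unfolding fc1_def[of _ 0] fc1_def[of v] by simp
  finally show "fc1 F k = fc1 v k / ipow \<alpha> k" by (simp add: fc1_weyl_kernel[OF \<alpha>])
qed

subsection \<open>Weyl derivatives and Fourier coefficients in one variable\<close>

definition primitive :: "(real \<Rightarrow> complex) \<Rightarrow> (real \<Rightarrow> complex) \<Rightarrow> bool" where
  "primitive G D \<longleftrightarrow> (\<forall>a b. a \<le> b \<longrightarrow> set_integrable lborel {a..b} D \<and> G b - G a = (LINT t:{a..b}|lborel. D t))"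

lemma primitive_continuous:
  assumes "primitive G D"
  shows "continuous_on UNIV G"
proof -
  have "continuous_on {- m<..<m} G" for m :: real
  proof (rule continuous_on_subset[of "{- m..m}"])
    show "continuous_on {- m..m} G"
    proof (cases "- m \<le> m")
      case True
      have "set_integrable lborel {- m..m} D" using assms True by (simp add: primitive_def)
      then have "D integrable_on {- m..m}" by (rule set_borel_integral_eq_integral(1))
      then have "continuous_on {- m..m} (\<lambda>x. G (- m) + integral {- m..x} D)"
        by (intro continuous_intros indefinite_integral_continuous_1)
      moreover have "G (- m) + integral {- m..x} D = G x" if "x \<in> {- m..m}" for x
      proof -
        have "- m \<le> x" using that by simp
        then have "set_integrable lborel {- m..x} D" "G x - G (- m) = (LINT t:{- m..x}|lborel. D t)"
          using assms by (auto simp: primitive_def)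
        then show ?thesis using set_borel_integral_eq_integral(2)[of "{- m..x}" D] by (simp add: algebra_simps)
      qed
      ultimately show ?thesis by (subst (asm) continuous_on_cong[OF refl]) auto
    qed simp
  qed auto
  then have "continuous_on (\<Union>m. {- m<..<m}) G" by (intro continuous_on_open_UN) auto
  moreover have "(\<Union>m. {- m<..<m}) = (UNIV :: real set)"
  proof -
    have "x \<in> {- (\<bar>x\<bar> + 1)<..<\<bar>x\<bar> + 1}" for x :: real by auto
    then show ?thesis by blast
  qed
  ultimately show ?thesis by simp
qed

lemma AE_eq_continuous:
  fixes f g :: "real \<Rightarrow> complex"
  assumes "continuous_on UNIV f" "continuous_on UNIV g" "AE x in lborel. f x = g x"
  shows "f x = g x"
proof (rule ccontr)
  assume n: "f x \<noteq> g x"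
  define S where "S = {x. f x \<noteq> g x}"
  have "open S" unfolding S_def by (rule open_Collect_neq[OF assms(1,2)])
  moreover have "S \<noteq> {}" using n by (auto simp: S_def)
  ultimately have "\<not> negligible S" by (rule open_not_negligible)
  moreover have "AE x in lebesgue. x \<notin> S" using AE_completion[OF assms(3)] by eventually_elim (simp add: S_def)
  then have "negligible S"
    using \<open>open S\<close> by (simp add: negligible_iff_null_sets AE_iff_null_sets[symmetric] lmeasurable_open)
  ultimately show False by simp
qed

lemma set_integral_shift:
  fixes D :: "real \<Rightarrow> complex"
  shows "(LINT t:{a..b}|lborel. D (t + c)) = (LINT t:{a + c..b + c}|lborel. D t)"
    "set_integrable lborel {a..b} (\<lambda>t. D (t + c)) \<longleftrightarrow> set_integrable lborel {a + c..b + c} D"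
proof -
  have i: "indicator {a + c..b + c} (c + 1 * t) = (indicator {a..b} t :: real)" for t by (auto simp: indicator_def)
  show "(LINT t:{a..b}|lborel. D (t + c)) = (LINT t:{a + c..b + c}|lborel. D t)"
    unfolding set_lebesgue_integral_def by (subst (2) lborel_integral_real_affine[where c = 1 and t = c]) (simp_all only: i, simp_all add: add.commute)
  show "set_integrable lborel {a..b} (\<lambda>t. D (t + c)) \<longleftrightarrow> set_integrable lborel {a + c..b + c} D"
    unfolding set_integrable_def
    by (subst (2) lborel_integrable_real_affine_iff[where c = 1 and t = c, symmetric]) (simp_all only: i, simp_all add: add.commute)
qed

text \<open>Almost everywhere periodicity of the continuous \<open>G\<close> holds everywhere. Hence
  \<open>D (x + 2 * pi) - D x\<close> has zero integral over every interval, and truncation to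
  bounded intervals allows \<open>AE_zero_if_interval_integrals_zero\<close> to be applied.\<close>

lemma primitive_periodic:
  assumes D: "D \<in> borel_measurable borel" and GD: "primitive G D" and per: "AE x in lborel. G (x + 2 * pi) = G x"
  shows "G (x + 2 * pi) = G x" "AE x in lborel. D (x + 2 * pi) = D x"
proof -
  note [measurable] = D
  have c: "continuous_on UNIV (\<lambda>x. G (x + 2 * pi))"
    by (rule continuous_on_compose2[OF primitive_continuous[OF GD]]) (auto intro!: continuous_intros)
  show P: "G (x + 2 * pi) = G x" for x by (rule AE_eq_continuous[OF c primitive_continuous[OF GD] per])
  define u where "u x = D (x + 2 * pi) - D x" for x
  have si: "set_integrable lborel {a..b} D" for a b
    using GD by (cases "a \<le> b") (auto simp: primitive_def set_integrable_def)
  have si': "set_integrable lborel {a..b} (\<lambda>x. D (x + 2 * pi))" for a b using si set_integral_shift(2) by simp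
  have iu: "set_integrable lborel {a..b} u" for a b
    unfolding u_def by (rule set_integral_diff(1)[OF si' si])
  have zu: "(LINT x:{a..b}|lborel. u x) = 0" if "a \<le> b" for a b
  proof -
    have "(LINT x:{a..b}|lborel. u x) = (LINT x:{a + 2 * pi..b + 2 * pi}|lborel. D x) - (LINT x:{a..b}|lborel. D x)"
      unfolding u_def set_integral_diff(2)[OF si' si] set_integral_shift(1) ..
    also have "\<dots> = (G (b + 2 * pi) - G (a + 2 * pi)) - (G b - G a)"
      using GD that by (simp add: primitive_def)
    finally show ?thesis by (simp add: P)
  qed
  have "AE x in lborel. indicator {- real n..real n} x *\<^sub>R u x = 0" for n
  proof (rule AE_zero_if_interval_integrals_zero)
    show "sigma_finite_measure (lborel :: real measure)" by (rule lborel.sigma_finite_measure_axioms)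
    show "integrable lborel (\<lambda>x. indicator {- real n..real n} x *\<^sub>R u x)" using iu[of "- real n" "real n"] by (simp add: set_integrable_def)
    fix a b :: real
    have "(LINT x:{a<..<b}|lborel. indicator {- real n..real n} x *\<^sub>R u x) = (LINT x:{max a (- real n)..min b (real n)}|lborel. u x)"
      unfolding set_lebesgue_integral_def
    proof (rule integral_cong_AE)
      show "AE x in lborel. indicator {a<..<b} x *\<^sub>R indicator {- real n..real n} x *\<^sub>R u x = indicator {max a (- real n)..min b (real n)} x *\<^sub>R u x"
        using AE_lborel_singleton[of a] AE_lborel_singleton[of b] by eventually_elim (auto simp: indicator_def)
    qed (auto simp: u_def)
    also have "\<dots> = 0" using zu by (cases "max a (- real n) \<le> min b (real n)") (auto simp: set_lebesgue_integral_def)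
    finally show "(LINT x:{a<..<b}|lborel. indicator {- real n..real n} x *\<^sub>R u x) = 0" .
  qed simp
  then have "AE x in lborel. \<forall>n. indicator {- real n..real n} x *\<^sub>R u x = 0" unfolding AE_all_countable by blast
  then show "AE x in lborel. D (x + 2 * pi) = D x"
  proof eventually_elim
    case (elim x)
    obtain n :: nat where "\<bar>x\<bar> \<le> real n" using real_arch_simple by blast
    then have "x \<in> {- real n..real n}" by auto
    then show ?case using elim[rule_format, of n] by (simp add: u_def)
  qed
qed

lemma AE_circ_interval: "AE x in circ. 0 \<le> x \<and> x \<le> 2 * pi"
  unfolding circ_def by (subst AE_density) (auto simp: indicator_def)

lemma fc1_const: "fc1 (\<lambda>_. c) k = (if k = 0 then of_real (2 * pi) * c else 0)"
  using fc1_trig_polynomial[of "\<lambda>_. c" 0 k] by simp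

text \<open>Integration by parts for a density that is merely integrable, done as Fubini on the
  triangle \<open>t \<le> x\<close>. Integrating \<open>D t\<close> first yields the coefficient of
  \<open>G - G 0\<close>; integrating the exponential first yields
  \<open>(fc1 D k - fc1 D 0) / (\<i> * k)\<close>, where \<open>fc1 D 0 = G (2 * pi) - G 0\<close>
  vanishes.\<close>

lemma fc1_primitive:
  assumes D: "D \<in> borel_measurable borel" and GD: "primitive G D" and per: "G (2 * pi) = G 0"
  shows "integrable circ G" "integrable circ D" "fc1 D k = (\<i> * of_int k) * fc1 G k"
proof -
  note [measurable] = D
  have Gc: "continuous_on UNIV G" by (rule primitive_continuous[OF GD])
  have Gm [measurable]: "G \<in> borel_measurable borel" by (rule borel_measurable_continuous_onI[OF Gc])
  have "set_integrable lborel {0..2 * pi} G"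
    by (rule borel_integrable_atLeastAtMost') (rule continuous_on_subset[OF Gc], simp)
  then show Gi: "integrable circ G" by (simp add: integral_circ_lborel(2))
  show Di: "integrable circ D" using GD by (simp add: integral_circ_lborel(2) primitive_def)
  have D0: "fc1 D 0 = 0"
  proof -
    have "fc1 D 0 = (LINT t:{0..2 * pi}|lborel. D t)" by (simp add: fc1_def integral_circ_lborel(1))
    also have "\<dots> = G (2 * pi) - G 0" using GD by (simp add: primitive_def)
    finally show ?thesis by (simp add: per)
  qed
  show "fc1 D k = (\<i> * of_int k) * fc1 G k"
  proof (cases "k = 0")
    case True
    then show ?thesis by (simp add: D0)
  next
    case k: False
    define H where "H z = (if snd z \<le> fst z then D (snd z) else 0)" for z :: "real \<times> real"
    have Hm: "H \<in> borel_measurable borel" unfolding H_def by measurable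
    have Dp: "integrable (circ \<Otimes>\<^sub>M circ) (\<lambda>z. D (snd z))"
    proof (rule integrableI_bounded)
      have "(\<integral>\<^sup>+z. ennreal (norm (D (snd z))) \<partial>(circ \<Otimes>\<^sub>M circ)) = (\<integral>\<^sup>+x. \<integral>\<^sup>+y. ennreal (norm (D y)) \<partial>circ \<partial>circ)"
        by (subst circ.nn_integral_fst[symmetric]) auto
      also have "\<dots> < \<infinity>" using Di by (simp add: integrable_iff_bounded emeasure_circ ennreal_mult_less_top)
      finally show "(\<integral>\<^sup>+z. ennreal (norm (D (snd z))) \<partial>(circ \<Otimes>\<^sub>M circ)) < \<infinity>" .
    qed simp
    have Hi: "integrable (circ \<Otimes>\<^sub>M circ) H"
      by (rule Bochner_Integration.integrable_bound[OF Dp]) (use Hm in \<open>auto simp: H_def\<close>)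
    have "fc2 H k 0 = fc1 (\<lambda>x. fc1 (\<lambda>t. H (x, t)) 0) k" by (rule fc2_iterated(2)[OF Hi])
    also have "\<dots> = fc1 (\<lambda>x. G x - G 0) k"
      unfolding fc1_def[of _ k]
    proof (rule integral_cong_AE)
      show "AE x in circ. fc1 (\<lambda>t. H (x, t)) 0 * cis (- (of_int k * x)) = (G x - G 0) * cis (- (of_int k * x))"
        using AE_circ_interval
      proof eventually_elim
        case (elim x)
        have "fc1 (\<lambda>t. H (x, t)) 0 = (LINT t:{0..2 * pi}|lborel. H (x, t))"
          unfolding H_def by (simp add: fc1_def integral_circ_lborel(1))
        also have "\<dots> = (LINT t:{0..x}|lborel. D t)"
          unfolding set_lebesgue_integral_def H_def using elim
          by (intro Bochner_Integration.integral_cong) (auto simp: indicator_def)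
        also have "\<dots> = G x - G 0" using GD elim by (simp add: primitive_def)
        finally show ?case by simp
      qed
      show "(\<lambda>x. fc1 (\<lambda>t. H (x, t)) 0 * cis (- (of_int k * x))) \<in> borel_measurable circ"
        by (rule borel_measurable_integrable[OF integrable_mult_cis[OF fc2_iterated(1)[OF Hi], of _ "- of_int k", simplified]])
    qed simp
    also have "\<dots> = fc1 G k - fc1 (\<lambda>_. G 0) k"
      unfolding fc1_def left_diff_distrib using integrable_mult_cis[OF Gi, of "- of_int k"] integrable_mult_cis[of "\<lambda>_. G 0" "- of_int k"]
      by (intro Bochner_Integration.integral_diff) auto
    also have "fc1 (\<lambda>_. G 0) k = 0" using k by (simp add: fc1_const)
    finally have A: "fc2 H k 0 = fc1 G k" by simp
    note sw = fc2_swap[OF Hi]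
    have "fc2 H k 0 = fc2 (\<lambda>z. H (snd z, fst z)) 0 k" by (rule sw(2)[symmetric])
    also have "\<dots> = fc1 (\<lambda>t. fc1 (\<lambda>x. H (x, t)) k) 0" by (subst fc2_iterated(2)[OF sw(1)]) simp
    also have "\<dots> = (LINT t|circ. (D t * cis (- (of_int k * t)) - D t) / (\<i> * of_int k))"
      unfolding fc1_def[of _ 0]
    proof (rule integral_cong_AE)
      show "AE t in circ. fc1 (\<lambda>x. H (x, t)) k * cis (- (of_int 0 * t)) = (D t * cis (- (of_int k * t)) - D t) / (\<i> * of_int k)"
        using AE_circ_interval
      proof eventually_elim
        case (elim t)
        define E where "E x = \<i> / of_int k * cis (- (of_int k * x))" for x
        have "fc1 (\<lambda>x. H (x, t)) k = (LINT x:{0..2 * pi}|lborel. H (x, t) * cis (- (of_int k * x)))"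
          unfolding H_def by (simp add: fc1_def integral_circ_lborel(1))
        also have "\<dots> = (LINT x|lborel. D t * (indicator {t..2 * pi} x *\<^sub>R cis (- (of_int k * x))))"
          unfolding set_lebesgue_integral_def H_def using elim
          by (intro Bochner_Integration.integral_cong) (auto simp: indicator_def)
        also have "\<dots> = D t * (LINT x|lborel. indicator {t..2 * pi} x *\<^sub>R cis (- (of_int k * x)))"
          by (rule integral_mult_right_zero)
        also have "(LINT x|lborel. indicator {t..2 * pi} x *\<^sub>R cis (- (of_int k * x))) = E (2 * pi) - E t"
        proof (rule integral_FTC_Icc)
          show "t \<le> 2 * pi" using elim by simp
          show "(E has_vector_derivative cis (- (of_int k * x))) (at x within {t..2 * pi})" for x
          proof -
            have "((\<lambda>x. cis (- (of_int k * x))) has_vector_derivative of_real (- of_int k) * (\<i> * cis (- (of_int k * x)))) (at x within {t..2 * pi})"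
              using has_derivative_cis[of "\<lambda>x. - (of_int k * x)" "\<lambda>h. - (of_int k * h)" x "{t..2 * pi}"]
              by (auto simp: has_vector_derivative_def scaleR_conv_of_real mult_ac intro!: derivative_eq_intros)
            from has_vector_derivative_mult_right[OF this, of "\<i> / of_int k"] show ?thesis
              unfolding E_def using k by simp
          qed
          show "continuous_on {t..2 * pi} (\<lambda>x. cis (- (of_int k * x)))" by (intro continuous_intros)
        qed
        also have "E (2 * pi) = \<i> / of_int k"
          using cis_multiple_2pi[of "of_int (- k)"] by (simp add: E_def mult_ac)
        finally have "fc1 (\<lambda>x. H (x, t)) k = D t * (\<i> / of_int k) * (1 - cis (- (of_int k * t)))" by (simp add: E_def algebra_simps)
        also have "\<i> / of_int k = - (1 / (\<i> * of_int k))" using k by (simp add: field_simps)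
        finally show ?case by (simp add: algebra_simps diff_divide_distrib)
      qed
      show "(\<lambda>t. fc1 (\<lambda>x. H (x, t)) k * cis (- (of_int 0 * t))) \<in> borel_measurable circ"
        using borel_measurable_integrable[OF fc2_iterated(1)[OF sw(1), of k]] by simp
    qed simp
    also have "\<dots> = (fc1 D k - fc1 D 0) / (\<i> * of_int k)"
    proof -
      have "(LINT t|circ. D t * cis (- (of_int k * t)) - D t) = fc1 D k - fc1 D 0"
        unfolding fc1_def using integrable_mult_cis[OF Di, of "- of_int k"] Di
        by (subst Bochner_Integration.integral_diff) auto
      then show ?thesis by (simp only: integral_divide_zero)
    qed
    finally show ?thesis using k by (simp add: A D0 field_simps)
  qed
qed

lemma fc1_AE_cong:
  assumes "AE x in lborel. u x = v x" "u \<in> borel_measurable borel" "v \<in> borel_measurable borel"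
  shows "fc1 u k = fc1 v k" "integrable circ u \<longleftrightarrow> integrable circ v"
proof -
  note [measurable] = assms(2,3)
  show "fc1 u k = fc1 v k" unfolding fc1_def
    by (rule integral_cong_AE) (use AE_circ[OF assms(1)] in auto)
  show "integrable circ u \<longleftrightarrow> integrable circ v"
    by (rule integrable_cong_AE) (use AE_circ[OF assms(1)] in auto)
qed

lemma lebesgue_measurable_if_locally_integrable:
  fixes F :: "real \<Rightarrow> complex"
  assumes "\<And>a b. a \<le> b \<Longrightarrow> set_integrable lebesgue {a..b} F"
  shows "F \<in> borel_measurable lebesgue"
proof (rule borel_measurable_LIMSEQ_metric)
  show "(\<lambda>x. indicator {- real n..real n} x *\<^sub>R F x) \<in> borel_measurable lebesgue" for n
    using assms[of "- real n" "real n"] by (simp add: set_integrable_def)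
  show "(\<lambda>n. indicator {- real n..real n} x *\<^sub>R F x) \<longlonglongrightarrow> F x" for x
  proof -
    have "eventually (\<lambda>n. indicator {- real n..real n} x *\<^sub>R F x = F x) sequentially"
      using eventually_ge_at_top[of "nat \<lceil>\<bar>x\<bar>\<rceil>"] by eventually_elim (auto simp: indicator_def)
    then show ?thesis by (rule tendsto_eventually)
  qed
qed

text \<open>Each derivative inherits periodicity almost everywhere, which is what excludes boundary
  terms at the next step. The functions \<open>F\<close> and \<open>v\<close> are known up to null
  sets only, hence the Borel companions \<open>u\<close> and \<open>w\<close>.\<close>

lemma nth_derivative_fc1:
  assumes "has_nth_derivative n F v" and "u \<in> borel_measurable borel" "AE x in lborel. F x = u x"
    and "AE x in lborel. u (x + 2 * pi) = u x" "integrable circ u"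
    and w: "w \<in> borel_measurable borel" "AE x in lborel. v x = w x"
  shows "integrable circ w \<and> fc1 w k = (\<i> * of_int k) ^ n * fc1 u k"
  using assms(1-5)
proof (induction n arbitrary: F u)
  case 0
  have "AE x in lborel. F x = v x" using 0(1) by (simp add: AE_completion_iff)
  with 0(3) w(2) have "AE x in lborel. u x = w x" by eventually_elim simp
  from fc1_AE_cong[OF this 0(2) w(1)] 0 show ?case by simp
next
  case (Suc n)
  obtain G F1 where FG: "AE x in lebesgue. F x = G x"
    and G: "\<And>a b. a \<le> b \<Longrightarrow> set_integrable lebesgue {a..b} F1" "\<And>a b. a \<le> b \<Longrightarrow> G b - G a = (LINT t:{a..b}|lebesgue. F1 t)"
    and n: "has_nth_derivative n F1 v"
    using Suc.prems(1) by auto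
  obtain D where D: "D \<in> borel_measurable borel" "AE x in lborel. F1 x = D x"
    using lebesgue_borel_version[OF lebesgue_measurable_if_locally_integrable[OF G(1)]] by auto
  have D': "AE x in lborel. x \<in> {a..b} \<longrightarrow> F1 x = D x" for a b using D(2) by eventually_elim simp
  have GD: "primitive G D"
    unfolding primitive_def
    using G set_integral_lborel[OF _ D(1) D'] by simp
  have uG: "AE x in lborel. u x = G x" using FG Suc.prems(3) unfolding AE_completion_iff by eventually_elim simp
  have "AE x in lborel. G (x + 2 * pi) = G x"
    using uG Suc.prems(4) AE_lborel_translate[OF uG, of "2 * pi"] by eventually_elim metis
  note per = primitive_periodic[OF D(1) GD this]
  note fcD = fc1_primitive[OF D(1) GD per(1)[of 0, simplified]]
  have Gm: "G \<in> borel_measurable borel" by (rule borel_measurable_continuous_onI[OF primitive_continuous[OF GD]])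
  have "fc1 u k = fc1 G k" by (rule fc1_AE_cong(1)[OF uG Suc.prems(2) Gm])
  then show ?case using Suc.IH[OF n D(1) D(2) per(2) fcD(2)] fcD(3)[of k] by simp
qed

lemma ipow_add_nat:
  assumes "k \<noteq> 0"
  shows "ipow (real n - \<rho>) k * ipow \<rho> k = (\<i> * of_int k) ^ n"
proof -
  have "ipow (real n - \<rho>) k * ipow \<rho> k = (\<i> * of_int k) powr of_nat n"
    unfolding ipow_def by (simp add: powr_add[symmetric])
  then show ?thesis using assms by (simp add: powr_nat')
qed

lemma ipow_nonzero: "k \<noteq> 0 \<Longrightarrow> ipow r k \<noteq> 0" by (simp add: ipow_def)

text \<open>The Weyl integral divides the coefficients by \<open>ipow (n - \<rho>) k\<close> and the
  \<open>n\<close> derivatives multiply them by \<open>(\<i> * k) ^ n\<close>, leaving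
  \<open>ipow \<rho> k\<close>. With \<open>n = nat \<lfloor>\<rho>\<rfloor> + 1\<close> the order
  \<open>n - \<rho>\<close> lies in the range above \<open>0\<close> and up to \<open>1\<close> for
  which the kernel was studied.\<close>

lemma weyl_derivative_fc1:
  assumes \<rho>: "0 < \<rho>" and d: "has_weyl_derivative \<rho> u v"
    and u': "u' \<in> borel_measurable borel" "AE x in lborel. u x = u' x"
    and v': "v' \<in> borel_measurable borel" "AE x in lborel. v x = v' x"
  shows "integrable circ u'" "integrable circ v'" "fc1 v' k = ipow \<rho> k * fc1 u' k"
proof -
  define n where "n = nat \<lfloor>\<rho>\<rfloor> + 1"
  have n: "0 < real n - \<rho>" "real n - \<rho> \<le> 1" "n \<noteq> 0" using \<rho> unfolding n_def by linarith+
  have si: "set_integrable lebesgue {0..2 * pi} u" and nd: "has_nth_derivative n (weyl_integral (real n - \<rho>) u) v"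
    using d unfolding has_weyl_derivative_def Let_def n_def by auto
  show u'i: "integrable circ u'" using si unfolding set_integral_circ(2)[OF u'] .
  define F where "F = (\<lambda>x. (LINT t|circ. u' t * weyl_kernel (real n - \<rho>) (x - t)) / (2 * pi))"
  have WF: "weyl_integral (real n - \<rho>) u = F" unfolding F_def by (rule ext) (rule weyl_integral_circ[OF u'])
  note conv = convolution_fc1[OF n(1,2) u'(1) u'i F_def]
  have "integrable circ v' \<and> fc1 v' k = (\<i> * of_int k) ^ n * fc1 F k"
    by (rule nth_derivative_fc1[OF nd[unfolded WF] conv(1) _ _ conv(2) v']) (simp_all add: conv(3))
  then have v'F: "integrable circ v'" "fc1 v' k = (\<i> * of_int k) ^ n * (fc1 u' k / ipow (real n - \<rho>) k)" unfolding conv(4) by blast+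
  show "integrable circ v'" by (rule v'F)
  show "fc1 v' k = ipow \<rho> k * fc1 u' k"
  proof (cases "k = 0")
    case False
    from v'F(2) show ?thesis unfolding ipow_add_nat[OF False, of n \<rho>, symmetric] using ipow_nonzero[OF False, of "real n - \<rho>"] by simp
  qed (use v'F(2) in simp)
qed

lemma integrable_periodic_interval:
  fixes v :: "real \<Rightarrow> complex"
  assumes v: "v \<in> borel_measurable borel" "integrable circ v" and per: "\<And>x. v (x + 2 * pi) = v x"
  shows "set_integrable lborel {a..b} v"
proof -
  have base: "set_integrable lborel {c..2 * pi + c} v" for c
  proof -
    have m: "(\<lambda>x. v (x + c)) \<in> borel_measurable borel" using v(1) by measurable
    have "integrable circ (\<lambda>x. v (x + c))" by (rule fc1_shift(1)[OF v(2,1) per])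
    then have "set_integrable lborel {0 + c..2 * pi + c} v" unfolding integral_circ_lborel(2)[OF m] set_integral_shift(2) .
    then show ?thesis by simp
  qed
  have "set_integrable lborel {a..a + 2 * pi * real (Suc n)} v" for n
  proof (induction n)
    case 0
    then show ?case using base[of a] by (simp add: add.commute)
  next
    case (Suc n)
    define c where "c = a + 2 * pi * real (Suc n)"
    have "a \<le> c" by (simp add: c_def)
    then have "{a..c} \<union> {c..2 * pi + c} = {a..2 * pi + c}" by (intro ivl_disj_un_two_touch(4)) auto
    moreover have "2 * pi + c = a + 2 * pi * real (Suc (Suc n))" by (simp add: c_def algebra_simps)
    moreover have "set_integrable lborel ({a..c} \<union> {c..2 * pi + c}) v"
      by (rule set_integrable_Un[OF Suc[folded c_def] base]) auto
    ultimately show ?case by simp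
  qed
  note 1 = this
  obtain n :: nat where "(b - a) / (2 * pi) \<le> real n" using real_arch_simple by blast
  then have "b - a \<le> 2 * pi * real n" by (simp add: field_simps)
  also have "\<dots> \<le> 2 * pi * real (Suc n)" by simp
  finally have "b \<le> a + 2 * pi * real (Suc n)" by simp
  then show ?thesis by (intro set_integrable_subset[OF 1[of n]]) auto
qed

lemma periodic_primitive_ex:
  assumes v: "v \<in> borel_measurable borel" "integrable circ v" and per: "\<And>x. v (x + 2 * pi) = v x" and v0: "fc1 v 0 = 0"
  shows "\<exists>G. primitive G v \<and> G \<in> borel_measurable borel \<and> integrable circ G \<and> (\<forall>x. G (x + 2 * pi) = G x) \<and> fc1 G 0 = 0"
proof -
  note [measurable] = v(1)
  note si = integrable_periodic_interval[OF v per]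
  define P where "P x = (LBINT t=ereal 0..ereal x. v t)" for x
  have diff: "P b - P a = (LINT t:{a..b}|lborel. v t)" if "a \<le> b" for a b
  proof -
    have "(LBINT t=ereal 0..ereal a. v t) + (LBINT t=ereal a..ereal b. v t) = (LBINT t=ereal 0..ereal b. v t)"
    proof (rule interval_integral_sum)
      show "interval_lebesgue_integrable lborel (min (ereal 0) (min (ereal a) (ereal b))) (max (ereal 0) (max (ereal a) (ereal b))) v"
        unfolding interval_lebesgue_integrable_def ereal_min[symmetric] ereal_max[symmetric] einterval_eq
        using set_integrable_subset[OF si, of "{min 0 (min a b)<..<max 0 (max a b)}" "min 0 (min a b)" "max 0 (max a b)"]
        by (auto simp: greaterThanLessThan_subseteq_atLeastAtMost_iff)
    qed
    then show ?thesis using interval_integral_Icc[OF that, of v] by (simp add: P_def algebra_simps)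
  qed
  \<comment> \<open>The constant of integration is chosen to make the mean of \<open>G\<close> zero,
    so that the construction can be repeated; the mean zero of \<open>v\<close> is what makes
    \<open>P\<close> and \<open>G\<close> periodic.\<close>
  define G where "G x = P x - fc1 P 0 / (2 * pi)" for x
  have GP: "primitive G v" "primitive P v" unfolding primitive_def G_def using diff si by auto
  have z: "(LINT t:{x..x + 2 * pi}|lborel. v t) = 0" for x
  proof -
    have m: "(\<lambda>t. v (t + x)) \<in> borel_measurable borel" by measurable
    have "fc1 (\<lambda>t. v (t + x)) 0 = 0" using fc1_shift(2)[OF v(2,1) per, of x 0] v0 by simp
    then show ?thesis using set_integral_shift(1)[of 0 "2 * pi" v x] by (simp add: fc1_def integral_circ_lborel(1)[OF m] add.commute)
  qed
  have Gper: "G (x + 2 * pi) = G x" for x using diff[of x "x + 2 * pi"] z[of x] by (simp add: G_def)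
  have Pper: "P (2 * pi) = P 0" using Gper[of 0] by (simp add: G_def)
  have Pi: "integrable circ P" by (rule fc1_primitive(1)[OF v(1) GP(2) Pper])
  have "fc1 G 0 = fc1 P 0 - fc1 (\<lambda>_. fc1 P 0 / (2 * pi)) 0"
    unfolding fc1_def[of G] fc1_def[of "\<lambda>_. fc1 P 0 / (2 * pi)"] G_def using Pi by (simp add: fc1_def[of P])
  also have "fc1 (\<lambda>_. fc1 P 0 / (2 * pi)) 0 = fc1 P 0" by (simp add: fc1_const)
  finally have "fc1 G 0 = 0" by simp
  moreover have "integrable circ G" by (rule fc1_primitive(1)[OF v(1) GP(1)]) (use Gper[of 0] in simp)
  moreover have "G \<in> borel_measurable borel" by (rule borel_measurable_continuous_onI[OF primitive_continuous[OF GP(1)]])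
  ultimately show ?thesis using GP(1) Gper by blast
qed

lemma nth_primitive_ex:
  assumes v: "v \<in> borel_measurable borel" "integrable circ v" and per: "\<And>x. v (x + 2 * pi) = v x" and v0: "fc1 v 0 = 0"
  shows "\<exists>F. has_nth_derivative n F v \<and> F \<in> borel_measurable borel \<and> integrable circ F \<and> (\<forall>x. F (x + 2 * pi) = F x) \<and> fc1 F 0 = 0
    \<and> (\<forall>k. fc1 v k = (\<i> * of_int k) ^ n * fc1 F k)"
proof (induction n)
  case 0
  then show ?case using assms by (intro exI[of _ v]) simp
next
  case (Suc n)
  then obtain F where F: "has_nth_derivative n F v" "F \<in> borel_measurable borel" "integrable circ F" "\<And>x. F (x + 2 * pi) = F x" "fc1 F 0 = 0"
    "\<And>k. fc1 v k = (\<i> * of_int k) ^ n * fc1 F k" by blast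
  obtain G where G: "primitive G F" "G \<in> borel_measurable borel" "integrable circ G" "\<And>x. G (x + 2 * pi) = G x" "fc1 G 0 = 0"
    using periodic_primitive_ex[OF F(2-5)] by blast
  have "has_nth_derivative (Suc n) G v"
  proof -
    have "set_integrable lebesgue {a..b} F \<and> G b - G a = (LINT t:{a..b}|lebesgue. F t)" if "a \<le> b" for a b
      using G(1) that set_integral_lborel[of "{a..b}" F F] F(2) by (simp add: primitive_def)
    then show ?thesis unfolding has_nth_derivative.simps using F(1)
      by - (rule exI[of _ G], rule exI[of _ F], simp)
  qed
  moreover have "fc1 v k = (\<i> * of_int k) ^ Suc n * fc1 G k" for k
    using F(6)[of k] fc1_primitive(3)[OF F(2) G(1), of k] G(4)[of 0] by simp
  ultimately show ?case using G by blast
qed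

lemma periodic_AE:
  assumes "AE x in circ. Q x" and per: "\<And>x. Q (x + 2 * pi) = Q x"
  shows "AE x in lborel. Q x"
proof -
  have "AE x in lborel. 0 < (indicator {0..2 * pi} x :: ennreal) \<longrightarrow> Q x"
    using assms(1) unfolding circ_def by (subst (asm) AE_density) simp_all
  then have "AE x in lborel. x \<in> {0..2 * pi} \<longrightarrow> Q x" by eventually_elim (auto simp: indicator_def)
  from AE_lborel_translate[OF this] have "AE x in lborel. \<forall>n::int. x + - (2 * pi * of_int n) \<in> {0..2 * pi} \<longrightarrow> Q (x + - (2 * pi * of_int n))"
    unfolding AE_all_countable by blast
  then show ?thesis
  proof eventually_elim
    case (elim x)
    define n where "n = \<lfloor>x / (2 * pi)\<rfloor>"
    have "of_int n \<le> x / (2 * pi)" "x / (2 * pi) \<le> of_int n + 1" unfolding n_def by linarith+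
    then have "x + - (2 * pi * of_int n) \<in> {0..2 * pi}" by (simp add: field_simps)
    with elim have "Q (x - 2 * pi * of_int n)" by simp
    then show ?case using periodic_int[of Q x n] per by simp
  qed
qed

lemma fc1_eq_imp_AE_eq:
  assumes "integrable circ u" "integrable circ v" "\<And>k. fc1 u k = fc1 v k"
  shows "AE x in circ. u x = v x"
proof -
  have "fc1 (\<lambda>x. u x - v x) k = 0" for k
  proof -
    have "fc1 (\<lambda>x. u x - v x) k = fc1 u k - fc1 v k"
      unfolding fc1_def left_diff_distrib using integrable_mult_cis[OF assms(1), of "- of_int k"] integrable_mult_cis[OF assms(2), of "- of_int k"]
      by (intro Bochner_Integration.integral_diff) auto
    then show ?thesis by (simp add: assms(3))
  qed
  then have "AE x in circ. u x - v x = 0" using assms by (intro fc1_unique) auto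
  then show ?thesis by simp
qed

lemma has_nth_derivative_cong:
  assumes "AE x in lebesgue. F x = H x" "has_nth_derivative n F v"
  shows "has_nth_derivative n H v"
proof (cases n)
  case 0
  then have "AE x in lebesgue. F x = v x" using assms(2) by simp
  with assms(1) have "AE x in lebesgue. H x = v x" by eventually_elim simp
  then show ?thesis by (simp add: 0)
next
  case (Suc m)
  then obtain G F1 where GF: "AE x in lebesgue. F x = G x"
    "\<forall>a b. a \<le> b \<longrightarrow> set_integrable lebesgue {a..b} F1 \<and> G b - G a = (LINT t:{a..b}|lebesgue. F1 t)" "has_nth_derivative m F1 v"
    using assms(2) by auto
  have "AE x in lebesgue. H x = G x" using GF(1) assms(1) by eventually_elim simp
  then show ?thesis using GF(2,3) unfolding Suc has_nth_derivative.simps by blast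
qed

text \<open>Conversely, an \<open>n\<close>-fold periodic primitive of \<open>v\<close> with mean
  zero has the same Fourier coefficients as the Weyl integral of \<open>u\<close>. By uniqueness the
  two agree almost everywhere, and \<open>has_nth_derivative\<close> does not see null sets.\<close>

lemma weyl_derivative_if_fc1:
  assumes \<rho>: "0 < \<rho>"
    and u': "u' \<in> borel_measurable borel" "AE x in lborel. u x = u' x" "integrable circ u'"
    and v: "v \<in> borel_measurable borel" "integrable circ v" "\<And>x. v (x + 2 * pi) = v x"
    and fc: "\<And>k. fc1 v k = ipow \<rho> k * fc1 u' k"
  shows "has_weyl_derivative \<rho> u v"
proof -
  define n where "n = nat \<lfloor>\<rho>\<rfloor> + 1"
  have n: "0 < real n - \<rho>" "real n - \<rho> \<le> 1" using \<rho> unfolding n_def by linarith+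
  obtain F where F: "has_nth_derivative n F v" "F \<in> borel_measurable borel" "integrable circ F" "\<And>x. F (x + 2 * pi) = F x" "fc1 F 0 = 0"
    "\<And>k. fc1 v k = (\<i> * of_int k) ^ n * fc1 F k"
    using nth_primitive_ex[OF v(1-3), of n] fc[of 0] by auto
  define W where "W = (\<lambda>x. (LINT t|circ. u' t * weyl_kernel (real n - \<rho>) (x - t)) / (2 * pi))"
  have WF: "weyl_integral (real n - \<rho>) u = W" unfolding W_def by (rule ext) (rule weyl_integral_circ[OF u'(1,2)])
  note conv = convolution_fc1[OF n u'(1,3) W_def]
  have "fc1 F k = fc1 W k" for k
  proof (cases "k = 0")
    case False
    have "ipow (real n - \<rho>) k * ipow \<rho> k * fc1 F k = ipow \<rho> k * fc1 u' k"
      using F(6)[of k] fc[of k] ipow_add_nat[OF False, of n \<rho>] by simp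
    then have "ipow \<rho> k * (ipow (real n - \<rho>) k * fc1 F k) = ipow \<rho> k * fc1 u' k" by (simp only: mult_ac)
    then have "ipow (real n - \<rho>) k * fc1 F k = fc1 u' k" using ipow_nonzero[OF False, of \<rho>] by simp
    then show ?thesis using ipow_nonzero[OF False, of "real n - \<rho>"] by (simp add: conv(4) field_simps)
  qed (simp add: conv(4) F(5))
  then have "AE x in circ. F x = W x" by (rule fc1_eq_imp_AE_eq[OF F(3) conv(2)])
  then have "AE x in lborel. F x = W x" by (rule periodic_AE) (simp add: F(4) conv(3))
  from has_nth_derivative_cong[OF AE_completion[OF this] F(1)] have "has_nth_derivative n (weyl_integral (real n - \<rho>) u) v"
    unfolding WF .
  moreover have "set_integrable lebesgue {0..2 * pi} u" using u'(3) unfolding set_integral_circ(2)[OF u'(1,2)] .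
  ultimately show ?thesis by (simp add: has_weyl_derivative_def n_def)
qed

subsection \<open>Mixed Weyl derivatives and double Fourier coefficients\<close>

lemma cis_real_of_int: "cis (of_int k * x) = of_real (cos (real (nat \<bar>k\<bar>) * x)) + \<i> * of_int (sgn k) * of_real (sin (real (nat \<bar>k\<bar>) * x))"
  by (cases k rule: int_cases4) (auto simp: complex_eq_iff)

lemma fc2_cosine_series:
  assumes f': "f' \<in> borel_measurable borel" "integrable (circ \<Otimes>\<^sub>M circ) f'" and eq: "AE z in lborel. f z = f' z"
    and a: "has_cosine_series f a"
  shows "fc2 f' k l = of_real (pi\<^sup>2 * a (nat \<bar>k\<bar>) (nat \<bar>l\<bar>)) * (ipow 0 k * ipow 0 l)"
proof -
  note [measurable] = f'(1)
  define m n where "m = nat \<bar>k\<bar>" and "n = nat \<bar>l\<bar>"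
  define s t :: complex where "s = \<i> * of_int (sgn (- k))" and "t = \<i> * of_int (sgn (- l))"
  define I where "I \<phi> = (LINT z|(circ \<Otimes>\<^sub>M circ). f' z * of_real (\<phi> z))" for \<phi> :: "real \<times> real \<Rightarrow> real"
  define cc where "cc z = cos (real m * fst z) * cos (real n * snd z)" for z
  define cs where "cs z = cos (real m * fst z) * sin (real n * snd z)" for z
  define sc where "sc z = sin (real m * fst z) * cos (real n * snd z)" for z
  define ss where "ss z = sin (real m * fst z) * sin (real n * snd z)" for z
  have [measurable]: "cc \<in> borel_measurable borel" "cs \<in> borel_measurable borel" "sc \<in> borel_measurable borel" "ss \<in> borel_measurable borel"
    unfolding cc_def cs_def sc_def ss_def by (intro borel_measurable_continuous_onI continuous_intros)+
  have bd: "norm (cc z) \<le> 1" "norm (cs z) \<le> 1" "norm (sc z) \<le> 1" "norm (ss z) \<le> 1" for z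
    unfolding cc_def cs_def sc_def ss_def by (auto simp: abs_mult intro!: mult_le_one)
  have fl: "f \<in> borel_measurable lebesgue"
  proof (rule borel_measurable_AE)
    show "f' \<in> borel_measurable lebesgue" by (rule measurable_completion) simp
    show "AE z in lebesgue. f' z = f z" using AE_completion[OF eq] by eventually_elim simp
  qed
  have tr: "(LINT z:torus|lebesgue. f z * of_real (\<phi> z)) = I \<phi>" if "\<phi> \<in> borel_measurable borel" for \<phi>
    unfolding I_def
  proof (rule integral_torus)
    show "(\<lambda>z. f' z * of_real (\<phi> z)) \<in> borel_measurable borel" using that by measurable
    show "AE z in lborel. f z * of_real (\<phi> z) = f' z * of_real (\<phi> z)" using eq by eventually_elim simp
    have "(\<lambda>z. complex_of_real (\<phi> z)) \<in> borel_measurable lebesgue" by (rule measurable_completion) (use that in measurable)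
    then show "(\<lambda>z. f z * of_real (\<phi> z)) \<in> borel_measurable lebesgue" by (rule borel_measurable_times[OF fl])
  qed
  have int: "integrable (circ \<Otimes>\<^sub>M circ) (\<lambda>z. f' z * of_real (\<phi> z))" if "\<phi> \<in> borel_measurable borel" "\<And>z. norm (\<phi> z) \<le> 1" for \<phi> :: "real \<times> real \<Rightarrow> real"
  proof (rule Bochner_Integration.integrable_bound[OF f'(2)])
    show "(\<lambda>z. f' z * complex_of_real (\<phi> z)) \<in> borel_measurable (circ \<Otimes>\<^sub>M circ)"
      unfolding measurable_circ2 using that(1) by measurable
    show "AE z in circ \<Otimes>\<^sub>M circ. norm (f' z * complex_of_real (\<phi> z)) \<le> norm (f' z)"
      using that(2) by (auto simp: norm_mult intro!: AE_I2 mult_left_le)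
  qed
  have A: "I cc = (if m \<ge> 1 \<and> n \<ge> 1 then of_real (pi\<^sup>2 * a m n) else 0)" "I cs = 0" "I sc = 0" "I ss = 0"
  proof -
    have T: "I cc = (LINT z:torus|lebesgue. f z * of_real (cc z))" "I cs = (LINT z:torus|lebesgue. f z * of_real (cs z))"
      "I sc = (LINT z:torus|lebesgue. f z * of_real (sc z))" "I ss = (LINT z:torus|lebesgue. f z * of_real (ss z))"
      by (rule tr[symmetric], measurable)+
    show "I cc = (if m \<ge> 1 \<and> n \<ge> 1 then of_real (pi\<^sup>2 * a m n) else 0)" "I cs = 0" "I sc = 0" "I ss = 0"
      unfolding T cc_def cs_def sc_def ss_def using a unfolding has_cosine_series_def by blast+
  qed
  have "f' z * cis (- (of_int k * fst z + of_int l * snd z))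
    = f' z * of_real (cc z) + t * (f' z * of_real (cs z)) + s * (f' z * of_real (sc z)) + s * t * (f' z * of_real (ss z))" for z
  proof -
    have "cis (- (of_int k * fst z + of_int l * snd z)) = cis (of_int (- k) * fst z) * cis (of_int (- l) * snd z)"
      by (simp add: cis_mult)
    also have "\<dots> = (of_real (cos (real m * fst z)) + s * of_real (sin (real m * fst z))) * (of_real (cos (real n * snd z)) + t * of_real (sin (real n * snd z)))"
      unfolding cis_real_of_int[of "- k"] cis_real_of_int[of "- l"] by (simp add: m_def n_def s_def t_def)
    finally show ?thesis by (simp add: cc_def cs_def sc_def ss_def algebra_simps)
  qed
  then have "fc2 f' k l = I cc + t * I cs + s * I sc + s * t * I ss"
    unfolding fc2_def I_def using int[of cc] int[of cs] int[of sc] int[of ss] bd by simp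
  moreover have "m \<ge> 1 \<longleftrightarrow> k \<noteq> 0" "n \<ge> 1 \<longleftrightarrow> l \<noteq> 0" by (auto simp: m_def n_def)
  ultimately show ?thesis unfolding A by (simp add: m_def[symmetric] n_def[symmetric] ipow_def)
qed

lemma M_class_coefficients:
  assumes p: "1 < p" and f: "f \<in> M_class p"
  shows "\<exists>a f'. doubly_monotone a \<and> f' \<in> Lpb p \<and> (AE z in lborel. f z = f' z) \<and> weyl_coefficients a 0 0 f'"
proof -
  obtain a where a: "has_cosine_series f a" "\<And>m n. m \<ge> 1 \<Longrightarrow> n \<ge> 1 \<Longrightarrow> a m n - a (m + 1) n - a m (n + 1) + a (m + 1) (n + 1) \<ge> 0"
    and fp: "f \<in> Lp_space p"
    using f by (auto simp: M_class_def Lp0_space_def)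
  obtain f' where f': "f' \<in> Lpb p" "AE z in lborel. f z = f' z" using Lp_space_borel_version[OF _ fp] p by auto
  have int: "integrable (circ \<Otimes>\<^sub>M circ) f'" by (rule Lpb_integrable[OF p f'(1)])
  have m: "f' \<in> borel_measurable borel" using f'(1) by (simp add: Lpb_def)
  note fc = fc2_cosine_series[OF m int f'(2) a(1)]
  have "doubly_monotone a"
  proof (rule doubly_monotone_coefficients[OF int, of "pi\<^sup>2"])
    show "fc2 f' (int m) (int n) = of_real (pi\<^sup>2) * of_real (a m n)" if "1 \<le> m" "1 \<le> n" for m n
      using that unfolding fc by (simp add: ipow_def)
  qed (use a(2) in auto)
  then show ?thesis using f' fc by (auto simp: weyl_coefficients_def)
qed

lemma AE_slices:
  assumes "AE z in lborel. P (z :: real \<times> real)"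
  shows "AE x in lborel. AE y in lborel. P (x, y)" "AE z in lborel. P (snd z, fst z)"
proof -
  have P: "AE z in lborel \<Otimes>\<^sub>M lborel. P z" unfolding lborel_prod by (rule assms)
  show "AE x in lborel. AE y in lborel. P (x, y)" by (rule lborel_pair.AE_pair[OF P])
  have "AE z in distr (lborel \<Otimes>\<^sub>M lborel) (lborel \<Otimes>\<^sub>M lborel) (\<lambda>(x, y). (y, x)). P z"
    using P by (subst (asm) lborel_pair.distr_pair_swap)
  then have "AE z in lborel \<Otimes>\<^sub>M lborel. P (case z of (x, y) \<Rightarrow> (y, x))"
    by (rule AE_distrD[rotated]) measurable
  then show "AE z in lborel. P (snd z, fst z)" unfolding lborel_prod by (simp add: case_prod_unfold)
qed

lemma slice_measurable: "F \<in> borel_measurable borel \<Longrightarrow> (\<lambda>y. F (x, y)) \<in> borel_measurable borel" for F :: "real \<times> real \<Rightarrow> complex" and x :: real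
  by (erule measurable_compose[rotated]) (intro borel_measurable_continuous_onI continuous_intros)

text \<open>By Fubini almost every slice of \<open>f\<close> and \<open>h\<close> agrees almost
  everywhere with the slice of its Borel version, so the one-variable identity holds for almost
  every slice and is then integrated over the other variable. The case of the first variable follows
  by exchanging the coordinates.\<close>

lemma fc2_weyl_derivative:
  fixes F H f h :: "real \<times> real \<Rightarrow> complex"
  assumes \<rho>: "0 < \<rho>"
    and F: "F \<in> borel_measurable borel" "integrable (circ \<Otimes>\<^sub>M circ) F" "AE z in lborel. f z = F z"
    and H: "H \<in> borel_measurable borel" "integrable (circ \<Otimes>\<^sub>M circ) H" "AE z in lborel. h z = H z"
  shows "(AE x in lebesgue. has_weyl_derivative \<rho> (\<lambda>y. f (x, y)) (\<lambda>y. h (x, y))) \<Longrightarrow> fc2 H k l = ipow \<rho> l * fc2 F k l"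
    and "(AE y in lebesgue. has_weyl_derivative \<rho> (\<lambda>x. f (x, y)) (\<lambda>x. h (x, y))) \<Longrightarrow> fc2 H k l = ipow \<rho> k * fc2 F k l"
proof -
  have gen: "fc2 H k l = ipow \<rho> l * fc2 F k l"
    if F: "F \<in> borel_measurable borel" "integrable (circ \<Otimes>\<^sub>M circ) F" "AE z in lborel. f z = F z"
      and H: "H \<in> borel_measurable borel" "integrable (circ \<Otimes>\<^sub>M circ) H" "AE z in lborel. h z = H z"
      and d: "AE x in lebesgue. has_weyl_derivative \<rho> (\<lambda>y. f (x, y)) (\<lambda>y. h (x, y))"
    for F H f h :: "real \<times> real \<Rightarrow> complex" and k l
  proof -
    have "AE x in lborel. fc1 (\<lambda>y. H (x, y)) l = ipow \<rho> l * fc1 (\<lambda>y. F (x, y)) l"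
      using d[unfolded AE_completion_iff] AE_slices(1)[OF F(3)] AE_slices(1)[OF H(3)]
    proof eventually_elim
      case (elim x)
      show ?case by (rule weyl_derivative_fc1(3)[OF \<rho> elim(1) slice_measurable[OF F(1)] elim(2) slice_measurable[OF H(1)] elim(3)])
    qed
    then have ae: "AE x in circ. fc1 (\<lambda>y. H (x, y)) l * cis (- (of_int k * x)) = ipow \<rho> l * (fc1 (\<lambda>y. F (x, y)) l * cis (- (of_int k * x)))"
      by (rule AE_mp[OF AE_circ]) simp
    have "fc2 H k l = (LINT x|circ. ipow \<rho> l * (fc1 (\<lambda>y. F (x, y)) l * cis (- (of_int k * x))))"
      unfolding fc2_iterated(2)[OF H(2)] fc1_def[of _ k]
    proof (rule integral_cong_AE[OF _ _ ae])
      show "(\<lambda>x. fc1 (\<lambda>y. H (x, y)) l * cis (- (of_int k * x))) \<in> borel_measurable circ"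
        using borel_measurable_integrable[OF integrable_mult_cis[OF fc2_iterated(1)[OF H(2)], of l "- of_int k"]] by simp
      show "(\<lambda>x. ipow \<rho> l * (fc1 (\<lambda>y. F (x, y)) l * cis (- (of_int k * x)))) \<in> borel_measurable circ"
        using borel_measurable_integrable[OF integrable_mult_cis[OF fc2_iterated(1)[OF F(2)], of l "- of_int k"]] by simp
    qed
    also have "\<dots> = ipow \<rho> l * fc2 F k l" unfolding fc2_iterated(2)[OF F(2)] fc1_def[of _ k] by (rule integral_mult_right_zero)
    finally show ?thesis .
  qed
  show "(AE x in lebesgue. has_weyl_derivative \<rho> (\<lambda>y. f (x, y)) (\<lambda>y. h (x, y))) \<Longrightarrow> fc2 H k l = ipow \<rho> l * fc2 F k l"
    by (rule gen[OF F H])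
  have sw: "(\<lambda>z. u (snd z, fst z)) \<in> borel_measurable borel" if "u \<in> borel_measurable borel" for u :: "real \<times> real \<Rightarrow> complex"
    by (rule measurable_compose[OF _ that]) (intro borel_measurable_continuous_onI continuous_intros)
  assume "AE y in lebesgue. has_weyl_derivative \<rho> (\<lambda>x. f (x, y)) (\<lambda>x. h (x, y))"
  then have "fc2 (\<lambda>z. H (snd z, fst z)) l k = ipow \<rho> k * fc2 (\<lambda>z. F (snd z, fst z)) l k"
    by (intro gen[OF sw[OF F(1)] fc2_swap(1)[OF F(2)] AE_slices(2)[OF F(3)] sw[OF H(1)] fc2_swap(1)[OF H(2)] AE_slices(2)[OF H(3)]]) simp
  then show "fc2 H k l = ipow \<rho> k * fc2 F k l" by (simp only: fc2_swap(2)[OF F(2)] fc2_swap(2)[OF H(2)])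
qed

lemma Lpb_1_integrable:
  assumes "f \<in> Lpb 1"
  shows "integrable (circ \<Otimes>\<^sub>M circ) f"
  using assms by (intro integrableI_bounded) (auto simp: Lpb_def Lnorm_def)

lemma weyl_coefficients_mixed_derivative:
  assumes p: "1 < p" and r: "0 < r1" "0 < r2"
    and f': "f' \<in> Lpb p" "AE z in lborel. f z = f' z" "weyl_coefficients a 0 0 f'"
    and g': "g' \<in> Lpb p" "AE z in lborel. g z = g' z" and d: "has_mixed_weyl_derivative r1 r2 f g"
  shows "weyl_coefficients a r1 r2 g'"
proof -
  obtain h where h: "h \<in> Lp_space 1" "AE y in lebesgue. has_weyl_derivative r1 (\<lambda>x. f (x, y)) (\<lambda>x. h (x, y))"
    "AE x in lebesgue. has_weyl_derivative r2 (\<lambda>y. h (x, y)) (\<lambda>y. g (x, y))"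
    using d by (auto simp: has_mixed_weyl_derivative_def)
  obtain h' where h': "h' \<in> Lpb 1" "AE z in lborel. h z = h' z" using Lp_space_borel_version[OF _ h(1)] by auto
  have m: "f' \<in> borel_measurable borel" "g' \<in> borel_measurable borel" "h' \<in> borel_measurable borel"
    using f'(1) g'(1) h'(1) by (auto simp: Lpb_def)
  note i = Lpb_integrable[OF p f'(1)] Lpb_integrable[OF p g'(1)] Lpb_1_integrable[OF h'(1)]
  have "fc2 g' k l = ipow r2 l * (ipow r1 k * fc2 f' k l)" for k l
    using fc2_weyl_derivative(1)[OF r(2) m(3) i(3) h'(2) m(2) i(2) g'(2) h(3), of k l]
      fc2_weyl_derivative(2)[OF r(1) m(1) i(1) f'(2) m(3) i(3) h'(2) h(2), of k l] by simp
  then show ?thesis using f'(3) by (auto simp: weyl_coefficients_def ipow_def)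
qed

text \<open>For each frequency \<open>l\<close> in the differentiated variable, uniqueness in the
  other variable turns the identity of double coefficients into one valid on almost every slice.
  There are countably many \<open>l\<close>, so almost every slice satisfies the hypotheses of
  \<open>weyl_derivative_if_fc1\<close>.\<close>

lemma weyl_derivative_if_fc2:
  fixes F H f :: "real \<times> real \<Rightarrow> complex"
  assumes \<rho>: "0 < \<rho>"
    and F: "F \<in> borel_measurable borel" "integrable (circ \<Otimes>\<^sub>M circ) F" "periodic2 F" "AE z in lborel. f z = F z"
    and H: "H \<in> borel_measurable borel" "integrable (circ \<Otimes>\<^sub>M circ) H" "periodic2 H"
  shows "(\<And>k l. fc2 H k l = ipow \<rho> l * fc2 F k l) \<Longrightarrow> AE x in lebesgue. has_weyl_derivative \<rho> (\<lambda>y. f (x, y)) (\<lambda>y. H (x, y))"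
    and "(\<And>k l. fc2 H k l = ipow \<rho> k * fc2 F k l) \<Longrightarrow> AE y in lebesgue. has_weyl_derivative \<rho> (\<lambda>x. f (x, y)) (\<lambda>x. H (x, y))"
proof -
  have gen: "AE x in lebesgue. has_weyl_derivative \<rho> (\<lambda>y. f (x, y)) (\<lambda>y. H (x, y))"
    if F: "F \<in> borel_measurable borel" "integrable (circ \<Otimes>\<^sub>M circ) F" "periodic2 F" "AE z in lborel. f z = F z"
      and H: "H \<in> borel_measurable borel" "integrable (circ \<Otimes>\<^sub>M circ) H" "periodic2 H"
      and fc: "\<And>k l. fc2 H k l = ipow \<rho> l * fc2 F k l"
    for F H f :: "real \<times> real \<Rightarrow> complex"
  proof -
    have "AE x in circ. fc1 (\<lambda>y. H (x, y)) l = ipow \<rho> l * fc1 (\<lambda>y. F (x, y)) l" for l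
    proof (rule fc1_eq_imp_AE_eq)
      show "integrable circ (\<lambda>x. fc1 (\<lambda>y. H (x, y)) l)" by (rule fc2_iterated(1)[OF H(2)])
      show "integrable circ (\<lambda>x. ipow \<rho> l * fc1 (\<lambda>y. F (x, y)) l)" by (intro integrable_mult_right fc2_iterated(1)[OF F(2)])
      fix k
      have "fc1 (\<lambda>x. ipow \<rho> l * fc1 (\<lambda>y. F (x, y)) l) k = ipow \<rho> l * fc1 (\<lambda>x. fc1 (\<lambda>y. F (x, y)) l) k"
        unfolding fc1_def[of _ k] by (simp only: mult.assoc integral_mult_right_zero)
      then show "fc1 (\<lambda>x. fc1 (\<lambda>y. H (x, y)) l) k = fc1 (\<lambda>x. ipow \<rho> l * fc1 (\<lambda>y. F (x, y)) l) k"
        using fc[of k l] by (simp only: fc2_iterated(2)[OF H(2)] fc2_iterated(2)[OF F(2)])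
    qed
    then have "AE x in circ. \<forall>l. fc1 (\<lambda>y. H (x, y)) l = ipow \<rho> l * fc1 (\<lambda>y. F (x, y)) l" unfolding AE_all_countable by blast
    then have "AE x in circ. (\<forall>l. fc1 (\<lambda>y. H (x, y)) l = ipow \<rho> l * fc1 (\<lambda>y. F (x, y)) l) \<and> integrable circ (\<lambda>y. F (x, y)) \<and> integrable circ (\<lambda>y. H (x, y))"
      using circ2.AE_integrable_fst'[OF F(2)] circ2.AE_integrable_fst'[OF H(2)] by eventually_elim simp
    then have "AE x in lborel. (\<forall>l. fc1 (\<lambda>y. H (x, y)) l = ipow \<rho> l * fc1 (\<lambda>y. F (x, y)) l) \<and> integrable circ (\<lambda>y. F (x, y)) \<and> integrable circ (\<lambda>y. H (x, y))"
    proof (rule periodic_AE)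
      have "F (x + 2 * pi, y) = F (x, y)" "H (x + 2 * pi, y) = H (x, y)" for x y using F(3) H(3) by (auto simp: periodic2_def)
      note p = this
      show "((\<forall>l. fc1 (\<lambda>y. H (x + 2 * pi, y)) l = ipow \<rho> l * fc1 (\<lambda>y. F (x + 2 * pi, y)) l) \<and> integrable circ (\<lambda>y. F (x + 2 * pi, y)) \<and> integrable circ (\<lambda>y. H (x + 2 * pi, y)))
        = ((\<forall>l. fc1 (\<lambda>y. H (x, y)) l = ipow \<rho> l * fc1 (\<lambda>y. F (x, y)) l) \<and> integrable circ (\<lambda>y. F (x, y)) \<and> integrable circ (\<lambda>y. H (x, y)))" for x
        unfolding p ..
    qed
    then have "AE x in lborel. has_weyl_derivative \<rho> (\<lambda>y. f (x, y)) (\<lambda>y. H (x, y))"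
      using AE_slices(1)[OF F(4)]
    proof eventually_elim
      case (elim x)
      have p: "H (x, y + 2 * pi) = H (x, y)" for y using H(3) by (simp add: periodic2_def)
      show ?case
        by (rule weyl_derivative_if_fc1[OF \<rho> slice_measurable[OF F(1)] elim(2) _ slice_measurable[OF H(1)]]) (use elim(1) p in auto)
    qed
    then show ?thesis by (rule AE_completion)
  qed
  show "(\<And>k l. fc2 H k l = ipow \<rho> l * fc2 F k l) \<Longrightarrow> AE x in lebesgue. has_weyl_derivative \<rho> (\<lambda>y. f (x, y)) (\<lambda>y. H (x, y))"
    by (rule gen[OF F H])
  have sw: "(\<lambda>z. u (snd z, fst z)) \<in> borel_measurable borel" if "u \<in> borel_measurable borel" for u :: "real \<times> real \<Rightarrow> complex"
    by (rule measurable_compose[OF _ that]) (intro borel_measurable_continuous_onI continuous_intros)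
  have sp: "periodic2 (\<lambda>z. u (snd z, fst z))" if "periodic2 u" for u :: "real \<times> real \<Rightarrow> complex"
    using that by (simp add: periodic2_def)
  assume fc: "\<And>k l. fc2 H k l = ipow \<rho> k * fc2 F k l"
  have "fc2 (\<lambda>z. H (snd z, fst z)) k l = ipow \<rho> l * fc2 (\<lambda>z. F (snd z, fst z)) k l" for k l
    unfolding fc2_swap(2)[OF F(2)] fc2_swap(2)[OF H(2)] by (rule fc)
  from gen[OF sw[OF F(1)] fc2_swap(1)[OF F(2)] sp[OF F(3)] AE_slices(2)[OF F(4)] sw[OF H(1)] fc2_swap(1)[OF H(2)] sp[OF H(3)] this]
  show "AE y in lebesgue. has_weyl_derivative \<rho> (\<lambda>x. f (x, y)) (\<lambda>x. H (x, y))" by simp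
qed

section \<open>Existence of the mixed derivative and conclusion\<close>

lemma pdsum_mono:
  assumes p: "0 \<le> p" and "\<And>k. 0 \<le> V k" "\<And>k. 0 \<le> W k" "\<And>k. V k \<le> V' k" "\<And>k. W k \<le> W' k"
  shows "pdsum p a V W \<le> pdsum p a V' W'"
  unfolding pdsum_def using assms
  by (intro ennreal_suminf_le ennreal_leI mult_right_mono powr_mono2 mult_mono mult_nonneg_nonneg order_trans[OF assms(2,4)]) auto

lemma weyl_coefficients_ex:
  assumes p: "1 < p" and a: "doubly_monotone a" and r: "0 \<le> r1" "0 \<le> r2"
    and fin: "pdsum p a (\<lambda>k. real k powr r1) (\<lambda>k. real k powr r2) < \<infinity>"
  shows "\<exists>G\<in>Lpb p. weyl_coefficients a r1 r2 G"
proof -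
  define V where "V r k = 32 * 2 powr r * real k powr r" for r :: real and k
  have V: "(\<lambda>k. 4 * 2 powr r * (8 * real k powr r)) = V r" for r by (simp add: V_def fun_eq_iff)
  have "pdsum p a (V r1) (V r2) < \<infinity>"
    unfolding V_def using fin by (subst pdsum_scale[OF p]) (auto simp: ennreal_mult_less_top)
  then obtain G where G: "G \<in> borel_measurable borel"
    "\<forall>x y. G (x + 2 * pi, y) = G (x, y) \<and> G (x, y + 2 * pi) = G (x, y)"
    "Lnorm p G \<le> ennreal (hardy_const p * hardy_const p) * pdsum p a (V r1) (V r2)"
    "\<And>k l. fc2 G k l = of_real ((2 * pi)\<^sup>2 * a (nat \<bar>k\<bar>) (nat \<bar>l\<bar>)) * (ipow r1 k * ipow r2 l)"
    using synthesis[OF p a dominated_ipow[OF r(1), unfolded V] dominated_ipow[OF r(2), unfolded V] hardy_family_wker[OF p] hardy_family_wker[OF p]]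
      hardy_const_pos[OF p] unfolding Lnorm_def by (auto simp: V_def)
  define g where "g z = of_real (1 / 4) * G z" for z
  have "Lnorm p g \<le> Lnorm p G" unfolding g_def using Lnorm_divide4[OF G(1)] p by simp
  also have "\<dots> < \<infinity>" using G(3) \<open>pdsum p a (V r1) (V r2) < \<infinity>\<close> by (auto simp: ennreal_mult_less_top intro: order_le_less_trans)
  finally have fin: "Lnorm p g < \<infinity>" .
  have "g \<in> borel_measurable borel" unfolding g_def using G(1) by measurable
  moreover have "periodic2 g" using G(2) by (simp add: periodic2_def g_def)
  ultimately have "g \<in> Lpb p" using fin by (simp add: Lpb_def)
  moreover have "weyl_coefficients a r1 r2 g"
    unfolding weyl_coefficients_def g_def fc2_cmult G(4) by (simp add: power2_eq_square)
  ultimately show ?thesis by blast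
qed

text \<open>For \<open>k \<ge> 1\<close> the factor \<open>min 1 (k * \<delta>)\<close> is bounded
  below by \<open>min 1 \<delta>\<close>. Finiteness of the weighted sum at one
  \<open>\<delta>\<close> thus gives finiteness of the sum with the full weights
  \<open>k powr r\<close>; the constant may depend on \<open>\<delta>\<close>, since only finiteness
  is wanted.\<close>

lemma powr_le_Vw:
  assumes "0 < \<delta>" "0 < \<beta>" "0 < r"
  shows "real k powr r \<le> (1 / min 1 \<delta> powr \<beta>) * Vw r \<beta> \<delta> k"
proof (cases "k = 0")
  case False
  then have "\<delta> \<le> real k * \<delta>" using assms(1) by simp
  then have "min 1 \<delta> \<le> min 1 (real k * \<delta>)" by simp
  then have "min 1 \<delta> powr \<beta> \<le> min 1 (real k * \<delta>) powr \<beta>" using assms by (intro powr_mono2) auto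
  then have "real k powr r * min 1 \<delta> powr \<beta> \<le> Vw r \<beta> \<delta> k" unfolding Vw_def by (intro mult_left_mono) auto
  then show ?thesis using assms by (simp add: field_simps)
qed (simp add: Vw_def)

text \<open>Both \<open>g\<close> and the intermediate function \<open>h\<close>, differentiated in
  \<open>x\<close> alone, are synthesised from the same \<open>a\<close>; comparison of double
  coefficients then shows that they are successive Weyl derivatives.\<close>

lemma mixed_derivative_ex:
  assumes p: "1 < p" and \<beta>: "0 < \<beta>1" "0 < \<beta>2" and r: "0 < r1" "0 < r2" and \<delta>: "0 < \<delta>1" "0 < \<delta>2"
    and a: "doubly_monotone a" and f': "f' \<in> Lpb p" "AE z in lborel. f z = f' z" "weyl_coefficients a 0 0 f'"
    and fin: "pdsum p a (Vw r1 \<beta>1 \<delta>1) (Vw r2 \<beta>2 \<delta>2) < \<infinity>"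
  shows "\<exists>g\<in>Lp_space p. has_mixed_weyl_derivative r1 r2 f g"
proof -
  have "pdsum p a (\<lambda>k. real k powr r1) (\<lambda>k. real k powr r2)
    \<le> pdsum p a (\<lambda>k. (1 / min 1 \<delta>1 powr \<beta>1) * Vw r1 \<beta>1 \<delta>1 k) (\<lambda>k. (1 / min 1 \<delta>2 powr \<beta>2) * Vw r2 \<beta>2 \<delta>2 k)"
    using p \<beta> r \<delta> by (intro pdsum_mono powr_le_Vw) auto
  also have "\<dots> < \<infinity>"
    using fin by (subst pdsum_scale[OF p]) (auto simp: ennreal_mult_less_top Vw_nonneg)
  finally have S: "pdsum p a (\<lambda>k. real k powr r1) (\<lambda>k. real k powr r2) < \<infinity>" .
  \<comment> \<open>The sum belonging to \<open>h\<close> is dominated by that of \<open>g\<close>,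
    because \<open>k powr 0 \<le> k powr r2\<close> for all \<open>k\<close>; at
    \<open>k = 0\<close> both powers are \<open>0\<close>.\<close>
  have "pdsum p a (\<lambda>k. real k powr r1) (\<lambda>k. real k powr 0) \<le> pdsum p a (\<lambda>k. real k powr r1) (\<lambda>k. real k powr r2)"
  proof (rule pdsum_mono)
    show "real k powr 0 \<le> real k powr r2" for k using r by (cases "k = 0") (auto simp: ge_one_powr_ge_zero)
  qed (use p in auto)
  also note S
  finally have S0: "pdsum p a (\<lambda>k. real k powr r1) (\<lambda>k. real k powr 0) < \<infinity>" .
  obtain h where h: "h \<in> Lpb p" "weyl_coefficients a r1 0 h" using weyl_coefficients_ex[OF p a _ _ S0] r by auto
  obtain g where g: "g \<in> Lpb p" "weyl_coefficients a r1 r2 g" using weyl_coefficients_ex[OF p a _ _ S] r by auto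
  have m: "f' \<in> borel_measurable borel" "g \<in> borel_measurable borel" "h \<in> borel_measurable borel"
    and per: "periodic2 f'" "periodic2 g" "periodic2 h"
    using f'(1) g(1) h(1) by (auto simp: Lpb_def)
  note i = Lpb_integrable[OF p f'(1)] Lpb_integrable[OF p g(1)] Lpb_integrable[OF p h(1)]
  have "h \<in> Lpb 1"
  proof -
    have "Lnorm 1 h < \<infinity>" using i(3) by (simp add: Lnorm_def integrable_iff_bounded)
    then show ?thesis using h(1) by (simp add: Lpb_def)
  qed
  then have "h \<in> Lp_space 1" by (rule Lpb_Lp_space)
  moreover have "AE y in lebesgue. has_weyl_derivative r1 (\<lambda>x. f (x, y)) (\<lambda>x. h (x, y))"
    using f'(3) h(2) by (intro weyl_derivative_if_fc2(2)[OF r(1) m(1) i(1) per(1) f'(2) m(3) i(3) per(3)]) (auto simp: weyl_coefficients_def ipow_def)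
  moreover have "AE x in lebesgue. has_weyl_derivative r2 (\<lambda>y. h (x, y)) (\<lambda>y. g (x, y))"
    using g(2) h(2) by (intro weyl_derivative_if_fc2(1)[OF r(2) m(3) i(3) per(3) _ m(2) i(2) per(2)]) (auto simp: weyl_coefficients_def ipow_def)
  ultimately have "has_mixed_weyl_derivative r1 r2 f g" unfolding has_mixed_weyl_derivative_def by blast
  then show ?thesis using Lpb_Lp_space[OF g(1)] by blast
qed

lemma enn_powr_le_imp_le:
  assumes "0 < p" "0 \<le> M" "enn_powr X p \<le> ennreal M * enn_powr Y p"
  shows "X \<le> ennreal (M powr (1 / p)) * Y"
proof -
  have "X = enn_powr (enn_powr X p) (1 / p)" using assms(1) by (simp add: enn_powr_inverse')
  also have "\<dots> \<le> enn_powr (ennreal M * enn_powr Y p) (1 / p)" using assms by (intro enn_powr_mono) auto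
  also have "\<dots> = ennreal (M powr (1 / p)) * Y" using assms by (simp add: enn_powr_mult enn_powr_inverse')
  finally show ?thesis .
qed

theorem theorem8p2:
  fixes p \<beta>1 \<beta>2 r1 r2 :: real
  assumes "1 < p" and "0 < \<beta>1" and "0 < \<beta>2" and "0 < r1" and "0 < r2"
  shows "\<exists>C>0. \<forall>f\<in>M_class p. \<forall>\<delta>1\<in>{0<..<1/2}. \<forall>\<delta>2\<in>{0<..<1/2}.
    (smoothness_integral p r1 r2 \<beta>1 \<beta>2 f \<delta>1 \<delta>2 < \<infinity> \<longrightarrow>
       (\<exists>g\<in>Lp_space p. has_mixed_weyl_derivative r1 r2 f g)) \<and>
    (\<forall>g\<in>Lp_space p. has_mixed_weyl_derivative r1 r2 f g \<longrightarrow>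
       ennreal (1 / C) * smoothness_integral p r1 r2 \<beta>1 \<beta>2 f \<delta>1 \<delta>2
         \<le> mixed_modulus p \<beta>1 \<beta>2 g \<delta>1 \<delta>2 \<and>
       mixed_modulus p \<beta>1 \<beta>2 g \<delta>1 \<delta>2
         \<le> ennreal C * smoothness_integral p r1 r2 \<beta>1 \<beta>2 f \<delta>1 \<delta>2)"
proof -
  note p = assms(1) and \<beta> = assms(2,3) and r = assms(4,5)
  obtain K where K: "0 < K" and mod: "\<And>a f f' \<delta>1 \<delta>2. doubly_monotone a \<Longrightarrow> f' \<in> Lpb p \<Longrightarrow> (AE z in lborel. f z = f' z) \<Longrightarrow>
    weyl_coefficients a r1 r2 f' \<Longrightarrow> 0 < \<delta>1 \<Longrightarrow> 0 < \<delta>2 \<Longrightarrow>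
    enn_powr (mixed_modulus p \<beta>1 \<beta>2 f \<delta>1 \<delta>2) p \<le> ennreal K * pdsum p a (Vw r1 \<beta>1 \<delta>1) (Vw r2 \<beta>2 \<delta>2) \<and>
    pdsum p a (Vw r1 \<beta>1 \<delta>1) (Vw r2 \<beta>2 \<delta>2) \<le> ennreal K * enn_powr (mixed_modulus p \<beta>1 \<beta>2 f \<delta>1 \<delta>2) p"
    using modulus_two_sided[OF p \<beta>, of r1 r2] r by auto
  obtain L where L: "0 < L" and smooth: "\<And>a f f' \<delta>1 \<delta>2. doubly_monotone a \<Longrightarrow> f' \<in> Lpb p \<Longrightarrow> (AE z in lborel. f z = f' z) \<Longrightarrow>
    weyl_coefficients a 0 0 f' \<Longrightarrow> 0 < \<delta>1 \<Longrightarrow> 0 < \<delta>2 \<Longrightarrow>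
    enn_powr (smoothness_integral p r1 r2 \<beta>1 \<beta>2 f \<delta>1 \<delta>2) p \<le> ennreal L * pdsum p a (Vw r1 \<beta>1 \<delta>1) (Vw r2 \<beta>2 \<delta>2) \<and>
    pdsum p a (Vw r1 \<beta>1 \<delta>1) (Vw r2 \<beta>2 \<delta>2) \<le> ennreal L * enn_powr (smoothness_integral p r1 r2 \<beta>1 \<beta>2 f \<delta>1 \<delta>2) p"
    using smoothness_integral_two_sided[OF p \<beta> r] by auto
  \<comment> \<open>The coefficient sum is eliminated between two estimates of \<open>p\<close>-th
    powers, one with constant \<open>K\<close> and one with \<open>L\<close>. Either order of
    elimination gives the product \<open>K * L\<close>, so the same root serves both
    inequalities.\<close>
  define C where "C = (K * L) powr (1 / p)"
  have C: "0 < C" using K L by (simp add: C_def)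
  have comb: "X \<le> ennreal C * Y" if "enn_powr X p \<le> ennreal M * S" "S \<le> ennreal N * enn_powr Y p" "M * N = K * L" "0 < M" "0 < N" for X Y S M N
  proof -
    have "enn_powr X p \<le> ennreal M * (ennreal N * enn_powr Y p)" by (rule order_trans[OF that(1) mult_left_mono[OF that(2)]]) simp
    also have "\<dots> = ennreal (K * L) * enn_powr Y p"
      unfolding that(3)[symmetric] ennreal_mult[OF less_imp_le[OF that(4)] less_imp_le[OF that(5)]] by (rule mult.assoc[symmetric])
    finally show ?thesis unfolding C_def using p K L by (intro enn_powr_le_imp_le) auto
  qed
  show ?thesis
  proof (intro exI[of _ C] conjI ballI impI C)
    fix f and \<delta>1 \<delta>2 :: real
    assume f: "f \<in> M_class p" and \<delta>: "\<delta>1 \<in> {0<..<1/2}" "\<delta>2 \<in> {0<..<1/2}"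
    then have \<delta>': "0 < \<delta>1" "0 < \<delta>2" by auto
    let ?S = "\<lambda>a. pdsum p a (Vw r1 \<beta>1 \<delta>1) (Vw r2 \<beta>2 \<delta>2)"
    let ?J = "smoothness_integral p r1 r2 \<beta>1 \<beta>2 f \<delta>1 \<delta>2"
    obtain a f' where a: "doubly_monotone a" and f': "f' \<in> Lpb p" "AE z in lborel. f z = f' z" "weyl_coefficients a 0 0 f'"
      using M_class_coefficients[OF p f] by blast
    note sm = smooth[OF a f' \<delta>']
    show "\<exists>g\<in>Lp_space p. has_mixed_weyl_derivative r1 r2 f g" if "?J < \<infinity>"
    proof (rule mixed_derivative_ex[OF p \<beta> r \<delta>' a f'])
      have "ennreal L * enn_powr ?J p < \<infinity>" using that by (simp add: ennreal_mult_eq_top_iff less_top[symmetric])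
      then show "?S a < \<infinity>" using sm by (blast intro: order_le_less_trans)
    qed
    fix g assume g: "g \<in> Lp_space p" and d: "has_mixed_weyl_derivative r1 r2 f g"
    let ?m = "mixed_modulus p \<beta>1 \<beta>2 g \<delta>1 \<delta>2"
    obtain g' where g': "g' \<in> Lpb p" "AE z in lborel. g z = g' z" using Lp_space_borel_version[OF _ g] p by auto
    note md = mod[OF a g' weyl_coefficients_mixed_derivative[OF p r f' g' d] \<delta>']
    show "?m \<le> ennreal C * ?J" by (rule comb[of _ K "?S a" L]) (use md sm K L in auto)
    have "?J \<le> ennreal C * ?m" by (rule comb[of _ L "?S a" K]) (use md sm K L in auto)
    then have "ennreal (1 / C) * ?J \<le> ennreal (1 / C) * (ennreal C * ?m)" by (rule mult_left_mono) simp
    also have "\<dots> = ?m" using C by (simp add: ennreal_mult[symmetric] mult.assoc[symmetric])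
    finally show "ennreal (1 / C) * ?J \<le> ?m" .
  qed
qed

end
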